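(* Let $\Lambda$ be a finite dimensional hereditary algebra over an infinite field $K$. Suppose that $\alpha\in\mathbb N^n$ and $M$ is a rigid $\Lambda$-module (i.e. $\operatorname{Ext}^1_\Lambda(M,M)=0$) with $\underline{\dim}\,M=\alpha$. Then the set of all $f\in\operatorname{Rep}(\Lambda,\alpha)$ such that $N_f\cong M$ forms an open dense subset of $\operatorname{Rep}(\Lambda,\alpha)$ (in the Zariski topology).
   Context: $\Lambda$ is basic (the indecomposable summands of $\Lambda$ as a right module are pairwise nonisomorphic); modules are finite dimensional right $\Lambda$-modules. $S_1,\dots,S_n$ are the simple modules, $P_i$ is the projective cover of $S_i$, and $F_i=\operatorname{End}_\Lambda(S_i)\cong\operatorname{End}_\Lambda(P_i)$. The dimension vector $\underline{\dim}\,V\in\mathbb N^n$ has $i$-th coordinate $\dim_{F_i}\operatorname{Hom}_\Lambda(P_i,V)$. For $\alpha\in\mathbb N^n$ put $P(\alpha)=\bigoplus_i P_i^{\alpha_i}$. Representation space: put $d_{ji}=\dim_{F_i}\operatorname{Ext}^1_\Lambda(S_j,S_i)$ for $i\ne j$ (and $d_{ii}=0$). Fix isomorphisms $\varphi_j:\bigoplus_i P_i^{d_{ji}}\cong \operatorname{rad}P_j$ for each $j$; they induce an isomorphism $\varphi_\alpha=\bigoplus_j\varphi_j^{\alpha_j}:\bigoplus_{i,j}P_i^{\alpha_jd_{ji}}\cong \operatorname{rad}P(\alpha)$. Let $H(\Lambda,\alpha)=\prod_{i}\operatorname{Hom}_\Lambda(\bigoplus_j P_i^{\alpha_jd_{ji}},P_i^{\alpha_i})\subseteq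 \operatorname{Hom}_\Lambda(\bigoplus_{i,j}P_i^{\alpha_jd_{ji}},P(\alpha))$. Then $\operatorname{Rep}(\Lambda,\alpha)=\{f:\operatorname{rad}P(\alpha)\to P(\alpha)\mid f\circ\varphi_\alpha\in H(\Lambda,\alpha)\}$, an affine space over $K$. For $f\in\operatorname{Rep}(\Lambda,\alpha)$, $N_f=\operatorname{coker}(f-\mathrm{inc}:\operatorname{rad}P(\alpha)\to P(\alpha))$, where $\mathrm{inc}$ is the inclusion. *)

theory Defs
  imports
    "HOL-Algebra.Module"
    "HOL-Algebra.AbelCoset"
    "HOL-Analysis.Abstract_Topology"
begin

section \<open>Modules over a ring that need not be commutative\<close>

text \<open>
  Right modules are carried by the record type \<open>module\<close> of the library; the element
  \<open>a \<odot>\<^bsub>M\<^esub> x\<close> stands for $x \cdot a$. The ring fields \<open>mult\<close> and \<open>one\<close> of a module record are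
  irrelevant and left unspecified.
\<close>

locale right_module = R?: ring R + M?: abelian_group M
  for R :: "('a, 'c) ring_scheme" (structure) and M :: "('a, 'm) module" (structure) +
  assumes smult_closed [simp, intro]:
      "\<lbrakk>a \<in> carrier R; x \<in> carrier M\<rbrakk> \<Longrightarrow> a \<odot>\<^bsub>M\<^esub> x \<in> carrier M"
    and smult_l_distr:
      "\<lbrakk>a \<in> carrier R; b \<in> carrier R; x \<in> carrier M\<rbrakk> \<Longrightarrow>
        (a \<oplus>\<^bsub>R\<^esub> b) \<odot>\<^bsub>M\<^esub> x = a \<odot>\<^bsub>M\<^esub> x \<oplus>\<^bsub>M\<^esub> b \<odot>\<^bsub>M\<^esub> x"
    and smult_r_distr:
      "\<lbrakk>a \<in> carrier R; x \<in> carrier M; y \<in> carrier M\<rbrakk> \<Longrightarrow>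
        a \<odot>\<^bsub>M\<^esub> (x \<oplus>\<^bsub>M\<^esub> y) = a \<odot>\<^bsub>M\<^esub> x \<oplus>\<^bsub>M\<^esub> a \<odot>\<^bsub>M\<^esub> y"
    and smult_assoc:
      "\<lbrakk>a \<in> carrier R; b \<in> carrier R; x \<in> carrier M\<rbrakk> \<Longrightarrow>
        (a \<otimes>\<^bsub>R\<^esub> b) \<odot>\<^bsub>M\<^esub> x = b \<odot>\<^bsub>M\<^esub> (a \<odot>\<^bsub>M\<^esub> x)"
    and smult_one [simp]:
      "x \<in> carrier M \<Longrightarrow> \<one>\<^bsub>R\<^esub> \<odot>\<^bsub>M\<^esub> x = x"

definition regular :: "('a, 'c) ring_scheme \<Rightarrow> ('a, 'a) module" where
  "regular R = \<lparr>carrier = carrier R, mult = undefined, one = undefined,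
     zero = \<zero>\<^bsub>R\<^esub>, add = add R, smult = (\<lambda>a x. x \<otimes>\<^bsub>R\<^esub> a)\<rparr>"

definition sub_module :: "('r, 'm) module \<Rightarrow> 'm set \<Rightarrow> ('r, 'm) module" where
  "sub_module M N = M\<lparr>carrier := N\<rparr>"

definition quot_module :: "('r, 'm) module \<Rightarrow> 'm set \<Rightarrow> ('r, 'm set) module" where
  "quot_module M N = \<lparr>carrier = a_rcosets\<^bsub>M\<^esub> N, mult = undefined, one = undefined,
     zero = N, add = (\<lambda>A B. A <+>\<^bsub>M\<^esub> B),
     smult = (\<lambda>a A. \<Union>x\<in>A. N +>\<^bsub>M\<^esub> (a \<odot>\<^bsub>M\<^esub> x))\<rparr>"

definition dir_sum :: "'i set \<Rightarrow> ('i \<Rightarrow> ('r, 'm) module) \<Rightarrow> ('r, 'i \<Rightarrow> 'm) module" where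
  "dir_sum I M = \<lparr>carrier = {x \<in> \<Pi>\<^sub>E i\<in>I. carrier (M i). finite {i \<in> I. x i \<noteq> \<zero>\<^bsub>M i\<^esub>}},
     mult = undefined, one = undefined,
     zero = (\<lambda>i\<in>I. \<zero>\<^bsub>M i\<^esub>),
     add = (\<lambda>x y. \<lambda>i\<in>I. x i \<oplus>\<^bsub>M i\<^esub> y i),
     smult = (\<lambda>a x. \<lambda>i\<in>I. a \<odot>\<^bsub>M i\<^esub> x i)\<rparr>"

text \<open>Homomorphisms are extensional, so that equality of maps is equality on the carrier.\<close>

definition Hom :: "('r, 'c) ring_scheme \<Rightarrow> ('r, 'x) module \<Rightarrow> ('r, 'y) module \<Rightarrow> ('x \<Rightarrow> 'y) set" where
  "Hom R X Y = {f \<in> carrier X \<rightarrow>\<^sub>E carrier Y.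
     (\<forall>x\<in>carrier X. \<forall>x'\<in>carrier X. f (x \<oplus>\<^bsub>X\<^esub> x') = f x \<oplus>\<^bsub>Y\<^esub> f x') \<and>
     (\<forall>a\<in>carrier R. \<forall>x\<in>carrier X. f (a \<odot>\<^bsub>X\<^esub> x) = a \<odot>\<^bsub>Y\<^esub> f x)}"

definition Iso :: "('r, 'c) ring_scheme \<Rightarrow> ('r, 'x) module \<Rightarrow> ('r, 'y) module \<Rightarrow> ('x \<Rightarrow> 'y) set" where
  "Iso R X Y = {f \<in> Hom R X Y. bij_betw f (carrier X) (carrier Y)}"

definition isomorphic :: "('r, 'c) ring_scheme \<Rightarrow> ('r, 'x) module \<Rightarrow> ('r, 'y) module \<Rightarrow> bool" where
  "isomorphic R X Y \<longleftrightarrow> Iso R X Y \<noteq> {}"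

definition simple_module :: "('r, 'c) ring_scheme \<Rightarrow> ('r, 'm) module \<Rightarrow> bool" where
  "simple_module R M \<longleftrightarrow> right_module R M \<and> carrier M \<noteq> {\<zero>\<^bsub>M\<^esub>} \<and>
     (\<forall>N. submodule N R M \<longrightarrow> N = {\<zero>\<^bsub>M\<^esub>} \<or> N = carrier M)"

definition indecomposable :: "('r, 'c) ring_scheme \<Rightarrow> ('r, 'm) module \<Rightarrow> bool" where
  "indecomposable R M \<longleftrightarrow> right_module R M \<and> carrier M \<noteq> {\<zero>\<^bsub>M\<^esub>} \<and>
     (\<forall>N N'. submodule N R M \<and> submodule N' R M \<and>
        N \<inter> N' = {\<zero>\<^bsub>M\<^esub>} \<and> N <+>\<^bsub>M\<^esub> N' = carrier M \<longrightarrow>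
        N = {\<zero>\<^bsub>M\<^esub>} \<or> N' = {\<zero>\<^bsub>M\<^esub>})"

definition maximal_submodule :: "('r, 'c) ring_scheme \<Rightarrow> ('r, 'm) module \<Rightarrow> 'm set \<Rightarrow> bool" where
  "maximal_submodule R M N \<longleftrightarrow> submodule N R M \<and> N \<noteq> carrier M \<and>
     (\<forall>N'. submodule N' R M \<and> N \<subseteq> N' \<longrightarrow> N' = N \<or> N' = carrier M)"

definition radical :: "('r, 'c) ring_scheme \<Rightarrow> ('r, 'm) module \<Rightarrow> 'm set" where
  "radical R M = carrier M \<inter> \<Inter>{N. maximal_submodule R M N}"

text \<open>
  A definition cannot quantify over all types, so the test epimorphisms $X \to Y$ are those with
  \<open>Y\<close> on the type of \<open>P\<close> and \<open>X\<close> on the type of the free module on \<open>carrier P\<close>. By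
  \<open>projective_lift\<close> below this implies the lifting property against epimorphisms of arbitrary
  modules.
\<close>

definition projective :: "('r, 'c) ring_scheme \<Rightarrow> ('r, 'p) module \<Rightarrow> bool" where
  "projective R P \<longleftrightarrow> right_module R P \<and>
     (\<forall>(X :: ('r, 'p \<Rightarrow> 'r) module) (Y :: ('r, 'p) module). \<forall>g\<in>Hom R X Y. \<forall>h\<in>Hom R P Y.
        right_module R X \<and> right_module R Y \<and> g ` carrier X = carrier Y \<longrightarrow>
        (\<exists>u\<in>Hom R P X. compose (carrier P) g u = h))"

definition projective_cover ::
  "('r, 'c) ring_scheme \<Rightarrow> ('r, 'p) module \<Rightarrow> ('r, 's) module \<Rightarrow> ('p \<Rightarrow> 's) \<Rightarrow> bool" where
  "projective_cover R P S p \<longleftrightarrow> projective R P \<and> p \<in> Hom R P S \<and> p ` carrier P = carrier S \<and>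
     (\<forall>N. submodule N R P \<and> N <+>\<^bsub>P\<^esub> {x \<in> carrier P. p x = \<zero>\<^bsub>S\<^esub>} = carrier P \<longrightarrow> N = carrier P)"


section \<open>Algebras\<close>

text \<open>The case distinction left/right plays no role here: only \<open>smult\<close> is used.\<close>

definition finite_basis :: "('r, 'c) ring_scheme \<Rightarrow> ('r, 'v) module \<Rightarrow> 'v set \<Rightarrow> bool" where
  "finite_basis D V B \<longleftrightarrow> finite B \<and> B \<subseteq> carrier V \<and>
     (\<forall>v\<in>carrier V. \<exists>!c. c \<in> B \<rightarrow>\<^sub>E carrier D \<and> v = (\<Oplus>\<^bsub>V\<^esub>b\<in>B. c b \<odot>\<^bsub>V\<^esub> b))"

definition finite_dim :: "('r, 'c) ring_scheme \<Rightarrow> ('r, 'v) module \<Rightarrow> bool" where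
  "finite_dim D V \<longleftrightarrow> (\<exists>B. finite_basis D V B)"

text \<open>Dimension over a division ring acting from either side (unspecified if infinite).\<close>

definition dim_over :: "('r, 'c) ring_scheme \<Rightarrow> ('r, 'v) module \<Rightarrow> nat" where
  "dim_over D V = card (SOME B. finite_basis D V B)"

locale fd_algebra = field K + Module.module K A + ring A
  for K :: "'k ring" and A :: "('k, 'a) module" +
  assumes smult_mult_left: "\<lbrakk>k \<in> carrier K; x \<in> carrier A; y \<in> carrier A\<rbrakk> \<Longrightarrow>
      (k \<odot>\<^bsub>A\<^esub> x) \<otimes>\<^bsub>A\<^esub> y = k \<odot>\<^bsub>A\<^esub> (x \<otimes>\<^bsub>A\<^esub> y)"
    and smult_mult_right: "\<lbrakk>k \<in> carrier K; x \<in> carrier A; y \<in> carrier A\<rbrakk> \<Longrightarrow>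
      x \<otimes>\<^bsub>A\<^esub> (k \<odot>\<^bsub>A\<^esub> y) = k \<odot>\<^bsub>A\<^esub> (x \<otimes>\<^bsub>A\<^esub> y)"
    and fin_dim: "finite_dim K A"

text \<open>The \<open>K\<close>-space underlying a right \<open>A\<close>-module.\<close>

definition scalars :: "('k, 'a) module \<Rightarrow> ('a, 'm) module \<Rightarrow> ('k, 'm) module" where
  "scalars A M = \<lparr>carrier = carrier M, mult = undefined, one = undefined,
     zero = \<zero>\<^bsub>M\<^esub>, add = add M, smult = (\<lambda>k x. (k \<odot>\<^bsub>A\<^esub> \<one>\<^bsub>A\<^esub>) \<odot>\<^bsub>M\<^esub> x)\<rparr>"

definition fd_module :: "'k ring \<Rightarrow> ('k, 'a) module \<Rightarrow> ('a, 'm) module \<Rightarrow> bool" where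
  "fd_module K A M \<longleftrightarrow> right_module A M \<and> finite_dim K (scalars A M)"

definition hereditary :: "('r, 'c) ring_scheme \<Rightarrow> bool" where
  "hereditary R \<longleftrightarrow> (\<forall>I. submodule I R (regular R) \<longrightarrow> projective R (sub_module (regular R) I))"

definition internal_direct_sum :: "('r, 'm) module \<Rightarrow> nat \<Rightarrow> (nat \<Rightarrow> 'm set) \<Rightarrow> bool" where
  "internal_direct_sum M m X \<longleftrightarrow> (\<forall>t<m. X t \<subseteq> carrier M) \<and>
     (\<forall>v\<in>carrier M. \<exists>!x. x \<in> (\<Pi>\<^sub>E t\<in>{..<m}. X t) \<and> v = (\<Oplus>\<^bsub>M\<^esub>t\<in>{..<m}. x t))"

definition basic :: "('r, 'c) ring_scheme \<Rightarrow> bool" where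
  "basic R \<longleftrightarrow> (\<forall>m X. (\<forall>t<m. submodule (X t) R (regular R) \<and> indecomposable R (sub_module (regular R) (X t))) \<and>
     internal_direct_sum (regular R) m X \<longrightarrow>
     (\<forall>s<m. \<forall>t<m. s \<noteq> t \<longrightarrow> \<not> isomorphic R (sub_module (regular R) (X s)) (sub_module (regular R) (X t))))"


section \<open>Homomorphism spaces and extensions\<close>

definition hom_space ::
  "('r, 'c) ring_scheme \<Rightarrow> ('r, 'x) module \<Rightarrow> ('r, 'y) module \<Rightarrow> ('d \<Rightarrow> ('x \<Rightarrow> 'y) \<Rightarrow> ('x \<Rightarrow> 'y)) \<Rightarrow>
     ('d, 'x \<Rightarrow> 'y) module" where
  "hom_space R X Y act = \<lparr>carrier = Hom R X Y, mult = undefined, one = undefined,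
     zero = (\<lambda>x\<in>carrier X. \<zero>\<^bsub>Y\<^esub>),
     add = (\<lambda>f g. \<lambda>x\<in>carrier X. f x \<oplus>\<^bsub>Y\<^esub> g x),
     smult = act\<rparr>"

definition End_ring :: "('r, 'c) ring_scheme \<Rightarrow> ('r, 'x) module \<Rightarrow> ('x \<Rightarrow> 'x) ring" where
  "End_ring R X = \<lparr>carrier = Hom R X X, mult = compose (carrier X), one = (\<lambda>x\<in>carrier X. x),
     zero = (\<lambda>x\<in>carrier X. \<zero>\<^bsub>X\<^esub>), add = (\<lambda>f g. \<lambda>x\<in>carrier X. f x \<oplus>\<^bsub>X\<^esub> g x)\<rparr>"

text \<open>$\mathrm{Hom}(X,Y)$ as a right $\mathrm{End}(X)$-module and as a left $\mathrm{End}(Y)$-module.\<close>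

definition hom_precomp ::
  "('r, 'c) ring_scheme \<Rightarrow> ('r, 'x) module \<Rightarrow> ('r, 'y) module \<Rightarrow> ('x \<Rightarrow> 'x, 'x \<Rightarrow> 'y) module" where
  "hom_precomp R X Y = hom_space R X Y (\<lambda>e f. compose (carrier X) f e)"

definition hom_postcomp ::
  "('r, 'c) ring_scheme \<Rightarrow> ('r, 'x) module \<Rightarrow> ('r, 'y) module \<Rightarrow> ('y \<Rightarrow> 'y, 'x \<Rightarrow> 'y) module" where
  "hom_postcomp R X Y = hom_space R X Y (\<lambda>e f. compose (carrier X) e f)"

definition free_module :: "('r, 'c) ring_scheme \<Rightarrow> 'i set \<Rightarrow> ('r, 'i \<Rightarrow> 'r) module" where
  "free_module R I = dir_sum I (\<lambda>_. regular R)"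

definition free_map ::
  "('r, 'c) ring_scheme \<Rightarrow> 'i set \<Rightarrow> ('r, 'm) module \<Rightarrow> ('i \<Rightarrow> 'm) \<Rightarrow> ('i \<Rightarrow> 'r) \<Rightarrow> 'm" where
  "free_map R I M t = (\<lambda>c\<in>carrier (free_module R I).
     \<Oplus>\<^bsub>M\<^esub>i\<in>{i \<in> I. c i \<noteq> \<zero>\<^bsub>R\<^esub>}. c i \<odot>\<^bsub>M\<^esub> t i)"

text \<open>The kernel $\Omega X$ of the canonical epimorphism from the free module on \<open>carrier X\<close> to \<open>X\<close>.\<close>

definition syzygy :: "('r, 'c) ring_scheme \<Rightarrow> ('r, 'm) module \<Rightarrow> ('r, 'm \<Rightarrow> 'r) module" where
  "syzygy R X = sub_module (free_module R (carrier X))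
     {c \<in> carrier (free_module R (carrier X)). free_map R (carrier X) X (\<lambda>x. x) c = \<zero>\<^bsub>X\<^esub>}"

text \<open>
  $\mathrm{Ext}^1_R(X,Y)$ is the cokernel of $\mathrm{Hom}_R(F,Y) \to \mathrm{Hom}_R(\Omega X,Y)$ for
  the canonical free presentation $0 \to \Omega X \to F \to X \to 0$, as a left
  $\mathrm{End}_R(Y)$-module.
\<close>

definition Ext1 ::
  "('r, 'c) ring_scheme \<Rightarrow> ('r, 'x) module \<Rightarrow> ('r, 'y) module \<Rightarrow>
     ('y \<Rightarrow> 'y, (('x \<Rightarrow> 'r) \<Rightarrow> 'y) set) module" where
  "Ext1 R X Y = quot_module (hom_postcomp R (syzygy R X) Y)
     ((\<lambda>h. restrict h (carrier (syzygy R X))) ` Hom R (free_module R (carrier X)) Y)"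

definition rigid :: "('r, 'c) ring_scheme \<Rightarrow> ('r, 'm) module \<Rightarrow> bool" where
  "rigid R M \<longleftrightarrow> carrier (Ext1 R M M) = {\<zero>\<^bsub>Ext1 R M M\<^esub>}"

text \<open>
  The \<open>i\<close>-th coordinate of the dimension vector of \<open>V\<close> is \<open>dimv A (P i) V\<close>; the division ring
  $F_i$ acts on $\mathrm{Hom}(P_i,V)$ through its identification with $\mathrm{End}(P_i)$.
\<close>

definition dimv :: "('r, 'c) ring_scheme \<Rightarrow> ('r, 'p) module \<Rightarrow> ('r, 'm) module \<Rightarrow> nat" where
  "dimv R P V = dim_over (End_ring R P) (hom_precomp R P V)"

definition ext_dim :: "('r, 'c) ring_scheme \<Rightarrow> (nat \<Rightarrow> ('r, 's) module) \<Rightarrow> nat \<Rightarrow> nat \<Rightarrow> nat" where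
  "ext_dim R S j i = (if i = j then 0 else dim_over (End_ring R (S i)) (Ext1 R (S j) (S i)))"


section \<open>The representation space\<close>

text \<open>
  The simple modules are \<open>S i\<close> and their projective covers \<open>P i\<close>, for \<open>i < n\<close>. The pair \<open>(i, k)\<close>
  in \<open>copies n \<alpha>\<close> is the index of the \<open>k\<close>-th copy of \<open>P i\<close> in $P(\alpha)$.
\<close>

definition copies :: "nat \<Rightarrow> (nat \<Rightarrow> nat) \<Rightarrow> (nat \<times> nat) set" where
  "copies n \<alpha> = (SIGMA i:{..<n}. {..<\<alpha> i})"

definition Proj :: "nat \<Rightarrow> (nat \<Rightarrow> ('r, 'p) module) \<Rightarrow> (nat \<Rightarrow> nat) \<Rightarrow> ('r, nat \<times> nat \<Rightarrow> 'p) module" where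
  "Proj n P \<alpha> = dir_sum (copies n \<alpha>) (\<lambda>(i, k). P i)"

definition rad_Proj ::
  "('r, 'c) ring_scheme \<Rightarrow> nat \<Rightarrow> (nat \<Rightarrow> ('r, 'p) module) \<Rightarrow> (nat \<Rightarrow> nat) \<Rightarrow>
     ('r, nat \<times> nat \<Rightarrow> 'p) module" where
  "rad_Proj R n P \<alpha> = sub_module (Proj n P \<alpha>) (radical R (Proj n P \<alpha>))"

text \<open>
  The module $\bigoplus_{i,j} P_i^{\alpha_j d_{ji}}$: the index \<open>((j, k), (i, l))\<close> stands for the
  \<open>l\<close>-th copy of \<open>P i\<close> in the source of $\varphi_j$, for the \<open>k\<close>-th copy of \<open>P j\<close>.
\<close>

definition rad_copies ::
  "nat \<Rightarrow> (nat \<Rightarrow> nat \<Rightarrow> nat) \<Rightarrow> (nat \<Rightarrow> nat) \<Rightarrow> ((nat \<times> nat) \<times> (nat \<times> nat)) set" where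
  "rad_copies n d \<alpha> = (SIGMA (j, k):copies n \<alpha>. copies n (d j))"

definition Rad_source ::
  "nat \<Rightarrow> (nat \<Rightarrow> ('r, 'p) module) \<Rightarrow> (nat \<Rightarrow> nat \<Rightarrow> nat) \<Rightarrow> (nat \<Rightarrow> nat) \<Rightarrow>
     ('r, (nat \<times> nat) \<times> (nat \<times> nat) \<Rightarrow> 'p) module" where
  "Rad_source n P d \<alpha> = dir_sum (rad_copies n d \<alpha>) (\<lambda>((j, k), (i, l)). P i)"

definition Phi ::
  "nat \<Rightarrow> (nat \<Rightarrow> ('r, 'p) module) \<Rightarrow> (nat \<Rightarrow> nat \<Rightarrow> nat) \<Rightarrow> (nat \<Rightarrow> (nat \<times> nat \<Rightarrow> 'p) \<Rightarrow> 'p) \<Rightarrow>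
     (nat \<Rightarrow> nat) \<Rightarrow> ((nat \<times> nat) \<times> (nat \<times> nat) \<Rightarrow> 'p) \<Rightarrow> (nat \<times> nat \<Rightarrow> 'p)" where
  "Phi n P d \<phi> \<alpha> = (\<lambda>q\<in>carrier (Rad_source n P d \<alpha>).
     \<lambda>(j, k)\<in>copies n \<alpha>. \<phi> j (\<lambda>il\<in>copies n (d j). q ((j, k), il)))"

text \<open>
  $H(\Lambda,\alpha)$: the homomorphisms mapping $\bigoplus_j P_i^{\alpha_j d_{ji}}$ into
  $P_i^{\alpha_i}$ for each \<open>i\<close>.
\<close>

definition block_homs ::
  "('r, 'c) ring_scheme \<Rightarrow> nat \<Rightarrow> (nat \<Rightarrow> ('r, 'p) module) \<Rightarrow> (nat \<Rightarrow> nat \<Rightarrow> nat) \<Rightarrow> (nat \<Rightarrow> nat) \<Rightarrow>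
     (((nat \<times> nat) \<times> (nat \<times> nat) \<Rightarrow> 'p) \<Rightarrow> (nat \<times> nat \<Rightarrow> 'p)) set" where
  "block_homs R n P d \<alpha> = {h \<in> Hom R (Rad_source n P d \<alpha>) (Proj n P \<alpha>).
     \<forall>i<n. \<forall>q\<in>carrier (Rad_source n P d \<alpha>).
       (\<forall>((j, k), (i', l))\<in>rad_copies n d \<alpha>. i' \<noteq> i \<longrightarrow> q ((j, k), (i', l)) = \<zero>\<^bsub>P i'\<^esub>) \<longrightarrow>
       (\<forall>(i', k)\<in>copies n \<alpha>. i' \<noteq> i \<longrightarrow> h q (i', k) = \<zero>\<^bsub>P i'\<^esub>)}"

text \<open>$\mathrm{Rep}(\Lambda,\alpha)$ as a \<open>K\<close>-space, where \<open>k\<close> acts on \<open>f\<close> by $(kf)(x) = f(x) \cdot k$.\<close>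

definition Rep ::
  "('k, 'a) module \<Rightarrow> nat \<Rightarrow> (nat \<Rightarrow> ('a, 'p) module) \<Rightarrow> (nat \<Rightarrow> nat \<Rightarrow> nat) \<Rightarrow>
     (nat \<Rightarrow> (nat \<times> nat \<Rightarrow> 'p) \<Rightarrow> 'p) \<Rightarrow> (nat \<Rightarrow> nat) \<Rightarrow>
     ('k, (nat \<times> nat \<Rightarrow> 'p) \<Rightarrow> (nat \<times> nat \<Rightarrow> 'p)) module" where
  "Rep A n P d \<phi> \<alpha> =
     sub_module (hom_space A (rad_Proj A n P \<alpha>) (Proj n P \<alpha>)
            (\<lambda>k f. \<lambda>x\<in>carrier (rad_Proj A n P \<alpha>). (k \<odot>\<^bsub>A\<^esub> \<one>\<^bsub>A\<^esub>) \<odot>\<^bsub>Proj n P \<alpha>\<^esub> f x))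
       {f \<in> Hom A (rad_Proj A n P \<alpha>) (Proj n P \<alpha>).
          compose (carrier (Rad_source n P d \<alpha>)) f (Phi n P d \<phi> \<alpha>) \<in> block_homs A n P d \<alpha>}"

definition coker_rep ::
  "('r, 'c) ring_scheme \<Rightarrow> nat \<Rightarrow> (nat \<Rightarrow> ('r, 'p) module) \<Rightarrow> (nat \<Rightarrow> nat) \<Rightarrow>
     ((nat \<times> nat \<Rightarrow> 'p) \<Rightarrow> (nat \<times> nat \<Rightarrow> 'p)) \<Rightarrow> ('r, (nat \<times> nat \<Rightarrow> 'p) set) module" where
  "coker_rep R n P \<alpha> f = quot_module (Proj n P \<alpha>)
     ((\<lambda>x. f x \<ominus>\<^bsub>Proj n P \<alpha>\<^esub> x) ` carrier (rad_Proj R n P \<alpha>))"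


section \<open>The Zariski topology of a vector space\<close>

inductive_set polynomial_functions :: "'k ring \<Rightarrow> ('k, 'v) module \<Rightarrow> ('v \<Rightarrow> 'k) set"
  for K V where
  linear: "l \<in> Hom K V (regular K) \<Longrightarrow> l \<in> polynomial_functions K V"
| const: "c \<in> carrier K \<Longrightarrow> (\<lambda>v\<in>carrier V. c) \<in> polynomial_functions K V"
| add: "\<lbrakk>p \<in> polynomial_functions K V; q \<in> polynomial_functions K V\<rbrakk> \<Longrightarrow>
    (\<lambda>v\<in>carrier V. p v \<oplus>\<^bsub>K\<^esub> q v) \<in> polynomial_functions K V"
| mult: "\<lbrakk>p \<in> polynomial_functions K V; q \<in> polynomial_functions K V\<rbrakk> \<Longrightarrow>
    (\<lambda>v\<in>carrier V. p v \<otimes>\<^bsub>K\<^esub> q v) \<in> polynomial_functions K V"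

definition zariski_open :: "'k ring \<Rightarrow> ('k, 'v) module \<Rightarrow> 'v set \<Rightarrow> bool" where
  "zariski_open K V U \<longleftrightarrow> (\<exists>T \<subseteq> polynomial_functions K V.
     U = carrier V - {v \<in> carrier V. \<forall>p\<in>T. p v = \<zero>\<^bsub>K\<^esub>})"

definition zariski :: "'k ring \<Rightarrow> ('k, 'v) module \<Rightarrow> 'v topology" where
  "zariski K V = topology (zariski_open K V)"

lemma polynomial_functions_closed:
  assumes "field K" "p \<in> polynomial_functions K V" "v \<in> carrier V"
  shows "p v \<in> carrier K"
proof -
  interpret field K by fact
  show ?thesis
    using assms(2,3)
    by (induction rule: polynomial_functions.induct) (auto simp: Hom_def regular_def)
qed

lemma istopology_zariski_open:
  assumes "field K"
  shows "istopology (zariski_open K V)"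
proof -
  interpret field K by fact
  note cl = polynomial_functions_closed[OF assms]
  have inter: "zariski_open K V (U \<inter> U')" if "zariski_open K V U" "zariski_open K V U'" for U U'
  proof -
    obtain T T' where T: "T \<subseteq> polynomial_functions K V" "T' \<subseteq> polynomial_functions K V"
      and U: "U = carrier V - {v \<in> carrier V. \<forall>p\<in>T. p v = \<zero>\<^bsub>K\<^esub>}"
        "U' = carrier V - {v \<in> carrier V. \<forall>p\<in>T'. p v = \<zero>\<^bsub>K\<^esub>}"
      using \<open>zariski_open K V U\<close> \<open>zariski_open K V U'\<close> unfolding zariski_open_def by blast
    define T'' where "T'' = (\<lambda>(p, q). \<lambda>v\<in>carrier V. p v \<otimes>\<^bsub>K\<^esub> q v) ` (T \<times> T')"
    have "T'' \<subseteq> polynomial_functions K V"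
      using T by (auto simp: T''_def intro!: polynomial_functions.mult)
    moreover have "U \<inter> U' = carrier V - {v \<in> carrier V. \<forall>p\<in>T''. p v = \<zero>\<^bsub>K\<^esub>}"
    proof -
      have "(\<exists>p\<in>T''. p v \<noteq> \<zero>\<^bsub>K\<^esub>) \<longleftrightarrow> (\<exists>p\<in>T. p v \<noteq> \<zero>\<^bsub>K\<^esub>) \<and> (\<exists>q\<in>T'. q v \<noteq> \<zero>\<^bsub>K\<^esub>)"
        if v: "v \<in> carrier V" for v
      proof -
        have "p v \<otimes>\<^bsub>K\<^esub> q v \<noteq> \<zero>\<^bsub>K\<^esub> \<longleftrightarrow> p v \<noteq> \<zero>\<^bsub>K\<^esub> \<and> q v \<noteq> \<zero>\<^bsub>K\<^esub>" if "p \<in> T" "q \<in> T'" for p q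
        proof -
          have "p v \<in> carrier K" "q v \<in> carrier K"
            using cl[of p V v] cl[of q V v] T that v by auto
          then show ?thesis
            using integral_iff by blast
        qed
        then show ?thesis
          using v by (auto simp: T''_def)
      qed
      then show ?thesis
        unfolding U by blast
    qed
    ultimately show ?thesis
      unfolding zariski_open_def by blast
  qed
  have union: "zariski_open K V (\<Union>\<U>)" if "\<forall>U\<in>\<U>. zariski_open K V U" for \<U>
  proof -
    define T where "T = {p \<in> polynomial_functions K V. \<forall>v\<in>carrier V - \<Union>\<U>. p v = \<zero>\<^bsub>K\<^esub>}"
    have "\<Union>\<U> = carrier V - {v \<in> carrier V. \<forall>p\<in>T. p v = \<zero>\<^bsub>K\<^esub>}"
    proof (intro subset_antisym subsetI)
      fix v assume "v \<in> \<Union>\<U>"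
      then obtain U where U: "U \<in> \<U>" "v \<in> U" by blast
      then obtain T' where T': "T' \<subseteq> polynomial_functions K V"
        "U = carrier V - {v \<in> carrier V. \<forall>p\<in>T'. p v = \<zero>\<^bsub>K\<^esub>}"
        using \<open>\<forall>U\<in>\<U>. zariski_open K V U\<close> unfolding zariski_open_def by blast
      then obtain p where p: "v \<in> carrier V" "p \<in> T'" "p v \<noteq> \<zero>\<^bsub>K\<^esub>"
        using U by blast
      have "p \<in> T"
        using p T' U unfolding T_def by blast
      then show "v \<in> carrier V - {v \<in> carrier V. \<forall>p\<in>T. p v = \<zero>\<^bsub>K\<^esub>}"
        using p by blast
    next
      fix v assume "v \<in> carrier V - {v \<in> carrier V. \<forall>p\<in>T. p v = \<zero>\<^bsub>K\<^esub>}"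
      then show "v \<in> \<Union>\<U>"
        unfolding T_def by blast
    qed
    then show ?thesis
      unfolding zariski_open_def by (metis (no_types, lifting) T_def mem_Collect_eq subsetI)
  qed
  show ?thesis
    unfolding istopology_def using inter union by blast
qed

lemma openin_zariski: "field K \<Longrightarrow> openin (zariski K V) U \<longleftrightarrow> zariski_open K V U"
  by (simp add: zariski_def istopology_zariski_open topology_inverse')

lemma topspace_zariski:
  assumes "field K"
  shows "topspace (zariski K V) = carrier V"
proof -
  interpret field K by fact
  have "zariski_open K V (carrier V)"
    unfolding zariski_open_def
    by (rule exI[of _ "{\<lambda>v\<in>carrier V. \<one>\<^bsub>K\<^esub>}"]) (auto intro: polynomial_functions.const)
  moreover have "U \<subseteq> carrier V" if "zariski_open K V U" for U
    using that unfolding zariski_open_def by blast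
  ultimately show ?thesis
    unfolding topspace_def openin_zariski[OF assms] by blast
qed


section \<open>Facts about modules\<close>

lemma right_module_regular: "ring R \<Longrightarrow> right_module R (regular R)"
proof -
  assume "ring R"
  then interpret ring R .
  have "abelian_group (regular R)"
  proof (rule abelian_groupI)
    fix x assume "x \<in> carrier (regular R)"
    then show "\<exists>y\<in>carrier (regular R). y \<oplus>\<^bsub>regular R\<^esub> x = \<zero>\<^bsub>regular R\<^esub>"
      by (intro bexI[of _ "\<ominus>\<^bsub>R\<^esub> x"]) (auto simp: regular_def l_neg)
  qed (auto simp: regular_def a_ac)
  then show ?thesis
    by (intro right_module.intro right_module_axioms.intro \<open>ring R\<close>)
       (auto simp: regular_def l_distr r_distr m_assoc)
qed

lemma right_module_dir_sum:
  assumes "ring R" and "\<And>i. i \<in> I \<Longrightarrow> right_module R (M i)"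
  shows "right_module R (dir_sum I M)"
proof -
  have ab: "abelian_group (M i)" if "i \<in> I" for i
    using assms(2)[OF that] by (simp add: right_module_def)
  have fin: "finite {i \<in> I. x i \<oplus>\<^bsub>M i\<^esub> y i \<noteq> \<zero>\<^bsub>M i\<^esub>}"
    if "finite {i \<in> I. x i \<noteq> \<zero>\<^bsub>M i\<^esub>}" "finite {i \<in> I. y i \<noteq> \<zero>\<^bsub>M i\<^esub>}" for x y
  proof (rule finite_subset[OF _ finite_UnI[OF that]], safe)
    fix i assume "i \<in> I" "x i \<oplus>\<^bsub>M i\<^esub> y i \<noteq> \<zero>\<^bsub>M i\<^esub>" "y i = \<zero>\<^bsub>M i\<^esub>" "x i = \<zero>\<^bsub>M i\<^esub>"
    then show False
      using abelian_monoid.l_zero[OF abelian_group.axioms(1)[OF ab]]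
        abelian_monoid.zero_closed[OF abelian_group.axioms(1)[OF ab]] by metis
  qed
  have sm0: "a \<odot>\<^bsub>M i\<^esub> \<zero>\<^bsub>M i\<^esub> = \<zero>\<^bsub>M i\<^esub>" if "i \<in> I" "a \<in> carrier R" for i a
  proof -
    interpret right_module R "M i" using assms(2)[OF that(1)] .
    have "a \<odot>\<^bsub>M i\<^esub> \<zero>\<^bsub>M i\<^esub> = a \<odot>\<^bsub>M i\<^esub> \<zero>\<^bsub>M i\<^esub> \<oplus>\<^bsub>M i\<^esub> a \<odot>\<^bsub>M i\<^esub> \<zero>\<^bsub>M i\<^esub>"
      using smult_r_distr[of a "\<zero>\<^bsub>M i\<^esub>" "\<zero>\<^bsub>M i\<^esub>"] that by simp
    then show ?thesis
      using that M.add.l_cancel_one' smult_closed M.zero_closed by metis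
  qed
  have fin': "finite {i \<in> I. a \<odot>\<^bsub>M i\<^esub> x i \<noteq> \<zero>\<^bsub>M i\<^esub>}"
    if "a \<in> carrier R" "finite {i \<in> I. x i \<noteq> \<zero>\<^bsub>M i\<^esub>}" for a x
    by (rule finite_subset[OF _ that(2)]) (use sm0 that(1) in auto)
  have neg0: "\<ominus>\<^bsub>M i\<^esub> \<zero>\<^bsub>M i\<^esub> = \<zero>\<^bsub>M i\<^esub>" if "i \<in> I" for i
  proof -
    interpret abelian_group "M i" using ab[OF that] .
    show ?thesis using l_neg[of "\<zero>\<^bsub>M i\<^esub>"] by simp
  qed
  have grp: "abelian_group (dir_sum I M)"
  proof (rule abelian_groupI)
    fix x assume x: "x \<in> carrier (dir_sum I M)"
    have "finite {i \<in> I. \<ominus>\<^bsub>M i\<^esub> x i \<noteq> \<zero>\<^bsub>M i\<^esub>}"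
      by (rule finite_subset[of _ "{i \<in> I. x i \<noteq> \<zero>\<^bsub>M i\<^esub>}"]) (use x neg0 in \<open>auto simp: dir_sum_def\<close>)
    then have "(\<lambda>i\<in>I. \<ominus>\<^bsub>M i\<^esub> x i) \<in> carrier (dir_sum I M)"
      using x ab by (auto simp: dir_sum_def cong: conj_cong intro!: abelian_group.a_inv_closed)
    moreover have "(\<lambda>i\<in>I. \<ominus>\<^bsub>M i\<^esub> x i) \<oplus>\<^bsub>dir_sum I M\<^esub> x = \<zero>\<^bsub>dir_sum I M\<^esub>"
      using x ab by (auto simp: dir_sum_def intro!: restrict_ext abelian_group.l_neg)
    ultimately show "\<exists>y\<in>carrier (dir_sum I M). y \<oplus>\<^bsub>dir_sum I M\<^esub> x = \<zero>\<^bsub>dir_sum I M\<^esub>"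
      by blast
  next
    fix x y assume "x \<in> carrier (dir_sum I M)" "y \<in> carrier (dir_sum I M)"
    then show "x \<oplus>\<^bsub>dir_sum I M\<^esub> y \<in> carrier (dir_sum I M)"
      using fin[of x y] ab
      by (auto simp: dir_sum_def cong: conj_cong intro!: abelian_monoid.a_closed[OF abelian_group.axioms(1)])
  next
    show "\<zero>\<^bsub>dir_sum I M\<^esub> \<in> carrier (dir_sum I M)"
      using ab by (auto simp: dir_sum_def cong: conj_cong intro!: abelian_monoid.zero_closed[OF abelian_group.axioms(1)])
  next
    fix x assume x: "x \<in> carrier (dir_sum I M)"
    show "\<zero>\<^bsub>dir_sum I M\<^esub> \<oplus>\<^bsub>dir_sum I M\<^esub> x = x"
      by (rule extensionalityI[of _ I])
         (use x ab in \<open>auto simp: dir_sum_def PiE_def intro!: abelian_monoid.l_zero[OF abelian_group.axioms(1)]\<close>)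
  next
    fix x y z
    assume "x \<in> carrier (dir_sum I M)" "y \<in> carrier (dir_sum I M)" "z \<in> carrier (dir_sum I M)"
    then show "x \<oplus>\<^bsub>dir_sum I M\<^esub> y \<oplus>\<^bsub>dir_sum I M\<^esub> z = x \<oplus>\<^bsub>dir_sum I M\<^esub> (y \<oplus>\<^bsub>dir_sum I M\<^esub> z)"
      using ab by (auto simp: dir_sum_def intro!: restrict_ext
          abelian_monoid.a_assoc[OF abelian_group.axioms(1)])
  next
    fix x y
    assume "x \<in> carrier (dir_sum I M)" "y \<in> carrier (dir_sum I M)"
    then show "x \<oplus>\<^bsub>dir_sum I M\<^esub> y = y \<oplus>\<^bsub>dir_sum I M\<^esub> x"
      using ab by (auto simp: dir_sum_def intro!: restrict_ext
          abelian_monoid.a_comm[OF abelian_group.axioms(1)])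
  qed
  interpret ring R by fact
  note rm = assms(2)
  show ?thesis
  proof (intro right_module.intro right_module_axioms.intro grp \<open>ring R\<close>)
    fix a x assume "a \<in> carrier R" "x \<in> carrier (dir_sum I M)"
    then show "a \<odot>\<^bsub>dir_sum I M\<^esub> x \<in> carrier (dir_sum I M)"
      using fin'[of a x] by (auto simp: dir_sum_def cong: conj_cong intro!: right_module.smult_closed[OF rm])
  next
    fix x assume "x \<in> carrier (dir_sum I M)"
    then show "\<one>\<^bsub>R\<^esub> \<odot>\<^bsub>dir_sum I M\<^esub> x = x"
      by (intro extensionalityI[of _ I]) (auto simp: dir_sum_def PiE_def Pi_def right_module.smult_one[OF rm])
  qed (auto simp: dir_sum_def intro!: restrict_ext
        right_module.smult_l_distr[OF rm] right_module.smult_r_distr[OF rm] right_module.smult_assoc[OF rm])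
qed

lemma right_module_sub:
  assumes "right_module R M" "submodule N R M"
  shows "right_module R (sub_module M N)"
proof -
  interpret right_module R M by fact
  have sg: "subgroup N (add_monoid M)" using assms(2) by (rule submodule.axioms(1))
  note s = subgroup.subset[OF sg] subgroup.m_closed[OF sg] subgroup.one_closed[OF sg]
    subgroup.m_inv_closed[OF sg] submodule.smult_closed[OF assms(2)]
  have sub: "x \<in> carrier M" if "x \<in> N" for x using s(1) that by auto
  have "abelian_group (sub_module M N)"
  proof (rule abelian_groupI)
    fix x assume "x \<in> carrier (sub_module M N)"
    then show "\<exists>y\<in>carrier (sub_module M N). y \<oplus>\<^bsub>sub_module M N\<^esub> x = \<zero>\<^bsub>sub_module M N\<^esub>"
      by (intro bexI[of _ "\<ominus>\<^bsub>M\<^esub> x"]) (use s(4)[of x] M.l_neg[of x] sub in \<open>auto simp: sub_module_def a_inv_def\<close>)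
  qed (use s sub M.a_assoc M.a_comm in \<open>auto simp: sub_module_def\<close>)
  then show ?thesis
    by (intro right_module.intro right_module_axioms.intro R.ring_axioms)
       (use s sub in \<open>auto simp: sub_module_def smult_l_distr smult_r_distr smult_assoc\<close>)
qed

lemma right_module_quot:
  assumes "right_module R M" "submodule N R M"
  shows "right_module R (quot_module M N)"
proof -
  interpret right_module R M by fact
  have sg: "subgroup N (add_monoid M)" using assms(2) by (rule submodule.axioms(1))
  interpret N: abelian_subgroup N M
    by (rule abelian_subgroupI3) (auto simp: additive_subgroup_def sg M.abelian_group_axioms)
  have sc: "a \<odot>\<^bsub>M\<^esub> x \<in> N" if "a \<in> carrier R" "x \<in> N" for a x
    using submodule.smult_closed[OF assms(2)] that by blast
  have sm: "a \<odot>\<^bsub>quot_module M N\<^esub> (N +>\<^bsub>M\<^esub> x) = N +>\<^bsub>M\<^esub> (a \<odot>\<^bsub>M\<^esub> x)"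
    if a: "a \<in> carrier R" and x: "x \<in> carrier M" for a x
  proof -
    have "N +>\<^bsub>M\<^esub> (a \<odot>\<^bsub>M\<^esub> y) = N +>\<^bsub>M\<^esub> (a \<odot>\<^bsub>M\<^esub> x)" if y: "y \<in> N +>\<^bsub>M\<^esub> x" for y
    proof -
      obtain h where h: "h \<in> N" "y = h \<oplus>\<^bsub>M\<^esub> x"
        using y unfolding a_r_coset_def' by blast
      have "a \<odot>\<^bsub>M\<^esub> y = a \<odot>\<^bsub>M\<^esub> h \<oplus>\<^bsub>M\<^esub> a \<odot>\<^bsub>M\<^esub> x"
        unfolding h(2) by (rule smult_r_distr[OF a N.a_Hcarr[OF h(1)] x])
      then have "a \<odot>\<^bsub>M\<^esub> y \<in> N +>\<^bsub>M\<^esub> (a \<odot>\<^bsub>M\<^esub> x)"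
        using sc[OF a h(1)] unfolding a_r_coset_def' by blast
      then show ?thesis
        using M.a_repr_independence[OF _ smult_closed[OF a x] sg] by metis
    qed
    moreover have "x \<in> N +>\<^bsub>M\<^esub> x" using N.a_rcos_self x by blast
    ultimately have "(\<Union>y\<in>N +>\<^bsub>M\<^esub> x. N +>\<^bsub>M\<^esub> (a \<odot>\<^bsub>M\<^esub> y)) = N +>\<^bsub>M\<^esub> (a \<odot>\<^bsub>M\<^esub> x)"
      by (metis (no_types, lifting) SUP_cong UN_constant emptyE)
    then show ?thesis
      by (simp add: quot_module_def)
  qed
  have ad: "(N +>\<^bsub>M\<^esub> x) \<oplus>\<^bsub>quot_module M N\<^esub> (N +>\<^bsub>M\<^esub> y) = N +>\<^bsub>M\<^esub> (x \<oplus>\<^bsub>M\<^esub> y)"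
    if "x \<in> carrier M" "y \<in> carrier M" for x y
    using N.a_rcos_sum[OF that] by (simp add: quot_module_def)
  have car: "carrier (quot_module M N) = (\<lambda>x. N +>\<^bsub>M\<^esub> x) ` carrier M"
    by (auto simp: quot_module_def A_RCOSETS_def')
  have zero: "\<zero>\<^bsub>quot_module M N\<^esub> = N +>\<^bsub>M\<^esub> \<zero>\<^bsub>M\<^esub>"
    using M.a_coset_join2[OF M.zero_closed sg subgroup.one_closed[OF sg, unfolded monoid.simps]]
    by (simp add: quot_module_def)
  have "abelian_group (quot_module M N)"
  proof (rule abelian_groupI)
    fix A assume "A \<in> carrier (quot_module M N)"
    then obtain x where x: "x \<in> carrier M" "A = N +>\<^bsub>M\<^esub> x"
      by (auto simp: car)
    then show "\<exists>B\<in>carrier (quot_module M N). B \<oplus>\<^bsub>quot_module M N\<^esub> A = \<zero>\<^bsub>quot_module M N\<^esub>"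
      by (intro bexI[of _ "N +>\<^bsub>M\<^esub> (\<ominus>\<^bsub>M\<^esub> x)"]) (auto simp: car ad zero M.l_neg)
  next
    fix A B assume "A \<in> carrier (quot_module M N)" "B \<in> carrier (quot_module M N)"
    then obtain x y where "x \<in> carrier M" "A = N +>\<^bsub>M\<^esub> x" "y \<in> carrier M" "B = N +>\<^bsub>M\<^esub> y"
      by (auto simp: car)
    then show "A \<oplus>\<^bsub>quot_module M N\<^esub> B = B \<oplus>\<^bsub>quot_module M N\<^esub> A"
      using M.a_comm[of x y] by (simp add: ad)
  qed (auto simp: car ad zero M.a_assoc)
  then show ?thesis
    by (intro right_module.intro right_module_axioms.intro R.ring_axioms)
       (auto simp: car sm ad smult_l_distr smult_r_distr smult_assoc)
qed

lemma HomI: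
  assumes "\<And>x. x \<in> carrier X \<Longrightarrow> f x \<in> carrier Y"
    and "\<And>x. x \<notin> carrier X \<Longrightarrow> f x = undefined"
    and "\<And>x x'. \<lbrakk>x \<in> carrier X; x' \<in> carrier X\<rbrakk> \<Longrightarrow> f (x \<oplus>\<^bsub>X\<^esub> x') = f x \<oplus>\<^bsub>Y\<^esub> f x'"
    and "\<And>a x. \<lbrakk>a \<in> carrier R; x \<in> carrier X\<rbrakk> \<Longrightarrow> f (a \<odot>\<^bsub>X\<^esub> x) = a \<odot>\<^bsub>Y\<^esub> f x"
  shows "f \<in> Hom R X Y"
  using assms by (auto simp: Hom_def PiE_def extensional_def)

lemma HomD:
  assumes "f \<in> Hom R X Y"
  shows "\<And>x. x \<in> carrier X \<Longrightarrow> f x \<in> carrier Y"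
    and "\<And>x. x \<notin> carrier X \<Longrightarrow> f x = undefined"
    and "\<And>x x'. \<lbrakk>x \<in> carrier X; x' \<in> carrier X\<rbrakk> \<Longrightarrow> f (x \<oplus>\<^bsub>X\<^esub> x') = f x \<oplus>\<^bsub>Y\<^esub> f x'"
    and "\<And>a x. \<lbrakk>a \<in> carrier R; x \<in> carrier X\<rbrakk> \<Longrightarrow> f (a \<odot>\<^bsub>X\<^esub> x) = a \<odot>\<^bsub>Y\<^esub> f x"
  using assms by (auto simp: Hom_def PiE_def extensional_def)

lemma Hom_zero:
  assumes "right_module R X" "right_module R Y" "f \<in> Hom R X Y"
  shows "f \<zero>\<^bsub>X\<^esub> = \<zero>\<^bsub>Y\<^esub>"
proof -
  interpret X: right_module R X by fact
  interpret Y: right_module R Y by fact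
  have "f \<zero>\<^bsub>X\<^esub> \<oplus>\<^bsub>Y\<^esub> f \<zero>\<^bsub>X\<^esub> = f \<zero>\<^bsub>X\<^esub>"
    using HomD(3)[OF assms(3), of "\<zero>\<^bsub>X\<^esub>" "\<zero>\<^bsub>X\<^esub>"] by simp
  then show ?thesis
    using HomD(1)[OF assms(3), of "\<zero>\<^bsub>X\<^esub>"] Y.M.add.l_cancel_one' by auto
qed

lemma Hom_finsum:
  assumes "right_module R X" "right_module R Y" "f \<in> Hom R X Y"
    and "finite J" "\<And>j. j \<in> J \<Longrightarrow> v j \<in> carrier X"
  shows "f (\<Oplus>\<^bsub>X\<^esub>j\<in>J. v j) = (\<Oplus>\<^bsub>Y\<^esub>j\<in>J. f (v j))"
proof -
  interpret X: right_module R X by fact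
  interpret Y: right_module R Y by fact
  show ?thesis
    using assms(4,5)
  proof (induction J rule: finite_induct)
    case empty
    then show ?case using Hom_zero[OF assms(1-3)] by simp
  next
    case (insert j J)
    have "v \<in> J \<rightarrow> carrier X" "(\<lambda>j. f (v j)) \<in> J \<rightarrow> carrier Y"
      using insert HomD(1)[OF assms(3)] by auto
    then show ?case
      using insert HomD(1,3)[OF assms(3)] by (simp add: X.M.finsum_insert Y.M.finsum_insert)
  qed
qed

lemma Hom_compose:
  assumes "f \<in> Hom R X Y" "g \<in> Hom R Y Z" "right_module R X"
  shows "compose (carrier X) g f \<in> Hom R X Z"
proof -
  interpret X: right_module R X by fact
  show ?thesis
    by (rule HomI) (use HomD[OF assms(1)] HomD[OF assms(2)] in \<open>simp_all add: compose_def\<close>)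
qed

lemma smult_finsum:
  assumes "right_module R M" "a \<in> carrier R" "finite J" "\<And>j. j \<in> J \<Longrightarrow> v j \<in> carrier M"
  shows "a \<odot>\<^bsub>M\<^esub> (\<Oplus>\<^bsub>M\<^esub>j\<in>J. v j) = (\<Oplus>\<^bsub>M\<^esub>j\<in>J. a \<odot>\<^bsub>M\<^esub> v j)"
proof -
  interpret right_module R M by fact
  have z: "a \<odot>\<^bsub>M\<^esub> \<zero>\<^bsub>M\<^esub> = \<zero>\<^bsub>M\<^esub>"
    using smult_r_distr[of a "\<zero>\<^bsub>M\<^esub>" "\<zero>\<^bsub>M\<^esub>"] smult_closed[of a "\<zero>\<^bsub>M\<^esub>"] assms(2)
      M.add.l_cancel_one' by auto
  show ?thesis
    using assms(3,4)
  proof (induction J rule: finite_induct)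
    case empty
    then show ?case using z by simp
  next
    case (insert j J)
    have "v \<in> J \<rightarrow> carrier M" "(\<lambda>j. a \<odot>\<^bsub>M\<^esub> v j) \<in> J \<rightarrow> carrier M"
      using insert assms(2) by auto
    then show ?case
      using insert assms(2) by (simp add: M.finsum_insert smult_r_distr M.finsum_closed)
  qed
qed

lemma free_module_simps:
  "c \<in> carrier (free_module R I) \<longleftrightarrow>
     c \<in> (\<Pi>\<^sub>E i\<in>I. carrier R) \<and> finite {i \<in> I. c i \<noteq> \<zero>\<^bsub>R\<^esub>}"
  "c \<oplus>\<^bsub>free_module R I\<^esub> c' = (\<lambda>i\<in>I. c i \<oplus>\<^bsub>R\<^esub> c' i)"
  "a \<odot>\<^bsub>free_module R I\<^esub> c = (\<lambda>i\<in>I. c i \<otimes>\<^bsub>R\<^esub> a)"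
  by (simp_all add: free_module_def dir_sum_def regular_def)

lemma right_module_free: "ring R \<Longrightarrow> right_module R (free_module R I)"
  unfolding free_module_def by (intro right_module_dir_sum right_module_regular)

lemma free_map_eq:
  assumes "right_module R M" "t \<in> I \<rightarrow> carrier M" "c \<in> carrier (free_module R I)"
    and "finite J" "J \<subseteq> I" "{i \<in> I. c i \<noteq> \<zero>\<^bsub>R\<^esub>} \<subseteq> J"
  shows "free_map R I M t c = (\<Oplus>\<^bsub>M\<^esub>i\<in>J. c i \<odot>\<^bsub>M\<^esub> t i)"
proof -
  interpret right_module R M by fact
  have z: "\<zero>\<^bsub>R\<^esub> \<odot>\<^bsub>M\<^esub> x = \<zero>\<^bsub>M\<^esub>" if "x \<in> carrier M" for x
    using smult_l_distr[of "\<zero>\<^bsub>R\<^esub>" "\<zero>\<^bsub>R\<^esub>" x] smult_closed[of "\<zero>\<^bsub>R\<^esub>" x] that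
      M.add.l_cancel_one' by auto
  have c: "c i \<in> carrier R" if "i \<in> I" for i
    using assms(3) that by (auto simp: free_module_simps)
  have "(\<Oplus>\<^bsub>M\<^esub>i\<in>{i \<in> I. c i \<noteq> \<zero>\<^bsub>R\<^esub>}. c i \<odot>\<^bsub>M\<^esub> t i) = (\<Oplus>\<^bsub>M\<^esub>i\<in>J. c i \<odot>\<^bsub>M\<^esub> t i)"
    by (rule M.add.finprod_mono_neutral_cong_left) (use assms z c in \<open>auto simp: Pi_def subset_iff\<close>)
  then show ?thesis
    using assms(3) by (simp add: free_map_def)
qed

lemma free_map_Hom:
  assumes "right_module R M" "t \<in> I \<rightarrow> carrier M"
  shows "free_map R I M t \<in> Hom R (free_module R I) M"
proof -
  interpret right_module R M by fact
  interpret F: right_module R "free_module R I"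
    by (rule right_module_free) (rule R.ring_axioms)
  note c = free_module_simps(1)[of _ R I]
  have cl: "x i \<odot>\<^bsub>M\<^esub> t i \<in> carrier M" if "x \<in> carrier (free_module R I)" "i \<in> I" for x i
    using assms(2) that by (auto simp: c)
  show ?thesis
  proof (rule HomI)
    fix x assume x: "x \<in> carrier (free_module R I)"
    show "free_map R I M t x \<in> carrier M"
      unfolding free_map_def using x cl[OF x] by (auto intro!: M.finsum_closed)
  next
    fix x x' assume x: "x \<in> carrier (free_module R I)" "x' \<in> carrier (free_module R I)"
    define J where "J = {i \<in> I. x i \<noteq> \<zero>\<^bsub>R\<^esub>} \<union> {i \<in> I. x' i \<noteq> \<zero>\<^bsub>R\<^esub>}"
    have J: "finite J" "J \<subseteq> I"
      using x by (auto simp: J_def c)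
    have s: "{i \<in> I. (x \<oplus>\<^bsub>free_module R I\<^esub> x') i \<noteq> \<zero>\<^bsub>R\<^esub>} \<subseteq> J"
      by (auto simp: J_def free_module_simps)
    have "free_map R I M t (x \<oplus>\<^bsub>free_module R I\<^esub> x') =
        (\<Oplus>\<^bsub>M\<^esub>i\<in>J. (x \<oplus>\<^bsub>free_module R I\<^esub> x') i \<odot>\<^bsub>M\<^esub> t i)"
      by (rule free_map_eq[OF assms F.M.a_closed[OF x] J s])
    also have "\<dots> = (\<Oplus>\<^bsub>M\<^esub>i\<in>J. x i \<odot>\<^bsub>M\<^esub> t i \<oplus>\<^bsub>M\<^esub> x' i \<odot>\<^bsub>M\<^esub> t i)"
    proof (rule M.finsum_cong', simp)
      show "(\<lambda>i. x i \<odot>\<^bsub>M\<^esub> t i \<oplus>\<^bsub>M\<^esub> x' i \<odot>\<^bsub>M\<^esub> t i) \<in> J \<rightarrow> carrier M"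
        using J cl[OF x(1)] cl[OF x(2)] by auto
    next
      fix i assume "i \<in> J"
      then have "i \<in> I" "x i \<in> carrier R" "x' i \<in> carrier R" "t i \<in> carrier M"
        using J x assms(2) by (auto simp: c)
      then show "(x \<oplus>\<^bsub>free_module R I\<^esub> x') i \<odot>\<^bsub>M\<^esub> t i = x i \<odot>\<^bsub>M\<^esub> t i \<oplus>\<^bsub>M\<^esub> x' i \<odot>\<^bsub>M\<^esub> t i"
        by (simp add: free_module_simps smult_l_distr)
    qed
    also have "\<dots> = (\<Oplus>\<^bsub>M\<^esub>i\<in>J. x i \<odot>\<^bsub>M\<^esub> t i) \<oplus>\<^bsub>M\<^esub> (\<Oplus>\<^bsub>M\<^esub>i\<in>J. x' i \<odot>\<^bsub>M\<^esub> t i)"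
      by (rule M.finsum_addf) (use J cl[OF x(1)] cl[OF x(2)] in auto)
    also have "(\<Oplus>\<^bsub>M\<^esub>i\<in>J. x i \<odot>\<^bsub>M\<^esub> t i) = free_map R I M t x"
      by (rule free_map_eq[OF assms x(1) J, symmetric]) (simp add: J_def)
    also have "(\<Oplus>\<^bsub>M\<^esub>i\<in>J. x' i \<odot>\<^bsub>M\<^esub> t i) = free_map R I M t x'"
      by (rule free_map_eq[OF assms x(2) J, symmetric]) (simp add: J_def)
    finally show "free_map R I M t (x \<oplus>\<^bsub>free_module R I\<^esub> x') =
        free_map R I M t x \<oplus>\<^bsub>M\<^esub> free_map R I M t x'" .
  next
    fix a x assume a: "a \<in> carrier R" and x: "x \<in> carrier (free_module R I)"
    define J where "J = {i \<in> I. x i \<noteq> \<zero>\<^bsub>R\<^esub>}"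
    have J: "finite J" "J \<subseteq> I"
      using x by (auto simp: J_def c)
    have s: "{i \<in> I. (a \<odot>\<^bsub>free_module R I\<^esub> x) i \<noteq> \<zero>\<^bsub>R\<^esub>} \<subseteq> J"
      using a by (auto simp: J_def free_module_simps)
    have "free_map R I M t (a \<odot>\<^bsub>free_module R I\<^esub> x) =
        (\<Oplus>\<^bsub>M\<^esub>i\<in>J. (a \<odot>\<^bsub>free_module R I\<^esub> x) i \<odot>\<^bsub>M\<^esub> t i)"
      by (rule free_map_eq[OF assms F.smult_closed[OF a x] J s])
    also have "\<dots> = (\<Oplus>\<^bsub>M\<^esub>i\<in>J. a \<odot>\<^bsub>M\<^esub> (x i \<odot>\<^bsub>M\<^esub> t i))"
    proof (rule M.finsum_cong', simp)
      show "(\<lambda>i. a \<odot>\<^bsub>M\<^esub> (x i \<odot>\<^bsub>M\<^esub> t i)) \<in> J \<rightarrow> carrier M"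
        using J cl[OF x] a by auto
    next
      fix i assume "i \<in> J"
      then have "i \<in> I" "x i \<in> carrier R" "t i \<in> carrier M"
        using J x assms(2) by (auto simp: c)
      then show "(a \<odot>\<^bsub>free_module R I\<^esub> x) i \<odot>\<^bsub>M\<^esub> t i = a \<odot>\<^bsub>M\<^esub> (x i \<odot>\<^bsub>M\<^esub> t i)"
        using a by (simp add: free_module_simps smult_assoc)
    qed
    also have "\<dots> = a \<odot>\<^bsub>M\<^esub> (\<Oplus>\<^bsub>M\<^esub>i\<in>J. x i \<odot>\<^bsub>M\<^esub> t i)"
      by (rule smult_finsum[OF assms(1) a J(1), symmetric]) (use J cl[OF x] in auto)
    also have "(\<Oplus>\<^bsub>M\<^esub>i\<in>J. x i \<odot>\<^bsub>M\<^esub> t i) = free_map R I M t x"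
      by (rule free_map_eq[OF assms x J, symmetric]) (simp add: J_def)
    finally show "free_map R I M t (a \<odot>\<^bsub>free_module R I\<^esub> x) = a \<odot>\<^bsub>M\<^esub> free_map R I M t x" .
  qed (simp add: free_map_def)
qed

lemma free_map_onto:
  assumes "right_module R M" "t \<in> I \<rightarrow> carrier M" "t ` I = carrier M"
  shows "free_map R I M t ` carrier (free_module R I) = carrier M"
proof (intro subset_antisym subsetI)
  interpret right_module R M by fact
  fix x assume x: "x \<in> carrier M"
  then obtain i where i: "i \<in> I" "x = t i"
    using assms(3) by blast
  define c where "c = (\<lambda>j\<in>I. if j = i then \<one>\<^bsub>R\<^esub> else \<zero>\<^bsub>R\<^esub>)"
  have "{j \<in> I. c j \<noteq> \<zero>\<^bsub>R\<^esub>} \<subseteq> {i}"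
    by (auto simp: c_def)
  moreover from this have c: "c \<in> carrier (free_module R I)"
    by (auto simp: free_module_simps c_def intro: finite_subset)
  ultimately have "free_map R I M t c = (\<Oplus>\<^bsub>M\<^esub>j\<in>{i}. c j \<odot>\<^bsub>M\<^esub> t j)"
    using i by (intro free_map_eq[OF assms(1,2)]) auto
  also have "\<dots> = x"
    using i x by (simp add: M.finsum_insert c_def)
  finally show "x \<in> free_map R I M t ` carrier (free_module R I)"
    using c by blast
qed (use HomD(1)[OF free_map_Hom[OF assms(1,2)]] in blast)

lemma projective_lift:
  assumes "projective R P" "right_module R X" "right_module R Y"
    and g: "g \<in> Hom R X Y" "g ` carrier X = carrier Y" and h: "h \<in> Hom R P Y"
  shows "\<exists>u\<in>Hom R P X. compose (carrier P) g u = h"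
proof -
  have P: "right_module R P"
    using assms(1) by (simp add: projective_def)
  interpret P: right_module R P by (rule P)
  define F where "F = free_module R (carrier P)"
  define e where "e = free_map R (carrier P) P (\<lambda>x. x)"
  have F: "right_module R F"
    unfolding F_def by (rule right_module_free) (rule P.R.ring_axioms)
  have e: "e \<in> Hom R F P" "e ` carrier F = carrier P"
    using free_map_Hom[OF P, of "\<lambda>x. x" "carrier P"] free_map_onto[OF P, of "\<lambda>x. x" "carrier P"]
    by (simp_all add: e_def F_def)
  have "(\<lambda>x\<in>carrier P. x) \<in> Hom R P P"
    by (rule HomI) auto
  then obtain s where s: "s \<in> Hom R P F" "compose (carrier P) e s = (\<lambda>x\<in>carrier P. x)"
    using assms(1) e F P unfolding projective_def by blast
  define t where "t x = (SOME y. y \<in> carrier X \<and> g y = h x)" for x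
  have t: "t x \<in> carrier X \<and> g (t x) = h x" if "x \<in> carrier P" for x
  proof -
    have "h x \<in> g ` carrier X"
      using HomD(1)[OF h that] g(2) by simp
    then have "\<exists>y. y \<in> carrier X \<and> g y = h x"
      by force
    then show ?thesis
      unfolding t_def by (rule someI_ex)
  qed
  define w where "w = free_map R (carrier P) X t"
  have w: "w \<in> Hom R F X"
    unfolding w_def F_def by (rule free_map_Hom[OF assms(2)]) (use t in auto)
  have gw: "g (w c) = h (e c)" if c: "c \<in> carrier F" for c
  proof -
    define J where "J = {x \<in> carrier P. c x \<noteq> \<zero>\<^bsub>R\<^esub>}"
    have J: "finite J" "J \<subseteq> carrier P" and cR: "\<And>x. x \<in> J \<Longrightarrow> c x \<in> carrier R"
      using c by (auto simp: J_def F_def free_module_simps)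
    interpret X: right_module R X by fact
    interpret Y: right_module R Y by fact
    have "w c = (\<Oplus>\<^bsub>X\<^esub>x\<in>J. c x \<odot>\<^bsub>X\<^esub> t x)" "e c = (\<Oplus>\<^bsub>P\<^esub>x\<in>J. c x \<odot>\<^bsub>P\<^esub> x)"
      using c by (simp_all add: w_def e_def free_map_def F_def J_def)
    moreover have "g (\<Oplus>\<^bsub>X\<^esub>x\<in>J. c x \<odot>\<^bsub>X\<^esub> t x) = (\<Oplus>\<^bsub>Y\<^esub>x\<in>J. g (c x \<odot>\<^bsub>X\<^esub> t x))"
      by (rule Hom_finsum[OF assms(2,3) g(1) J(1)]) (use J cR t in auto)
    moreover have "h (\<Oplus>\<^bsub>P\<^esub>x\<in>J. c x \<odot>\<^bsub>P\<^esub> x) = (\<Oplus>\<^bsub>Y\<^esub>x\<in>J. h (c x \<odot>\<^bsub>P\<^esub> x))"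
      by (rule Hom_finsum[OF P assms(3) h J(1)]) (use J cR in auto)
    moreover have "(\<Oplus>\<^bsub>Y\<^esub>x\<in>J. g (c x \<odot>\<^bsub>X\<^esub> t x)) = (\<Oplus>\<^bsub>Y\<^esub>x\<in>J. h (c x \<odot>\<^bsub>P\<^esub> x))"
    proof (rule Y.M.finsum_cong', simp)
      show "(\<lambda>x. h (c x \<odot>\<^bsub>P\<^esub> x)) \<in> J \<rightarrow> carrier Y"
        using J cR HomD(1)[OF h] by auto
      fix x assume "x \<in> J"
      then have "c x \<in> carrier R" "x \<in> carrier P"
        using J cR by auto
      then show "g (c x \<odot>\<^bsub>X\<^esub> t x) = h (c x \<odot>\<^bsub>P\<^esub> x)"
        using t[of x] HomD(4)[OF g(1)] HomD(4)[OF h] by simp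
    qed
    ultimately show ?thesis by simp
  qed
  have "compose (carrier P) g (compose (carrier P) w s) = h"
  proof
    fix x
    show "compose (carrier P) g (compose (carrier P) w s) x = h x"
    proof (cases "x \<in> carrier P")
      case True
      then have "e (s x) = x"
        using fun_cong[OF s(2), of x] by (simp add: compose_def)
      then show ?thesis
        using True gw[OF HomD(1)[OF s(1) True]] by (simp add: compose_def)
    qed (simp add: compose_def HomD(2)[OF h])
  qed
  then show ?thesis
    using Hom_compose[OF s(1) w P] by blast
qed


lemma isomorphic_transport:
  fixes R :: "('r, 'c) ring_scheme" and X :: "('r, 'x) module" and g :: "'x \<Rightarrow> 'y"
  assumes "right_module R X" and inj: "inj_on g (carrier X)"
  obtains X' :: "('r, 'y) module" where "right_module R X'" "carrier X' = g ` carrier X"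
    "restrict g (carrier X) \<in> Iso R X X'"
proof -
  interpret right_module R X by fact
  define g' where "g' = inv_into (carrier X) g"
  have g': "g' (g x) = x" if "x \<in> carrier X" for x
    unfolding g'_def by (rule inv_into_f_f[OF inj that])
  define X' :: "('r, 'y) module" where "X' = \<lparr>carrier = g ` carrier X, mult = undefined, one = undefined,
    zero = g \<zero>\<^bsub>X\<^esub>, add = (\<lambda>A B. g (g' A \<oplus>\<^bsub>X\<^esub> g' B)), smult = (\<lambda>a A. g (a \<odot>\<^bsub>X\<^esub> g' A))\<rparr>"
  have ops: "carrier X' = g ` carrier X" "\<zero>\<^bsub>X'\<^esub> = g \<zero>\<^bsub>X\<^esub>"
    "\<And>A B. A \<oplus>\<^bsub>X'\<^esub> B = g (g' A \<oplus>\<^bsub>X\<^esub> g' B)" "\<And>a A. a \<odot>\<^bsub>X'\<^esub> A = g (a \<odot>\<^bsub>X\<^esub> g' A)"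
    by (simp_all add: X'_def)
  have "abelian_group X'"
  proof (rule abelian_groupI)
    fix A assume "A \<in> carrier X'"
    then obtain x where "x \<in> carrier X" "A = g x" by (auto simp: ops)
    then show "\<exists>B\<in>carrier X'. B \<oplus>\<^bsub>X'\<^esub> A = \<zero>\<^bsub>X'\<^esub>"
      by (intro bexI[of _ "g (\<ominus>\<^bsub>X\<^esub> x)"]) (auto simp: ops g' M.l_neg)
  next
    fix A B assume "A \<in> carrier X'" "B \<in> carrier X'"
    then obtain x y where "x \<in> carrier X" "A = g x" "y \<in> carrier X" "B = g y"
      by (auto simp: ops)
    then show "A \<oplus>\<^bsub>X'\<^esub> B = B \<oplus>\<^bsub>X'\<^esub> A"
      using M.a_comm[of x y] by (simp add: ops g')
  qed (auto simp: ops g' M.a_assoc)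
  then have "right_module R X'"
    by (intro right_module.intro right_module_axioms.intro R.ring_axioms)
       (auto simp: ops g' smult_l_distr smult_r_distr smult_assoc)
  moreover have "restrict g (carrier X) \<in> Hom R X X'"
    by (rule HomI) (auto simp: ops g')
  then have "restrict g (carrier X) \<in> Iso R X X'"
    using inj by (auto simp: Iso_def ops bij_betw_def)
  ultimately show ?thesis
    using that ops(1) by blast
qed

lemma simple_module_iso:
  assumes "simple_module R X" "right_module R X'" "g \<in> Iso R X X'"
  shows "simple_module R X'"
proof -
  have X: "right_module R X"
    using assms(1) by (simp add: simple_module_def)
  interpret X: right_module R X by (rule X)
  interpret X': right_module R X' by fact
  have g: "g \<in> Hom R X X'" "inj_on g (carrier X)" "g ` carrier X = carrier X'"
    using assms(3) by (auto simp: Iso_def bij_betw_def)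
  note g0 = Hom_zero[OF X assms(2) g(1)]
  have "N' = {\<zero>\<^bsub>X'\<^esub>} \<or> N' = carrier X'" if N': "submodule N' R X'" for N'
  proof -
    have sg: "subgroup N' (add_monoid X')" using N' by (rule submodule.axioms(1))
    note s = subgroup.subset[OF sg, unfolded monoid.simps partial_object.simps]
      subgroup.m_closed[OF sg, unfolded monoid.simps]
      subgroup.one_closed[OF sg, unfolded monoid.simps]
      subgroup.m_inv_closed[OF sg, folded a_inv_def] submodule.smult_closed[OF N']
    define N where "N = {x \<in> carrier X. g x \<in> N'}"
    have "subgroup N (add_monoid X)"
    proof (rule subgroup.intro)
      fix x assume "x \<in> N"
      then have x: "x \<in> carrier X" "g x \<in> N'" by (auto simp: N_def)
      have "g (\<ominus>\<^bsub>X\<^esub> x) \<oplus>\<^bsub>X'\<^esub> g x = \<zero>\<^bsub>X'\<^esub>"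
        using HomD(3)[OF g(1), of "\<ominus>\<^bsub>X\<^esub> x" x] x by (simp add: X.M.l_neg g0)
      then have "g (\<ominus>\<^bsub>X\<^esub> x) = \<ominus>\<^bsub>X'\<^esub> g x"
        using X'.M.minus_equality[of "g (\<ominus>\<^bsub>X\<^esub> x)" "g x"] x HomD(1)[OF g(1)] by simp
      then show "inv\<^bsub>add_monoid X\<^esub> x \<in> N"
        using x s(4) by (simp add: N_def flip: a_inv_def)
    qed (use s(2,3) HomD(3)[OF g(1)] g0 in \<open>auto simp: N_def\<close>)
    moreover have "a \<odot>\<^bsub>X\<^esub> x \<in> N" if "a \<in> carrier R" "x \<in> N" for a x
      using that s(5) HomD(4)[OF g(1)] by (auto simp: N_def)
    ultimately have "submodule N R X"
      by (intro submodule.intro submodule_axioms.intro)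
    then consider "N = {\<zero>\<^bsub>X\<^esub>}" | "N = carrier X"
      using assms(1) unfolding simple_module_def by blast
    moreover have "N' = g ` N"
      using s(1) g(3) by (auto simp: N_def)
    ultimately show ?thesis
      using g0 g(3) by cases auto
  qed
  moreover have "carrier X' \<noteq> {\<zero>\<^bsub>X'\<^esub>}"
  proof
    assume z: "carrier X' = {\<zero>\<^bsub>X'\<^esub>}"
    have "carrier X \<noteq> {\<zero>\<^bsub>X\<^esub>}"
      using assms(1) by (simp add: simple_module_def)
    then obtain x where x: "x \<in> carrier X" "x \<noteq> \<zero>\<^bsub>X\<^esub>"
      by blast
    have "g x = g \<zero>\<^bsub>X\<^esub>"
      using z HomD(1)[OF g(1) x(1)] g0 by auto
    then show False
      using inj_onD[OF g(2)] x by auto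
  qed
  ultimately show ?thesis
    using assms(2) by (simp add: simple_module_def)
qed

lemma simple_module_cyclic:
  assumes "simple_module R X" "x \<in> carrier X" "x \<noteq> \<zero>\<^bsub>X\<^esub>"
  shows "(\<lambda>a. a \<odot>\<^bsub>X\<^esub> x) ` carrier R = carrier X"
proof -
  interpret right_module R X
    using assms(1) by (simp add: simple_module_def)
  let ?N = "(\<lambda>a. a \<odot>\<^bsub>X\<^esub> x) ` carrier R"
  have z: "\<zero>\<^bsub>R\<^esub> \<odot>\<^bsub>X\<^esub> x = \<zero>\<^bsub>X\<^esub>"
    using smult_l_distr[of "\<zero>\<^bsub>R\<^esub>" "\<zero>\<^bsub>R\<^esub>" x] smult_closed[of "\<zero>\<^bsub>R\<^esub>" x] assms(2)
      M.add.l_cancel_one' by auto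
  have "subgroup ?N (add_monoid X)"
  proof (rule subgroup.intro)
    show "?N \<subseteq> carrier (add_monoid X)"
      using assms(2) by auto
  next
    fix y y' assume "y \<in> ?N" "y' \<in> ?N"
    then obtain a a' where a: "a \<in> carrier R" "y = a \<odot>\<^bsub>X\<^esub> x" "a' \<in> carrier R" "y' = a' \<odot>\<^bsub>X\<^esub> x"
      by blast
    then have "y \<oplus>\<^bsub>X\<^esub> y' = (a \<oplus>\<^bsub>R\<^esub> a') \<odot>\<^bsub>X\<^esub> x"
      using assms(2) by (simp add: smult_l_distr)
    then show "y \<otimes>\<^bsub>add_monoid X\<^esub> y' \<in> ?N"
      using a by auto
  next
    show "\<one>\<^bsub>add_monoid X\<^esub> \<in> ?N"
      using z R.zero_closed by (metis image_eqI monoid.simps(2))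
  next
    fix y assume "y \<in> ?N"
    then obtain a where a: "a \<in> carrier R" "y = a \<odot>\<^bsub>X\<^esub> x"
      by blast
    have "(\<ominus>\<^bsub>R\<^esub> a) \<odot>\<^bsub>X\<^esub> x \<oplus>\<^bsub>X\<^esub> y = \<zero>\<^bsub>X\<^esub>"
      using smult_l_distr[of "\<ominus>\<^bsub>R\<^esub> a" a x] a assms(2) z by (simp add: R.l_neg)
    then have "\<ominus>\<^bsub>X\<^esub> y = (\<ominus>\<^bsub>R\<^esub> a) \<odot>\<^bsub>X\<^esub> x"
      using M.minus_equality[of "(\<ominus>\<^bsub>R\<^esub> a) \<odot>\<^bsub>X\<^esub> x" y] a assms(2) by simp
    then show "inv\<^bsub>add_monoid X\<^esub> y \<in> ?N"
      using a by (auto simp flip: a_inv_def)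
  qed
  moreover have "b \<odot>\<^bsub>X\<^esub> y \<in> ?N" if b: "b \<in> carrier R" and y: "y \<in> ?N" for b y
  proof -
    obtain a where "a \<in> carrier R" "y = a \<odot>\<^bsub>X\<^esub> x"
      using y by blast
    then show ?thesis
      using b assms(2) smult_assoc[of a b x] by (metis image_eqI R.m_closed)
  qed
  ultimately have "submodule ?N R X"
    by (intro submodule.intro submodule_axioms.intro)
  moreover have "x \<in> ?N"
    using assms(2) smult_one[of x] by (metis R.one_closed image_eqI)
  ultimately show ?thesis
    using assms(1,3) unfolding simple_module_def by (metis singletonD)
qed

text \<open>
  A simple module is a quotient of the regular module, so a family of modules contains all simple
  modules up to isomorphism if it contains those on the type \<open>'r set\<close>.
\<close>

lemma simple_module_small:
  fixes R :: "('r, 'c) ring_scheme" and X :: "('r, 'x) module"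
  assumes "simple_module R X"
  obtains X' :: "('r, 'r set) module" where "simple_module R X'" "isomorphic R X X'"
proof -
  have X: "right_module R X" "carrier X \<noteq> {\<zero>\<^bsub>X\<^esub>}"
    using assms by (auto simp: simple_module_def)
  interpret right_module R X by (rule X)
  obtain x where x: "x \<in> carrier X" "x \<noteq> \<zero>\<^bsub>X\<^esub>"
    using X(2) M.zero_closed by blast
  define g where "g y = {a \<in> carrier R. a \<odot>\<^bsub>X\<^esub> x = y}" for y
  have "inj_on g (carrier X)"
  proof (rule inj_onI)
    fix y y' assume y: "y \<in> carrier X" "g y = g y'"
    then have "y \<in> (\<lambda>a. a \<odot>\<^bsub>X\<^esub> x) ` carrier R"
      by (simp add: simple_module_cyclic[OF assms x])
    then obtain a where "a \<in> g y"
      by (auto simp: g_def)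
    moreover from this have "a \<in> g y'"
      by (simp add: y(2))
    ultimately show "y = y'"
      by (simp add: g_def)
  qed
  then obtain X' where X': "right_module R X'" "restrict g (carrier X) \<in> Iso R X X'"
    by (rule isomorphic_transport[OF X(1)])
  then show ?thesis
    using that[of X'] simple_module_iso[OF assms X'] by (auto simp: isomorphic_def)
qed

end

theory Submission
  imports Defs "HOL-Algebra.Polynomial_Divisibility"
begin

text \<open>
  Write $P = P(\alpha)$, $R = \operatorname{rad} P$ and $\delta_f = f - \mathrm{inc} : R \to P$, so that
  $N_f$ is the cokernel of $\delta_f$. The set in question is a nonempty union of basic open
  sets, and over an infinite field any two nonempty Zariski open subsets of a vector space meet
  (\<open>zariski_open_dense\<close>): two nonzero polynomial functions restrict to nonzero polynomials in one
  variable on a suitable line, and have only finitely many zeros there.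

  Nonempty (\<open>exists_presentation\<close>). If $d_{ji} \neq 0$, then $P_i$ embeds properly into $P_j$, so the
  quiver with these arrows is acyclic, and maps in $\mathrm{Rep}(\Lambda,\alpha)$ lower a weight on
  the vertices. Hence $\delta_f$ is injective, and each map $P_i \to P$ agrees modulo the image of
  $\delta_f$ with one into the components $P_i$. Acyclicity also makes $F_i = \operatorname{End}(P_i)$
  a division ring. Bases of the spaces $\operatorname{Hom}(P_i,M)$ over $F_i$ define $\pi : P \to M$, and
  expanding $\pi|_R$ on the summands of $R$ in these bases yields an $f$ with $\pi f = \pi|_R$. Now the
  components $P_i \to P$ span $\operatorname{Hom}(P_i,N_f)$ and become a basis of
  $\operatorname{Hom}(P_i,M)$, for every $i$, so that $\pi$ induces $N_f \cong M$.

  Open (\<open>isomorphic_near\<close>). Let $N_{f_0} \cong M$. By rigidity every map $R \to P$ has the form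
  $a \delta_{f_0} + \delta_{f_0} b$ with endomorphisms $a$ of $P$ and $b$ of $R$
  (\<open>rigid_decompose\<close>). In other words, the linear system for maps $\delta_{f_0} \to \delta_v$ of
  presentations has a surjective coefficient map at $v = f_0$. Gaussian elimination (\<open>cramer\<close>)
  turns the identity solution at $f_0$ into a solution that depends polynomially on $v$, and its
  component on $P$ remains surjective where a polynomial does not vanish
  (\<open>surj_near_identity\<close>). Since all modules have finite length, the map of presentations is then
  an isomorphism and $N_v \cong N_{f_0}$. No group orbit and no tangent space enters, so this works
  over every infinite field.
\<close>

(* X denotes modules and vector spaces here, not the variable of a polynomial ring. *)
no_notation var (\<open>X\<index>\<close>)

section \<open>Submodules and homomorphisms\<close>

lemma (in right_module) smult_l_null [simp]:
  assumes "x \<in> carrier M" shows "\<zero>\<^bsub>R\<^esub> \<odot>\<^bsub>M\<^esub> x = \<zero>\<^bsub>M\<^esub>"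
  using smult_l_distr[of "\<zero>\<^bsub>R\<^esub>" "\<zero>\<^bsub>R\<^esub>" x] smult_closed[of "\<zero>\<^bsub>R\<^esub>" x] assms
    M.add.l_cancel_one' by auto

lemma (in right_module) smult_r_null [simp]:
  assumes "a \<in> carrier R" shows "a \<odot>\<^bsub>M\<^esub> \<zero>\<^bsub>M\<^esub> = \<zero>\<^bsub>M\<^esub>"
  using smult_r_distr[of a "\<zero>\<^bsub>M\<^esub>" "\<zero>\<^bsub>M\<^esub>"] smult_closed[of a "\<zero>\<^bsub>M\<^esub>"] assms
    M.add.l_cancel_one' by auto

lemma (in right_module) smult_l_minus:
  assumes "a \<in> carrier R" "x \<in> carrier M" shows "(\<ominus>\<^bsub>R\<^esub> a) \<odot>\<^bsub>M\<^esub> x = \<ominus>\<^bsub>M\<^esub> (a \<odot>\<^bsub>M\<^esub> x)"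
proof -
  have "(\<ominus>\<^bsub>R\<^esub> a) \<odot>\<^bsub>M\<^esub> x \<oplus>\<^bsub>M\<^esub> a \<odot>\<^bsub>M\<^esub> x = \<zero>\<^bsub>M\<^esub>"
    using smult_l_distr[of "\<ominus>\<^bsub>R\<^esub> a" a x] assms by (simp add: R.l_neg)
  then show ?thesis
    using M.minus_equality[of "(\<ominus>\<^bsub>R\<^esub> a) \<odot>\<^bsub>M\<^esub> x" "a \<odot>\<^bsub>M\<^esub> x"] assms by simp
qed

lemma (in right_module) minus_eq_smult:
  "x \<in> carrier M \<Longrightarrow> \<ominus>\<^bsub>M\<^esub> x = (\<ominus>\<^bsub>R\<^esub> \<one>\<^bsub>R\<^esub>) \<odot>\<^bsub>M\<^esub> x"
  by (simp add: smult_l_minus)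

lemma (in right_module) minus_eq_zero_iff:
  assumes "x \<in> carrier M" "y \<in> carrier M" shows "x \<ominus>\<^bsub>M\<^esub> y = \<zero>\<^bsub>M\<^esub> \<longleftrightarrow> x = y"
  using assms M.minus_equality[of x "\<ominus>\<^bsub>M\<^esub> y"] by (auto simp: a_minus_def M.r_neg)

lemma submodule_iff:
  assumes "right_module R X"
  shows "submodule U R X \<longleftrightarrow> U \<subseteq> carrier X \<and> \<zero>\<^bsub>X\<^esub> \<in> U \<and> (\<forall>x\<in>U. \<forall>y\<in>U. x \<oplus>\<^bsub>X\<^esub> y \<in> U) \<and>
     (\<forall>a\<in>carrier R. \<forall>x\<in>U. a \<odot>\<^bsub>X\<^esub> x \<in> U)" (is "_ \<longleftrightarrow> ?c")
proof
  assume "submodule U R X"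
  then show ?c
    using subgroup.subset[OF submodule.axioms(1)] subgroup.m_closed[OF submodule.axioms(1)]
      subgroup.one_closed[OF submodule.axioms(1)] submodule.smult_closed by fastforce
next
  assume c: ?c
  interpret right_module R X by fact
  have "\<ominus>\<^bsub>X\<^esub> x \<in> U" if "x \<in> U" for x
    using c that minus_eq_smult[of x] by auto
  then have "subgroup U (add_monoid X)"
    using c by (intro subgroup.intro) (auto simp flip: a_inv_def)
  then show "submodule U R X"
    using c by (intro submodule.intro submodule_axioms.intro) auto
qed

lemma
  assumes "right_module R X" "submodule U R X"
  shows submodule_subset: "U \<subseteq> carrier X"
    and submodule_zero: "\<zero>\<^bsub>X\<^esub> \<in> U"
    and submodule_add: "\<And>x y. \<lbrakk>x \<in> U; y \<in> U\<rbrakk> \<Longrightarrow> x \<oplus>\<^bsub>X\<^esub> y \<in> U"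
    and submodule_smult: "\<And>a x. \<lbrakk>a \<in> carrier R; x \<in> U\<rbrakk> \<Longrightarrow> a \<odot>\<^bsub>X\<^esub> x \<in> U"
    and submodule_uminus: "\<And>x. x \<in> U \<Longrightarrow> \<ominus>\<^bsub>X\<^esub> x \<in> U"
    and submodule_minus: "\<And>x y. \<lbrakk>x \<in> U; y \<in> U\<rbrakk> \<Longrightarrow> x \<ominus>\<^bsub>X\<^esub> y \<in> U"
proof -
  interpret right_module R X by fact
  note s = assms(2)[unfolded submodule_iff[OF assms(1)]]
  show "U \<subseteq> carrier X" "\<zero>\<^bsub>X\<^esub> \<in> U"
    and ad: "\<And>x y. \<lbrakk>x \<in> U; y \<in> U\<rbrakk> \<Longrightarrow> x \<oplus>\<^bsub>X\<^esub> y \<in> U"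
    and "\<And>a x. \<lbrakk>a \<in> carrier R; x \<in> U\<rbrakk> \<Longrightarrow> a \<odot>\<^bsub>X\<^esub> x \<in> U"
    using s by auto
  show um: "\<And>x. x \<in> U \<Longrightarrow> \<ominus>\<^bsub>X\<^esub> x \<in> U"
    using s minus_eq_smult by (metis R.add.inv_closed R.one_closed subsetD)
  show "\<And>x y. \<lbrakk>x \<in> U; y \<in> U\<rbrakk> \<Longrightarrow> x \<ominus>\<^bsub>X\<^esub> y \<in> U"
    using ad um by (simp add: a_minus_def)
qed

lemma submodule_finsum:
  assumes "right_module R X" "submodule U R X" "finite J" "\<And>j. j \<in> J \<Longrightarrow> v j \<in> U"
  shows "(\<Oplus>\<^bsub>X\<^esub>j\<in>J. v j) \<in> U"
proof -
  interpret right_module R X by fact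
  show ?thesis
    using assms(3,4)
  proof (induction J rule: finite_induct)
    case empty
    then show ?case by (simp add: submodule_zero[OF assms(1,2)])
  next
    case (insert j J)
    moreover have "v \<in> J \<rightarrow> carrier X" "v j \<in> carrier X"
      using insert submodule_subset[OF assms(1,2)] by auto
    ultimately show ?case
      by (simp add: M.finsum_insert submodule_add[OF assms(1,2)])
  qed
qed

lemma submodule_carrier: "right_module R X \<Longrightarrow> submodule (carrier X) R X"
proof -
  assume X: "right_module R X"
  interpret right_module R X by fact
  show ?thesis by (simp add: submodule_iff[OF X])
qed

lemma submodule_zero_set: "right_module R X \<Longrightarrow> submodule {\<zero>\<^bsub>X\<^esub>} R X"
proof -
  assume X: "right_module R X"
  interpret right_module R X by fact
  show ?thesis by (simp add: submodule_iff[OF X])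
qed

lemma sub_module_simps [simp]:
  "carrier (sub_module X U) = U" "\<zero>\<^bsub>sub_module X U\<^esub> = \<zero>\<^bsub>X\<^esub>"
  "x \<oplus>\<^bsub>sub_module X U\<^esub> y = x \<oplus>\<^bsub>X\<^esub> y" "a \<odot>\<^bsub>sub_module X U\<^esub> x = a \<odot>\<^bsub>X\<^esub> x"
  by (simp_all add: sub_module_def)

lemma submodule_sub_module_iff:
  assumes "right_module R X" "submodule U R X"
  shows "submodule V R (sub_module X U) \<longleftrightarrow> submodule V R X \<and> V \<subseteq> U"
  using submodule_subset[OF assms]
  by (auto simp: submodule_iff[OF assms(1)] submodule_iff[OF right_module_sub[OF assms]])

lemma submodule_Int:
  assumes "right_module R X" "submodule U R X" "submodule V R X"
  shows "submodule (U \<inter> V) R X"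
  using assms(2,3) by (auto simp: submodule_iff[OF assms(1)])

lemma submodule_sum:
  assumes "right_module R X" "submodule U R X" "submodule V R X"
  shows "submodule (U <+>\<^bsub>X\<^esub> V) R X" "U \<subseteq> U <+>\<^bsub>X\<^esub> V" "V \<subseteq> U <+>\<^bsub>X\<^esub> V"
proof -
  interpret right_module R X by fact
  note u = submodule_subset[OF assms(1,2)] submodule_zero[OF assms(1,2)]
    submodule_add[OF assms(1,2)] submodule_smult[OF assms(1,2)]
  note v = submodule_subset[OF assms(1,3)] submodule_zero[OF assms(1,3)]
    submodule_add[OF assms(1,3)] submodule_smult[OF assms(1,3)]
  have mem: "z \<in> U <+>\<^bsub>X\<^esub> V \<longleftrightarrow> (\<exists>x\<in>U. \<exists>y\<in>V. z = x \<oplus>\<^bsub>X\<^esub> y)" for z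
    by (auto simp: set_add_def')
  show "U \<subseteq> U <+>\<^bsub>X\<^esub> V"
    using u(1) v(2) unfolding mem subset_iff by (metis M.r_zero)
  show "V \<subseteq> U <+>\<^bsub>X\<^esub> V"
    using u v unfolding mem subset_iff by (metis M.l_zero subsetD)
  have 1: "x \<oplus>\<^bsub>X\<^esub> y \<oplus>\<^bsub>X\<^esub> (x' \<oplus>\<^bsub>X\<^esub> y') = (x \<oplus>\<^bsub>X\<^esub> x') \<oplus>\<^bsub>X\<^esub> (y \<oplus>\<^bsub>X\<^esub> y')"
    if "x \<in> U" "x' \<in> U" "y \<in> V" "y' \<in> V" for x x' y y'
    using that u(1) v(1) by (simp add: subset_iff M.a_ac)
  have 2: "a \<odot>\<^bsub>X\<^esub> (x \<oplus>\<^bsub>X\<^esub> y) = a \<odot>\<^bsub>X\<^esub> x \<oplus>\<^bsub>X\<^esub> a \<odot>\<^bsub>X\<^esub> y" if "x \<in> U" "y \<in> V" "a \<in> carrier R" for a x y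
    using that u(1) v(1) by (simp add: subset_iff smult_r_distr)
  show "submodule (U <+>\<^bsub>X\<^esub> V) R X"
    unfolding submodule_iff[OF assms(1)]
  proof (intro conjI ballI)
    show "U <+>\<^bsub>X\<^esub> V \<subseteq> carrier X"
      using u(1) v(1) by (auto simp: mem subset_iff)
    show "\<zero>\<^bsub>X\<^esub> \<in> U <+>\<^bsub>X\<^esub> V"
      using \<open>U \<subseteq> U <+>\<^bsub>X\<^esub> V\<close> u(2) by blast
  next
    fix z z' assume "z \<in> U <+>\<^bsub>X\<^esub> V" "z' \<in> U <+>\<^bsub>X\<^esub> V"
    then obtain x y x' y' where "x \<in> U" "y \<in> V" "x' \<in> U" "y' \<in> V" "z = x \<oplus>\<^bsub>X\<^esub> y" "z' = x' \<oplus>\<^bsub>X\<^esub> y'"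
      unfolding mem by blast
    then show "z \<oplus>\<^bsub>X\<^esub> z' \<in> U <+>\<^bsub>X\<^esub> V"
      unfolding mem using 1[of x x' y y'] u(3)[of x x'] v(3)[of y y'] by blast
  next
    fix a z assume "a \<in> carrier R" "z \<in> U <+>\<^bsub>X\<^esub> V"
    then obtain x y where "x \<in> U" "y \<in> V" "z = x \<oplus>\<^bsub>X\<^esub> y"
      unfolding mem by blast
    then show "a \<odot>\<^bsub>X\<^esub> z \<in> U <+>\<^bsub>X\<^esub> V"
      unfolding mem using 2[of x y a] u(4)[of a x] v(4)[of a y] \<open>a \<in> carrier R\<close> by blast
  qed
qed

lemma Hom_uminus:
  assumes "right_module R X" "right_module R Y" "f \<in> Hom R X Y" "x \<in> carrier X"
  shows "f (\<ominus>\<^bsub>X\<^esub> x) = \<ominus>\<^bsub>Y\<^esub> f x"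
proof -
  interpret X: right_module R X by fact
  interpret Y: right_module R Y by fact
  show ?thesis
    using assms(4) HomD(1,4)[OF assms(3)] by (simp add: X.minus_eq_smult Y.minus_eq_smult)
qed

lemma Hom_minus:
  assumes "right_module R X" "right_module R Y" "f \<in> Hom R X Y" "x \<in> carrier X" "x' \<in> carrier X"
  shows "f (x \<ominus>\<^bsub>X\<^esub> x') = f x \<ominus>\<^bsub>Y\<^esub> f x'"
proof -
  interpret X: right_module R X by fact
  show ?thesis
    using assms(4,5) HomD(3)[OF assms(3)] Hom_uminus[OF assms(1-3)] by (simp add: a_minus_def)
qed

lemma Hom_eqI:
  assumes "f \<in> Hom R X Y" "g \<in> Hom R X Z" "\<And>x. x \<in> carrier X \<Longrightarrow> f x = g x"
  shows "f = g"
  using assms HomD(2)[OF assms(1)] HomD(2)[OF assms(2)] by (metis ext)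

lemma Hom_restrict: "f \<in> Hom R X Y \<Longrightarrow> U \<subseteq> carrier X \<Longrightarrow> restrict f U \<in> Hom R (sub_module X U) Y"
  if "right_module R (sub_module X U)"
proof -
  interpret right_module R "sub_module X U" by fact
  assume f: "f \<in> Hom R X Y" "U \<subseteq> carrier X"
  show ?thesis
    by (rule HomI) (use f HomD[OF f(1)] M.a_closed smult_closed in \<open>auto simp: subset_iff\<close>)
qed

lemma Hom_into_sub:
  assumes "f \<in> Hom R X Y" "\<And>x. x \<in> carrier X \<Longrightarrow> f x \<in> V"
  shows "f \<in> Hom R X (sub_module Y V)"
  by (rule HomI) (use HomD[OF assms(1)] assms(2) in auto)

lemma Hom_from_into_sub:
  assumes "f \<in> Hom R X (sub_module Y V)" "V \<subseteq> carrier Y"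
  shows "f \<in> Hom R X Y"
  by (rule HomI) (use HomD[OF assms(1)] assms(2) in auto)

lemma Hom_id: "right_module R X \<Longrightarrow> (\<lambda>x\<in>carrier X. x) \<in> Hom R X X"
proof -
  assume "right_module R X"
  then interpret right_module R X .
  show ?thesis by (rule HomI) auto
qed

definition kern :: "('r, 'x) module \<Rightarrow> ('r, 'y) module \<Rightarrow> ('x \<Rightarrow> 'y) \<Rightarrow> 'x set" where
  "kern X Y f = {x \<in> carrier X. f x = \<zero>\<^bsub>Y\<^esub>}"

lemma submodule_vimage:
  assumes "right_module R X" "right_module R Y" "f \<in> Hom R X Y" "submodule V R Y"
  shows "submodule {x \<in> carrier X. f x \<in> V} R X"
proof -
  interpret X: right_module R X by fact
  interpret Y: right_module R Y by fact
  show ?thesis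
    using HomD(3,4)[OF assms(3)] Hom_zero[OF assms(1-3)] submodule_zero[OF assms(2,4)]
      submodule_add[OF assms(2,4)] submodule_smult[OF assms(2,4)]
    by (simp add: submodule_iff[OF assms(1)])
qed

lemma submodule_kern:
  assumes "right_module R X" "right_module R Y" "f \<in> Hom R X Y"
  shows "submodule (kern X Y f) R X"
  using submodule_vimage[OF assms submodule_zero_set[OF assms(2)]] by (simp add: kern_def)

lemma submodule_image:
  assumes "right_module R X" "right_module R Y" "f \<in> Hom R X Y" "submodule U R X"
  shows "submodule (f ` U) R Y"
proof -
  interpret X: right_module R X by fact
  interpret Y: right_module R Y by fact
  note u = submodule_subset[OF assms(1,4)] submodule_zero[OF assms(1,4)]
    submodule_add[OF assms(1,4)] submodule_smult[OF assms(1,4)]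
  have ux: "x \<in> carrier X" if "x \<in> U" for x using that u(1) by blast
  show ?thesis
    unfolding submodule_iff[OF assms(2)]
  proof (intro conjI ballI)
    show "f ` U \<subseteq> carrier Y" using HomD(1)[OF assms(3)] ux by blast
    show "\<zero>\<^bsub>Y\<^esub> \<in> f ` U" using u(2) Hom_zero[OF assms(1-3)] by (metis imageI)
  next
    fix y y' assume "y \<in> f ` U" "y' \<in> f ` U"
    then obtain x x' where x: "x \<in> U" "y = f x" "x' \<in> U" "y' = f x'" by blast
    then have "y \<oplus>\<^bsub>Y\<^esub> y' = f (x \<oplus>\<^bsub>X\<^esub> x')"
      using HomD(3)[OF assms(3) ux ux] by simp
    then show "y \<oplus>\<^bsub>Y\<^esub> y' \<in> f ` U"
      using u(3) x by simp
  next
    fix a y assume a: "a \<in> carrier R" and "y \<in> f ` U"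
    then obtain x where x: "x \<in> U" "y = f x" by blast
    then have "a \<odot>\<^bsub>Y\<^esub> y = f (a \<odot>\<^bsub>X\<^esub> x)"
      using HomD(4)[OF assms(3) a ux] by simp
    then show "a \<odot>\<^bsub>Y\<^esub> y \<in> f ` U"
      using u(4) x a by simp
  qed
qed

lemma Hom_eq_iff_kern:
  assumes "right_module R X" "right_module R Y" "f \<in> Hom R X Y" "x \<in> carrier X" "x' \<in> carrier X"
  shows "f x = f x' \<longleftrightarrow> x \<ominus>\<^bsub>X\<^esub> x' \<in> kern X Y f"
proof -
  interpret X: right_module R X by fact
  interpret Y: right_module R Y by fact
  show ?thesis
    using assms(4,5) HomD(1)[OF assms(3)] Hom_minus[OF assms]
    by (simp add: kern_def Y.minus_eq_zero_iff)
qed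

lemma inj_on_iff_kern:
  assumes "right_module R X" "right_module R Y" "f \<in> Hom R X Y"
  shows "inj_on f (carrier X) \<longleftrightarrow> kern X Y f = {\<zero>\<^bsub>X\<^esub>}"
proof -
  interpret X: right_module R X by fact
  show ?thesis
  proof
    assume inj: "inj_on f (carrier X)"
    have "x = \<zero>\<^bsub>X\<^esub>" if "x \<in> carrier X" "f x = \<zero>\<^bsub>Y\<^esub>" for x
      by (rule inj_onD[OF inj _ that(1) X.M.zero_closed]) (simp add: that Hom_zero[OF assms])
    then show "kern X Y f = {\<zero>\<^bsub>X\<^esub>}"
      unfolding kern_def using Hom_zero[OF assms] X.M.zero_closed by blast
  next
    assume k: "kern X Y f = {\<zero>\<^bsub>X\<^esub>}"
    show "inj_on f (carrier X)"
    proof (rule inj_onI)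
      fix x x' assume x: "x \<in> carrier X" "x' \<in> carrier X" "f x = f x'"
      then have "x \<ominus>\<^bsub>X\<^esub> x' \<in> {\<zero>\<^bsub>X\<^esub>}"
        using Hom_eq_iff_kern[OF assms x(1,2)] by (simp add: k)
      then show "x = x'"
        using X.minus_eq_zero_iff[OF x(1,2)] by simp
    qed
  qed
qed

lemma Hom_factor:
  assumes X: "right_module R X" and Y: "right_module R Y" and Z: "right_module R Z"
    and g: "g \<in> Hom R X Y" "g ` carrier X = carrier Y" and h: "h \<in> Hom R X Z"
    and k: "kern X Y g \<subseteq> kern X Z h"
  obtains t where "t \<in> Hom R Y Z" "\<And>x. x \<in> carrier X \<Longrightarrow> t (g x) = h x"
proof -
  interpret X: right_module R X by fact
  define t where "t = (\<lambda>y\<in>carrier Y. h (SOME x. x \<in> carrier X \<and> g x = y))"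
  have t: "t (g x) = h x" if x: "x \<in> carrier X" for x
  proof -
    define x' where "x' = (SOME x'. x' \<in> carrier X \<and> g x' = g x)"
    have "x' \<in> carrier X \<and> g x' = g x"
      unfolding x'_def by (rule someI[of _ x]) (use x in simp)
    then have "h x' = h x"
      using x k Hom_eq_iff_kern[OF X Y g(1)] Hom_eq_iff_kern[OF X Z h] by blast
    then show ?thesis
      using x HomD(1)[OF g(1)] by (simp add: t_def x'_def)
  qed
  have "t \<in> Hom R Y Z"
  proof (rule HomI)
    fix y assume "y \<in> carrier Y"
    then obtain x where "x \<in> carrier X" "y = g x" using g(2) by blast
    then show "t y \<in> carrier Z" using t HomD(1)[OF h] by simp
  next
    fix y y' assume "y \<in> carrier Y" "y' \<in> carrier Y"
    then obtain x x' where x: "x \<in> carrier X" "y = g x" "x' \<in> carrier X" "y' = g x'"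
      using g(2) by blast
    then have "t (y \<oplus>\<^bsub>Y\<^esub> y') = t (g (x \<oplus>\<^bsub>X\<^esub> x'))" by (simp add: HomD(3)[OF g(1)])
    also have "\<dots> = t y \<oplus>\<^bsub>Z\<^esub> t y'" using x t by (simp add: HomD(3)[OF h])
    finally show "t (y \<oplus>\<^bsub>Y\<^esub> y') = t y \<oplus>\<^bsub>Z\<^esub> t y'" .
  next
    fix a y assume a: "a \<in> carrier R" "y \<in> carrier Y"
    then obtain x where x: "x \<in> carrier X" "y = g x" using g(2) by blast
    then have "t (a \<odot>\<^bsub>Y\<^esub> y) = t (g (a \<odot>\<^bsub>X\<^esub> x))" using a by (simp add: HomD(4)[OF g(1)])
    also have "\<dots> = a \<odot>\<^bsub>Z\<^esub> t y" using x a t by (simp add: HomD(4)[OF h])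
    finally show "t (a \<odot>\<^bsub>Y\<^esub> y) = a \<odot>\<^bsub>Z\<^esub> t y" .
  qed (simp add: t_def)
  with t that show ?thesis by blast
qed

lemma isomorphic_if_same_kern:
  assumes X: "right_module R X" and Y: "right_module R Y" and Z: "right_module R Z"
    and g: "g \<in> Hom R X Y" "g ` carrier X = carrier Y"
    and h: "h \<in> Hom R X Z" "h ` carrier X = carrier Z"
    and k: "kern X Y g = kern X Z h"
  shows "isomorphic R Y Z"
proof -
  obtain t where t: "t \<in> Hom R Y Z" "\<And>x. x \<in> carrier X \<Longrightarrow> t (g x) = h x"
    using Hom_factor[OF X Y Z g h(1)] k by blast
  have "t ` carrier Y = carrier Z"
    using g(2) h(2) t(2) by (metis (no_types, lifting) image_cong image_image)
  moreover have "inj_on t (carrier Y)"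
  proof (rule inj_onI)
    fix y y' assume y: "y \<in> carrier Y" "y' \<in> carrier Y" "t y = t y'"
    then obtain x x' where x: "x \<in> carrier X" "y = g x" "x' \<in> carrier X" "y' = g x'"
      using g(2) by blast
    then show "y = y'"
      using y(3) t(2) k Hom_eq_iff_kern[OF X Y g(1)] Hom_eq_iff_kern[OF X Z h(1)] by simp
  qed
  ultimately show ?thesis
    using t(1) by (auto simp: isomorphic_def Iso_def bij_betw_def)
qed

lemma quot_map:
  assumes X: "right_module R X" and N: "submodule N R X"
  shows "(\<lambda>x\<in>carrier X. N +>\<^bsub>X\<^esub> x) \<in> Hom R X (quot_module X N)" (is "?q \<in> _")
    and "(\<lambda>x\<in>carrier X. N +>\<^bsub>X\<^esub> x) ` carrier X = carrier (quot_module X N)"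
    and "kern X (quot_module X N) (\<lambda>x\<in>carrier X. N +>\<^bsub>X\<^esub> x) = N"
proof -
  interpret right_module R X by fact
  have sg: "subgroup N (add_monoid X)" using N by (rule submodule.axioms(1))
  interpret N: abelian_subgroup N X
    by (rule abelian_subgroupI3) (auto simp: additive_subgroup_def sg M.abelian_group_axioms)
  have sm: "a \<odot>\<^bsub>quot_module X N\<^esub> (N +>\<^bsub>X\<^esub> x) = N +>\<^bsub>X\<^esub> (a \<odot>\<^bsub>X\<^esub> x)"
    if a: "a \<in> carrier R" and x: "x \<in> carrier X" for a x
  proof -
    have "N +>\<^bsub>X\<^esub> (a \<odot>\<^bsub>X\<^esub> y) = N +>\<^bsub>X\<^esub> (a \<odot>\<^bsub>X\<^esub> x)" if y: "y \<in> N +>\<^bsub>X\<^esub> x" for y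
    proof -
      obtain h where h: "h \<in> N" "y = h \<oplus>\<^bsub>X\<^esub> x"
        using y unfolding a_r_coset_def' by blast
      have "a \<odot>\<^bsub>X\<^esub> y = a \<odot>\<^bsub>X\<^esub> h \<oplus>\<^bsub>X\<^esub> a \<odot>\<^bsub>X\<^esub> x"
        unfolding h(2) by (rule smult_r_distr[OF a N.a_Hcarr[OF h(1)] x])
      then have "a \<odot>\<^bsub>X\<^esub> y \<in> N +>\<^bsub>X\<^esub> (a \<odot>\<^bsub>X\<^esub> x)"
        using submodule_smult[OF X N a h(1)] unfolding a_r_coset_def' by blast
      then show ?thesis
        using M.a_repr_independence[OF _ smult_closed[OF a x] sg] by metis
    qed
    moreover have "x \<in> N +>\<^bsub>X\<^esub> x" using N.a_rcos_self x by blast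
    ultimately have "(\<Union>y\<in>N +>\<^bsub>X\<^esub> x. N +>\<^bsub>X\<^esub> (a \<odot>\<^bsub>X\<^esub> y)) = N +>\<^bsub>X\<^esub> (a \<odot>\<^bsub>X\<^esub> x)"
      by (metis (no_types, lifting) SUP_cong UN_constant emptyE)
    then show ?thesis
      by (simp add: quot_module_def)
  qed
  have ad: "(N +>\<^bsub>X\<^esub> x) \<oplus>\<^bsub>quot_module X N\<^esub> (N +>\<^bsub>X\<^esub> y) = N +>\<^bsub>X\<^esub> (x \<oplus>\<^bsub>X\<^esub> y)"
    if "x \<in> carrier X" "y \<in> carrier X" for x y
    using N.a_rcos_sum[OF that] by (simp add: quot_module_def)
  have car: "carrier (quot_module X N) = (\<lambda>x. N +>\<^bsub>X\<^esub> x) ` carrier X"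
    by (auto simp: quot_module_def A_RCOSETS_def')
  show "?q \<in> Hom R X (quot_module X N)"
    by (rule HomI) (auto simp: car ad sm)
  show "?q ` carrier X = carrier (quot_module X N)"
    by (simp add: car)
  have "N +>\<^bsub>X\<^esub> x = N \<longleftrightarrow> x \<in> N" if x: "x \<in> carrier X" for x
    using N.a_rcos_self[OF x] M.a_coset_join2[OF x sg] by auto
  then show "kern X (quot_module X N) ?q = N"
    using submodule_subset[OF X N] by (auto simp: kern_def quot_module_def)
qed

lemma isomorphic_quot_iff:
  assumes X: "right_module R X" and N: "submodule N R X" and Y: "right_module R Y"
  shows "isomorphic R (quot_module X N) Y \<longleftrightarrow>
    (\<exists>\<pi>\<in>Hom R X Y. \<pi> ` carrier X = carrier Y \<and> kern X Y \<pi> = N)"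
proof
  let ?Q = "quot_module X N" and ?q = "\<lambda>x\<in>carrier X. N +>\<^bsub>X\<^esub> x"
  note q = quot_map[OF X N]
  note Q = right_module_quot[OF X N]
  assume "isomorphic R ?Q Y"
  then obtain e where e: "e \<in> Hom R ?Q Y" "bij_betw e (carrier ?Q) (carrier Y)"
    by (auto simp: isomorphic_def Iso_def)
  have "compose (carrier X) e ?q ` carrier X = carrier Y"
    using q(2) e(2) unfolding bij_betw_def
    by (metis (no_types, lifting) compose_eq image_cong image_image)
  moreover have "kern ?Q Y e = {\<zero>\<^bsub>?Q\<^esub>}"
    using e inj_on_iff_kern[OF Q Y e(1)] by (simp add: bij_betw_def)
  then have "e (?q x) = \<zero>\<^bsub>Y\<^esub> \<longleftrightarrow> ?q x = \<zero>\<^bsub>?Q\<^esub>" if "x \<in> carrier X" for x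
    using HomD(1)[OF q(1) that] unfolding kern_def by blast
  then have "kern X Y (compose (carrier X) e ?q) = kern X ?Q ?q"
    unfolding kern_def by (simp add: compose_eq cong: conj_cong)
  ultimately show "\<exists>\<pi>\<in>Hom R X Y. \<pi> ` carrier X = carrier Y \<and> kern X Y \<pi> = N"
    using Hom_compose[OF q(1) e(1) X] q(3) by metis
next
  assume "\<exists>\<pi>\<in>Hom R X Y. \<pi> ` carrier X = carrier Y \<and> kern X Y \<pi> = N"
  then show "isomorphic R (quot_module X N) Y"
    using isomorphic_if_same_kern[OF X right_module_quot[OF X N] Y quot_map(1,2)[OF X N]] quot_map(3)[OF X N]
    by metis
qed

section \<open>Finite direct sums\<close>

lemma dir_sum_simps:
  "finite I \<Longrightarrow> carrier (dir_sum I M) = (\<Pi>\<^sub>E i\<in>I. carrier (M i))"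
  "\<zero>\<^bsub>dir_sum I M\<^esub> = (\<lambda>i\<in>I. \<zero>\<^bsub>M i\<^esub>)"
  "x \<oplus>\<^bsub>dir_sum I M\<^esub> y = (\<lambda>i\<in>I. x i \<oplus>\<^bsub>M i\<^esub> y i)"
  "a \<odot>\<^bsub>dir_sum I M\<^esub> x = (\<lambda>i\<in>I. a \<odot>\<^bsub>M i\<^esub> x i)"
  by (auto simp: dir_sum_def)

definition ds_inj :: "'i set \<Rightarrow> ('i \<Rightarrow> ('r, 'm) module) \<Rightarrow> 'i \<Rightarrow> 'm \<Rightarrow> ('i \<Rightarrow> 'm)" where
  "ds_inj I M i = (\<lambda>y\<in>carrier (M i). \<lambda>j\<in>I. if j = i then y else \<zero>\<^bsub>M j\<^esub>)"

definition ds_proj :: "'i set \<Rightarrow> ('i \<Rightarrow> ('r, 'm) module) \<Rightarrow> 'i \<Rightarrow> ('i \<Rightarrow> 'm) \<Rightarrow> 'm" where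
  "ds_proj I M i = (\<lambda>x\<in>carrier (dir_sum I M). x i)"

definition ds_copair :: "'i set \<Rightarrow> ('i \<Rightarrow> ('r, 'm) module) \<Rightarrow> ('r, 'y) module \<Rightarrow> ('i \<Rightarrow> 'm \<Rightarrow> 'y) \<Rightarrow>
    ('i \<Rightarrow> 'm) \<Rightarrow> 'y" where
  "ds_copair I M Y g = (\<lambda>x\<in>carrier (dir_sum I M). \<Oplus>\<^bsub>Y\<^esub>i\<in>I. g i (x i))"

context
  fixes R :: "('r, 'c) ring_scheme" and I :: "'i set" and M :: "'i \<Rightarrow> ('r, 'm) module"
  assumes R: "ring R" and I: "finite I" and M: "\<And>i. i \<in> I \<Longrightarrow> right_module R (M i)"
begin

lemma ds_rm: "right_module R (dir_sum I M)"
  by (rule right_module_dir_sum[OF R M])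

lemma ds_proj_Hom: "i \<in> I \<Longrightarrow> ds_proj I M i \<in> Hom R (dir_sum I M) (M i)"
proof -
  assume i: "i \<in> I"
  interpret D: right_module R "dir_sum I M" by (rule ds_rm)
  show ?thesis
  proof (rule HomI)
    fix x assume "x \<in> carrier (dir_sum I M)"
    then show "ds_proj I M i x \<in> carrier (M i)"
      using i I by (auto simp: ds_proj_def dir_sum_simps(1))
  next
    fix x y assume "x \<in> carrier (dir_sum I M)" "y \<in> carrier (dir_sum I M)"
    then show "ds_proj I M i (x \<oplus>\<^bsub>dir_sum I M\<^esub> y) = ds_proj I M i x \<oplus>\<^bsub>M i\<^esub> ds_proj I M i y"
      using i D.M.a_closed[of x y] by (simp add: ds_proj_def) (simp add: dir_sum_simps)
  next
    fix a x assume "a \<in> carrier R" "x \<in> carrier (dir_sum I M)"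
    then show "ds_proj I M i (a \<odot>\<^bsub>dir_sum I M\<^esub> x) = a \<odot>\<^bsub>M i\<^esub> ds_proj I M i x"
      using i D.smult_closed[of a x] by (simp add: ds_proj_def) (simp add: dir_sum_simps)
  qed (simp add: ds_proj_def)
qed

lemma ds_inj_Hom: "i \<in> I \<Longrightarrow> ds_inj I M i \<in> Hom R (M i) (dir_sum I M)"
proof -
  assume i: "i \<in> I"
  interpret Mi: right_module R "M i" by (rule M[OF i])
  have z: "\<zero>\<^bsub>M j\<^esub> \<in> carrier (M j)" "\<zero>\<^bsub>M j\<^esub> \<oplus>\<^bsub>M j\<^esub> \<zero>\<^bsub>M j\<^esub> = \<zero>\<^bsub>M j\<^esub>"
    "a \<in> carrier R \<Longrightarrow> a \<odot>\<^bsub>M j\<^esub> \<zero>\<^bsub>M j\<^esub> = \<zero>\<^bsub>M j\<^esub>" if "j \<in> I" for j a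
  proof -
    interpret Mj: right_module R "M j" by (rule M[OF that])
    show "\<zero>\<^bsub>M j\<^esub> \<in> carrier (M j)" "\<zero>\<^bsub>M j\<^esub> \<oplus>\<^bsub>M j\<^esub> \<zero>\<^bsub>M j\<^esub> = \<zero>\<^bsub>M j\<^esub>"
      "a \<in> carrier R \<Longrightarrow> a \<odot>\<^bsub>M j\<^esub> \<zero>\<^bsub>M j\<^esub> = \<zero>\<^bsub>M j\<^esub>" by simp_all
  qed
  show ?thesis
    by (rule HomI) (use i I z in \<open>auto simp: ds_inj_def dir_sum_simps intro!: restrict_ext\<close>)
qed

lemma ds_finsum_nth:
  assumes "finite J" "\<And>j. j \<in> J \<Longrightarrow> v j \<in> carrier (dir_sum I M)" "i \<in> I"
  shows "(\<Oplus>\<^bsub>dir_sum I M\<^esub>j\<in>J. v j) i = (\<Oplus>\<^bsub>M i\<^esub>j\<in>J. v j i)"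
proof -
  interpret D: right_module R "dir_sum I M" by (rule ds_rm)
  interpret Mi: right_module R "M i" by (rule M[OF assms(3)])
  have c: "(\<Oplus>\<^bsub>dir_sum I M\<^esub>j\<in>J. v j) \<in> carrier (dir_sum I M)"
    using assms(2) by (intro D.M.finsum_closed) auto
  have "ds_proj I M i (\<Oplus>\<^bsub>dir_sum I M\<^esub>j\<in>J. v j) = (\<Oplus>\<^bsub>M i\<^esub>j\<in>J. ds_proj I M i (v j))"
    by (rule Hom_finsum[OF ds_rm M[OF assms(3)] ds_proj_Hom[OF assms(3)] assms(1,2)])
  also have "\<dots> = (\<Oplus>\<^bsub>M i\<^esub>j\<in>J. v j i)"
    using assms HomD(1)[OF ds_proj_Hom[OF assms(3)]]
    by (intro Mi.M.finsum_cong') (auto simp: ds_proj_def)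
  finally show ?thesis using c by (simp add: ds_proj_def)
qed

lemma ds_sum_inj:
  assumes x: "x \<in> carrier (dir_sum I M)"
  shows "(\<Oplus>\<^bsub>dir_sum I M\<^esub>i\<in>I. ds_inj I M i (x i)) = x"
proof -
  interpret D: right_module R "dir_sum I M" by (rule ds_rm)
  have xi: "x i \<in> carrier (M i)" if "i \<in> I" for i
    using x I that by (auto simp: dir_sum_simps)
  have v: "ds_inj I M i (x i) \<in> carrier (dir_sum I M)" if "i \<in> I" for i
    using HomD(1)[OF ds_inj_Hom[OF that]] xi that by simp
  have c: "(\<Oplus>\<^bsub>dir_sum I M\<^esub>i\<in>I. ds_inj I M i (x i)) \<in> carrier (dir_sum I M)"
    using v by (intro D.M.finsum_closed) auto
  show ?thesis
  proof (rule PiE_ext[OF c[unfolded dir_sum_simps(1)[OF I]] x[unfolded dir_sum_simps(1)[OF I]]])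
    fix j assume j: "j \<in> I"
    interpret Mj: right_module R "M j" by (rule M[OF j])
    have "(\<Oplus>\<^bsub>dir_sum I M\<^esub>i\<in>I. ds_inj I M i (x i)) j = (\<Oplus>\<^bsub>M j\<^esub>i\<in>I. ds_inj I M i (x i) j)"
      by (rule ds_finsum_nth[OF I v j])
    also have "\<dots> = (\<Oplus>\<^bsub>M j\<^esub>i\<in>I. if j = i then x j else \<zero>\<^bsub>M j\<^esub>)"
      using j xi by (intro Mj.M.finsum_cong') (auto simp: ds_inj_def)
    also have "\<dots> = x j"
      using Mj.M.finsum_singleton[OF j I, of "\<lambda>_. x j"] xi[OF j] by simp
    finally show "(\<Oplus>\<^bsub>dir_sum I M\<^esub>i\<in>I. ds_inj I M i (x i)) j = x j" .
  qed
qed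

lemma ds_copair_Hom:
  assumes Y: "right_module R Y" and g: "\<And>i. i \<in> I \<Longrightarrow> g i \<in> Hom R (M i) Y"
  shows "ds_copair I M Y g \<in> Hom R (dir_sum I M) Y"
proof -
  interpret D: right_module R "dir_sum I M" by (rule ds_rm)
  interpret Y: right_module R Y by fact
  have gc: "g i (x i) \<in> carrier Y" if "i \<in> I" "x \<in> carrier (dir_sum I M)" for i x
    using that HomD(1)[OF g[OF that(1)]] I by (auto simp: dir_sum_simps)
  have xc: "x i \<in> carrier (M i)" if "i \<in> I" "x \<in> carrier (dir_sum I M)" for i x
    using that I by (auto simp: dir_sum_simps)
  show ?thesis
  proof (rule HomI)
    fix x assume "x \<in> carrier (dir_sum I M)"
    then show "ds_copair I M Y g x \<in> carrier Y"
      using gc by (auto simp: ds_copair_def intro!: Y.M.finsum_closed)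
  next
    fix x y assume x: "x \<in> carrier (dir_sum I M)" "y \<in> carrier (dir_sum I M)"
    have "(\<Oplus>\<^bsub>Y\<^esub>i\<in>I. g i ((x \<oplus>\<^bsub>dir_sum I M\<^esub> y) i)) = (\<Oplus>\<^bsub>Y\<^esub>i\<in>I. g i (x i) \<oplus>\<^bsub>Y\<^esub> g i (y i))"
      using x gc xc HomD(3)[OF g] by (intro Y.M.finsum_cong') (auto simp: dir_sum_simps(2-))
    also have "\<dots> = (\<Oplus>\<^bsub>Y\<^esub>i\<in>I. g i (x i)) \<oplus>\<^bsub>Y\<^esub> (\<Oplus>\<^bsub>Y\<^esub>i\<in>I. g i (y i))"
      using x gc by (intro Y.M.finsum_addf) auto
    finally show "ds_copair I M Y g (x \<oplus>\<^bsub>dir_sum I M\<^esub> y) = ds_copair I M Y g x \<oplus>\<^bsub>Y\<^esub> ds_copair I M Y g y"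
      using x by (simp add: ds_copair_def)
  next
    fix a x assume a: "a \<in> carrier R" and x: "x \<in> carrier (dir_sum I M)"
    have "(\<Oplus>\<^bsub>Y\<^esub>i\<in>I. g i ((a \<odot>\<^bsub>dir_sum I M\<^esub> x) i)) = (\<Oplus>\<^bsub>Y\<^esub>i\<in>I. a \<odot>\<^bsub>Y\<^esub> g i (x i))"
      using a x gc xc HomD(4)[OF g] by (intro Y.M.finsum_cong') (auto simp: dir_sum_simps(2-))
    also have "\<dots> = a \<odot>\<^bsub>Y\<^esub> (\<Oplus>\<^bsub>Y\<^esub>i\<in>I. g i (x i))"
      using x gc by (intro smult_finsum[OF Y a I, symmetric]) auto
    finally show "ds_copair I M Y g (a \<odot>\<^bsub>dir_sum I M\<^esub> x) = a \<odot>\<^bsub>Y\<^esub> ds_copair I M Y g x"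
      using x a by (simp add: ds_copair_def)
  qed (simp add: ds_copair_def)
qed

text \<open>Lifts on the summands assemble to a lift on the sum.\<close>

lemma projective_dir_sum:
  assumes "\<And>i. i \<in> I \<Longrightarrow> projective R (M i)"
  shows "projective R (dir_sum I M)"
proof -
  have "\<exists>u\<in>Hom R (dir_sum I M) X. compose (carrier (dir_sum I M)) g u = h"
    if g: "g \<in> Hom R X Y" "g ` carrier X = carrier Y" and h: "h \<in> Hom R (dir_sum I M) Y"
      and X: "right_module R X" and Y: "right_module R Y"
    for X :: "('r, ('i \<Rightarrow> 'm) \<Rightarrow> 'r) module" and Y :: "('r, 'i \<Rightarrow> 'm) module" and g h
  proof -
    interpret D: right_module R "dir_sum I M" by (rule ds_rm)
    interpret Y: right_module R Y by fact
    have "\<exists>u\<in>Hom R (M i) X. compose (carrier (M i)) g u = compose (carrier (M i)) h (ds_inj I M i)"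
      if "i \<in> I" for i
      by (rule projective_lift[OF assms[OF that] X Y g])
         (rule Hom_compose[OF ds_inj_Hom[OF that] h M[OF that]])
    then obtain u where u: "\<And>i. i \<in> I \<Longrightarrow> u i \<in> Hom R (M i) X"
      "\<And>i. i \<in> I \<Longrightarrow> compose (carrier (M i)) g (u i) = compose (carrier (M i)) h (ds_inj I M i)"
      by metis
    have "compose (carrier (dir_sum I M)) g (ds_copair I M X u) = h"
    proof (rule Hom_eqI[OF _ h])
      show "compose (carrier (dir_sum I M)) g (ds_copair I M X u) \<in> Hom R (dir_sum I M) Y"
        by (rule Hom_compose[OF ds_copair_Hom[OF X u(1)] g(1) ds_rm])
      fix x assume x: "x \<in> carrier (dir_sum I M)"
      then have xi: "x i \<in> carrier (M i)" if "i \<in> I" for i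
        using that I by (auto simp: dir_sum_simps)
      have "g (\<Oplus>\<^bsub>X\<^esub>i\<in>I. u i (x i)) = (\<Oplus>\<^bsub>Y\<^esub>i\<in>I. g (u i (x i)))"
        by (rule Hom_finsum[OF X Y g(1) I]) (rule HomD(1)[OF u(1) xi])
      also have "\<dots> = (\<Oplus>\<^bsub>Y\<^esub>i\<in>I. h (ds_inj I M i (x i)))"
      proof (rule Y.M.finsum_cong')
        show "(\<lambda>i. h (ds_inj I M i (x i))) \<in> I \<rightarrow> carrier Y"
          using xi HomD(1)[OF h] HomD(1)[OF ds_inj_Hom] by auto
        show "g (u i (x i)) = h (ds_inj I M i (x i))" if "i \<in> I" for i
          using fun_cong[OF u(2)[OF that], of "x i"] xi[OF that] by (simp add: compose_def)
      qed simp
      also have "\<dots> = h (\<Oplus>\<^bsub>dir_sum I M\<^esub>i\<in>I. ds_inj I M i (x i))"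
        by (rule Hom_finsum[OF ds_rm Y h I, symmetric]) (rule HomD(1)[OF ds_inj_Hom xi])
      finally show "compose (carrier (dir_sum I M)) g (ds_copair I M X u) x = h x"
        using x by (simp add: compose_def ds_sum_inj ds_copair_def)
    qed
    then show ?thesis
      using ds_copair_Hom[OF X u(1)] by blast
  qed
  then show ?thesis
    unfolding projective_def using ds_rm by blast
qed

end

section \<open>Finite length\<close>

text \<open>
  A rank that increases strictly along inclusions of submodules bounds the length of every chain,
  and conversely the length of a submodule is such a rank. A rank is easily transported along maps
  and along changes of the ring, and all finiteness used below reduces to its existence.
\<close>

definition finite_length :: "('r, 'c) ring_scheme \<Rightarrow> ('r, 'x) module \<Rightarrow> bool" where
  "finite_length R X \<longleftrightarrow> (\<exists>\<rho> :: 'x set \<Rightarrow> nat. \<forall>U V. submodule U R X \<longrightarrow> submodule V R X \<longrightarrow>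
     U \<subset> V \<longrightarrow> \<rho> U < \<rho> V)"

lemma finite_length_transfer:
  assumes "finite_length R Y"
    and "\<And>U. submodule U S X \<Longrightarrow> submodule (T U) R Y"
    and "\<And>U V. \<lbrakk>submodule U S X; submodule V S X; U \<subset> V\<rbrakk> \<Longrightarrow> T U \<subset> T V"
  shows "finite_length S X"
proof -
  obtain \<rho> where "\<And>U V. \<lbrakk>submodule U R Y; submodule V R Y; U \<subset> V\<rbrakk> \<Longrightarrow> (\<rho> U :: nat) < \<rho> V"
    using assms(1) unfolding finite_length_def by blast
  then have "\<rho> (T U) < \<rho> (T V)" if "submodule U S X" "submodule V S X" "U \<subset> V" for U V
    using that assms(2,3) by simp
  then show ?thesis
    unfolding finite_length_def by (intro exI[of _ "\<lambda>U. \<rho> (T U)"]) simp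
qed

lemma finite_length_inj:
  assumes "right_module R X" "right_module R Y" "f \<in> Hom R X Y" "inj_on f (carrier X)"
    and "finite_length R Y"
  shows "finite_length R X"
proof (rule finite_length_transfer[OF assms(5), where T = "\<lambda>U. f ` U"])
  fix U V assume "submodule U R X" "submodule V R X" "U \<subset> V"
  moreover from this have "V \<subseteq> carrier X" using submodule_subset[OF assms(1)] by blast
  ultimately show "f ` U \<subset> f ` V"
    using inj_on_image_eq_iff[OF assms(4), of U V] by blast
qed (rule submodule_image[OF assms(1-3)])

lemma finite_length_sub:
  assumes X: "right_module R X" "finite_length R X" and U: "submodule U R X"
  shows "finite_length R (sub_module X U)"
  by (rule finite_length_transfer[OF X(2), where T = "\<lambda>V. V"])
     (simp_all add: submodule_sub_module_iff[OF X(1) U])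

lemma finite_length_surj:
  assumes "right_module R X" "right_module R Y" "f \<in> Hom R X Y" "f ` carrier X = carrier Y"
    and "finite_length R X"
  shows "finite_length R Y"
proof (rule finite_length_transfer[OF assms(5), where T = "\<lambda>V. {x \<in> carrier X. f x \<in> V}"])
  fix U V assume UV: "submodule U R Y" "submodule V R Y" "U \<subset> V"
  then obtain y where y: "y \<in> V" "y \<notin> U" by blast
  moreover have "V \<subseteq> f ` carrier X"
    using submodule_subset[OF assms(2)] UV(2) assms(4) by blast
  ultimately obtain x where "x \<in> carrier X" "y = f x" by blast
  then show "{x \<in> carrier X. f x \<in> U} \<subset> {x \<in> carrier X. f x \<in> V}"
    using y UV(3) by blast
qed (rule submodule_vimage[OF assms(1-3)])

lemma finite_length_quot:
  assumes "right_module R X" "finite_length R X" "submodule N R X"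
  shows "finite_length R (quot_module X N)"
  by (rule finite_length_surj[OF assms(1) right_module_quot quot_map(1,2) assms(2)])
     (use assms in auto)

text \<open>
  The rank of the image in the quotient and that of the intersection with the kernel add up to a rank.
\<close>

lemma finite_length_extension:
  assumes X: "right_module R X" and Y: "right_module R Y" and f: "f \<in> Hom R X Y"
    and flY: "finite_length R Y" and flK: "finite_length R (sub_module X (kern X Y f))"
  shows "finite_length R X"
proof -
  interpret X: right_module R X by fact
  note K = submodule_kern[OF X Y f]
  obtain \<rho> where \<rho>: "\<And>U V. \<lbrakk>submodule U R Y; submodule V R Y; U \<subset> V\<rbrakk> \<Longrightarrow> (\<rho> U :: nat) < \<rho> V"
    using flY unfolding finite_length_def by blast
  obtain \<kappa> where \<kappa>': "\<And>U V. \<lbrakk>submodule U R (sub_module X (kern X Y f));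
      submodule V R (sub_module X (kern X Y f)); U \<subset> V\<rbrakk> \<Longrightarrow> (\<kappa> U :: nat) < \<kappa> V"
    using flK unfolding finite_length_def by blast
  have \<kappa>: "\<kappa> (U \<inter> kern X Y f) < \<kappa> (V \<inter> kern X Y f)"
    if "submodule U R X" "submodule V R X" "U \<inter> kern X Y f \<subset> V \<inter> kern X Y f" for U V
    by (rule \<kappa>') (use that in \<open>simp_all add: submodule_sub_module_iff[OF X K] submodule_Int[OF X _ K]\<close>)
  have "\<rho> (f ` U) + \<kappa> (U \<inter> kern X Y f) < \<rho> (f ` V) + \<kappa> (V \<inter> kern X Y f)"
    if U: "submodule U R X" and V: "submodule V R X" and UV: "U \<subset> V" for U V
  proof -
    note fU = submodule_image[OF X Y f U] submodule_image[OF X Y f V]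
    have le: "\<rho> (f ` U) \<le> \<rho> (f ` V)"
      using image_mono[of U V f] \<rho>[OF fU] UV by (metis order.order_iff_strict)
    have le': "\<kappa> (U \<inter> kern X Y f) \<le> \<kappa> (V \<inter> kern X Y f)"
      using Int_mono[of U V "kern X Y f" "kern X Y f"] \<kappa>[OF U V] UV by (metis order.order_iff_strict)
    have "f ` U \<subset> f ` V \<or> U \<inter> kern X Y f \<subset> V \<inter> kern X Y f"
    proof (rule ccontr)
      assume "\<not> ?thesis"
      then have eq: "f ` U = f ` V" "U \<inter> kern X Y f = V \<inter> kern X Y f"
        using UV by blast+
      obtain v where v: "v \<in> V" "v \<notin> U" using UV by blast
      then obtain u where u: "u \<in> U" "f v = f u" using eq(1) by blast
      have c: "u \<in> carrier X" "v \<in> carrier X"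
        using u v submodule_subset[OF X U] submodule_subset[OF X V] by auto
      have "v \<ominus>\<^bsub>X\<^esub> u \<in> V \<inter> kern X Y f"
        using u v UV submodule_minus[OF X V] Hom_eq_iff_kern[OF X Y f c(2,1)] by blast
      then have "v \<ominus>\<^bsub>X\<^esub> u \<in> U" using eq(2) by blast
      then have "(v \<ominus>\<^bsub>X\<^esub> u) \<oplus>\<^bsub>X\<^esub> u \<in> U" using u submodule_add[OF X U] by blast
      then show False
        using v c by (simp add: a_minus_def X.M.a_assoc X.M.l_neg)
    qed
    then show ?thesis
      using \<rho>[OF fU] \<kappa>[OF U V] le le' by linarith
  qed
  then show ?thesis
    unfolding finite_length_def
    by (intro exI[of _ "\<lambda>U. \<rho> (f ` U) + \<kappa> (U \<inter> kern X Y f)"]) simp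
qed

lemma finite_length_trivial:
  assumes "right_module R X" "carrier X = {\<zero>\<^bsub>X\<^esub>}"
  shows "finite_length R X"
proof -
  have "U = {\<zero>\<^bsub>X\<^esub>}" if "submodule U R X" for U
    using submodule_subset[OF assms(1) that] submodule_zero[OF assms(1) that] assms(2) by blast
  then show ?thesis
    unfolding finite_length_def by (metis less_irrefl)
qed

lemma finite_length_dir_sum:
  assumes R: "ring R" and "finite I" and "\<And>i. i \<in> I \<Longrightarrow> right_module R (M i)"
    and "\<And>i. i \<in> I \<Longrightarrow> finite_length R (M i)"
  shows "finite_length R (dir_sum I M)"
  using assms(2-)
proof (induction I rule: finite_induct)
  case empty
  show ?case
    by (rule finite_length_trivial[OF right_module_dir_sum[OF R]]) (auto simp: dir_sum_simps)
next
  case (insert i I)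
  let ?D = "dir_sum (insert i I) M"
  have fin: "finite (insert i I)" using insert by simp
  have Mi: "right_module R (M i)" by (simp add: insert)
  have D: "right_module R ?D" by (rule right_module_dir_sum[OF R]) (rule insert)
  have D': "right_module R (dir_sum I M)" by (rule right_module_dir_sum[OF R]) (simp add: insert)
  have p: "ds_proj (insert i I) M i \<in> Hom R ?D (M i)"
    by (rule ds_proj_Hom[OF R fin]) (simp_all add: insert)
  note k = submodule_kern[OF D Mi p]
  let ?K = "sub_module ?D (kern ?D (M i) (ds_proj (insert i I) M i))"
  note K = right_module_sub[OF D k]
  let ?f = "\<lambda>x\<in>carrier ?K. restrict x I"
  have Kc: "x \<in> carrier ?K \<longleftrightarrow> x \<in> carrier ?D \<and> x i = \<zero>\<^bsub>M i\<^esub>" for x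
    by (auto simp: kern_def ds_proj_def)
  interpret K: right_module R ?K by (rule K)
  have f: "?f \<in> Hom R ?K (dir_sum I M)"
  proof (rule HomI)
    fix x assume x: "x \<in> carrier ?K"
    then have "x \<in> carrier ?D" using Kc by blast
    then have "restrict x I \<in> carrier (dir_sum I M)"
      using insert(1) fin by (auto simp: dir_sum_simps(1))
    then show "?f x \<in> carrier (dir_sum I M)" using x by simp
  next
    fix x y assume "x \<in> carrier ?K" "y \<in> carrier ?K"
    then show "?f (x \<oplus>\<^bsub>?K\<^esub> y) = ?f x \<oplus>\<^bsub>dir_sum I M\<^esub> ?f y"
      using K.M.a_closed[of x y] by (auto simp: dir_sum_simps(3))
  next
    fix a x assume "a \<in> carrier R" "x \<in> carrier ?K"
    then show "?f (a \<odot>\<^bsub>?K\<^esub> x) = a \<odot>\<^bsub>dir_sum I M\<^esub> ?f x"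
      using K.smult_closed[of a x] by (auto simp: dir_sum_simps(4))
  qed simp
  have "inj_on ?f (carrier ?K)"
  proof (rule inj_onI)
    fix x y assume x: "x \<in> carrier ?K" "y \<in> carrier ?K" "?f x = ?f y"
    have eq: "restrict x I = restrict y I"
      using x by (simp only: restrict_apply' if_True)
    have xD: "x \<in> (\<Pi>\<^sub>E j\<in>insert i I. carrier (M j))" "y \<in> (\<Pi>\<^sub>E j\<in>insert i I. carrier (M j))"
      and xi: "x i = y i"
      using x(1,2) by (simp_all only: Kc dir_sum_simps(1)[OF fin])
    show "x = y"
    proof (rule PiE_ext[OF xD])
      fix j assume "j \<in> insert i I"
      then show "x j = y j"
        using xi fun_cong[OF eq, of j] by auto
    qed
  qed
  then have "finite_length R ?K"
    by (rule finite_length_inj[OF K D' f]) (use insert in auto)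
  then show ?case
    by (rule finite_length_extension[OF D Mi p insert(5)[OF insertI1]])
qed

text \<open>The next two lemmas are Fitting's argument: otherwise the images or kernels of the powers of
  the endomorphism form an infinite strict chain.\<close>

lemma finite_length_inj_surj:
  assumes X: "right_module R X" and fl: "finite_length R X"
    and f: "f \<in> Hom R X X" and inj: "inj_on f (carrier X)"
  shows "f ` carrier X = carrier X"
proof (rule ccontr)
  obtain \<rho> where \<rho>: "\<And>U V. \<lbrakk>submodule U R X; submodule V R X; U \<subset> V\<rbrakk> \<Longrightarrow> (\<rho> U :: nat) < \<rho> V"
    using fl unfolding finite_length_def by blast
  have False if "submodule U R X" "f ` U \<subset> U" for U
    using that
  proof (induction "\<rho> U" arbitrary: U rule: less_induct)
    case less
    have s: "submodule (f ` U) R X" by (rule submodule_image[OF X X f less(2)])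
    have "U \<subseteq> carrier X" "f ` U \<subseteq> carrier X"
      using submodule_subset[OF X] s less(2) by auto
    then have "f ` (f ` U) \<subset> f ` U"
      using less(3) inj_on_image_eq_iff[OF inj, of "f ` U" U] by blast
    then show False
      using less(1)[OF _ s] \<rho>[OF s less(2,3)] by blast
  qed
  moreover assume "f ` carrier X \<noteq> carrier X"
  then have "f ` carrier X \<subset> carrier X" using HomD(1)[OF f] by blast
  ultimately show False using submodule_carrier[OF X] by blast
qed

lemma finite_length_surj_inj:
  assumes X: "right_module R X" and fl: "finite_length R X"
    and f: "f \<in> Hom R X X" and surj: "f ` carrier X = carrier X"
  shows "inj_on f (carrier X)"
proof (rule ccontr)
  interpret right_module R X by (rule X)
  obtain \<rho> where \<rho>: "\<And>U V. \<lbrakk>submodule U R X; submodule V R X; U \<subset> V\<rbrakk> \<Longrightarrow> (\<rho> U :: nat) < \<rho> V"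
    using fl unfolding finite_length_def by blast
  define T where "T U = {x \<in> carrier X. f x \<in> U}" for U
  have sT: "submodule (T U) R X" if "submodule U R X" for U
    unfolding T_def by (rule submodule_vimage[OF X X f that])
  have "False" if "submodule U R X" "U \<subset> T U" for U
    using that
  proof (induction "\<rho> (carrier X) - \<rho> U" arbitrary: U rule: less_induct)
    case less
    note s = sT[OF less(2)] sT[OF sT[OF less(2)]]
    obtain y where y: "y \<in> T U" "y \<notin> U" using less(3) by blast
    moreover from y obtain x where "x \<in> carrier X" "y = f x"
      using surj unfolding T_def by blast
    ultimately have "x \<in> T (T U)" "x \<notin> T U" by (auto simp: T_def)
    then have st: "T U \<subset> T (T U)" using less(3) by (auto simp: T_def)
    have "T (T U) \<subseteq> carrier X" by (auto simp: T_def)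
    then have "T U \<subset> carrier X" using st by blast
    then have "\<rho> (T U) < \<rho> (carrier X)"
      by (rule \<rho>[OF s(1) submodule_carrier[OF X]])
    then have "\<rho> (carrier X) - \<rho> (T U) < \<rho> (carrier X) - \<rho> U"
      using \<rho>[OF less(2) s(1) less(3)] by linarith
    then show False
      using less(1)[OF _ s(1) st] by blast
  qed
  moreover assume "\<not> inj_on f (carrier X)"
  then have "kern X X f \<noteq> {\<zero>\<^bsub>X\<^esub>}"
    using inj_on_iff_kern[OF X X f] by blast
  then have "{\<zero>\<^bsub>X\<^esub>} \<subset> T {\<zero>\<^bsub>X\<^esub>}"
    using Hom_zero[OF X X f] by (auto simp: T_def kern_def)
  ultimately show False using submodule_zero_set[OF X] by blast
qed

lemma finite_length_simple_submodule:
  assumes X: "right_module R X" and fl: "finite_length R X" and nz: "carrier X \<noteq> {\<zero>\<^bsub>X\<^esub>}"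
  obtains U where "submodule U R X" "simple_module R (sub_module X U)"
proof -
  interpret right_module R X by (rule X)
  obtain \<rho> where \<rho>: "\<And>U V. \<lbrakk>submodule U R X; submodule V R X; U \<subset> V\<rbrakk> \<Longrightarrow> (\<rho> U :: nat) < \<rho> V"
    using fl unfolding finite_length_def by blast
  let ?P = "\<lambda>U. submodule U R X \<and> U \<noteq> {\<zero>\<^bsub>X\<^esub>}"
  define U where "U = (ARG_MIN \<rho> U. ?P U)"
  have "?P (carrier X)" using nz submodule_carrier[OF X] by blast
  then have U: "?P U" and min: "\<And>V. ?P V \<Longrightarrow> \<rho> U \<le> \<rho> V"
    unfolding U_def using arg_min_natI[of ?P _ \<rho>] arg_min_nat_le[of ?P _ \<rho>] by blast+
  have "V = {\<zero>\<^bsub>X\<^esub>} \<or> V = U" if "submodule V R X" "V \<subseteq> U" for V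
    using that min[of V] \<rho>[of V U] U by (meson leD psubsetI)
  then have "simple_module R (sub_module X U)"
    using U right_module_sub[OF X] by (auto simp: simple_module_def submodule_sub_module_iff[OF X])
  then show ?thesis using that U by blast
qed

section \<open>Bases over division rings\<close>

definition division_ring :: "('r, 'c) ring_scheme \<Rightarrow> bool" where
  "division_ring D \<longleftrightarrow> ring D \<and> (\<forall>d\<in>carrier D. d \<noteq> \<zero>\<^bsub>D\<^esub> \<longrightarrow> (\<exists>e\<in>carrier D. d \<otimes>\<^bsub>D\<^esub> e = \<one>\<^bsub>D\<^esub>))"

lemma regular_simps [simp]:
  "carrier (regular R) = carrier R" "\<zero>\<^bsub>regular R\<^esub> = \<zero>\<^bsub>R\<^esub>"
  "x \<oplus>\<^bsub>regular R\<^esub> y = x \<oplus>\<^bsub>R\<^esub> y" "a \<odot>\<^bsub>regular R\<^esub> x = x \<otimes>\<^bsub>R\<^esub> a"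
  by (simp_all add: regular_def)

lemma division_ring_field: "field K \<Longrightarrow> division_ring K"
proof -
  assume "field K"
  then interpret field K .
  show ?thesis
    unfolding division_ring_def using ring_axioms field_Units Units_r_inv Units_inv_closed by blast
qed

lemma finite_length_regular:
  assumes "division_ring D"
  shows "finite_length D (regular D)"
proof -
  interpret ring D using assms by (simp add: division_ring_def)
  have D: "right_module D (regular D)" by (rule right_module_regular) (rule ring_axioms)
  have full: "U = carrier D" if U: "submodule U D (regular D)" and "U \<noteq> {\<zero>\<^bsub>D\<^esub>}" for U
  proof -
    have sub: "U \<subseteq> carrier D" using submodule_subset[OF D U] by simp
    have "\<zero>\<^bsub>D\<^esub> \<in> U" using submodule_zero[OF D U] by simp
    then obtain u where u: "u \<in> U" "u \<noteq> \<zero>\<^bsub>D\<^esub>" using \<open>U \<noteq> {\<zero>\<^bsub>D\<^esub>}\<close> by blast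
    then obtain e where e: "e \<in> carrier D" "u \<otimes>\<^bsub>D\<^esub> e = \<one>\<^bsub>D\<^esub>"
      using assms sub unfolding division_ring_def by blast
    have "x \<in> U" if "x \<in> carrier D" for x
    proof -
      have "u \<otimes>\<^bsub>D\<^esub> (e \<otimes>\<^bsub>D\<^esub> x) \<in> U"
        using submodule_smult[OF D U _ u(1), of "e \<otimes>\<^bsub>D\<^esub> x"] e that by simp
      moreover have "u \<otimes>\<^bsub>D\<^esub> (e \<otimes>\<^bsub>D\<^esub> x) = x"
        using u(1) sub e that m_assoc[of u e x] by (simp add: subset_iff)
      ultimately show ?thesis by simp
    qed
    then show ?thesis using sub by blast
  qed
  have "(if U = {\<zero>\<^bsub>D\<^esub>} then 0 else 1 :: nat) < (if V = {\<zero>\<^bsub>D\<^esub>} then 0 else 1)"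
    if UV: "submodule U D (regular D)" "submodule V D (regular D)" "U \<subset> V" for U V
  proof -
    have "V \<noteq> {\<zero>\<^bsub>D\<^esub>}" using UV(3) submodule_zero[OF D UV(1)] by auto
    moreover have "U = {\<zero>\<^bsub>D\<^esub>}"
      using full[OF UV(1)] full[OF UV(2) calculation] UV(3) by blast
    ultimately show ?thesis by simp
  qed
  then show ?thesis
    unfolding finite_length_def by (intro exI[of _ "\<lambda>U. if U = {\<zero>\<^bsub>D\<^esub>} then 0 else 1"]) simp
qed

lemma finite_basisD:
  assumes "finite_basis D V B"
  shows "finite B" "B \<subseteq> carrier V"
    and "\<And>v. v \<in> carrier V \<Longrightarrow> \<exists>!c. c \<in> B \<rightarrow>\<^sub>E carrier D \<and> v = (\<Oplus>\<^bsub>V\<^esub>b\<in>B. c b \<odot>\<^bsub>V\<^esub> b)"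
proof -
  note b = assms[unfolded finite_basis_def]
  show "finite B" by (rule conjunct1[OF b])
  show "B \<subseteq> carrier V" by (rule conjunct1[OF conjunct2[OF b]])
  show "\<exists>!c. c \<in> B \<rightarrow>\<^sub>E carrier D \<and> v = (\<Oplus>\<^bsub>V\<^esub>b\<in>B. c b \<odot>\<^bsub>V\<^esub> b)" if "v \<in> carrier V" for v
    by (rule bspec[OF conjunct2[OF conjunct2[OF b]] that])
qed

lemma finite_dim_finite_length:
  assumes D: "division_ring D" and V: "right_module D V" and fin: "finite_dim D V"
  shows "finite_length D V"
proof -
  interpret right_module D V by (rule V)
  obtain B where B: "finite_basis D V B"
    using fin unfolding finite_dim_def by blast
  note ex = finite_basisD(3)[OF B, THEN ex1_implies_ex]
  note B = finite_basisD(1,2)[OF B]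
  have id: "(\<lambda>b. b) \<in> B \<rightarrow> carrier V" using B by auto
  let ?f = "free_map D B V (\<lambda>b. b)"
  note f = free_map_Hom[OF V id]
  have "v \<in> ?f ` carrier (free_module D B)" if v: "v \<in> carrier V" for v
  proof -
    obtain c where c: "c \<in> B \<rightarrow>\<^sub>E carrier D" "v = (\<Oplus>\<^bsub>V\<^esub>b\<in>B. c b \<odot>\<^bsub>V\<^esub> b)"
      using ex[OF v] by blast
    then have cF: "c \<in> carrier (free_module D B)" using B by (simp add: free_module_simps)
    have "?f c = v"
      using c B free_map_eq[OF V id cF, of B] by auto
    then show ?thesis using cF by blast
  qed
  then have "?f ` carrier (free_module D B) = carrier V"
    using HomD(1)[OF f] by blast
  moreover have "finite_length D (free_module D B)"
    unfolding free_module_def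
    by (rule finite_length_dir_sum[OF R.ring_axioms B(1)])
       (auto intro: right_module_regular R.ring_axioms finite_length_regular[OF D])
  ultimately show ?thesis
    using finite_length_surj[OF right_module_free[OF R.ring_axioms] V f] by blast
qed

text \<open>An independent set whose span has the greatest possible rank is a basis.\<close>

lemma finite_length_finite_dim:
  assumes D: "division_ring D" and V: "right_module D V" and fl: "finite_length D V"
  shows "finite_dim D V"
proof -
  interpret right_module D V by (rule V)
  obtain \<rho> where \<rho>: "\<And>U W. \<lbrakk>submodule U D V; submodule W D V; U \<subset> W\<rbrakk> \<Longrightarrow> (\<rho> U :: nat) < \<rho> W"
    using fl unfolding finite_length_def by blast
  have \<rho>le: "\<rho> U \<le> \<rho> (carrier V)" if "submodule U D V" for U
    using \<rho>[OF that submodule_carrier[OF V]] submodule_subset[OF V that]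
    by (metis nless_le order.order_iff_strict psubsetI)
  define L where "L B c = (\<Oplus>\<^bsub>V\<^esub>b\<in>B. c b \<odot>\<^bsub>V\<^esub> b)" for B c
  define span where "span B = L B ` (B \<rightarrow>\<^sub>E carrier D)" for B
  define indep where "indep B \<longleftrightarrow> finite B \<and> B \<subseteq> carrier V \<and> inj_on (L B) (B \<rightarrow>\<^sub>E carrier D)" for B
  have span: "submodule (span B) D V" if B: "finite B" "B \<subseteq> carrier V" for B
  proof -
    have id: "(\<lambda>b. b) \<in> B \<rightarrow> carrier V" using B by auto
    have F: "carrier (free_module D B) = B \<rightarrow>\<^sub>E carrier D"
      using B(1) by (auto simp: free_module_simps)
    have "free_map D B V (\<lambda>b. b) c = L B c" if "c \<in> B \<rightarrow>\<^sub>E carrier D" for c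
      unfolding L_def by (rule free_map_eq[OF V id]) (use that F B in auto)
    then have "free_map D B V (\<lambda>b. b) ` carrier (free_module D B) = span B"
      unfolding span_def F by (simp cong: image_cong)
    then show ?thesis
      using submodule_image[OF right_module_free[OF R.ring_axioms] V free_map_Hom[OF V id]
          submodule_carrier[OF right_module_free[OF R.ring_axioms]]] by metis
  qed
  have Lc: "L B c \<in> carrier V" if "B \<subseteq> carrier V" "c \<in> B \<rightarrow> carrier D" for B c
    unfolding L_def using that by (intro M.finsum_closed) (auto simp: subset_iff Pi_iff)
  have "indep {}" by (auto simp: indep_def inj_on_def)
  then obtain B where B: "indep B" and max: "\<And>B'. indep B' \<Longrightarrow> \<rho> (span B') \<le> \<rho> (span B)"
    using ex_has_greatest_nat[of indep "{}" "\<lambda>B. \<rho> (span B)" "Suc (\<rho> (carrier V))"] \<rho>le span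
    unfolding indep_def by (metis le_imp_less_Suc)
  have Bf: "finite B" "B \<subseteq> carrier V" and Bi: "inj_on (L B) (B \<rightarrow>\<^sub>E carrier D)"
    using B by (auto simp: indep_def)
  note sB = span[OF Bf]
  have "span B = carrier V"
  proof (rule ccontr)
    assume "span B \<noteq> carrier V"
    then obtain v where v: "v \<in> carrier V" "v \<notin> span B"
      using submodule_subset[OF V sB] by blast
    have Lr: "L B (restrict c B) = L B c" if "c \<in> B \<rightarrow> carrier D" for c
      unfolding L_def using that Bf by (intro M.finsum_cong') (auto simp: subset_iff Pi_iff)
    have LB0: "L B c \<in> span B" if "c \<in> B \<rightarrow> carrier D" for c
      using that unfolding span_def Lr[OF that, symmetric] by (intro imageI) (auto simp: Pi_iff)
    have vB: "v \<notin> B"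
    proof
      assume vB: "v \<in> B"
      have "L B (\<lambda>b. if v = b then \<one>\<^bsub>D\<^esub> else \<zero>\<^bsub>D\<^esub>) = (\<Oplus>\<^bsub>V\<^esub>b\<in>B. if v = b then b else \<zero>\<^bsub>V\<^esub>)"
        unfolding L_def using Bf by (intro M.finsum_cong') auto
      also have "\<dots> = v" using M.finsum_singleton[OF vB Bf(1), of "\<lambda>b. b"] Bf by auto
      finally show False using LB0[of "\<lambda>b. if v = b then \<one>\<^bsub>D\<^esub> else \<zero>\<^bsub>D\<^esub>"] v by auto
    qed
    let ?B = "insert v B"
    have Lins: "L ?B c = c v \<odot>\<^bsub>V\<^esub> v \<oplus>\<^bsub>V\<^esub> L B c" if "c \<in> ?B \<rightarrow> carrier D" for c
      unfolding L_def using that Bf v vB by (subst M.finsum_insert) auto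
    have key: "d = \<zero>\<^bsub>D\<^esub>" if d: "d \<in> carrier D" and dv: "d \<odot>\<^bsub>V\<^esub> v \<in> span B" for d
    proof (rule ccontr)
      assume "d \<noteq> \<zero>\<^bsub>D\<^esub>"
      then obtain e where e: "e \<in> carrier D" "d \<otimes>\<^bsub>D\<^esub> e = \<one>\<^bsub>D\<^esub>"
        using D d unfolding division_ring_def by blast
      have "v = (d \<otimes>\<^bsub>D\<^esub> e) \<odot>\<^bsub>V\<^esub> v" using v e by simp
      also have "\<dots> = e \<odot>\<^bsub>V\<^esub> (d \<odot>\<^bsub>V\<^esub> v)" by (rule smult_assoc) (use v e d in auto)
      also have "\<dots> \<in> span B" by (rule submodule_smult[OF V sB e(1) dv])
      finally show False using v by blast
    qed
    have "indep ?B"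
      unfolding indep_def
    proof (intro conjI inj_onI)
      show "finite ?B" "?B \<subseteq> carrier V" using Bf v by auto
      fix c c' assume c: "c \<in> ?B \<rightarrow>\<^sub>E carrier D" "c' \<in> ?B \<rightarrow>\<^sub>E carrier D" "L ?B c = L ?B c'"
      have cB: "c \<in> ?B \<rightarrow> carrier D" "c' \<in> ?B \<rightarrow> carrier D"
        using c(1,2) by (simp_all only: PiE_def Int_iff)
      have cc: "c v \<in> carrier D" "c' v \<in> carrier D" "c \<in> B \<rightarrow> carrier D" "c' \<in> B \<rightarrow> carrier D"
        using c by auto
      define x where "x = L B c"
      define y where "y = L B c'"
      have xy: "x \<in> span B" "y \<in> span B" "x \<in> carrier V" "y \<in> carrier V"
        using LB0 cc Lc[OF Bf(2)] by (auto simp: x_def y_def)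
      have eq: "c v \<odot>\<^bsub>V\<^esub> v \<oplus>\<^bsub>V\<^esub> x = c' v \<odot>\<^bsub>V\<^esub> v \<oplus>\<^bsub>V\<^esub> y"
        using c(3) Lins[OF cB(1)] Lins[OF cB(2)] by (simp add: x_def y_def)
      have "(c v \<ominus>\<^bsub>D\<^esub> c' v) \<odot>\<^bsub>V\<^esub> v = c v \<odot>\<^bsub>V\<^esub> v \<ominus>\<^bsub>V\<^esub> c' v \<odot>\<^bsub>V\<^esub> v"
        using v cc by (simp add: a_minus_def smult_l_distr smult_l_minus)
      also have "\<dots> = (c v \<odot>\<^bsub>V\<^esub> v \<oplus>\<^bsub>V\<^esub> x) \<ominus>\<^bsub>V\<^esub> x \<ominus>\<^bsub>V\<^esub> c' v \<odot>\<^bsub>V\<^esub> v"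
        using v cc xy by (simp add: a_minus_def M.a_assoc M.r_neg)
      also have "\<dots> = y \<ominus>\<^bsub>V\<^esub> x"
        unfolding eq using v cc xy
        by (simp add: a_minus_def M.a_ac M.r_neg M.r_neg1 M.r_neg2)
      finally have "(c v \<ominus>\<^bsub>D\<^esub> c' v) \<odot>\<^bsub>V\<^esub> v \<in> span B"
        using submodule_minus[OF V sB] xy by simp
      then have "c v \<ominus>\<^bsub>D\<^esub> c' v = \<zero>\<^bsub>D\<^esub>" using key cc by simp
      then have cv: "c v = c' v"
        using R.minus_equality[of "c v" "\<ominus>\<^bsub>D\<^esub> c' v"] cc by (simp add: a_minus_def)
      then have "x = y" using eq v cc xy by simp
      then have "L B (restrict c B) = L B (restrict c' B)"
        using Lr cc by (simp add: x_def y_def)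
      then have "restrict c B = restrict c' B"
        using inj_onD[OF Bi] cc by auto
      show "c = c'"
      proof (rule PiE_ext[OF c(1,2)])
        fix b assume "b \<in> ?B"
        then show "c b = c' b" using cv fun_cong[OF \<open>restrict c B = restrict c' B\<close>, of b] by auto
      qed
    qed
    then have "\<rho> (span ?B) \<le> \<rho> (span B)" by (rule max)
    moreover have "span B \<subset> span ?B"
    proof
      show "span B \<subseteq> span ?B"
      proof
        fix x assume "x \<in> span B"
        then obtain c where c: "c \<in> B \<rightarrow>\<^sub>E carrier D" "x = L B c" by (auto simp: span_def)
        let ?c = "c(v := \<zero>\<^bsub>D\<^esub>)"
        have c': "?c \<in> ?B \<rightarrow>\<^sub>E carrier D"
          using c(1) by (auto simp: PiE_def extensional_def)
        have "L B ?c = x"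
          unfolding c(2) L_def using c(1) Bf vB by (intro M.finsum_cong') auto
        then have "L ?B ?c = x"
          using Lins[of ?c] c' v Lc[OF Bf(2), of c] c by (simp add: PiE_iff Pi_iff)
        then show "x \<in> span ?B" using c' by (auto simp: span_def)
      qed
      let ?c = "\<lambda>b\<in>?B. if b = v then \<one>\<^bsub>D\<^esub> else \<zero>\<^bsub>D\<^esub>"
      have "L B ?c = (\<Oplus>\<^bsub>V\<^esub>b\<in>B. \<zero>\<^bsub>V\<^esub>)"
        unfolding L_def using Bf vB by (intro M.finsum_cong') (auto simp: subset_iff)
      then have "L ?B ?c = v"
        using Lins[of ?c] v by (simp add: Pi_iff)
      moreover have "?c \<in> ?B \<rightarrow>\<^sub>E carrier D" by auto
      ultimately have "v \<in> span ?B" unfolding span_def by (metis imageI)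
      then show "span B \<noteq> span ?B" using v by blast
    qed
    then have "\<rho> (span B) < \<rho> (span ?B)"
      using \<rho>[OF sB span] Bf v by auto
    ultimately show False by simp
  qed
  have "finite_basis D V B"
    unfolding finite_basis_def
  proof (intro conjI ballI Bf)
    fix v assume "v \<in> carrier V"
    then obtain c where c: "c \<in> B \<rightarrow>\<^sub>E carrier D" "v = L B c"
      using \<open>span B = carrier V\<close> unfolding span_def by blast
    show "\<exists>!c. c \<in> B \<rightarrow>\<^sub>E carrier D \<and> v = (\<Oplus>\<^bsub>V\<^esub>b\<in>B. c b \<odot>\<^bsub>V\<^esub> b)"
    proof (rule ex1I, rule conjI)
      show "c \<in> B \<rightarrow>\<^sub>E carrier D" "v = (\<Oplus>\<^bsub>V\<^esub>b\<in>B. c b \<odot>\<^bsub>V\<^esub> b)"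
        using c by (simp_all add: L_def)
      fix c' assume c': "c' \<in> B \<rightarrow>\<^sub>E carrier D \<and> v = (\<Oplus>\<^bsub>V\<^esub>b\<in>B. c' b \<odot>\<^bsub>V\<^esub> b)"
      then have "L B c' = L B c"
        unfolding c(2)[symmetric] by (simp only: L_def)
      then show "c' = c"
        using inj_onD[OF Bi _ conjunct1[OF c'] c(1)] by blast
    qed
  qed
  then show ?thesis by (auto simp: finite_dim_def)
qed

section \<open>Polynomial maps between vector spaces\<close>

definition poly_fun :: "'k ring \<Rightarrow> ('k, 'v) module \<Rightarrow> ('v \<Rightarrow> 'k) \<Rightarrow> bool" where
  "poly_fun K V p \<longleftrightarrow> restrict p (carrier V) \<in> polynomial_functions K V"

text \<open>Being polynomial is tested on all linear functionals, so that no basis has to be chosen.\<close>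

definition poly_map :: "'k ring \<Rightarrow> ('k, 'v) module \<Rightarrow> ('k, 'x) module \<Rightarrow> ('v \<Rightarrow> 'x) \<Rightarrow> bool" where
  "poly_map K V X g \<longleftrightarrow> (\<forall>v\<in>carrier V. g v \<in> carrier X) \<and>
     (\<forall>\<xi>\<in>Hom K X (regular K). poly_fun K V (\<lambda>v. \<xi> (g v)))"

locale poly_space = field K + V: right_module K V
  for K :: "'k ring" and V :: "('k, 'v) module"
begin

lemma field_K: "field K" by (rule field_axioms)

lemma rm_reg: "right_module K (regular K)" by (rule right_module_regular) (rule ring_axioms)

lemma poly_fun_cong: "poly_fun K V p \<Longrightarrow> (\<And>v. v \<in> carrier V \<Longrightarrow> p v = q v) \<Longrightarrow> poly_fun K V q"
  unfolding poly_fun_def by (metis restrict_ext)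

lemma poly_fun_closed: "poly_fun K V p \<Longrightarrow> v \<in> carrier V \<Longrightarrow> p v \<in> carrier K"
  using polynomial_functions_closed[OF field_K, of "restrict p (carrier V)" V v]
  unfolding poly_fun_def by simp

lemma poly_fun_const: "c \<in> carrier K \<Longrightarrow> poly_fun K V (\<lambda>v. c)"
  unfolding poly_fun_def by (rule polynomial_functions.const)

lemma poly_fun_linear: "l \<in> Hom K V (regular K) \<Longrightarrow> poly_fun K V l"
proof -
  assume l: "l \<in> Hom K V (regular K)"
  then have "restrict l (carrier V) = l" by (auto simp: Hom_def PiE_def extensional_restrict)
  then show ?thesis
    unfolding poly_fun_def using polynomial_functions.linear[OF l] by simp
qed

lemma poly_fun_add: "poly_fun K V p \<Longrightarrow> poly_fun K V q \<Longrightarrow> poly_fun K V (\<lambda>v. p v \<oplus>\<^bsub>K\<^esub> q v)"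
  unfolding poly_fun_def by (drule (1) polynomial_functions.add) (simp cong: restrict_cong)

lemma poly_fun_mult: "poly_fun K V p \<Longrightarrow> poly_fun K V q \<Longrightarrow> poly_fun K V (\<lambda>v. p v \<otimes>\<^bsub>K\<^esub> q v)"
  unfolding poly_fun_def by (drule (1) polynomial_functions.mult) (simp cong: restrict_cong)

lemma poly_fun_uminus: "poly_fun K V p \<Longrightarrow> poly_fun K V (\<lambda>v. \<ominus>\<^bsub>K\<^esub> p v)"
  by (rule poly_fun_cong[OF poly_fun_mult[OF poly_fun_const[of "\<ominus>\<^bsub>K\<^esub> \<one>\<^bsub>K\<^esub>"]]])
     (auto simp: poly_fun_closed l_minus)

lemma poly_fun_minus: "poly_fun K V p \<Longrightarrow> poly_fun K V q \<Longrightarrow> poly_fun K V (\<lambda>v. p v \<ominus>\<^bsub>K\<^esub> q v)"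
  unfolding a_minus_def by (intro poly_fun_add poly_fun_uminus)

lemma poly_fun_finsum:
  assumes "finite J" "\<And>j. j \<in> J \<Longrightarrow> poly_fun K V (p j)"
  shows "poly_fun K V (\<lambda>v. \<Oplus>\<^bsub>K\<^esub>j\<in>J. p j v)"
  using assms
proof (induction J rule: finite_induct)
  case empty
  then show ?case by (simp add: poly_fun_const)
next
  case (insert j J)
  then have "poly_fun K V (\<lambda>v. p j v \<oplus>\<^bsub>K\<^esub> (\<Oplus>\<^bsub>K\<^esub>j\<in>J. p j v))"
    by (intro poly_fun_add) auto
  then show ?case
  proof (rule poly_fun_cong)
    fix v assume "v \<in> carrier V"
    then show "p j v \<oplus>\<^bsub>K\<^esub> (\<Oplus>\<^bsub>K\<^esub>j\<in>J. p j v) = (\<Oplus>\<^bsub>K\<^esub>j\<in>insert j J. p j v)"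
      using insert poly_fun_closed by (subst finsum_insert) auto
  qed
qed

lemma poly_map_closed: "poly_map K V X g \<Longrightarrow> v \<in> carrier V \<Longrightarrow> g v \<in> carrier X"
  by (simp add: poly_map_def)

lemma poly_mapD: "poly_map K V X g \<Longrightarrow> \<xi> \<in> Hom K X (regular K) \<Longrightarrow> poly_fun K V (\<lambda>v. \<xi> (g v))"
  by (simp add: poly_map_def)

lemma poly_map_cong:
  assumes g: "poly_map K V X g" and eq: "\<And>v. v \<in> carrier V \<Longrightarrow> g v = h v"
  shows "poly_map K V X h"
  unfolding poly_map_def
proof (intro conjI ballI)
  show "h v \<in> carrier X" if "v \<in> carrier V" for v
    using poly_map_closed[OF g that] eq[OF that] by simp
  show "poly_fun K V (\<lambda>v. \<xi> (h v))" if "\<xi> \<in> Hom K X (regular K)" for \<xi>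
    by (rule poly_fun_cong[OF poly_mapD[OF g that]]) (simp add: eq)
qed

lemma poly_map_const: "x \<in> carrier X \<Longrightarrow> poly_map K V X (\<lambda>v. x)"
  unfolding poly_map_def using poly_fun_const HomD(1)[of _ K X "regular K" x] by auto

lemma poly_map_linear: "g \<in> Hom K V X \<Longrightarrow> poly_map K V X g"
  unfolding poly_map_def
proof (intro conjI ballI)
  fix \<xi> assume g: "g \<in> Hom K V X" and \<xi>: "\<xi> \<in> Hom K X (regular K)"
  show "poly_fun K V (\<lambda>v. \<xi> (g v))"
    by (rule poly_fun_cong[OF poly_fun_linear[OF Hom_compose[OF g \<xi> V.right_module_axioms]]])
       (simp add: compose_def)
qed (rule HomD(1))

lemma poly_map_add:
  "poly_map K V X g \<Longrightarrow> poly_map K V X h \<Longrightarrow> right_module K X \<Longrightarrow> poly_map K V X (\<lambda>v. g v \<oplus>\<^bsub>X\<^esub> h v)"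
  unfolding poly_map_def
proof (intro conjI ballI; (elim conjE)?)
  assume X: "right_module K X"
  interpret X: right_module K X by (rule X)
  assume g: "\<forall>v\<in>carrier V. g v \<in> carrier X" "\<forall>\<xi>\<in>Hom K X (regular K). poly_fun K V (\<lambda>v. \<xi> (g v))"
    and h: "\<forall>v\<in>carrier V. h v \<in> carrier X" "\<forall>\<xi>\<in>Hom K X (regular K). poly_fun K V (\<lambda>v. \<xi> (h v))"
  {
    fix v assume "v \<in> carrier V"
    with g h show "g v \<oplus>\<^bsub>X\<^esub> h v \<in> carrier X" by simp
  next
    fix \<xi> assume \<xi>: "\<xi> \<in> Hom K X (regular K)"
    show "poly_fun K V (\<lambda>v. \<xi> (g v \<oplus>\<^bsub>X\<^esub> h v))"
      by (rule poly_fun_cong[OF poly_fun_add[OF bspec[OF g(2) \<xi>] bspec[OF h(2) \<xi>]]])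
         (use g h HomD(3)[OF \<xi>] in simp)
  }
qed

lemma poly_map_smult:
  assumes p: "poly_fun K V p" and g: "poly_map K V X g" and X: "right_module K X"
  shows "poly_map K V X (\<lambda>v. p v \<odot>\<^bsub>X\<^esub> g v)"
  unfolding poly_map_def
proof (intro conjI ballI)
  interpret X: right_module K X by (rule X)
  show "p v \<odot>\<^bsub>X\<^esub> g v \<in> carrier X" if "v \<in> carrier V" for v
    using poly_fun_closed[OF p that] poly_map_closed[OF g that] by simp
  fix \<xi> assume \<xi>: "\<xi> \<in> Hom K X (regular K)"
  show "poly_fun K V (\<lambda>v. \<xi> (p v \<odot>\<^bsub>X\<^esub> g v))"
    by (rule poly_fun_cong[OF poly_fun_mult[OF poly_mapD[OF g \<xi>] p]])
       (use HomD(4)[OF \<xi>] poly_fun_closed[OF p] poly_map_closed[OF g] in simp)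
qed

lemma poly_map_finsum:
  assumes X: "right_module K X" and "finite J" "\<And>j. j \<in> J \<Longrightarrow> poly_map K V X (g j)"
  shows "poly_map K V X (\<lambda>v. \<Oplus>\<^bsub>X\<^esub>j\<in>J. g j v)"
proof -
  interpret X: right_module K X by (rule X)
  show ?thesis
    using assms(2,3)
  proof (induction J rule: finite_induct)
    case empty
    then show ?case by (simp add: poly_map_const)
  next
    case (insert j J)
    then have "poly_map K V X (\<lambda>v. g j v \<oplus>\<^bsub>X\<^esub> (\<Oplus>\<^bsub>X\<^esub>j\<in>J. g j v))"
      by (intro poly_map_add X) auto
    then show ?case
    proof (rule poly_map_cong)
      fix v assume "v \<in> carrier V"
      then show "g j v \<oplus>\<^bsub>X\<^esub> (\<Oplus>\<^bsub>X\<^esub>j\<in>J. g j v) = (\<Oplus>\<^bsub>X\<^esub>j\<in>insert j J. g j v)"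
        using insert poly_map_closed[of X] by (subst X.M.finsum_insert) auto
    qed
  qed
qed

lemma poly_map_compose:
  assumes X: "right_module K X" and g: "poly_map K V X g" and h: "h \<in> Hom K X Y"
  shows "poly_map K V Y (\<lambda>v. h (g v))"
  unfolding poly_map_def
proof (intro conjI ballI)
  show "h (g v) \<in> carrier Y" if "v \<in> carrier V" for v
    using HomD(1)[OF h] poly_map_closed[OF g that] by simp
  fix \<xi> assume \<xi>: "\<xi> \<in> Hom K Y (regular K)"
  show "poly_fun K V (\<lambda>v. \<xi> (h (g v)))"
    by (rule poly_fun_cong[OF poly_mapD[OF g Hom_compose[OF h \<xi> X]]])
       (simp add: compose_def poly_map_closed[OF g])
qed

end

lemma basis_coordinates:
  assumes X: "right_module K X" and B: "finite_basis K X B" and K: "ring K"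
  obtains \<xi> where "\<And>b. b \<in> B \<Longrightarrow> \<xi> b \<in> Hom K X (regular K)"
    and "\<And>x. x \<in> carrier X \<Longrightarrow> (\<Oplus>\<^bsub>X\<^esub>b\<in>B. \<xi> b x \<odot>\<^bsub>X\<^esub> b) = x"
    and "\<And>b b'. \<lbrakk>b \<in> B; b' \<in> B\<rbrakk> \<Longrightarrow> \<xi> b b' = (if b = b' then \<one>\<^bsub>K\<^esub> else \<zero>\<^bsub>K\<^esub>)"
proof -
  interpret X: right_module K X by (rule X)
  note fB = finite_basisD(1,2)[OF B]
  have bX: "b \<in> carrier X" if "b \<in> B" for b using fB that by blast
  define L where "L c = (\<Oplus>\<^bsub>X\<^esub>b\<in>B. c b \<odot>\<^bsub>X\<^esub> b)" for c
  have ex: "\<exists>!c. c \<in> B \<rightarrow>\<^sub>E carrier K \<and> x = L c" if "x \<in> carrier X" for x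
    using finite_basisD(3)[OF B that] by (simp add: L_def)
  define c where "c x = (THE c. c \<in> B \<rightarrow>\<^sub>E carrier K \<and> x = L c)" for x
  have c: "c x \<in> B \<rightarrow>\<^sub>E carrier K" "L (c x) = x" if "x \<in> carrier X" for x
    using theI'[OF ex[OF that]] unfolding c_def[symmetric] by simp_all
  have Lr: "L (restrict d B) = L d" if "d \<in> B \<rightarrow> carrier K" for d
    unfolding L_def using that bX by (intro X.M.finsum_cong') (auto simp: Pi_iff)
  have cu: "c x b = d b" if "d \<in> B \<rightarrow> carrier K" "x = L d" "b \<in> B" for x d b
  proof -
    have "L d \<in> carrier X" unfolding L_def using that bX by (intro X.M.finsum_closed) (auto simp: Pi_iff)
    then have x: "x \<in> carrier X" using that by simp
    have "restrict d B \<in> B \<rightarrow>\<^sub>E carrier K \<and> x = L (restrict d B)"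
      using that Lr by (auto simp: Pi_iff)
    moreover have "c x \<in> B \<rightarrow>\<^sub>E carrier K \<and> x = L (c x)" using c[OF x] by simp
    ultimately have "restrict d B = c x" using ex1E[OF ex[OF x]] by metis
    then show ?thesis using that(3) by (metis restrict_apply')
  qed
  have cK: "c x b \<in> carrier K" if "x \<in> carrier X" "b \<in> B" for x b
    using c(1)[OF that(1)] that(2) by (auto simp: PiE_iff)
  define \<xi> where "\<xi> b = (\<lambda>x\<in>carrier X. c x b)" for b
  have "\<xi> b \<in> Hom K X (regular K)" if b: "b \<in> B" for b
  proof (rule HomI)
    show "\<xi> b x \<in> carrier (regular K)" if "x \<in> carrier X" for x
      using cK[OF that b] that by (simp add: \<xi>_def)
    show "\<xi> b x = undefined" if "x \<notin> carrier X" for x using that by (simp add: \<xi>_def)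
  next
    fix x y assume x: "x \<in> carrier X" "y \<in> carrier X"
    have "L (\<lambda>b. c x b \<oplus>\<^bsub>K\<^esub> c y b) = (\<Oplus>\<^bsub>X\<^esub>b\<in>B. c x b \<odot>\<^bsub>X\<^esub> b \<oplus>\<^bsub>X\<^esub> c y b \<odot>\<^bsub>X\<^esub> b)"
      unfolding L_def using cK x bX by (intro X.M.finsum_cong') (auto simp: X.smult_l_distr)
    also have "\<dots> = L (c x) \<oplus>\<^bsub>X\<^esub> L (c y)"
      unfolding L_def using cK x bX by (intro X.M.finsum_addf) auto
    finally have "x \<oplus>\<^bsub>X\<^esub> y = L (\<lambda>b. c x b \<oplus>\<^bsub>K\<^esub> c y b)" using c x by simp
    then have "c (x \<oplus>\<^bsub>X\<^esub> y) b = c x b \<oplus>\<^bsub>K\<^esub> c y b"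
      by (rule cu[rotated]) (use b cK x in auto)
    then show "\<xi> b (x \<oplus>\<^bsub>X\<^esub> y) = \<xi> b x \<oplus>\<^bsub>regular K\<^esub> \<xi> b y"
      using x by (simp add: \<xi>_def)
  next
    fix a x assume a: "a \<in> carrier K" and x: "x \<in> carrier X"
    have "L (\<lambda>b. c x b \<otimes>\<^bsub>K\<^esub> a) = (\<Oplus>\<^bsub>X\<^esub>b\<in>B. a \<odot>\<^bsub>X\<^esub> (c x b \<odot>\<^bsub>X\<^esub> b))"
      unfolding L_def using cK x bX a by (intro X.M.finsum_cong') (auto simp: X.smult_assoc)
    also have "\<dots> = a \<odot>\<^bsub>X\<^esub> L (c x)"
      unfolding L_def using cK x bX by (intro smult_finsum[OF X a fB(1), symmetric]) auto
    finally have "a \<odot>\<^bsub>X\<^esub> x = L (\<lambda>b. c x b \<otimes>\<^bsub>K\<^esub> a)" using c x by simp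
    then have "c (a \<odot>\<^bsub>X\<^esub> x) b = c x b \<otimes>\<^bsub>K\<^esub> a"
      by (rule cu[rotated]) (use b cK x a in auto)
    then show "\<xi> b (a \<odot>\<^bsub>X\<^esub> x) = a \<odot>\<^bsub>regular K\<^esub> \<xi> b x"
      using x a by (simp add: \<xi>_def)
  qed
  moreover have "(\<Oplus>\<^bsub>X\<^esub>b\<in>B. \<xi> b x \<odot>\<^bsub>X\<^esub> b) = x" if "x \<in> carrier X" for x
    using c(2)[OF that] that by (simp add: L_def \<xi>_def)
  moreover have "\<xi> b b' = (if b = b' then \<one>\<^bsub>K\<^esub> else \<zero>\<^bsub>K\<^esub>)" if b: "b \<in> B" "b' \<in> B" for b b'
  proof -
    let ?d = "\<lambda>b. if b' = b then \<one>\<^bsub>K\<^esub> else \<zero>\<^bsub>K\<^esub>"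
    have "L ?d = (\<Oplus>\<^bsub>X\<^esub>b\<in>B. if b' = b then b else \<zero>\<^bsub>X\<^esub>)"
      unfolding L_def using bX by (intro X.M.finsum_cong') auto
    also have "\<dots> = b'"
      using X.M.finsum_singleton[OF b(2) fB(1), of "\<lambda>b. b"] bX by auto
    finally have "b' = L ?d" by simp
    then have "c b' b = ?d b" by (rule cu[rotated]) (use b in auto)
    then show ?thesis using bX[OF b(2)] by (auto simp: \<xi>_def)
  qed
  ultimately show ?thesis using that by blast
qed

lemma functional_comb_Hom:
  assumes X: "right_module K X" and Y: "right_module K Y" and J: "finite J"
    and \<xi>: "\<And>j. j \<in> J \<Longrightarrow> \<xi> j \<in> Hom K X (regular K)" and e: "\<And>j. j \<in> J \<Longrightarrow> e j \<in> carrier Y"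
  shows "(\<lambda>x\<in>carrier X. \<Oplus>\<^bsub>Y\<^esub>j\<in>J. \<xi> j x \<odot>\<^bsub>Y\<^esub> e j) \<in> Hom K X Y"
proof -
  interpret X: right_module K X by (rule X)
  interpret Y: right_module K Y by (rule Y)
  have c: "\<xi> j x \<in> carrier K" if "j \<in> J" "x \<in> carrier X" for j x
    using HomD(1)[OF \<xi>[OF that(1)] that(2)] by simp
  show ?thesis
  proof (rule HomI)
    fix x assume x: "x \<in> carrier X"
    then show "(\<lambda>x\<in>carrier X. \<Oplus>\<^bsub>Y\<^esub>j\<in>J. \<xi> j x \<odot>\<^bsub>Y\<^esub> e j) x \<in> carrier Y"
      using c e by (auto intro!: Y.M.finsum_closed)
  next
    fix x x' assume x: "x \<in> carrier X" "x' \<in> carrier X"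
    have "(\<Oplus>\<^bsub>Y\<^esub>j\<in>J. \<xi> j (x \<oplus>\<^bsub>X\<^esub> x') \<odot>\<^bsub>Y\<^esub> e j) = (\<Oplus>\<^bsub>Y\<^esub>j\<in>J. \<xi> j x \<odot>\<^bsub>Y\<^esub> e j \<oplus>\<^bsub>Y\<^esub> \<xi> j x' \<odot>\<^bsub>Y\<^esub> e j)"
    proof (rule Y.M.finsum_cong')
      fix j assume j: "j \<in> J"
      show "\<xi> j (x \<oplus>\<^bsub>X\<^esub> x') \<odot>\<^bsub>Y\<^esub> e j = \<xi> j x \<odot>\<^bsub>Y\<^esub> e j \<oplus>\<^bsub>Y\<^esub> \<xi> j x' \<odot>\<^bsub>Y\<^esub> e j"
        using HomD(3)[OF \<xi>[OF j] x] c[OF j] e[OF j] x by (simp add: Y.smult_l_distr)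
    qed (use c e x in auto)
    also have "\<dots> = (\<Oplus>\<^bsub>Y\<^esub>j\<in>J. \<xi> j x \<odot>\<^bsub>Y\<^esub> e j) \<oplus>\<^bsub>Y\<^esub> (\<Oplus>\<^bsub>Y\<^esub>j\<in>J. \<xi> j x' \<odot>\<^bsub>Y\<^esub> e j)"
      by (rule Y.M.finsum_addf) (use c e x in auto)
    finally show "(\<lambda>x\<in>carrier X. \<Oplus>\<^bsub>Y\<^esub>j\<in>J. \<xi> j x \<odot>\<^bsub>Y\<^esub> e j) (x \<oplus>\<^bsub>X\<^esub> x') =
        (\<lambda>x\<in>carrier X. \<Oplus>\<^bsub>Y\<^esub>j\<in>J. \<xi> j x \<odot>\<^bsub>Y\<^esub> e j) x \<oplus>\<^bsub>Y\<^esub> (\<lambda>x\<in>carrier X. \<Oplus>\<^bsub>Y\<^esub>j\<in>J. \<xi> j x \<odot>\<^bsub>Y\<^esub> e j) x'"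
      using x by simp
  next
    fix k x assume k: "k \<in> carrier K" and x: "x \<in> carrier X"
    have "(\<Oplus>\<^bsub>Y\<^esub>j\<in>J. \<xi> j (k \<odot>\<^bsub>X\<^esub> x) \<odot>\<^bsub>Y\<^esub> e j) = (\<Oplus>\<^bsub>Y\<^esub>j\<in>J. k \<odot>\<^bsub>Y\<^esub> (\<xi> j x \<odot>\<^bsub>Y\<^esub> e j))"
    proof (rule Y.M.finsum_cong')
      fix j assume j: "j \<in> J"
      show "\<xi> j (k \<odot>\<^bsub>X\<^esub> x) \<odot>\<^bsub>Y\<^esub> e j = k \<odot>\<^bsub>Y\<^esub> (\<xi> j x \<odot>\<^bsub>Y\<^esub> e j)"
        using HomD(4)[OF \<xi>[OF j] k x] Y.smult_assoc[OF c[OF j x] k e[OF j]] by simp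
    qed (use c e x k in auto)
    also have "\<dots> = k \<odot>\<^bsub>Y\<^esub> (\<Oplus>\<^bsub>Y\<^esub>j\<in>J. \<xi> j x \<odot>\<^bsub>Y\<^esub> e j)"
      by (rule smult_finsum[OF Y k J, symmetric]) (use c e x in auto)
    finally show "(\<lambda>x\<in>carrier X. \<Oplus>\<^bsub>Y\<^esub>j\<in>J. \<xi> j x \<odot>\<^bsub>Y\<^esub> e j) (k \<odot>\<^bsub>X\<^esub> x) =
        k \<odot>\<^bsub>Y\<^esub> (\<lambda>x\<in>carrier X. \<Oplus>\<^bsub>Y\<^esub>j\<in>J. \<xi> j x \<odot>\<^bsub>Y\<^esub> e j) x"
      using x k by simp
  qed simp
qed

section \<open>Linear systems near a solvable one\<close>

context poly_space
begin

text \<open>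
  Gaussian elimination without divisions: a square polynomial system that is the identity at \<open>v0\<close>
  has, up to a common denominator that is $1$ at \<open>v0\<close>, a polynomial solution. The pivot
  \<open>A c c\<close> is $1$ at \<open>v0\<close>, and the system that remains is again the identity there.
\<close>

lemma cramer_matrix:
  assumes v0: "v0 \<in> carrier V"
  shows "finite J \<Longrightarrow> (\<And>i j. \<lbrakk>i \<in> J; j \<in> J\<rbrakk> \<Longrightarrow> poly_fun K V (A i j)) \<Longrightarrow>
    (\<And>i j. \<lbrakk>i \<in> J; j \<in> J\<rbrakk> \<Longrightarrow> A i j v0 = (if i = j then \<one>\<^bsub>K\<^esub> else \<zero>\<^bsub>K\<^esub>)) \<Longrightarrow>
    (\<And>i. i \<in> J \<Longrightarrow> poly_fun K V (b i)) \<Longrightarrow>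
    \<exists>p x. poly_fun K V p \<and> p v0 = \<one>\<^bsub>K\<^esub> \<and> (\<forall>j\<in>J. poly_fun K V (x j)) \<and>
      (\<forall>v\<in>carrier V. \<forall>i\<in>J. (\<Oplus>\<^bsub>K\<^esub>j\<in>J. A i j v \<otimes>\<^bsub>K\<^esub> x j v) = p v \<otimes>\<^bsub>K\<^esub> b i v)"
proof (induction J arbitrary: A b rule: finite_induct)
  case empty
  then show ?case by (intro exI[of _ "\<lambda>_. \<one>\<^bsub>K\<^esub>"]) (simp add: poly_fun_const)
next
  case (insert c J)
  note A = insert.prems(1) and A0 = insert.prems(2) and b = insert.prems(3)
  let ?a = "A c c"
  define A' where "A' i j v = ?a v \<otimes>\<^bsub>K\<^esub> A i j v \<ominus>\<^bsub>K\<^esub> A i c v \<otimes>\<^bsub>K\<^esub> A c j v" for i j v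
  define b' where "b' i v = ?a v \<otimes>\<^bsub>K\<^esub> b i v \<ominus>\<^bsub>K\<^esub> A i c v \<otimes>\<^bsub>K\<^esub> b c v" for i v
  have "\<exists>p x. poly_fun K V p \<and> p v0 = \<one>\<^bsub>K\<^esub> \<and> (\<forall>j\<in>J. poly_fun K V (x j)) \<and>
      (\<forall>v\<in>carrier V. \<forall>i\<in>J. (\<Oplus>\<^bsub>K\<^esub>j\<in>J. A' i j v \<otimes>\<^bsub>K\<^esub> x j v) = p v \<otimes>\<^bsub>K\<^esub> b' i v)"
  proof (rule insert.IH)
    fix i j assume "i \<in> J" "j \<in> J"
    then show "poly_fun K V (A' i j)"
      unfolding A'_def by (intro poly_fun_minus poly_fun_mult A) auto
    have "i \<noteq> c" "j \<noteq> c" using \<open>i \<in> J\<close> \<open>j \<in> J\<close> insert.hyps by auto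
    then show "A' i j v0 = (if i = j then \<one>\<^bsub>K\<^esub> else \<zero>\<^bsub>K\<^esub>)"
      using \<open>i \<in> J\<close> \<open>j \<in> J\<close> by (simp add: A'_def A0 a_minus_def)
  next
    fix i assume "i \<in> J"
    then show "poly_fun K V (b' i)"
      unfolding b'_def by (intro poly_fun_minus poly_fun_mult A b) auto
  qed
  then obtain p' x' where p': "poly_fun K V p'" "p' v0 = \<one>\<^bsub>K\<^esub>"
    and x': "\<And>j. j \<in> J \<Longrightarrow> poly_fun K V (x' j)"
    and eq': "\<And>v i. \<lbrakk>v \<in> carrier V; i \<in> J\<rbrakk> \<Longrightarrow> (\<Oplus>\<^bsub>K\<^esub>j\<in>J. A' i j v \<otimes>\<^bsub>K\<^esub> x' j v) = p' v \<otimes>\<^bsub>K\<^esub> b' i v"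
    by blast
  define S where "S v = (\<Oplus>\<^bsub>K\<^esub>j\<in>J. A c j v \<otimes>\<^bsub>K\<^esub> x' j v)" for v
  have S: "poly_fun K V S"
    unfolding S_def by (intro poly_fun_finsum insert.hyps poly_fun_mult A x') auto
  define p where "p v = ?a v \<otimes>\<^bsub>K\<^esub> p' v" for v
  define x where "x j v = (if j = c then p' v \<otimes>\<^bsub>K\<^esub> b c v \<ominus>\<^bsub>K\<^esub> S v else ?a v \<otimes>\<^bsub>K\<^esub> x' j v)" for j v
  have "poly_fun K V p"
    unfolding p_def by (intro poly_fun_mult A p') auto
  moreover have "p v0 = \<one>\<^bsub>K\<^esub>"
    by (simp add: p_def A0 p')
  moreover have "poly_fun K V (x j)" if "j \<in> insert c J" for j
  proof (cases "j = c")
    case True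
    then show ?thesis
      unfolding x_def by (auto intro!: poly_fun_minus poly_fun_mult p' b S)
  next
    case False
    then have "poly_fun K V (\<lambda>v. ?a v \<otimes>\<^bsub>K\<^esub> x' j v)"
      using that by (intro poly_fun_mult A x') auto
    moreover have "x j = (\<lambda>v. ?a v \<otimes>\<^bsub>K\<^esub> x' j v)" using False by (simp add: x_def fun_eq_iff)
    ultimately show ?thesis by simp
  qed
  moreover have "(\<Oplus>\<^bsub>K\<^esub>j\<in>insert c J. A i j v \<otimes>\<^bsub>K\<^esub> x j v) = p v \<otimes>\<^bsub>K\<^esub> b i v"
    if v: "v \<in> carrier V" and i: "i \<in> insert c J" for v i
  proof -
    have Ac: "A i j v \<in> carrier K" if "i \<in> insert c J" "j \<in> insert c J" for i j
      using poly_fun_closed[OF A[OF that] v] .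
    have x'c: "x' j v \<in> carrier K" if "j \<in> J" for j using poly_fun_closed[OF x'[OF that] v] .
    have bc: "b i v \<in> carrier K" if "i \<in> insert c J" for i using poly_fun_closed[OF b[OF that] v] .
    have Sc: "S v \<in> carrier K" "p' v \<in> carrier K"
      using poly_fun_closed[OF S v] poly_fun_closed[OF p'(1) v] .
    define T where "T = (\<Oplus>\<^bsub>K\<^esub>j\<in>J. A i j v \<otimes>\<^bsub>K\<^esub> (?a v \<otimes>\<^bsub>K\<^esub> x' j v))"
    have Tc: "T \<in> carrier K"
      unfolding T_def using Ac x'c i by (intro finsum_closed) auto
    have sumT: "(\<Oplus>\<^bsub>K\<^esub>j\<in>J. A i j v \<otimes>\<^bsub>K\<^esub> x j v) = T"
      unfolding T_def using Ac x'c i insert.hyps by (intro finsum_cong') (auto simp: x_def)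
    have cl: "A i j v \<otimes>\<^bsub>K\<^esub> x j v \<in> carrier K" if "j \<in> insert c J" for j
      using that Ac x'c i bc Sc by (auto simp: x_def)
    have "(\<Oplus>\<^bsub>K\<^esub>j\<in>insert c J. A i j v \<otimes>\<^bsub>K\<^esub> x j v) =
        A i c v \<otimes>\<^bsub>K\<^esub> x c v \<oplus>\<^bsub>K\<^esub> (\<Oplus>\<^bsub>K\<^esub>j\<in>J. A i j v \<otimes>\<^bsub>K\<^esub> x j v)"
      by (rule finsum_insert[OF insert.hyps]) (use cl in auto)
    then have sum: "(\<Oplus>\<^bsub>K\<^esub>j\<in>insert c J. A i j v \<otimes>\<^bsub>K\<^esub> x j v) =
        A i c v \<otimes>\<^bsub>K\<^esub> (p' v \<otimes>\<^bsub>K\<^esub> b c v \<ominus>\<^bsub>K\<^esub> S v) \<oplus>\<^bsub>K\<^esub> T"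
      unfolding sumT by (simp add: x_def)
    show ?thesis
    proof (cases "i = c")
      case True
      have "T = (\<Oplus>\<^bsub>K\<^esub>j\<in>J. ?a v \<otimes>\<^bsub>K\<^esub> (A c j v \<otimes>\<^bsub>K\<^esub> x' j v))"
        unfolding T_def True using Ac x'c by (intro finsum_cong') (auto simp: m_lcomm)
      also have "\<dots> = ?a v \<otimes>\<^bsub>K\<^esub> S v"
        unfolding S_def using Ac x'c insert.hyps by (intro finsum_rdistr[symmetric]) auto
      finally have T: "T = ?a v \<otimes>\<^bsub>K\<^esub> S v" .
      have "a \<otimes>\<^bsub>K\<^esub> (q \<otimes>\<^bsub>K\<^esub> y \<ominus>\<^bsub>K\<^esub> s) \<oplus>\<^bsub>K\<^esub> a \<otimes>\<^bsub>K\<^esub> s = a \<otimes>\<^bsub>K\<^esub> q \<otimes>\<^bsub>K\<^esub> y"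
        if "a \<in> carrier K" "q \<in> carrier K" "y \<in> carrier K" "s \<in> carrier K" for a q y s
        using that by algebra
      then show ?thesis
        unfolding p_def using Ac bc Sc sum[unfolded T] True by simp
    next
      case False
      then have iJ: "i \<in> J" using i by simp
      have "T = (\<Oplus>\<^bsub>K\<^esub>j\<in>J. A' i j v \<otimes>\<^bsub>K\<^esub> x' j v \<oplus>\<^bsub>K\<^esub> A i c v \<otimes>\<^bsub>K\<^esub> (A c j v \<otimes>\<^bsub>K\<^esub> x' j v))"
        unfolding T_def
      proof (rule finsum_cong')
        fix j assume j: "j \<in> J"
        have "m \<otimes>\<^bsub>K\<^esub> (a \<otimes>\<^bsub>K\<^esub> y) = (a \<otimes>\<^bsub>K\<^esub> m \<ominus>\<^bsub>K\<^esub> l \<otimes>\<^bsub>K\<^esub> k) \<otimes>\<^bsub>K\<^esub> y \<oplus>\<^bsub>K\<^esub> l \<otimes>\<^bsub>K\<^esub> (k \<otimes>\<^bsub>K\<^esub> y)"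
          if "m \<in> carrier K" "a \<in> carrier K" "y \<in> carrier K" "l \<in> carrier K" "k \<in> carrier K" for m a y l k
          using that by algebra
        then show "A i j v \<otimes>\<^bsub>K\<^esub> (?a v \<otimes>\<^bsub>K\<^esub> x' j v) =
            A' i j v \<otimes>\<^bsub>K\<^esub> x' j v \<oplus>\<^bsub>K\<^esub> A i c v \<otimes>\<^bsub>K\<^esub> (A c j v \<otimes>\<^bsub>K\<^esub> x' j v)"
          unfolding A'_def using Ac x'c i j by simp
      qed (use Ac x'c i in \<open>auto simp: A'_def\<close>)
      also have "\<dots> = (\<Oplus>\<^bsub>K\<^esub>j\<in>J. A' i j v \<otimes>\<^bsub>K\<^esub> x' j v) \<oplus>\<^bsub>K\<^esub> (\<Oplus>\<^bsub>K\<^esub>j\<in>J. A i c v \<otimes>\<^bsub>K\<^esub> (A c j v \<otimes>\<^bsub>K\<^esub> x' j v))"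
        using Ac x'c i by (intro finsum_addf) (auto simp: A'_def)
      also have "(\<Oplus>\<^bsub>K\<^esub>j\<in>J. A i c v \<otimes>\<^bsub>K\<^esub> (A c j v \<otimes>\<^bsub>K\<^esub> x' j v)) = A i c v \<otimes>\<^bsub>K\<^esub> S v"
        unfolding S_def using Ac x'c insert.hyps i by (intro finsum_rdistr[symmetric]) auto
      also have "(\<Oplus>\<^bsub>K\<^esub>j\<in>J. A' i j v \<otimes>\<^bsub>K\<^esub> x' j v) = p' v \<otimes>\<^bsub>K\<^esub> b' i v"
        by (rule eq'[OF v iJ])
      finally have T: "T = p' v \<otimes>\<^bsub>K\<^esub> b' i v \<oplus>\<^bsub>K\<^esub> A i c v \<otimes>\<^bsub>K\<^esub> S v" .
      have "l \<otimes>\<^bsub>K\<^esub> (q \<otimes>\<^bsub>K\<^esub> y \<ominus>\<^bsub>K\<^esub> s) \<oplus>\<^bsub>K\<^esub> (q \<otimes>\<^bsub>K\<^esub> (a \<otimes>\<^bsub>K\<^esub> z \<ominus>\<^bsub>K\<^esub> l \<otimes>\<^bsub>K\<^esub> y) \<oplus>\<^bsub>K\<^esub> l \<otimes>\<^bsub>K\<^esub> s) = a \<otimes>\<^bsub>K\<^esub> q \<otimes>\<^bsub>K\<^esub> z"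
        if "a \<in> carrier K" "q \<in> carrier K" "y \<in> carrier K" "s \<in> carrier K" "l \<in> carrier K" "z \<in> carrier K"
        for a q y s l z
        using that by algebra
      then show ?thesis
        unfolding sum T p_def b'_def using Ac bc Sc i by simp
    qed
  qed
  ultimately show ?case by blast
qed

text \<open>
  In coordinates this is \<open>cramer_matrix\<close>. As \<open>L v0\<close> is the identity, the solution has the value
  \<open>b v0\<close> at \<open>v0\<close>.
\<close>

lemma cramer:
  assumes X: "right_module K X" "finite_dim K X" and v0: "v0 \<in> carrier V"
    and L: "\<And>v. v \<in> carrier V \<Longrightarrow> L v \<in> Hom K X X"
    and Lp: "\<And>x. x \<in> carrier X \<Longrightarrow> poly_map K V X (\<lambda>v. L v x)"
    and L0: "\<And>x. x \<in> carrier X \<Longrightarrow> L v0 x = x"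
    and b: "poly_map K V X b"
  obtains p x where "poly_fun K V p" "p v0 = \<one>\<^bsub>K\<^esub>" "poly_map K V X x"
    "\<And>v. v \<in> carrier V \<Longrightarrow> L v (x v) = p v \<odot>\<^bsub>X\<^esub> b v"
proof -
  interpret X: right_module K X by (rule X)
  obtain B where B: "finite_basis K X B" using X(2) by (auto simp: finite_dim_def)
  note fB = finite_basisD(1,2)[OF B]
  have bX: "e \<in> carrier X" if "e \<in> B" for e using fB that by blast
  obtain \<xi> where \<xi>: "\<And>b. b \<in> B \<Longrightarrow> \<xi> b \<in> Hom K X (regular K)"
    and \<xi>s: "\<And>x. x \<in> carrier X \<Longrightarrow> (\<Oplus>\<^bsub>X\<^esub>b\<in>B. \<xi> b x \<odot>\<^bsub>X\<^esub> b) = x"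
    and \<xi>b: "\<And>b b'. \<lbrakk>b \<in> B; b' \<in> B\<rbrakk> \<Longrightarrow> \<xi> b b' = (if b = b' then \<one>\<^bsub>K\<^esub> else \<zero>\<^bsub>K\<^esub>)"
    using basis_coordinates[OF X(1) B ring_axioms] by blast
  have "\<exists>p x. poly_fun K V p \<and> p v0 = \<one>\<^bsub>K\<^esub> \<and> (\<forall>j\<in>B. poly_fun K V (x j)) \<and>
      (\<forall>v\<in>carrier V. \<forall>i\<in>B. (\<Oplus>\<^bsub>K\<^esub>j\<in>B. \<xi> i (L v j) \<otimes>\<^bsub>K\<^esub> x j v) = p v \<otimes>\<^bsub>K\<^esub> \<xi> i (b v))"
    by (rule cramer_matrix[OF v0 fB(1), of "\<lambda>i j v. \<xi> i (L v j)" "\<lambda>i v. \<xi> i (b v)"])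
       (auto intro!: poly_mapD[OF Lp] poly_mapD[OF b] \<xi> simp: bX L0 \<xi>b)
  then obtain p y where p: "poly_fun K V p" "p v0 = \<one>\<^bsub>K\<^esub>" and y: "\<And>j. j \<in> B \<Longrightarrow> poly_fun K V (y j)"
    and eq: "\<And>v i. \<lbrakk>v \<in> carrier V; i \<in> B\<rbrakk> \<Longrightarrow> (\<Oplus>\<^bsub>K\<^esub>j\<in>B. \<xi> i (L v j) \<otimes>\<^bsub>K\<^esub> y j v) = p v \<otimes>\<^bsub>K\<^esub> \<xi> i (b v)"
    by blast
  define x where "x v = (\<Oplus>\<^bsub>X\<^esub>j\<in>B. y j v \<odot>\<^bsub>X\<^esub> j)" for v
  have "poly_map K V X x"
    unfolding x_def by (intro poly_map_finsum poly_map_smult poly_map_const X y fB(1) bX)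
  moreover have "L v (x v) = p v \<odot>\<^bsub>X\<^esub> b v" if v: "v \<in> carrier V" for v
  proof -
    have yc: "y j v \<in> carrier K" if "j \<in> B" for j using poly_fun_closed[OF y[OF that] v] .
    have pb: "p v \<in> carrier K" "b v \<in> carrier X"
      using poly_fun_closed[OF p(1) v] poly_map_closed[OF b v] .
    have xc: "x v \<in> carrier X" by (rule poly_map_closed[OF \<open>poly_map K V X x\<close> v])
    note Lc = HomD(1)[OF L[OF v]]
    have Lx: "L v (x v) = (\<Oplus>\<^bsub>X\<^esub>j\<in>B. y j v \<odot>\<^bsub>X\<^esub> L v j)"
    proof -
      have "L v (x v) = (\<Oplus>\<^bsub>X\<^esub>j\<in>B. L v (y j v \<odot>\<^bsub>X\<^esub> j))"
        unfolding x_def by (rule Hom_finsum[OF X(1) X(1) L[OF v] fB(1)]) (simp add: yc bX)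
      also have "\<dots> = (\<Oplus>\<^bsub>X\<^esub>j\<in>B. y j v \<odot>\<^bsub>X\<^esub> L v j)"
        using yc bX Lc HomD(4)[OF L[OF v]] by (intro X.M.finsum_cong') auto
      finally show ?thesis .
    qed
    have co: "\<xi> i (L v (x v)) = \<xi> i (p v \<odot>\<^bsub>X\<^esub> b v)" if i: "i \<in> B" for i
    proof -
      have "\<xi> i (L v (x v)) = (\<Oplus>\<^bsub>regular K\<^esub>j\<in>B. \<xi> i (y j v \<odot>\<^bsub>X\<^esub> L v j))"
        unfolding Lx by (rule Hom_finsum[OF X(1) rm_reg \<xi>[OF i] fB(1)]) (simp add: yc bX Lc)
      also have "\<dots> = (\<Oplus>\<^bsub>K\<^esub>j\<in>B. \<xi> i (y j v \<odot>\<^bsub>X\<^esub> L v j))"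
        by (simp add: finsum_def finprod_def regular_def)
      also have "\<dots> = (\<Oplus>\<^bsub>K\<^esub>j\<in>B. \<xi> i (L v j) \<otimes>\<^bsub>K\<^esub> y j v)"
        using yc bX Lc HomD[OF \<xi>[OF i]] by (intro finsum_cong') auto
      also have "\<dots> = \<xi> i (p v \<odot>\<^bsub>X\<^esub> b v)"
        unfolding eq[OF v i] using pb HomD[OF \<xi>[OF i]] by (simp add: m_comm)
      finally show ?thesis .
    qed
    have "(\<Oplus>\<^bsub>X\<^esub>i\<in>B. \<xi> i (L v (x v)) \<odot>\<^bsub>X\<^esub> i) = (\<Oplus>\<^bsub>X\<^esub>i\<in>B. \<xi> i (p v \<odot>\<^bsub>X\<^esub> b v) \<odot>\<^bsub>X\<^esub> i)"
      using HomD(1)[OF \<xi>] pb bX by (intro X.M.finsum_cong') (auto simp: co)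
    then show ?thesis
      using \<xi>s[OF Lc[OF xc]] \<xi>s[of "p v \<odot>\<^bsub>X\<^esub> b v"] pb by simp
  qed
  ultimately show ?thesis using that p by blast
qed

text \<open>By \<open>cramer\<close> each element of a basis, times a function that is $1$ at \<open>v0\<close>, is a value of \<open>L v\<close>.\<close>

lemma surj_near_identity:
  assumes X: "right_module K X" "finite_dim K X" and v0: "v0 \<in> carrier V"
    and L: "\<And>v. v \<in> carrier V \<Longrightarrow> L v \<in> Hom K X X"
    and Lp: "\<And>x. x \<in> carrier X \<Longrightarrow> poly_map K V X (\<lambda>v. L v x)"
    and L0: "\<And>x. x \<in> carrier X \<Longrightarrow> L v0 x = x"
  obtains p where "poly_fun K V p" "p v0 = \<one>\<^bsub>K\<^esub>"
    "\<And>v. \<lbrakk>v \<in> carrier V; p v \<noteq> \<zero>\<^bsub>K\<^esub>\<rbrakk> \<Longrightarrow> L v ` carrier X = carrier X"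
proof -
  interpret X: right_module K X by (rule X)
  obtain B where B: "finite_basis K X B" using X(2) by (auto simp: finite_dim_def)
  note fB = finite_basisD(1,2)[OF B]
  have one: "\<exists>p. poly_fun K V p \<and> p v0 = \<one>\<^bsub>K\<^esub> \<and> (\<forall>v\<in>carrier V. p v \<noteq> \<zero>\<^bsub>K\<^esub> \<longrightarrow> e \<in> L v ` carrier X)"
    if e: "e \<in> carrier X" for e
  proof -
    obtain p x where p: "poly_fun K V p" "p v0 = \<one>\<^bsub>K\<^esub>" and x: "poly_map K V X x"
      and eq: "\<And>v. v \<in> carrier V \<Longrightarrow> L v (x v) = p v \<odot>\<^bsub>X\<^esub> e"
      using cramer[OF X v0 L Lp L0 poly_map_const[OF e]] by blast
    have "e \<in> L v ` carrier X" if v: "v \<in> carrier V" and nz: "p v \<noteq> \<zero>\<^bsub>K\<^esub>" for v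
    proof -
      have pc: "p v \<in> carrier K" "inv\<^bsub>K\<^esub> (p v) \<in> carrier K" "p v \<otimes>\<^bsub>K\<^esub> inv\<^bsub>K\<^esub> (p v) = \<one>\<^bsub>K\<^esub>"
        using poly_fun_closed[OF p(1) v] nz field_Units by auto
      have xc: "x v \<in> carrier X" by (rule poly_map_closed[OF x v])
      have "L v (inv\<^bsub>K\<^esub> (p v) \<odot>\<^bsub>X\<^esub> x v) = inv\<^bsub>K\<^esub> (p v) \<odot>\<^bsub>X\<^esub> (p v \<odot>\<^bsub>X\<^esub> e)"
        using HomD(4)[OF L[OF v] pc(2) xc] eq[OF v] by simp
      also have "\<dots> = (p v \<otimes>\<^bsub>K\<^esub> inv\<^bsub>K\<^esub> (p v)) \<odot>\<^bsub>X\<^esub> e"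
        by (rule X.smult_assoc[symmetric]) (use pc e in auto)
      also have "\<dots> = e" using e by (simp add: pc)
      finally show ?thesis using pc xc by (metis X.smult_closed imageI)
    qed
    then show ?thesis using p by blast
  qed
  have "\<exists>p. poly_fun K V p \<and> p v0 = \<one>\<^bsub>K\<^esub> \<and> (\<forall>v\<in>carrier V. p v \<noteq> \<zero>\<^bsub>K\<^esub> \<longrightarrow> E \<subseteq> L v ` carrier X)"
    if "finite E" "E \<subseteq> carrier X" for E
    using that
  proof (induction E rule: finite_induct)
    case empty
    then show ?case by (intro exI[of _ "\<lambda>_. \<one>\<^bsub>K\<^esub>"]) (simp add: poly_fun_const)
  next
    case (insert e E)
    then obtain p where p: "poly_fun K V p" "p v0 = \<one>\<^bsub>K\<^esub>"
      "\<And>v. \<lbrakk>v \<in> carrier V; p v \<noteq> \<zero>\<^bsub>K\<^esub>\<rbrakk> \<Longrightarrow> E \<subseteq> L v ` carrier X" by auto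
    obtain q where q: "poly_fun K V q" "q v0 = \<one>\<^bsub>K\<^esub>"
      "\<And>v. \<lbrakk>v \<in> carrier V; q v \<noteq> \<zero>\<^bsub>K\<^esub>\<rbrakk> \<Longrightarrow> e \<in> L v ` carrier X" using one[of e] insert.prems by auto
    have "insert e E \<subseteq> L v ` carrier X" if v: "v \<in> carrier V" and nz: "p v \<otimes>\<^bsub>K\<^esub> q v \<noteq> \<zero>\<^bsub>K\<^esub>" for v
    proof -
      have "p v \<noteq> \<zero>\<^bsub>K\<^esub>" "q v \<noteq> \<zero>\<^bsub>K\<^esub>"
        using nz poly_fun_closed[OF p(1) v] poly_fun_closed[OF q(1) v] by auto
      then show ?thesis using p(3)[OF v] q(3)[OF v] by blast
    qed
    moreover have "p v0 \<otimes>\<^bsub>K\<^esub> q v0 = \<one>\<^bsub>K\<^esub>" by (simp add: p q)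
    ultimately show ?case
      using poly_fun_mult[OF p(1) q(1)] by (intro exI[of _ "\<lambda>v. p v \<otimes>\<^bsub>K\<^esub> q v"]) blast
  qed
  from this[OF fB] obtain p where p: "poly_fun K V p" "p v0 = \<one>\<^bsub>K\<^esub>"
    and pB: "\<And>v. \<lbrakk>v \<in> carrier V; p v \<noteq> \<zero>\<^bsub>K\<^esub>\<rbrakk> \<Longrightarrow> B \<subseteq> L v ` carrier X" by auto
  have "L v ` carrier X = carrier X" if v: "v \<in> carrier V" "p v \<noteq> \<zero>\<^bsub>K\<^esub>" for v
  proof
    note s = submodule_image[OF X(1) X(1) L[OF v(1)] submodule_carrier[OF X(1)]]
    show "L v ` carrier X \<subseteq> carrier X" by (rule submodule_subset[OF X(1) s])
    show "carrier X \<subseteq> L v ` carrier X"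
    proof
      fix x assume "x \<in> carrier X"
      then obtain c where c: "c \<in> B \<rightarrow>\<^sub>E carrier K" "x = (\<Oplus>\<^bsub>X\<^esub>b\<in>B. c b \<odot>\<^bsub>X\<^esub> b)"
        using ex1_implies_ex[OF finite_basisD(3)[OF B]] by blast
      show "x \<in> L v ` carrier X"
        unfolding c(2)
        by (rule submodule_finsum[OF X(1) s fB(1)], rule submodule_smult[OF X(1) s])
           (use c(1) pB[OF v] in \<open>auto simp: PiE_iff\<close>)
    qed
  qed
  then show ?thesis using that p by blast
qed

section \<open>The Zariski topology over an infinite field\<close>

lemma openin_zariskiI:
  assumes "U \<subseteq> carrier V"
    and "\<And>v. v \<in> U \<Longrightarrow> \<exists>p. poly_fun K V p \<and> p v \<noteq> \<zero>\<^bsub>K\<^esub> \<and> (\<forall>w\<in>carrier V. p w \<noteq> \<zero>\<^bsub>K\<^esub> \<longrightarrow> w \<in> U)"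
  shows "openin (zariski K V) U"
proof -
  define T where "T = {p \<in> polynomial_functions K V. \<forall>w\<in>carrier V. p w \<noteq> \<zero>\<^bsub>K\<^esub> \<longrightarrow> w \<in> U}"
  have "U = carrier V - {v \<in> carrier V. \<forall>p\<in>T. p v = \<zero>\<^bsub>K\<^esub>}"
  proof (intro equalityI subsetI)
    fix v assume v: "v \<in> U"
    then obtain p where p: "poly_fun K V p" "p v \<noteq> \<zero>\<^bsub>K\<^esub>" "\<And>w. \<lbrakk>w \<in> carrier V; p w \<noteq> \<zero>\<^bsub>K\<^esub>\<rbrakk> \<Longrightarrow> w \<in> U"
      using assms(2) by blast
    have "v \<in> carrier V" using v assms(1) by blast
    moreover have "restrict p (carrier V) \<in> T" using p by (auto simp: T_def poly_fun_def)
    moreover have "restrict p (carrier V) v \<noteq> \<zero>\<^bsub>K\<^esub>" using p(2) calculation(1) by simp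
    ultimately show "v \<in> carrier V - {v \<in> carrier V. \<forall>p\<in>T. p v = \<zero>\<^bsub>K\<^esub>}" by blast
  qed (auto simp: T_def)
  then show ?thesis
    unfolding openin_zariski[OF field_K] zariski_open_def
    by (intro exI[of _ T]) (auto simp: T_def)
qed

lemma polynomial_function_on_line:
  assumes v: "v \<in> carrier V" and u: "u \<in> carrier V" and p: "p \<in> polynomial_functions K V"
  shows "\<exists>f\<in>carrier (poly_ring K). \<forall>t\<in>carrier K. p (v \<oplus>\<^bsub>V\<^esub> t \<odot>\<^bsub>V\<^esub> u) = eval f t"
  using p
proof (induction rule: polynomial_functions.induct)
  case (linear l)
  have c: "l v \<in> carrier K" "l u \<in> carrier K" using HomD(1)[OF linear] v u by auto
  \<comment> \<open>Coefficient lists start with the leading one: this is $l(u)\,t + l(v)$.\<close>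
  have "l (v \<oplus>\<^bsub>V\<^esub> t \<odot>\<^bsub>V\<^esub> u) = eval (normalize [l u, l v]) t" if "t \<in> carrier K" for t
    using that c v u HomD(3,4)[OF linear] by (simp add: eval_normalize) (simp add: a_comm)
  moreover have "normalize [l u, l v] \<in> carrier (poly_ring K)"
    using normalize_gives_polynomial[of "[l u, l v]" "carrier K"] c by (simp add: univ_poly_carrier)
  ultimately show ?case by blast
next
  case (const c)
  have "(\<lambda>v\<in>carrier V. c) (v \<oplus>\<^bsub>V\<^esub> t \<odot>\<^bsub>V\<^esub> u) = eval (normalize [c]) t" if "t \<in> carrier K" for t
    using that const v u by (simp add: eval_normalize)
  moreover have "normalize [c] \<in> carrier (poly_ring K)"
    using normalize_gives_polynomial[of "[c]" "carrier K"] const by (simp add: univ_poly_carrier)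
  ultimately show ?case by blast
next
  case (add p q)
  then obtain f g where f: "f \<in> carrier (poly_ring K)" "\<And>t. t \<in> carrier K \<Longrightarrow> p (v \<oplus>\<^bsub>V\<^esub> t \<odot>\<^bsub>V\<^esub> u) = eval f t"
    and g: "g \<in> carrier (poly_ring K)" "\<And>t. t \<in> carrier K \<Longrightarrow> q (v \<oplus>\<^bsub>V\<^esub> t \<odot>\<^bsub>V\<^esub> u) = eval g t"
    by blast
  interpret UP: domain "poly_ring K" by (rule univ_poly_is_domain[OF carrier_is_subring])
  have "(\<lambda>v\<in>carrier V. p v \<oplus>\<^bsub>K\<^esub> q v) (v \<oplus>\<^bsub>V\<^esub> t \<odot>\<^bsub>V\<^esub> u) = eval (f \<oplus>\<^bsub>poly_ring K\<^esub> g) t"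
    if t: "t \<in> carrier K" for t
    using ring_hom_add[OF eval_is_hom[OF carrier_is_subring t] f(1) g(1)] f(2)[OF t] g(2)[OF t] v u t by simp
  then show ?case using UP.a_closed[OF f(1) g(1)] by blast
next
  case (mult p q)
  then obtain f g where f: "f \<in> carrier (poly_ring K)" "\<And>t. t \<in> carrier K \<Longrightarrow> p (v \<oplus>\<^bsub>V\<^esub> t \<odot>\<^bsub>V\<^esub> u) = eval f t"
    and g: "g \<in> carrier (poly_ring K)" "\<And>t. t \<in> carrier K \<Longrightarrow> q (v \<oplus>\<^bsub>V\<^esub> t \<odot>\<^bsub>V\<^esub> u) = eval g t"
    by blast
  interpret UP: domain "poly_ring K" by (rule univ_poly_is_domain[OF carrier_is_subring])
  have "(\<lambda>v\<in>carrier V. p v \<otimes>\<^bsub>K\<^esub> q v) (v \<oplus>\<^bsub>V\<^esub> t \<odot>\<^bsub>V\<^esub> u) = eval (f \<otimes>\<^bsub>poly_ring K\<^esub> g) t"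
    if t: "t \<in> carrier K" for t
    using ring_hom_mult[OF eval_is_hom[OF carrier_is_subring t] f(1) g(1)] f(2)[OF t] g(2)[OF t] v u t by simp
  then show ?case using UP.m_closed[OF f(1) g(1)] by blast
qed

text \<open>
  Two nonzero polynomial functions restrict to nonzero polynomials in one variable on the line
  through a point where the first and a point where the second does not vanish.
\<close>

lemma polynomial_functions_common_nonzero:
  assumes inf: "infinite (carrier K)"
    and p: "p \<in> polynomial_functions K V" "v \<in> carrier V" "p v \<noteq> \<zero>\<^bsub>K\<^esub>"
    and q: "q \<in> polynomial_functions K V" "w \<in> carrier V" "q w \<noteq> \<zero>\<^bsub>K\<^esub>"
  obtains x where "x \<in> carrier V" "p x \<noteq> \<zero>\<^bsub>K\<^esub>" "q x \<noteq> \<zero>\<^bsub>K\<^esub>"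
proof -
  interpret UP: domain "poly_ring K" by (rule univ_poly_is_domain[OF carrier_is_subring])
  let ?u = "w \<ominus>\<^bsub>V\<^esub> v"
  have u: "?u \<in> carrier V" using p q by simp
  obtain f where f: "f \<in> carrier (poly_ring K)" "\<And>t. t \<in> carrier K \<Longrightarrow> p (v \<oplus>\<^bsub>V\<^esub> t \<odot>\<^bsub>V\<^esub> ?u) = eval f t"
    using polynomial_function_on_line[OF p(2) u p(1)] by blast
  obtain g where g: "g \<in> carrier (poly_ring K)" "\<And>t. t \<in> carrier K \<Longrightarrow> q (v \<oplus>\<^bsub>V\<^esub> t \<odot>\<^bsub>V\<^esub> ?u) = eval g t"
    using polynomial_function_on_line[OF p(2) u q(1)] by blast
  have "v \<oplus>\<^bsub>V\<^esub> \<zero>\<^bsub>K\<^esub> \<odot>\<^bsub>V\<^esub> ?u = v" using p u by simp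
  then have "f \<noteq> []" using f(2)[of "\<zero>\<^bsub>K\<^esub>"] p by auto
  have "v \<oplus>\<^bsub>V\<^esub> \<one>\<^bsub>K\<^esub> \<odot>\<^bsub>V\<^esub> ?u = w"
    using p(2) q(2) u V.M.a_lcomm[of v w "\<ominus>\<^bsub>V\<^esub> v"] by (simp add: a_minus_def V.M.r_neg)
  then have "g \<noteq> []" using g(2)[of "\<one>\<^bsub>K\<^esub>"] q by auto
  have "finite ({x. is_root f x} \<union> {x. is_root g x})"
    using finite_number_of_roots[OF f(1)] finite_number_of_roots[OF g(1)] by blast
  then obtain t where t: "t \<in> carrier K" "\<not> is_root f t" "\<not> is_root g t"
    using inf by (metis (mono_tags, lifting) UnCI finite_subset mem_Collect_eq subsetI)
  then have "eval f t \<noteq> \<zero>\<^bsub>K\<^esub>" "eval g t \<noteq> \<zero>\<^bsub>K\<^esub>"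
    using \<open>f \<noteq> []\<close> \<open>g \<noteq> []\<close> by (auto simp: is_root_def)
  then show ?thesis
    using that[of "v \<oplus>\<^bsub>V\<^esub> t \<odot>\<^bsub>V\<^esub> ?u"] f(2)[OF t(1)] g(2)[OF t(1)] p(2) u t(1) by simp
qed

lemma zariski_open_dense:
  assumes inf: "infinite (carrier K)" and U: "openin (zariski K V) U" "U \<noteq> {}"
  shows "zariski K V closure_of U = topspace (zariski K V)"
  unfolding dense_intersects_open
proof (intro allI impI)
  have wit: "\<exists>p\<in>polynomial_functions K V. \<exists>v\<in>carrier V. p v \<noteq> \<zero>\<^bsub>K\<^esub> \<and> (\<forall>w\<in>carrier V. p w \<noteq> \<zero>\<^bsub>K\<^esub> \<longrightarrow> w \<in> W)"
    if open_W: "openin (zariski K V) W" and ne: "W \<noteq> {}" for W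
  proof -
    have "\<exists>T\<subseteq>polynomial_functions K V. W = carrier V - {v \<in> carrier V. \<forall>p\<in>T. p v = \<zero>\<^bsub>K\<^esub>}"
      using open_W unfolding openin_zariski[OF field_K] zariski_open_def .
    then obtain T where T: "T \<subseteq> polynomial_functions K V"
      and W: "W = carrier V - {v \<in> carrier V. \<forall>p\<in>T. p v = \<zero>\<^bsub>K\<^esub>}"
      by (elim exE conjE)
    obtain v where "v \<in> W" using ne by blast
    then obtain p where p: "p \<in> T" "v \<in> carrier V" "p v \<noteq> \<zero>\<^bsub>K\<^esub>" unfolding W by auto
    show ?thesis
      by (rule bexI[of _ p], rule bexI[of _ v]) (use p T in \<open>auto simp: W\<close>)
  qed
  fix W assume W: "openin (zariski K V) W \<and> W \<noteq> {}"
  obtain q w where q: "q \<in> polynomial_functions K V" "w \<in> carrier V" "q w \<noteq> \<zero>\<^bsub>K\<^esub>"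
    "\<And>x. \<lbrakk>x \<in> carrier V; q x \<noteq> \<zero>\<^bsub>K\<^esub>\<rbrakk> \<Longrightarrow> x \<in> W" using wit[OF conjunct1[OF W] conjunct2[OF W]] by blast
  obtain p v where p: "p \<in> polynomial_functions K V" "v \<in> carrier V" "p v \<noteq> \<zero>\<^bsub>K\<^esub>"
    "\<And>x. \<lbrakk>x \<in> carrier V; p x \<noteq> \<zero>\<^bsub>K\<^esub>\<rbrakk> \<Longrightarrow> x \<in> U" using wit[OF U] by blast
  obtain x where "x \<in> carrier V" "p x \<noteq> \<zero>\<^bsub>K\<^esub>" "q x \<noteq> \<zero>\<^bsub>K\<^esub>"
    using polynomial_functions_common_nonzero[OF inf p(1-3) q(1-3)] by blast
  then show "U \<inter> W \<noteq> {}" using p(4) q(4) by blast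
qed

end

section \<open>Homomorphism spaces\<close>

lemma Hom_zero_map:
  assumes "right_module R X" "right_module R Y"
  shows "(\<lambda>x\<in>carrier X. \<zero>\<^bsub>Y\<^esub>) \<in> Hom R X Y"
proof -
  interpret X: right_module R X by fact
  interpret Y: right_module R Y by fact
  show ?thesis by (rule HomI) auto
qed

lemma Hom_add:
  assumes "right_module R X" "right_module R Y" and f: "f \<in> Hom R X Y" and g: "g \<in> Hom R X Y"
  shows "(\<lambda>x\<in>carrier X. f x \<oplus>\<^bsub>Y\<^esub> g x) \<in> Hom R X Y"
proof -
  interpret X: right_module R X by fact
  interpret Y: right_module R Y by fact
  show ?thesis
    by (rule HomI) (use HomD[OF f] HomD[OF g] in \<open>auto simp: Y.M.a_ac Y.smult_r_distr\<close>)
qed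

lemma Hom_minus_map:
  assumes "right_module R X" "right_module R Y" and f: "f \<in> Hom R X Y"
  shows "(\<lambda>x\<in>carrier X. \<ominus>\<^bsub>Y\<^esub> f x) \<in> Hom R X Y"
proof -
  interpret X: right_module R X by fact
  interpret Y: right_module R Y by fact
  have "\<ominus>\<^bsub>Y\<^esub> (a \<odot>\<^bsub>Y\<^esub> y) = a \<odot>\<^bsub>Y\<^esub> (\<ominus>\<^bsub>Y\<^esub> y)" if "a \<in> carrier R" "y \<in> carrier Y" for a y
  proof -
    have "a \<odot>\<^bsub>Y\<^esub> (\<ominus>\<^bsub>Y\<^esub> y) \<oplus>\<^bsub>Y\<^esub> a \<odot>\<^bsub>Y\<^esub> y = \<zero>\<^bsub>Y\<^esub>"
      using Y.smult_r_distr[of a "\<ominus>\<^bsub>Y\<^esub> y" y] that by (simp add: Y.M.l_neg)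
    then show ?thesis
      using Y.M.minus_equality[of "a \<odot>\<^bsub>Y\<^esub> (\<ominus>\<^bsub>Y\<^esub> y)" "a \<odot>\<^bsub>Y\<^esub> y"] that by simp
  qed
  then show ?thesis
    by (intro HomI) (use HomD[OF f] in \<open>auto simp: Y.M.minus_add\<close>)
qed

lemma Hom_diff:
  assumes X: "right_module R X" and Y: "right_module R Y" and f: "f \<in> Hom R X Y" and g: "g \<in> Hom R X Y"
  shows "(\<lambda>x\<in>carrier X. f x \<ominus>\<^bsub>Y\<^esub> g x) \<in> Hom R X Y"
  using Hom_add[OF X Y f Hom_minus_map[OF X Y g]] by (simp add: a_minus_def cong: restrict_cong)

lemma Hom_inverse:
  assumes X: "right_module R X" and Y: "right_module R Y" and f: "f \<in> Hom R X Y"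
    and inj: "inj_on f (carrier X)" and surj: "f ` carrier X = carrier Y"
  obtains g where "g \<in> Hom R Y X" "\<And>x. x \<in> carrier X \<Longrightarrow> g (f x) = x" "\<And>y. y \<in> carrier Y \<Longrightarrow> f (g y) = y"
proof -
  interpret X: right_module R X by (rule X)
  have "kern X Y f \<subseteq> kern X X (\<lambda>x\<in>carrier X. x)"
    using inj inj_on_iff_kern[OF X Y f] by (simp add: kern_def)
  then obtain g where g: "g \<in> Hom R Y X" "\<And>x. x \<in> carrier X \<Longrightarrow> g (f x) = (\<lambda>x\<in>carrier X. x) x"
    using Hom_factor[OF X Y X f surj Hom_id[OF X]] by metis
  have gf: "g (f x) = x" if "x \<in> carrier X" for x using g(2)[OF that] that by simp
  have "f (g y) = y" if y: "y \<in> carrier Y" for y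
  proof -
    obtain x where "x \<in> carrier X" "y = f x" using y surj by blast
    then show ?thesis using gf by simp
  qed
  then show ?thesis using that[OF g(1) gf] by blast
qed

lemma hom_space_simps [simp]:
  "carrier (hom_space R X Y act) = Hom R X Y"
  "\<zero>\<^bsub>hom_space R X Y act\<^esub> = (\<lambda>x\<in>carrier X. \<zero>\<^bsub>Y\<^esub>)"
  "f \<oplus>\<^bsub>hom_space R X Y act\<^esub> g = (\<lambda>x\<in>carrier X. f x \<oplus>\<^bsub>Y\<^esub> g x)"
  "a \<odot>\<^bsub>hom_space R X Y act\<^esub> f = act a f"
  by (simp_all add: hom_space_def)

lemma abelian_group_hom_space:
  assumes X: "right_module R X" and Y: "right_module R Y"
  shows "abelian_group (hom_space R X Y act)"
proof -
  interpret X: right_module R X by fact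
  interpret Y: right_module R Y by fact
  show ?thesis
  proof (rule abelian_groupI)
    fix f g h
    assume f: "f \<in> carrier (hom_space R X Y act)" and g: "g \<in> carrier (hom_space R X Y act)"
    then have f': "f \<in> Hom R X Y" and g': "g \<in> Hom R X Y" by simp_all
    show "f \<oplus>\<^bsub>hom_space R X Y act\<^esub> g \<in> carrier (hom_space R X Y act)"
      using Hom_add[OF X Y f' g'] by simp
    show "f \<oplus>\<^bsub>hom_space R X Y act\<^esub> g = g \<oplus>\<^bsub>hom_space R X Y act\<^esub> f"
      using HomD(1)[OF f'] HomD(1)[OF g'] by (auto simp: Y.M.a_comm intro!: restrict_ext)
    assume h: "h \<in> carrier (hom_space R X Y act)"
    then have h': "h \<in> Hom R X Y" by simp
    show "f \<oplus>\<^bsub>hom_space R X Y act\<^esub> g \<oplus>\<^bsub>hom_space R X Y act\<^esub> h =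
        f \<oplus>\<^bsub>hom_space R X Y act\<^esub> (g \<oplus>\<^bsub>hom_space R X Y act\<^esub> h)"
      using HomD(1)[OF f'] HomD(1)[OF g'] HomD(1)[OF h'] by (auto simp: Y.M.a_assoc intro!: restrict_ext)
  next
    show "\<zero>\<^bsub>hom_space R X Y act\<^esub> \<in> carrier (hom_space R X Y act)"
      using Hom_zero_map[OF X Y] by simp
  next
    fix f assume "f \<in> carrier (hom_space R X Y act)"
    then have f: "f \<in> Hom R X Y" by simp
    note fc = HomD(1)[OF f]
    show "\<zero>\<^bsub>hom_space R X Y act\<^esub> \<oplus>\<^bsub>hom_space R X Y act\<^esub> f = f"
      using fc HomD(2)[OF f] by (auto simp: fun_eq_iff)
    have "(\<lambda>x\<in>carrier X. \<ominus>\<^bsub>Y\<^esub> f x) \<oplus>\<^bsub>hom_space R X Y act\<^esub> f = \<zero>\<^bsub>hom_space R X Y act\<^esub>"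
      using fc by (auto simp: Y.M.l_neg intro!: restrict_ext)
    then show "\<exists>g\<in>carrier (hom_space R X Y act). g \<oplus>\<^bsub>hom_space R X Y act\<^esub> f = \<zero>\<^bsub>hom_space R X Y act\<^esub>"
      using Hom_minus_map[OF X Y f] by (intro bexI[of _ "\<lambda>x\<in>carrier X. \<ominus>\<^bsub>Y\<^esub> f x"]) simp_all
  qed
qed

lemma hom_space_finsum_apply:
  assumes X: "right_module R X" and Y: "right_module R Y" and J: "finite J"
    and v: "\<And>j. j \<in> J \<Longrightarrow> v j \<in> Hom R X Y" and x: "x \<in> carrier X"
  shows "(\<Oplus>\<^bsub>hom_space R X Y act\<^esub>j\<in>J. v j) x = (\<Oplus>\<^bsub>Y\<^esub>j\<in>J. v j x)"
proof -
  interpret H: abelian_group "hom_space R X Y act" by (rule abelian_group_hom_space[OF X Y])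
  interpret Y: right_module R Y by (rule Y)
  show ?thesis
    using J v
  proof (induction J rule: finite_induct)
    case empty
    then show ?case using x by simp
  next
    case (insert j J)
    have "v \<in> J \<rightarrow> carrier (hom_space R X Y act)" "v j \<in> carrier (hom_space R X Y act)"
      using insert.prems by auto
    moreover have "(\<lambda>j. v j x) \<in> J \<rightarrow> carrier Y" "v j x \<in> carrier Y"
      using insert.prems HomD(1)[OF insert.prems x] by auto
    ultimately show ?case
      using insert x by (simp add: H.finsum_insert Y.M.finsum_insert)
  qed
qed

lemma End_ring_simps [simp]:
  "carrier (End_ring R X) = Hom R X X"
  "f \<otimes>\<^bsub>End_ring R X\<^esub> g = compose (carrier X) f g"
  "\<one>\<^bsub>End_ring R X\<^esub> = (\<lambda>x\<in>carrier X. x)"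
  "\<zero>\<^bsub>End_ring R X\<^esub> = (\<lambda>x\<in>carrier X. \<zero>\<^bsub>X\<^esub>)"
  "f \<oplus>\<^bsub>End_ring R X\<^esub> g = (\<lambda>x\<in>carrier X. f x \<oplus>\<^bsub>X\<^esub> g x)"
  by (simp_all add: End_ring_def)

lemma ring_End_ring:
  assumes X: "right_module R X"
  shows "ring (End_ring R X)"
proof -
  interpret X: right_module R X by fact
  interpret H: abelian_group "hom_space R X X undefined" by (rule abelian_group_hom_space[OF X X])
  have "abelian_group (End_ring R X)"
  proof (rule abelian_groupI)
    fix f assume "f \<in> carrier (End_ring R X)"
    then have "f \<in> carrier (hom_space R X X undefined)" by simp
    then show "\<exists>g\<in>carrier (End_ring R X). g \<oplus>\<^bsub>End_ring R X\<^esub> f = \<zero>\<^bsub>End_ring R X\<^esub>"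
      using H.l_neg[of f] H.a_inv_closed[of f]
      by (intro bexI[of _ "\<ominus>\<^bsub>hom_space R X X undefined\<^esub> f"]) simp_all
  qed (use H.a_closed H.zero_closed H.a_assoc H.a_comm H.l_zero in simp_all)
  moreover have "monoid (End_ring R X)"
  proof (rule monoidI)
    fix f g h assume "f \<in> carrier (End_ring R X)" "g \<in> carrier (End_ring R X)" "h \<in> carrier (End_ring R X)"
    then have f: "f \<in> Hom R X X" and g: "g \<in> Hom R X X" and h: "h \<in> Hom R X X" by simp_all
    show "f \<otimes>\<^bsub>End_ring R X\<^esub> g \<in> carrier (End_ring R X)"
      using Hom_compose[OF g f X] by simp
    show "f \<otimes>\<^bsub>End_ring R X\<^esub> g \<otimes>\<^bsub>End_ring R X\<^esub> h = f \<otimes>\<^bsub>End_ring R X\<^esub> (g \<otimes>\<^bsub>End_ring R X\<^esub> h)"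
      using HomD(1)[OF h] by (auto simp: compose_def fun_eq_iff)
  next
    fix f assume "f \<in> carrier (End_ring R X)"
    then have f: "f \<in> Hom R X X" by simp
    show "\<one>\<^bsub>End_ring R X\<^esub> \<otimes>\<^bsub>End_ring R X\<^esub> f = f" "f \<otimes>\<^bsub>End_ring R X\<^esub> \<one>\<^bsub>End_ring R X\<^esub> = f"
      using HomD(1)[OF f] HomD(2)[OF f] by (auto simp: compose_def fun_eq_iff)
  qed (use Hom_id[OF X] in simp)
  moreover have "(f \<oplus>\<^bsub>End_ring R X\<^esub> g) \<otimes>\<^bsub>End_ring R X\<^esub> h = f \<otimes>\<^bsub>End_ring R X\<^esub> h \<oplus>\<^bsub>End_ring R X\<^esub> g \<otimes>\<^bsub>End_ring R X\<^esub> h"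
    "h \<otimes>\<^bsub>End_ring R X\<^esub> (f \<oplus>\<^bsub>End_ring R X\<^esub> g) = h \<otimes>\<^bsub>End_ring R X\<^esub> f \<oplus>\<^bsub>End_ring R X\<^esub> h \<otimes>\<^bsub>End_ring R X\<^esub> g"
    if "f \<in> carrier (End_ring R X)" "g \<in> carrier (End_ring R X)" "h \<in> carrier (End_ring R X)" for f g h
  proof -
    have f: "f \<in> Hom R X X" and g: "g \<in> Hom R X X" and h: "h \<in> Hom R X X" using that by simp_all
    show "(f \<oplus>\<^bsub>End_ring R X\<^esub> g) \<otimes>\<^bsub>End_ring R X\<^esub> h = f \<otimes>\<^bsub>End_ring R X\<^esub> h \<oplus>\<^bsub>End_ring R X\<^esub> g \<otimes>\<^bsub>End_ring R X\<^esub> h"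
      using HomD(1)[OF h] by (auto simp: compose_def fun_eq_iff)
    show "h \<otimes>\<^bsub>End_ring R X\<^esub> (f \<oplus>\<^bsub>End_ring R X\<^esub> g) = h \<otimes>\<^bsub>End_ring R X\<^esub> f \<oplus>\<^bsub>End_ring R X\<^esub> h \<otimes>\<^bsub>End_ring R X\<^esub> g"
      using HomD(1)[OF f] HomD(1)[OF g] HomD(3)[OF h] by (auto simp: compose_def fun_eq_iff)
  qed
  ultimately show ?thesis by (intro ringI) (auto dest: abelian_group.axioms)
qed

lemma right_module_hom_precomp:
  assumes X: "right_module R X" and Y: "right_module R Y"
  shows "right_module (End_ring R X) (hom_precomp R X Y)"
proof (intro right_module.intro right_module_axioms.intro ring_End_ring[OF X])
  show "abelian_group (hom_precomp R X Y)"
    unfolding hom_precomp_def by (rule abelian_group_hom_space[OF X Y])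
next
  fix e f assume "e \<in> carrier (End_ring R X)" "f \<in> carrier (hom_precomp R X Y)"
  then show "e \<odot>\<^bsub>hom_precomp R X Y\<^esub> f \<in> carrier (hom_precomp R X Y)"
    using Hom_compose[OF _ _ X, of e X f Y] by (simp add: hom_precomp_def)
next
  fix e e' f assume "e \<in> carrier (End_ring R X)" "e' \<in> carrier (End_ring R X)" "f \<in> carrier (hom_precomp R X Y)"
  then have e: "e \<in> Hom R X X" and e': "e' \<in> Hom R X X" and f: "f \<in> Hom R X Y"
    by (simp_all add: hom_precomp_def)
  show "(e \<oplus>\<^bsub>End_ring R X\<^esub> e') \<odot>\<^bsub>hom_precomp R X Y\<^esub> f =
      e \<odot>\<^bsub>hom_precomp R X Y\<^esub> f \<oplus>\<^bsub>hom_precomp R X Y\<^esub> e' \<odot>\<^bsub>hom_precomp R X Y\<^esub> f"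
    using HomD(3)[OF f HomD(1)[OF e] HomD(1)[OF e']] by (auto simp: hom_precomp_def compose_def fun_eq_iff)
  show "(e \<otimes>\<^bsub>End_ring R X\<^esub> e') \<odot>\<^bsub>hom_precomp R X Y\<^esub> f =
      e' \<odot>\<^bsub>hom_precomp R X Y\<^esub> (e \<odot>\<^bsub>hom_precomp R X Y\<^esub> f)"
    using HomD(1)[OF e'] by (auto simp: hom_precomp_def compose_def fun_eq_iff)
next
  fix e f g assume "e \<in> carrier (End_ring R X)" "f \<in> carrier (hom_precomp R X Y)" "g \<in> carrier (hom_precomp R X Y)"
  then have e: "e \<in> Hom R X X" by simp
  show "e \<odot>\<^bsub>hom_precomp R X Y\<^esub> (f \<oplus>\<^bsub>hom_precomp R X Y\<^esub> g) =
      e \<odot>\<^bsub>hom_precomp R X Y\<^esub> f \<oplus>\<^bsub>hom_precomp R X Y\<^esub> e \<odot>\<^bsub>hom_precomp R X Y\<^esub> g"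
    using HomD(1)[OF e] by (auto simp: hom_precomp_def compose_def fun_eq_iff)
next
  fix f assume "f \<in> carrier (hom_precomp R X Y)"
  then have f: "f \<in> Hom R X Y" by (simp add: hom_precomp_def)
  show "\<one>\<^bsub>End_ring R X\<^esub> \<odot>\<^bsub>hom_precomp R X Y\<^esub> f = f"
    using HomD(2)[OF f] by (auto simp: hom_precomp_def compose_def fun_eq_iff)
qed

section \<open>Algebras over a field\<close>

lemma scalars_simps [simp]:
  "carrier (scalars A X) = carrier X" "\<zero>\<^bsub>scalars A X\<^esub> = \<zero>\<^bsub>X\<^esub>"
  "x \<oplus>\<^bsub>scalars A X\<^esub> y = x \<oplus>\<^bsub>X\<^esub> y" "k \<odot>\<^bsub>scalars A X\<^esub> x = (k \<odot>\<^bsub>A\<^esub> \<one>\<^bsub>A\<^esub>) \<odot>\<^bsub>X\<^esub> x"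
  by (simp_all add: scalars_def)

text \<open>
  A scalar \<open>k\<close> acts on every right module as the central element \<open>k \<cdot> 1\<close> of the algebra, and so
  commutes with homomorphisms; this makes the homomorphisms a vector space.
\<close>

definition hom_scalars ::
  "('k, 'a) module \<Rightarrow> ('a, 'x) module \<Rightarrow> ('a, 'y) module \<Rightarrow> ('k, 'x \<Rightarrow> 'y) module" where
  "hom_scalars A X Y = hom_space A X Y (\<lambda>k f. \<lambda>x\<in>carrier X. (k \<odot>\<^bsub>A\<^esub> \<one>\<^bsub>A\<^esub>) \<odot>\<^bsub>Y\<^esub> f x)"

lemma hom_scalars_simps [simp]:
  "carrier (hom_scalars A X Y) = Hom A X Y"
  "\<zero>\<^bsub>hom_scalars A X Y\<^esub> = (\<lambda>x\<in>carrier X. \<zero>\<^bsub>Y\<^esub>)"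
  "f \<oplus>\<^bsub>hom_scalars A X Y\<^esub> g = (\<lambda>x\<in>carrier X. f x \<oplus>\<^bsub>Y\<^esub> g x)"
  "k \<odot>\<^bsub>hom_scalars A X Y\<^esub> f = (\<lambda>x\<in>carrier X. (k \<odot>\<^bsub>A\<^esub> \<one>\<^bsub>A\<^esub>) \<odot>\<^bsub>Y\<^esub> f x)"
  by (simp_all add: hom_scalars_def restrict_def)

lemma hom_scalars_finsum_apply:
  assumes "right_module A X" "right_module A Y" "finite J"
    and "\<And>j. j \<in> J \<Longrightarrow> v j \<in> Hom A X Y" and "x \<in> carrier X"
  shows "(\<Oplus>\<^bsub>hom_scalars A X Y\<^esub>j\<in>J. v j) x = (\<Oplus>\<^bsub>Y\<^esub>j\<in>J. v j x)"
  unfolding hom_scalars_def using assms by (rule hom_space_finsum_apply)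

context
  fixes K :: "'k ring" and A :: "('k, 'a) module"
  assumes A: "fd_algebra K A"
begin

interpretation K: field K by (rule fd_algebra.axioms(1)[OF A])
interpretation KA: Module.module K A by (rule fd_algebra.axioms(2)[OF A])
interpretation L: ring A by (rule fd_algebra.axioms(3)[OF A])

lemma fd_field: "field K" by (rule K.field_axioms)
lemma fd_ring: "ring A" by (rule L.ring_axioms)

lemma
  shows unit_scalar_closed: "k \<in> carrier K \<Longrightarrow> k \<odot>\<^bsub>A\<^esub> \<one>\<^bsub>A\<^esub> \<in> carrier A"
    and unit_scalar_add: "\<lbrakk>k \<in> carrier K; l \<in> carrier K\<rbrakk> \<Longrightarrow>
      (k \<oplus>\<^bsub>K\<^esub> l) \<odot>\<^bsub>A\<^esub> \<one>\<^bsub>A\<^esub> = k \<odot>\<^bsub>A\<^esub> \<one>\<^bsub>A\<^esub> \<oplus>\<^bsub>A\<^esub> l \<odot>\<^bsub>A\<^esub> \<one>\<^bsub>A\<^esub>"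
    and unit_scalar_one: "\<one>\<^bsub>K\<^esub> \<odot>\<^bsub>A\<^esub> \<one>\<^bsub>A\<^esub> = \<one>\<^bsub>A\<^esub>"
    and unit_scalar_right: "\<lbrakk>k \<in> carrier K; a \<in> carrier A\<rbrakk> \<Longrightarrow> a \<otimes>\<^bsub>A\<^esub> (k \<odot>\<^bsub>A\<^esub> \<one>\<^bsub>A\<^esub>) = k \<odot>\<^bsub>A\<^esub> a"
    and unit_scalar_left: "\<lbrakk>k \<in> carrier K; a \<in> carrier A\<rbrakk> \<Longrightarrow> (k \<odot>\<^bsub>A\<^esub> \<one>\<^bsub>A\<^esub>) \<otimes>\<^bsub>A\<^esub> a = k \<odot>\<^bsub>A\<^esub> a"
  using fd_algebra.smult_mult_left[OF A] fd_algebra.smult_mult_right[OF A]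
  by (simp_all add: KA.smult_l_distr KA.smult_assoc1)

lemma unit_scalar_mult: "\<lbrakk>k \<in> carrier K; l \<in> carrier K\<rbrakk> \<Longrightarrow>
      (k \<otimes>\<^bsub>K\<^esub> l) \<odot>\<^bsub>A\<^esub> \<one>\<^bsub>A\<^esub> = (k \<odot>\<^bsub>A\<^esub> \<one>\<^bsub>A\<^esub>) \<otimes>\<^bsub>A\<^esub> (l \<odot>\<^bsub>A\<^esub> \<one>\<^bsub>A\<^esub>)"
  by (simp only: unit_scalar_left unit_scalar_closed KA.smult_assoc1 L.one_closed)

lemma unit_scalar_zero: "\<zero>\<^bsub>K\<^esub> \<odot>\<^bsub>A\<^esub> \<one>\<^bsub>A\<^esub> = \<zero>\<^bsub>A\<^esub>"
  by (simp add: KA.smult_l_null)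

lemma central_smult:
  assumes X: "right_module A X" and "k \<in> carrier K" "a \<in> carrier A" "x \<in> carrier X"
  shows "(k \<odot>\<^bsub>A\<^esub> \<one>\<^bsub>A\<^esub>) \<odot>\<^bsub>X\<^esub> (a \<odot>\<^bsub>X\<^esub> x) = a \<odot>\<^bsub>X\<^esub> ((k \<odot>\<^bsub>A\<^esub> \<one>\<^bsub>A\<^esub>) \<odot>\<^bsub>X\<^esub> x)"
proof -
  interpret X: right_module A X by (rule X)
  show ?thesis
    using assms(2-) X.smult_assoc[of a "k \<odot>\<^bsub>A\<^esub> \<one>\<^bsub>A\<^esub>" x] X.smult_assoc[of "k \<odot>\<^bsub>A\<^esub> \<one>\<^bsub>A\<^esub>" a x]
    by (simp add: unit_scalar_closed unit_scalar_left unit_scalar_right)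
qed

lemma right_module_scalars:
  assumes X: "right_module A X"
  shows "right_module K (scalars A X)"
proof -
  interpret X: right_module A X by (rule X)
  have "abelian_group (scalars A X)"
  proof (rule abelian_groupI)
    fix x assume "x \<in> carrier (scalars A X)"
    then show "\<exists>y\<in>carrier (scalars A X). y \<oplus>\<^bsub>scalars A X\<^esub> x = \<zero>\<^bsub>scalars A X\<^esub>"
      by (intro bexI[of _ "\<ominus>\<^bsub>X\<^esub> x"]) (simp_all add: X.M.l_neg)
  qed (simp_all add: X.M.a_ac)
  then show ?thesis
    by (intro right_module.intro right_module_axioms.intro K.ring_axioms)
       (simp_all add: unit_scalar_closed unit_scalar_add unit_scalar_mult unit_scalar_one
          X.smult_l_distr X.smult_r_distr X.smult_assoc)
qed

lemma submodule_scalars: "right_module A X \<Longrightarrow> submodule U A X \<Longrightarrow> submodule U K (scalars A X)"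
  by (simp add: submodule_iff right_module_scalars unit_scalar_closed)

lemma Hom_scalars:
  assumes f: "f \<in> Hom A X Y"
  shows "f \<in> Hom K (scalars A X) (scalars A Y)"
  by (rule HomI) (use HomD[OF f] unit_scalar_closed in simp_all)

lemma fd_module_iff:
  "fd_module K A X \<longleftrightarrow> right_module A X \<and> finite_length K (scalars A X)"
  unfolding fd_module_def
  using finite_dim_finite_length[OF division_ring_field[OF fd_field] right_module_scalars]
    finite_length_finite_dim[OF division_ring_field[OF fd_field] right_module_scalars] by blast

lemma fd_module_finite_length: "fd_module K A X \<Longrightarrow> finite_length A X"
  unfolding fd_module_iff
  by (rule finite_length_transfer[of K "scalars A X" A X "\<lambda>U. U"]) (auto simp: submodule_scalars)

lemma fd_module_regular: "fd_module K A (regular A)"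
proof -
  have ag: "abelian_group A" by (rule L.is_abelian_group)
  have KAr: "right_module K A"
    by (intro right_module.intro right_module_axioms.intro K.ring_axioms ag)
       (simp_all add: KA.smult_l_distr KA.smult_r_distr KA.smult_assoc1[symmetric] K.m_comm)
  have fl: "finite_length K A"
    by (rule finite_dim_finite_length[OF division_ring_field[OF fd_field] KAr fd_algebra.fin_dim[OF A]])
  have rm: "right_module A (regular A)" by (rule right_module_regular[OF fd_ring])
  have "submodule U K A" if "submodule U K (scalars A (regular A))" for U
    using that unfolding submodule_iff[OF right_module_scalars[OF rm]] submodule_iff[OF KAr]
    by (auto simp: unit_scalar_right subset_iff)
  then have "finite_length K (scalars A (regular A))"
    by (intro finite_length_transfer[OF fl, of K _ "\<lambda>U. U"]) auto
  then show ?thesis using rm by (simp add: fd_module_iff)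
qed

lemma fd_module_surj:
  assumes "fd_module K A X" "right_module A Y" "f \<in> Hom A X Y" "f ` carrier X = carrier Y"
  shows "fd_module K A Y"
  using finite_length_surj[of K "scalars A X" "scalars A Y" f] assms
  by (simp add: fd_module_iff right_module_scalars Hom_scalars)

lemma fd_module_inj:
  assumes "fd_module K A Y" "right_module A X" "f \<in> Hom A X Y" "inj_on f (carrier X)"
  shows "fd_module K A X"
  using finite_length_inj[of K "scalars A X" "scalars A Y" f] assms
  by (simp add: fd_module_iff right_module_scalars Hom_scalars)

lemma fd_module_sub:
  assumes "fd_module K A X" "submodule U A X"
  shows "fd_module K A (sub_module X U)"
proof -
  have X: "right_module A X" using assms(1) by (simp add: fd_module_iff)
  have "(\<lambda>x\<in>carrier (sub_module X U). x) \<in> Hom A (sub_module X U) X"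
    using Hom_from_into_sub[OF Hom_id[OF right_module_sub[OF X assms(2)]] submodule_subset[OF X assms(2)]] .
  then show ?thesis
    by (rule fd_module_inj[OF assms(1) right_module_sub[OF X assms(2)]]) (auto simp: inj_on_def)
qed

lemma fd_module_dir_sum:
  assumes "finite I" "\<And>i. i \<in> I \<Longrightarrow> fd_module K A (M i)"
  shows "fd_module K A (dir_sum I M)"
proof -
  have "scalars A (dir_sum I M) = dir_sum I (\<lambda>i. scalars A (M i))"
    by (simp add: scalars_def dir_sum_def fun_eq_iff)
  moreover have "finite_length K (dir_sum I (\<lambda>i. scalars A (M i)))"
    by (rule finite_length_dir_sum[OF K.ring_axioms assms(1)])
       (use assms(2) in \<open>auto simp: fd_module_iff right_module_scalars\<close>)
  ultimately show ?thesis
    using right_module_dir_sum[OF fd_ring, of I M] assms(2) by (simp add: fd_module_iff)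
qed

lemma Hom_unit_scalar:
  assumes X: "right_module A X" and Y: "right_module A Y" and f: "f \<in> Hom A X Y" and k: "k \<in> carrier K"
  shows "(\<lambda>x\<in>carrier X. (k \<odot>\<^bsub>A\<^esub> \<one>\<^bsub>A\<^esub>) \<odot>\<^bsub>Y\<^esub> f x) \<in> Hom A X Y"
proof -
  interpret X: right_module A X by (rule X)
  interpret Y: right_module A Y by (rule Y)
  show ?thesis
    by (rule HomI)
       (use HomD[OF f] unit_scalar_closed[OF k] k in \<open>auto simp: Y.smult_r_distr central_smult[OF Y]\<close>)
qed

lemma right_module_hom_scalars:
  assumes X: "right_module A X" and Y: "right_module A Y"
  shows "right_module K (hom_scalars A X Y)"
proof -
  interpret Y: right_module A Y by (rule Y)
  show ?thesis
  proof (intro right_module.intro right_module_axioms.intro K.ring_axioms)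
    show "abelian_group (hom_scalars A X Y)"
      unfolding hom_scalars_def by (rule abelian_group_hom_space[OF X Y])
  next
    fix k f assume "k \<in> carrier K" "f \<in> carrier (hom_scalars A X Y)"
    then show "k \<odot>\<^bsub>hom_scalars A X Y\<^esub> f \<in> carrier (hom_scalars A X Y)"
      using Hom_unit_scalar[OF X Y] by simp
  next
    fix k l f assume "k \<in> carrier K" "l \<in> carrier K" "f \<in> carrier (hom_scalars A X Y)"
    then show "(k \<oplus>\<^bsub>K\<^esub> l) \<odot>\<^bsub>hom_scalars A X Y\<^esub> f =
        k \<odot>\<^bsub>hom_scalars A X Y\<^esub> f \<oplus>\<^bsub>hom_scalars A X Y\<^esub> l \<odot>\<^bsub>hom_scalars A X Y\<^esub> f"
      and "(k \<otimes>\<^bsub>K\<^esub> l) \<odot>\<^bsub>hom_scalars A X Y\<^esub> f = l \<odot>\<^bsub>hom_scalars A X Y\<^esub> (k \<odot>\<^bsub>hom_scalars A X Y\<^esub> f)"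
      using HomD(1)[of f A X Y]
      by (auto simp: unit_scalar_closed unit_scalar_add unit_scalar_mult Y.smult_l_distr Y.smult_assoc
          intro!: restrict_ext)
  next
    fix k f g assume "k \<in> carrier K" "f \<in> carrier (hom_scalars A X Y)" "g \<in> carrier (hom_scalars A X Y)"
    then show "k \<odot>\<^bsub>hom_scalars A X Y\<^esub> (f \<oplus>\<^bsub>hom_scalars A X Y\<^esub> g) =
        k \<odot>\<^bsub>hom_scalars A X Y\<^esub> f \<oplus>\<^bsub>hom_scalars A X Y\<^esub> k \<odot>\<^bsub>hom_scalars A X Y\<^esub> g"
      using HomD(1)[of f A X Y] HomD(1)[of g A X Y]
      by (auto simp: unit_scalar_closed Y.smult_r_distr intro!: restrict_ext)
  next
    fix f assume "f \<in> carrier (hom_scalars A X Y)"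
    then show "\<one>\<^bsub>K\<^esub> \<odot>\<^bsub>hom_scalars A X Y\<^esub> f = f"
      using HomD(1)[of f A X Y] HomD(2)[of f A X Y] by (auto simp: unit_scalar_one fun_eq_iff)
  qed
qed

lemma eval_Hom:
  assumes X: "right_module A X" and Y: "right_module A Y" and x: "x \<in> carrier X"
  shows "(\<lambda>f\<in>Hom A X Y. f x) \<in> Hom K (hom_scalars A X Y) (scalars A Y)"
proof (rule HomI)
  fix f g assume "f \<in> carrier (hom_scalars A X Y)" "g \<in> carrier (hom_scalars A X Y)"
  then show "(\<lambda>f\<in>Hom A X Y. f x) (f \<oplus>\<^bsub>hom_scalars A X Y\<^esub> g) =
      (\<lambda>f\<in>Hom A X Y. f x) f \<oplus>\<^bsub>scalars A Y\<^esub> (\<lambda>f\<in>Hom A X Y. f x) g"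
    using x Hom_add[OF X Y, of f g] by simp
next
  fix k f assume "k \<in> carrier K" "f \<in> carrier (hom_scalars A X Y)"
  then show "(\<lambda>f\<in>Hom A X Y. f x) (k \<odot>\<^bsub>hom_scalars A X Y\<^esub> f) =
      k \<odot>\<^bsub>scalars A Y\<^esub> (\<lambda>f\<in>Hom A X Y. f x) f"
    using x Hom_unit_scalar[OF X Y, of f k] by simp
qed (use x HomD(1)[of _ A X Y] in simp_all)

text \<open>A homomorphism is determined by its values on a finite \<open>K\<close>-basis of the source.\<close>

lemma finite_length_hom_scalars:
  assumes X: "fd_module K A X" and Y: "fd_module K A Y"
  shows "finite_length K (hom_scalars A X Y)"
proof -
  have Xr: "right_module A X" and Yr: "right_module A Y" using X Y by (auto simp: fd_module_iff)
  obtain B where B: "finite_basis K (scalars A X) B"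
    using X by (auto simp: fd_module_def finite_dim_def)
  note fB = finite_basisD(1,2)[OF B]
  have BX: "b \<in> carrier X" if "b \<in> B" for b using that fB(2) by auto
  let ?D = "dir_sum B (\<lambda>_. scalars A Y)"
  note Ys = right_module_scalars[OF Yr]
  note D = right_module_dir_sum[OF K.ring_axioms, of B "\<lambda>_. scalars A Y", OF Ys]
  note H = right_module_hom_scalars[OF Xr Yr]
  let ?e = "\<lambda>f\<in>Hom A X Y. restrict f B"
  have "?e \<in> Hom K (hom_scalars A X Y) ?D"
  proof (rule HomI)
    fix f assume "f \<in> carrier (hom_scalars A X Y)"
    then show "?e f \<in> carrier ?D"
      using fB BX HomD(1)[of f A X Y] by (auto simp: dir_sum_simps(1))
  next
    fix f g assume "f \<in> carrier (hom_scalars A X Y)" "g \<in> carrier (hom_scalars A X Y)"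
    then show "?e (f \<oplus>\<^bsub>hom_scalars A X Y\<^esub> g) = ?e f \<oplus>\<^bsub>?D\<^esub> ?e g"
      using Hom_add[OF Xr Yr, of f g] BX by (auto simp: dir_sum_simps(3) intro!: restrict_ext)
  next
    fix k f assume "k \<in> carrier K" "f \<in> carrier (hom_scalars A X Y)"
    then show "?e (k \<odot>\<^bsub>hom_scalars A X Y\<^esub> f) = k \<odot>\<^bsub>?D\<^esub> ?e f"
      using Hom_unit_scalar[OF Xr Yr, of f k] BX by (auto simp: dir_sum_simps(4) intro!: restrict_ext)
  qed simp
  moreover have "inj_on ?e (carrier (hom_scalars A X Y))"
  proof (rule inj_onI)
    fix f g assume "f \<in> carrier (hom_scalars A X Y)" "g \<in> carrier (hom_scalars A X Y)" "?e f = ?e g"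
    then have f: "f \<in> Hom A X Y" and g: "g \<in> Hom A X Y" and eq: "restrict f B = restrict g B" by simp_all
    note fK = Hom_scalars[OF f] and gK = Hom_scalars[OF g]
    interpret Xs: right_module K "scalars A X" by (rule right_module_scalars[OF Xr])
    interpret Ys: right_module K "scalars A Y" by (rule Ys)
    have bc: "b \<in> carrier (scalars A X)" if "b \<in> B" for b using BX[OF that] by simp
    show "f = g"
    proof (rule Hom_eqI[OF f g])
      fix x assume "x \<in> carrier X"
      then have "x \<in> carrier (scalars A X)" by simp
      then obtain c where c: "c \<in> B \<rightarrow>\<^sub>E carrier K"
        "x = (\<Oplus>\<^bsub>scalars A X\<^esub>b\<in>B. c b \<odot>\<^bsub>scalars A X\<^esub> b)"
        using ex1_implies_ex[OF finite_basisD(3)[OF B]] by blast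
      have cb: "c b \<odot>\<^bsub>scalars A X\<^esub> b \<in> carrier (scalars A X)" if "b \<in> B" for b
        by (rule Xs.smult_closed) (use c(1) bc[OF that] that in \<open>auto simp: PiE_iff\<close>)
      have "f x = (\<Oplus>\<^bsub>scalars A Y\<^esub>b\<in>B. f (c b \<odot>\<^bsub>scalars A X\<^esub> b))"
        unfolding c(2) by (rule Hom_finsum[OF Xs.right_module_axioms Ys fK fB(1) cb])
      also have "\<dots> = (\<Oplus>\<^bsub>scalars A Y\<^esub>b\<in>B. g (c b \<odot>\<^bsub>scalars A X\<^esub> b))"
      proof (rule Ys.M.finsum_cong')
        fix b assume b: "b \<in> B"
        have "c b \<in> carrier K" using c(1) b by (auto simp: PiE_iff)
        moreover have "f b = g b" using fun_cong[OF eq, of b] b by simp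
        ultimately show "f (c b \<odot>\<^bsub>scalars A X\<^esub> b) = g (c b \<odot>\<^bsub>scalars A X\<^esub> b)"
          using HomD(4)[OF fK _ bc[OF b]] HomD(4)[OF gK _ bc[OF b]] by metis
      qed (use HomD(1)[OF gK cb] in auto)
      also have "\<dots> = g x"
        unfolding c(2) by (rule Hom_finsum[OF Xs.right_module_axioms Ys gK fB(1) cb, symmetric])
      finally show "f x = g x" .
    qed
  qed
  moreover have "finite_length K ?D"
    by (rule finite_length_dir_sum[OF K.ring_axioms fB(1)]) (use Y Ys in \<open>auto simp: fd_module_iff\<close>)
  ultimately show ?thesis
    by (rule finite_length_inj[OF H D])
qed

text \<open>
  The scalars act through $\mathrm{End}(X)$, so that $\mathrm{End}(X)$-submodules are subspaces.
\<close>

lemma finite_length_hom_precomp: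
  assumes X: "fd_module K A X" and Y: "fd_module K A Y"
  shows "finite_length (End_ring A X) (hom_precomp A X Y)"
proof (rule finite_length_transfer[OF finite_length_hom_scalars[OF X Y], where T = "\<lambda>U. U"])
  have Xr: "right_module A X" and Yr: "right_module A Y" using X Y by (auto simp: fd_module_iff)
  interpret X: right_module A X by (rule Xr)
  fix U assume "submodule U (End_ring A X) (hom_precomp A X Y)"
  then have U: "U \<subseteq> Hom A X Y" "(\<lambda>x\<in>carrier X. \<zero>\<^bsub>Y\<^esub>) \<in> U"
    "\<And>f g. \<lbrakk>f \<in> U; g \<in> U\<rbrakk> \<Longrightarrow> (\<lambda>x\<in>carrier X. f x \<oplus>\<^bsub>Y\<^esub> g x) \<in> U"
    "\<And>e f. \<lbrakk>e \<in> Hom A X X; f \<in> U\<rbrakk> \<Longrightarrow> compose (carrier X) f e \<in> U"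
    unfolding submodule_iff[OF right_module_hom_precomp[OF Xr Yr]] by (simp_all add: hom_precomp_def)
  have "(\<lambda>x\<in>carrier X. (k \<odot>\<^bsub>A\<^esub> \<one>\<^bsub>A\<^esub>) \<odot>\<^bsub>Y\<^esub> f x) \<in> U" if k: "k \<in> carrier K" and f: "f \<in> U" for k f
  proof -
    let ?e = "\<lambda>x\<in>carrier X. (k \<odot>\<^bsub>A\<^esub> \<one>\<^bsub>A\<^esub>) \<odot>\<^bsub>X\<^esub> (\<lambda>x\<in>carrier X. x) x"
    have "?e \<in> Hom A X X" by (rule Hom_unit_scalar[OF Xr Xr Hom_id[OF Xr] k])
    moreover have "compose (carrier X) f ?e = (\<lambda>x\<in>carrier X. (k \<odot>\<^bsub>A\<^esub> \<one>\<^bsub>A\<^esub>) \<odot>\<^bsub>Y\<^esub> f x)"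
      using HomD(4)[of f A X Y] f U(1) unit_scalar_closed[OF k] by (auto simp: compose_def fun_eq_iff)
    ultimately show ?thesis using U(4) f by metis
  qed
  then show "submodule U K (hom_scalars A X Y)"
    using U(1-3) by (simp add: submodule_iff[OF right_module_hom_scalars[OF Xr Yr]])
qed

end

section \<open>Radicals\<close>

text \<open>
  The quotient by the preimage embeds into the simple quotient by \<open>N\<close>, so it is zero or simple.
\<close>

lemma maximal_submodule_vimage:
  assumes X: "right_module R X" and Y: "right_module R Y" and f: "f \<in> Hom R X Y"
    and N: "maximal_submodule R Y N"
  shows "{x \<in> carrier X. f x \<in> N} = carrier X \<or> maximal_submodule R X {x \<in> carrier X. f x \<in> N}"
proof -
  interpret X: right_module R X by (rule X)
  interpret Y: right_module R Y by (rule Y)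
  have sN: "submodule N R Y" using N by (simp add: maximal_submodule_def)
  let ?V = "{x \<in> carrier X. f x \<in> N}"
  have "W = ?V \<or> W = carrier X" if W: "submodule W R X" "?V \<subseteq> W" for W
  proof -
    note fW = submodule_image[OF X Y f W(1)]
    note s = submodule_sum[OF Y sN fW]
    note Wc = submodule_subset[OF X W(1)]
    have "N <+>\<^bsub>Y\<^esub> f ` W = N \<or> N <+>\<^bsub>Y\<^esub> f ` W = carrier Y"
      using N s(1,2) unfolding maximal_submodule_def by blast
    then show ?thesis
    proof
      assume "N <+>\<^bsub>Y\<^esub> f ` W = N"
      then have "W \<subseteq> ?V" using s(3) Wc by blast
      then show ?thesis using W(2) by blast
    next
      assume a: "N <+>\<^bsub>Y\<^esub> f ` W = carrier Y"
      have "x \<in> W" if x: "x \<in> carrier X" for x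
      proof -
        have "f x \<in> N <+>\<^bsub>Y\<^esub> f ` W" using HomD(1)[OF f x] a by simp
        then obtain m w where m: "m \<in> N" "w \<in> W" "f x = m \<oplus>\<^bsub>Y\<^esub> f w"
          unfolding set_add_def' by blast
        have c: "w \<in> carrier X" "m \<in> carrier Y" using m Wc submodule_subset[OF Y sN] by auto
        have "f (x \<ominus>\<^bsub>X\<^esub> w) = m"
          using Hom_minus[OF X Y f x c(1)] m(3) c HomD(1)[OF f c(1)]
          by (simp add: a_minus_def Y.M.a_assoc Y.M.r_neg)
        then have "x \<ominus>\<^bsub>X\<^esub> w \<in> W" using W(2) m(1) x c by auto
        then have "(x \<ominus>\<^bsub>X\<^esub> w) \<oplus>\<^bsub>X\<^esub> w \<in> W" using submodule_add[OF X W(1)] m by blast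
        then show "x \<in> W" using x c by (simp add: a_minus_def X.M.a_assoc X.M.l_neg)
      qed
      then show ?thesis using Wc by blast
    qed
  qed
  then show ?thesis
    using submodule_vimage[OF X Y f sN] unfolding maximal_submodule_def by blast
qed

lemma Hom_radical:
  assumes X: "right_module R X" and Y: "right_module R Y" and f: "f \<in> Hom R X Y"
    and x: "x \<in> radical R X"
  shows "f x \<in> radical R Y"
proof -
  have xX: "x \<in> carrier X" and xN: "\<And>N. maximal_submodule R X N \<Longrightarrow> x \<in> N"
    using x by (auto simp: radical_def)
  have "f x \<in> N" if "maximal_submodule R Y N" for N
    using maximal_submodule_vimage[OF X Y f that] xX xN by blast
  then show ?thesis using HomD(1)[OF f xX] by (auto simp: radical_def)
qed

lemma submodule_radical:
  assumes X: "right_module R X"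
  shows "submodule (radical R X) R X"
proof -
  interpret X: right_module R X by (rule X)
  have "submodule N R X" if "maximal_submodule R X N" for N
    using that by (simp add: maximal_submodule_def)
  then show ?thesis
    unfolding submodule_iff[OF X] radical_def
    using submodule_zero[OF X] submodule_add[OF X] submodule_smult[OF X] by auto
qed

text \<open>
  The two inclusions are the functoriality of the radical under the projections and under the
  injections of the direct sum.
\<close>

lemma radical_dir_sum:
  assumes R: "ring R" and I: "finite I" and M: "\<And>i. i \<in> I \<Longrightarrow> right_module R (M i)"
  shows "radical R (dir_sum I M) = (\<Pi>\<^sub>E i\<in>I. radical R (M i))"
proof (intro equalityI subsetI)
  fix x assume x: "x \<in> radical R (dir_sum I M)"
  then have c: "x \<in> carrier (dir_sum I M)" by (simp add: radical_def)
  have "x i \<in> radical R (M i)" if i: "i \<in> I" for i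
    using Hom_radical[OF ds_rm[OF R I M] M[OF i] ds_proj_Hom[OF R I M i] x] c by (simp add: ds_proj_def)
  then show "x \<in> (\<Pi>\<^sub>E i\<in>I. radical R (M i))"
    using c I by (auto simp: dir_sum_simps PiE_iff)
next
  fix x assume x: "x \<in> (\<Pi>\<^sub>E i\<in>I. radical R (M i))"
  then have c: "x \<in> carrier (dir_sum I M)" using I by (auto simp: dir_sum_simps PiE_iff radical_def)
  have D: "right_module R (dir_sum I M)" by (rule right_module_dir_sum[OF R M])
  have "(\<Oplus>\<^bsub>dir_sum I M\<^esub>i\<in>I. ds_inj I M i (x i)) \<in> radical R (dir_sum I M)"
  proof (rule submodule_finsum[OF D submodule_radical[OF D] I])
    fix i assume i: "i \<in> I"
    have "x i \<in> radical R (M i)" using x i by (auto simp: PiE_iff)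
    then show "ds_inj I M i (x i) \<in> radical R (dir_sum I M)"
      by (rule Hom_radical[OF M[OF i] D, rotated]) (rule ds_inj_Hom[OF R I M i], assumption)
  qed
  then show "x \<in> radical R (dir_sum I M)"
    using ds_sum_inj[OF R I M c] by simp
qed

lemma simple_kern_maximal:
  assumes X: "right_module R X" and S: "simple_module R S" and f: "f \<in> Hom R X S" "f ` carrier X = carrier S"
    and W: "submodule W R X" "kern X S f \<subseteq> W"
  shows "W = kern X S f \<or> W = carrier X"
proof -
  have Sr: "right_module R S" using S by (simp add: simple_module_def)
  interpret X: right_module R X by (rule X)
  note Wc = submodule_subset[OF X W(1)]
  have "f ` W = {\<zero>\<^bsub>S\<^esub>} \<or> f ` W = carrier S"
    using S submodule_image[OF X Sr f(1) W(1)] unfolding simple_module_def by blast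
  then show ?thesis
  proof
    assume "f ` W = {\<zero>\<^bsub>S\<^esub>}"
    then have "W \<subseteq> kern X S f" using Wc by (auto simp: kern_def)
    then show ?thesis using W(2) by blast
  next
    assume a: "f ` W = carrier S"
    have "x \<in> W" if x: "x \<in> carrier X" for x
    proof -
      have "f x \<in> f ` W" using HomD(1)[OF f(1) x] a by simp
      then obtain w where w: "w \<in> W" "f x = f w" by blast
      have wc: "w \<in> carrier X" using w Wc by blast
      have "x \<ominus>\<^bsub>X\<^esub> w \<in> W" using Hom_eq_iff_kern[OF X Sr f(1) x wc] w W(2) by blast
      then have "(x \<ominus>\<^bsub>X\<^esub> w) \<oplus>\<^bsub>X\<^esub> w \<in> W" using submodule_add[OF X W(1)] w by blast
      then show "x \<in> W" using x wc by (simp add: a_minus_def X.M.a_assoc X.M.l_neg)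
    qed
    then show ?thesis using Wc by blast
  qed
qed

lemma Hom_simple_zero_or_surj:
  assumes X: "right_module R X" and S: "simple_module R S" and f: "f \<in> Hom R X S"
  shows "(\<forall>x\<in>carrier X. f x = \<zero>\<^bsub>S\<^esub>) \<or> f ` carrier X = carrier S"
proof -
  have Sr: "right_module R S" using S by (simp add: simple_module_def)
  have "f ` carrier X = {\<zero>\<^bsub>S\<^esub>} \<or> f ` carrier X = carrier S"
    using S submodule_image[OF X Sr f submodule_carrier[OF X]] unfolding simple_module_def by blast
  then show ?thesis by blast
qed

section \<open>Rigid modules\<close>

lemma rigid_extend_syzygy:
  assumes M: "right_module R M" and rig: "rigid R M" and \<tau>: "\<tau> \<in> Hom R (syzygy R M) M"
  obtains h where "h \<in> Hom R (free_module R (carrier M)) M" "restrict h (carrier (syzygy R M)) = \<tau>"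
proof -
  interpret M: right_module R M by (rule M)
  let ?F = "free_module R (carrier M)" and ?H = "hom_postcomp R (syzygy R M) M"
  let ?N = "(\<lambda>h. restrict h (carrier (syzygy R M))) ` Hom R ?F M"
  have "carrier (Ext1 R M M) = {\<zero>\<^bsub>Ext1 R M M\<^esub>}" using rig by (simp add: rigid_def)
  moreover have "?N +>\<^bsub>?H\<^esub> \<tau> \<in> carrier (Ext1 R M M)"
    using \<tau> by (auto simp: Ext1_def quot_module_def A_RCOSETS_def' hom_postcomp_def)
  ultimately have "?N +>\<^bsub>?H\<^esub> \<tau> = ?N" by (simp add: Ext1_def quot_module_def)
  moreover have "\<tau> \<in> ?N +>\<^bsub>?H\<^esub> \<tau>"
  proof -
    let ?z = "\<lambda>x\<in>carrier ?F. \<zero>\<^bsub>M\<^esub>"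
    have F: "right_module R ?F" by (rule right_module_free[OF M.R.ring_axioms])
    have "restrict ?z (carrier (syzygy R M)) \<in> ?N" using Hom_zero_map[OF F M] by blast
    moreover have "restrict ?z (carrier (syzygy R M)) \<oplus>\<^bsub>?H\<^esub> \<tau> = \<tau>"
      using HomD(1)[OF \<tau>] HomD(2)[OF \<tau>]
      by (auto simp: hom_postcomp_def fun_eq_iff syzygy_def)
    ultimately show ?thesis unfolding a_r_coset_def' by fastforce
  qed
  ultimately have "\<tau> \<in> ?N" by simp
  then show ?thesis by (elim imageE) (rule that, simp_all)
qed

text \<open>
  Vanishing of $\mathrm{Ext}^1(M,M)$ can be read off any projective presentation: comparing it with
  the free one, by \<open>s\<close> and \<open>r\<close> below, the map to be extended becomes a map on the syzygy, and the
  deviation of \<open>r \<circ> s\<close> from the identity already lands in the kernel.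
\<close>

lemma rigid_extend:
  assumes P: "projective R P" and M: "right_module R M" and rig: "rigid R M"
    and \<pi>: "\<pi> \<in> Hom R P M" "\<pi> ` carrier P = carrier M"
    and \<theta>: "\<theta> \<in> Hom R (sub_module P (kern P M \<pi>)) M"
  obtains h where "h \<in> Hom R P M" "\<And>z. z \<in> kern P M \<pi> \<Longrightarrow> h z = \<theta> z"
proof -
  have Pr: "right_module R P" using P by (simp add: projective_def)
  interpret P: right_module R P by (rule Pr)
  interpret M: right_module R M by (rule M)
  let ?F = "free_module R (carrier M)" and ?Z = "sub_module P (kern P M \<pi>)"
  define \<epsilon> where "\<epsilon> = free_map R (carrier M) M (\<lambda>x. x)"
  have F: "right_module R ?F" by (rule right_module_free[OF P.R.ring_axioms])
  have \<epsilon>: "\<epsilon> \<in> Hom R ?F M" "\<epsilon> ` carrier ?F = carrier M"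
    unfolding \<epsilon>_def by (rule free_map_Hom[OF M], simp) (rule free_map_onto[OF M], auto)
  have syz: "syzygy R M = sub_module ?F (kern ?F M \<epsilon>)"
    by (simp add: syzygy_def kern_def \<epsilon>_def)
  note kP = submodule_kern[OF Pr M \<pi>(1)] and kF = submodule_kern[OF F M \<epsilon>(1)]
  note Z = right_module_sub[OF Pr kP] and Om = right_module_sub[OF F kF]
  obtain s where s: "s \<in> Hom R P ?F" "compose (carrier P) \<epsilon> s = \<pi>"
    using projective_lift[OF P F M \<epsilon> \<pi>(1)] by blast
  have \<epsilon>s: "\<epsilon> (s x) = \<pi> x" if "x \<in> carrier P" for x
    using fun_cong[OF s(2), of x] that by (simp add: compose_def)
  define t where "t m = (SOME y. y \<in> carrier P \<and> \<pi> y = m)" for m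
  have t: "t m \<in> carrier P \<and> \<pi> (t m) = m" if "m \<in> carrier M" for m
  proof -
    have "m \<in> \<pi> ` carrier P" using that \<pi>(2) by simp
    then have "\<exists>y. y \<in> carrier P \<and> \<pi> y = m" by (elim imageE) (rule exI, simp)
    then show ?thesis unfolding t_def by (rule someI_ex)
  qed
  define r where "r = free_map R (carrier M) P t"
  have r: "r \<in> Hom R ?F P"
    unfolding r_def by (rule free_map_Hom[OF Pr]) (use t in auto)
  have \<pi>r: "\<pi> (r c) = \<epsilon> c" if c: "c \<in> carrier ?F" for c
  proof -
    define J where "J = {x \<in> carrier M. c x \<noteq> \<zero>\<^bsub>R\<^esub>}"
    have J: "finite J" "J \<subseteq> carrier M" and cR: "\<And>x. x \<in> J \<Longrightarrow> c x \<in> carrier R"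
      using c by (auto simp: J_def free_module_simps)
    have "r c = (\<Oplus>\<^bsub>P\<^esub>x\<in>J. c x \<odot>\<^bsub>P\<^esub> t x)" and e: "\<epsilon> c = (\<Oplus>\<^bsub>M\<^esub>x\<in>J. c x \<odot>\<^bsub>M\<^esub> x)"
      using c by (simp_all add: r_def \<epsilon>_def free_map_def J_def)
    then have "\<pi> (r c) = (\<Oplus>\<^bsub>M\<^esub>x\<in>J. \<pi> (c x \<odot>\<^bsub>P\<^esub> t x))"
      using Hom_finsum[OF Pr M \<pi>(1) J(1), of "\<lambda>x. c x \<odot>\<^bsub>P\<^esub> t x"] J cR t by auto
    also have "\<dots> = \<epsilon> c"
      unfolding e
    proof (rule M.M.finsum_cong')
      fix x assume "x \<in> J"
      then have "c x \<in> carrier R" "x \<in> carrier M" using J cR by auto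
      then show "\<pi> (c x \<odot>\<^bsub>P\<^esub> t x) = c x \<odot>\<^bsub>M\<^esub> x"
        using t[of x] HomD(4)[OF \<pi>(1)] by simp
    qed (use J cR in auto)
    finally show ?thesis .
  qed
  define r' where "r' = restrict r (kern ?F M \<epsilon>)"
  have r': "r' \<in> Hom R (syzygy R M) ?Z"
    unfolding syz r'_def
  proof (rule Hom_into_sub[OF Hom_restrict[OF Om r submodule_subset[OF F kF]]])
    fix c assume "c \<in> carrier (sub_module ?F (kern ?F M \<epsilon>))"
    then show "restrict r (kern ?F M \<epsilon>) c \<in> kern P M \<pi>"
      using \<pi>r[of c] HomD(1)[OF r, of c] by (simp add: kern_def)
  qed
  have "compose (carrier (syzygy R M)) \<theta> r' \<in> Hom R (syzygy R M) M"
    by (rule Hom_compose[OF r' \<theta>]) (simp add: syz Om)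
  then obtain h0 where h0: "h0 \<in> Hom R ?F M"
    "restrict h0 (carrier (syzygy R M)) = compose (carrier (syzygy R M)) \<theta> r'"
    using rigid_extend_syzygy[OF M rig] by blast
  have h0r: "h0 c = \<theta> (r c)" if "c \<in> kern ?F M \<epsilon>" for c
    using fun_cong[OF h0(2), of c] that by (simp add: syz compose_def r'_def)
  define \<kappa> where "\<kappa> = (\<lambda>x\<in>carrier P. (\<lambda>x\<in>carrier P. x) x \<ominus>\<^bsub>P\<^esub> compose (carrier P) r s x)"
  have "\<kappa> \<in> Hom R P P"
    unfolding \<kappa>_def by (rule Hom_diff[OF Pr Pr Hom_id[OF Pr] Hom_compose[OF s(1) r Pr]])
  have \<kappa>x: "\<kappa> x = x \<ominus>\<^bsub>P\<^esub> r (s x)" if "x \<in> carrier P" for x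
    using that by (simp add: \<kappa>_def compose_def)
  have \<kappa>: "\<kappa> \<in> Hom R P ?Z"
  proof (rule Hom_into_sub[OF \<open>\<kappa> \<in> Hom R P P\<close>])
    fix x assume x: "x \<in> carrier P"
    have "\<pi> (r (s x)) = \<pi> x" using \<pi>r[OF HomD(1)[OF s(1) x]] \<epsilon>s[OF x] by simp
    then show "\<kappa> x \<in> kern P M \<pi>"
      using Hom_eq_iff_kern[OF Pr M \<pi>(1) x HomD(1)[OF r HomD(1)[OF s(1) x]]] \<kappa>x[OF x] by simp
  qed
  define h where "h = (\<lambda>x\<in>carrier P. compose (carrier P) h0 s x \<oplus>\<^bsub>M\<^esub> compose (carrier P) \<theta> \<kappa> x)"
  have "h \<in> Hom R P M"
    unfolding h_def by (rule Hom_add[OF Pr M Hom_compose[OF s(1) h0(1) Pr] Hom_compose[OF \<kappa> \<theta> Pr]])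
  moreover have "h z = \<theta> z" if z: "z \<in> kern P M \<pi>" for z
  proof -
    have zP: "z \<in> carrier P" and \<pi>z: "\<pi> z = \<zero>\<^bsub>M\<^esub>" using z by (auto simp: kern_def)
    have sz: "s z \<in> carrier ?F" by (rule HomD(1)[OF s(1) zP])
    then have k: "s z \<in> kern ?F M \<epsilon>" using \<epsilon>s[OF zP] \<pi>z by (simp add: kern_def)
    have rc: "r (s z) \<in> carrier P" by (rule HomD(1)[OF r sz])
    have rk: "r (s z) \<in> kern P M \<pi>" using rc \<pi>r[OF sz] k by (simp add: kern_def)
    have kk: "\<kappa> z \<in> kern P M \<pi>" using HomD(1)[OF \<kappa> zP] by simp
    have "h z = \<theta> (r (s z)) \<oplus>\<^bsub>M\<^esub> \<theta> (\<kappa> z)"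
      using zP h0r[OF k] by (simp add: h_def compose_def)
    also have "\<dots> = \<theta> (r (s z) \<oplus>\<^bsub>P\<^esub> \<kappa> z)"
      using HomD(3)[OF \<theta>, of "r (s z)" "\<kappa> z"] rk kk by simp
    also have "r (s z) \<oplus>\<^bsub>P\<^esub> \<kappa> z = z"
      using zP rc P.M.a_lcomm[of "r (s z)" z "\<ominus>\<^bsub>P\<^esub> r (s z)"] by (simp add: \<kappa>x a_minus_def P.M.r_neg)
    finally show ?thesis .
  qed
  ultimately show ?thesis using that by blast
qed

section \<open>Indecomposable projective modules\<close>

lemma acyclic_weight:
  assumes "finite r" "acyclic r"
  obtains w :: "'i \<Rightarrow> nat" where "\<And>i j. (i, j) \<in> r \<Longrightarrow> w i < w j"
proof
  fix i j assume ij: "(i, j) \<in> r"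
  have fin: "finite {k. (k, j) \<in> r\<^sup>+}"
    by (rule finite_subset[of _ "fst ` (r\<^sup>+)"]) (use assms(1) in \<open>force simp: image_iff\<close>)+
  have "{k. (k, i) \<in> r\<^sup>+} \<subset> {k. (k, j) \<in> r\<^sup>+}"
  proof
    show "{k. (k, i) \<in> r\<^sup>+} \<subseteq> {k. (k, j) \<in> r\<^sup>+}" using ij by auto
    have "i \<in> {k. (k, j) \<in> r\<^sup>+}" "i \<notin> {k. (k, i) \<in> r\<^sup>+}"
      using ij assms(2) by (auto simp: acyclic_def)
    then show "{k. (k, i) \<in> r\<^sup>+} \<noteq> {k. (k, j) \<in> r\<^sup>+}" by blast
  qed
  then show "card {k. (k, i) \<in> r\<^sup>+} < card {k. (k, j) \<in> r\<^sup>+}"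
    by (rule psubset_card_mono[OF fin])
qed

text \<open>
  The data that define the representation space, for an arbitrary matrix \<open>d\<close> of multiplicities of the
  indecomposable projective modules in their radicals.
\<close>

locale rep_setup =
  fixes K :: "'k ring" and \<Lambda> :: "('k, 'a) module" and n :: nat
    and S :: "nat \<Rightarrow> ('a, 's) module" and P :: "nat \<Rightarrow> ('a, 'p) module"
    and d :: "nat \<Rightarrow> nat \<Rightarrow> nat" and \<phi> :: "nat \<Rightarrow> (nat \<times> nat \<Rightarrow> 'p) \<Rightarrow> 'p" and \<alpha> :: "nat \<Rightarrow> nat"
  assumes alg: "fd_algebra K \<Lambda>"
    and S_simple: "\<And>i. i < n \<Longrightarrow> simple_module \<Lambda> (S i)"
    and S_distinct: "\<And>i j. \<lbrakk>i < n; j < n; i \<noteq> j\<rbrakk> \<Longrightarrow> \<not> isomorphic \<Lambda> (S i) (S j)"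
    and S_all: "\<And>X :: ('a, 'a set) module. simple_module \<Lambda> X \<Longrightarrow> \<exists>i<n. isomorphic \<Lambda> X (S i)"
    and P_cover: "\<And>i. i < n \<Longrightarrow> \<exists>p. projective_cover \<Lambda> (P i) (S i) p"
    and \<phi>_iso: "\<And>j. j < n \<Longrightarrow> \<phi> j \<in> Iso \<Lambda> (Proj n P (d j)) (sub_module (P j) (radical \<Lambda> (P j)))"
begin

lemma ring_\<Lambda>: "ring \<Lambda>" by (rule fd_ring[OF alg])

lemma S_rm: "i < n \<Longrightarrow> right_module \<Lambda> (S i)"
  using S_simple by (simp add: simple_module_def)

lemma S_nonzero: "i < n \<Longrightarrow> carrier (S i) \<noteq> {\<zero>\<^bsub>S i\<^esub>}"
  using S_simple by (simp add: simple_module_def)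

lemma S_nontrivial:
  assumes "i < n"
  shows "\<not> carrier (S i) \<subseteq> {\<zero>\<^bsub>S i\<^esub>}"
  using S_nonzero[OF assms] submodule_zero[OF S_rm[OF assms] submodule_carrier[OF S_rm[OF assms]]] by auto

definition pc :: "nat \<Rightarrow> 'p \<Rightarrow> 's" where
  "pc i = (SOME p. projective_cover \<Lambda> (P i) (S i) p)"

lemma pc: "i < n \<Longrightarrow> projective_cover \<Lambda> (P i) (S i) (pc i)"
  unfolding pc_def by (rule someI_ex[OF P_cover])

lemma P_projective: "i < n \<Longrightarrow> projective \<Lambda> (P i)"
  using pc by (simp add: projective_cover_def)

lemma P_rm: "i < n \<Longrightarrow> right_module \<Lambda> (P i)"
  using P_projective by (simp add: projective_def)

lemma pc_Hom: "i < n \<Longrightarrow> pc i \<in> Hom \<Lambda> (P i) (S i)"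
  and pc_surj: "i < n \<Longrightarrow> pc i ` carrier (P i) = carrier (S i)"
  using pc by (auto simp: projective_cover_def)

lemma pc_superfluous:
  "\<lbrakk>i < n; submodule N \<Lambda> (P i); N <+>\<^bsub>P i\<^esub> kern (P i) (S i) (pc i) = carrier (P i)\<rbrakk> \<Longrightarrow> N = carrier (P i)"
  using pc[of i] by (simp add: projective_cover_def kern_def)

lemma pc_submodule:
  assumes i: "i < n" and N: "submodule N \<Lambda> (P i)" and s: "pc i ` N = carrier (S i)"
  shows "N = carrier (P i)"
proof (rule pc_superfluous[OF i N])
  interpret Pi: right_module \<Lambda> "P i" by (rule P_rm[OF i])
  note k = submodule_kern[OF P_rm[OF i] S_rm[OF i] pc_Hom[OF i]]
  note sm = submodule_sum[OF P_rm[OF i] N k]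
  have "kern (P i) (S i) (pc i) \<subseteq> N <+>\<^bsub>P i\<^esub> kern (P i) (S i) (pc i)" by (rule sm(3))
  then have "N <+>\<^bsub>P i\<^esub> kern (P i) (S i) (pc i) = kern (P i) (S i) (pc i) \<or>
      N <+>\<^bsub>P i\<^esub> kern (P i) (S i) (pc i) = carrier (P i)"
    by (rule simple_kern_maximal[OF P_rm[OF i] S_simple[OF i] pc_Hom[OF i] pc_surj[OF i] sm(1)])
  moreover have "N <+>\<^bsub>P i\<^esub> kern (P i) (S i) (pc i) \<noteq> kern (P i) (S i) (pc i)"
  proof
    assume "N <+>\<^bsub>P i\<^esub> kern (P i) (S i) (pc i) = kern (P i) (S i) (pc i)"
    then have "N \<subseteq> kern (P i) (S i) (pc i)" using sm(2) by simp
    then have "pc i ` N \<subseteq> {\<zero>\<^bsub>S i\<^esub>}" by (auto simp: kern_def)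
    then show False using s S_nontrivial[OF i] by simp
  qed
  ultimately show "N <+>\<^bsub>P i\<^esub> kern (P i) (S i) (pc i) = carrier (P i)" by simp
qed

text \<open>\<open>P i\<close> is generated by any element outside the kernel of \<open>pc i\<close>.\<close>

lemma P_fd:
  assumes i: "i < n"
  shows "fd_module K \<Lambda> (P i)"
proof -
  interpret Pi: right_module \<Lambda> "P i" by (rule P_rm[OF i])
  interpret Si: right_module \<Lambda> "S i" by (rule S_rm[OF i])
  obtain s where s: "s \<in> carrier (S i)" "s \<noteq> \<zero>\<^bsub>S i\<^esub>"
    using S_nonzero[OF i] Si.M.zero_closed by blast
  then have "s \<in> pc i ` carrier (P i)" using pc_surj[OF i] by simp
  then obtain x where x: "x \<in> carrier (P i)" "pc i x = s" by blast
  let ?g = "\<lambda>a\<in>carrier (regular \<Lambda>). a \<odot>\<^bsub>P i\<^esub> x"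
  have reg: "right_module \<Lambda> (regular \<Lambda>)" by (rule right_module_regular[OF ring_\<Lambda>])
  have g: "?g \<in> Hom \<Lambda> (regular \<Lambda>) (P i)"
    by (rule HomI) (use x in \<open>auto simp: Pi.smult_l_distr Pi.smult_assoc\<close>)
  note im = submodule_image[OF reg P_rm[OF i] g submodule_carrier[OF reg]]
  note im' = submodule_image[OF P_rm[OF i] S_rm[OF i] pc_Hom[OF i] im]
  have "?g \<one>\<^bsub>\<Lambda>\<^esub> = x" using x by simp
  then have "x \<in> ?g ` carrier (regular \<Lambda>)" by (metis Pi.R.one_closed imageI regular_simps(1))
  then have "s \<in> pc i ` (?g ` carrier (regular \<Lambda>))" using x(2) by blast
  then have "pc i ` (?g ` carrier (regular \<Lambda>)) = carrier (S i)"
    using S_simple[OF i] im' s(2) unfolding simple_module_def by blast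
  then have "?g ` carrier (regular \<Lambda>) = carrier (P i)"
    by (rule pc_submodule[OF i im])
  then show ?thesis
    by (rule fd_module_surj[OF alg fd_module_regular[OF alg] P_rm[OF i] g])
qed

lemma P_zero:
  assumes "i < n"
  shows "\<zero>\<^bsub>P i\<^esub> \<in> carrier (P i)" "\<zero>\<^bsub>P i\<^esub> \<oplus>\<^bsub>P i\<^esub> \<zero>\<^bsub>P i\<^esub> = \<zero>\<^bsub>P i\<^esub>"
    "a \<in> carrier \<Lambda> \<Longrightarrow> a \<odot>\<^bsub>P i\<^esub> \<zero>\<^bsub>P i\<^esub> = \<zero>\<^bsub>P i\<^esub>"
proof -
  interpret Pi: right_module \<Lambda> "P i" by (rule P_rm[OF assms])
  show "\<zero>\<^bsub>P i\<^esub> \<in> carrier (P i)" "\<zero>\<^bsub>P i\<^esub> \<oplus>\<^bsub>P i\<^esub> \<zero>\<^bsub>P i\<^esub> = \<zero>\<^bsub>P i\<^esub>"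
    "a \<in> carrier \<Lambda> \<Longrightarrow> a \<odot>\<^bsub>P i\<^esub> \<zero>\<^bsub>P i\<^esub> = \<zero>\<^bsub>P i\<^esub>" by simp_all
qed

lemma P_finite_length: "i < n \<Longrightarrow> finite_length \<Lambda> (P i)"
  by (rule fd_module_finite_length[OF alg P_fd])

lemma radical_P:
  assumes i: "i < n"
  shows "radical \<Lambda> (P i) = kern (P i) (S i) (pc i)"
proof (intro equalityI subsetI)
  note k = submodule_kern[OF P_rm[OF i] S_rm[OF i] pc_Hom[OF i]]
  have ne: "kern (P i) (S i) (pc i) \<noteq> carrier (P i)"
  proof
    assume "kern (P i) (S i) (pc i) = carrier (P i)"
    then have "pc i ` carrier (P i) \<subseteq> {\<zero>\<^bsub>S i\<^esub>}" by (auto simp: kern_def)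
    then show False using pc_surj[OF i] S_nontrivial[OF i] by simp
  qed
  fix x assume "x \<in> radical \<Lambda> (P i)"
  moreover have "maximal_submodule \<Lambda> (P i) (kern (P i) (S i) (pc i))"
    unfolding maximal_submodule_def
    using k ne simple_kern_maximal[OF P_rm[OF i] S_simple[OF i] pc_Hom[OF i] pc_surj[OF i]] by blast
  ultimately show "x \<in> kern (P i) (S i) (pc i)" by (auto simp: radical_def)
next
  note k = submodule_kern[OF P_rm[OF i] S_rm[OF i] pc_Hom[OF i]]
  fix x assume x: "x \<in> kern (P i) (S i) (pc i)"
  have "x \<in> N" if N: "maximal_submodule \<Lambda> (P i) N" for N
  proof -
    have sN: "submodule N \<Lambda> (P i)" using N by (simp add: maximal_submodule_def)
    note sm = submodule_sum[OF P_rm[OF i] sN k]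
    have "N <+>\<^bsub>P i\<^esub> kern (P i) (S i) (pc i) = N \<or> N <+>\<^bsub>P i\<^esub> kern (P i) (S i) (pc i) = carrier (P i)"
      using N sm(1,2) unfolding maximal_submodule_def by blast
    then show ?thesis
    proof
      assume "N <+>\<^bsub>P i\<^esub> kern (P i) (S i) (pc i) = N"
      then show ?thesis using sm(3) x by blast
    next
      assume "N <+>\<^bsub>P i\<^esub> kern (P i) (S i) (pc i) = carrier (P i)"
      then have "N = carrier (P i)" by (rule pc_superfluous[OF i sN])
      then show ?thesis using N by (simp add: maximal_submodule_def)
    qed
  qed
  then show "x \<in> radical \<Lambda> (P i)" using x by (auto simp: radical_def kern_def)
qed

lemma radical_P_proper: "i < n \<Longrightarrow> radical \<Lambda> (P i) \<noteq> carrier (P i)"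
proof
  assume i: "i < n" and "radical \<Lambda> (P i) = carrier (P i)"
  then have "pc i ` carrier (P i) \<subseteq> {\<zero>\<^bsub>S i\<^esub>}" by (auto simp: radical_P[OF i] kern_def)
  then show False using pc_surj[OF i] S_nontrivial[OF i] by simp
qed

text \<open>
  The radical is the kernel of the projective cover \<open>pc j\<close>, and a submodule that \<open>pc j\<close> maps onto the
  simple module \<open>S j\<close> is everything.
\<close>

lemma nonsurj_into_radical:
  assumes i: "i < n" and j: "j < n" and f: "f \<in> Hom \<Lambda> (P i) (P j)"
    and ns: "f ` carrier (P i) \<noteq> carrier (P j)" and x: "x \<in> carrier (P i)"
  shows "f x \<in> radical \<Lambda> (P j)"
proof -
  let ?g = "compose (carrier (P i)) (pc j) f"
  have g: "?g \<in> Hom \<Lambda> (P i) (S j)" by (rule Hom_compose[OF f pc_Hom[OF j] P_rm[OF i]])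
  have im: "?g ` carrier (P i) = pc j ` (f ` carrier (P i))"
    by (simp add: image_image compose_eq cong: image_cong)
  have "\<not> ?g ` carrier (P i) = carrier (S j)"
    using pc_submodule[OF j submodule_image[OF P_rm[OF i] P_rm[OF j] f submodule_carrier[OF P_rm[OF i]]]] ns
    unfolding im by blast
  then have "?g x = \<zero>\<^bsub>S j\<^esub>" using Hom_simple_zero_or_surj[OF P_rm[OF i] S_simple[OF j] g] x by blast
  then show ?thesis using x HomD(1)[OF f x] by (simp add: radical_P[OF j] kern_def compose_eq)
qed

text \<open>Otherwise \<open>S i\<close> and \<open>S j\<close> would be quotients of \<open>P i\<close> with the same kernel.\<close>

lemma distinct_into_radical:
  assumes i: "i < n" and j: "j < n" and "i \<noteq> j" and f: "f \<in> Hom \<Lambda> (P i) (P j)" and x: "x \<in> carrier (P i)"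
  shows "f x \<in> radical \<Lambda> (P j)"
proof (rule nonsurj_into_radical[OF i j f _ x])
  let ?g = "compose (carrier (P i)) (pc j) f"
  have g: "?g \<in> Hom \<Lambda> (P i) (S j)" by (rule Hom_compose[OF f pc_Hom[OF j] P_rm[OF i]])
  let ?W = "kern (P i) (S j) ?g" and ?k = "kern (P i) (S i) (pc i)"
  note W = submodule_kern[OF P_rm[OF i] S_rm[OF j] g]
  note k = submodule_kern[OF P_rm[OF i] S_rm[OF i] pc_Hom[OF i]]
  note sm = submodule_sum[OF P_rm[OF i] W k]
  show "f ` carrier (P i) \<noteq> carrier (P j)"
  proof
    assume "f ` carrier (P i) = carrier (P j)"
    then have gs: "?g ` carrier (P i) = carrier (S j)"
      using pc_surj[OF j] by (metis (no_types, lifting) compose_eq image_cong image_image)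
    have Wne: "?W \<noteq> carrier (P i)"
    proof
      assume "?W = carrier (P i)"
      then have "?g ` carrier (P i) \<subseteq> {\<zero>\<^bsub>S j\<^esub>}" unfolding kern_def by blast
      then show False using gs S_nontrivial[OF j] by simp
    qed
    have "?W <+>\<^bsub>P i\<^esub> ?k = ?k \<or> ?W <+>\<^bsub>P i\<^esub> ?k = carrier (P i)"
      by (rule simple_kern_maximal[OF P_rm[OF i] S_simple[OF i] pc_Hom[OF i] pc_surj[OF i] sm(1,3)])
    then have "?W <+>\<^bsub>P i\<^esub> ?k = ?k" using pc_superfluous[OF i W] Wne by blast
    then have "?W \<subseteq> ?k" using sm(2) by simp
    then have "?k = ?W \<or> ?k = carrier (P i)"
      by (rule simple_kern_maximal[OF P_rm[OF i] S_simple[OF j] g gs k])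
    then have "?k = ?W" using radical_P_proper[OF i] radical_P[OF i] by simp
    then have "isomorphic \<Lambda> (S i) (S j)"
      by (rule isomorphic_if_same_kern[OF P_rm[OF i] S_rm[OF i] S_rm[OF j] pc_Hom[OF i] pc_surj[OF i] g gs])
    then show False using S_distinct[OF i j \<open>i \<noteq> j\<close>] by blast
  qed
qed

section \<open>Acyclicity\<close>

lemma finite_copies [simp]: "finite (copies n \<beta>)"
  unfolding copies_def by auto

lemma copies_iff: "ik \<in> copies n \<beta> \<longleftrightarrow> fst ik < n \<and> snd ik < \<beta> (fst ik)"
  by (cases ik) (simp add: copies_def)

lemma copy_rm: "ik \<in> copies n \<beta> \<Longrightarrow> right_module \<Lambda> ((\<lambda>(i, k). P i) ik)"
  by (auto simp: copies_def P_rm)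

lemma Proj_rm: "right_module \<Lambda> (Proj n P \<beta>)"
  unfolding Proj_def by (rule right_module_dir_sum[OF ring_\<Lambda> copy_rm])

lemma Proj_fd: "fd_module K \<Lambda> (Proj n P \<beta>)"
  unfolding Proj_def by (rule fd_module_dir_sum[OF alg]) (auto simp: copies_def P_fd)

lemma Proj_projective: "projective \<Lambda> (Proj n P \<beta>)"
  unfolding Proj_def
  by (rule projective_dir_sum[OF ring_\<Lambda> finite_copies copy_rm]) (auto simp: copies_def P_projective)

lemma Proj_carrier: "x \<in> carrier (Proj n P \<beta>) \<longleftrightarrow> x \<in> (\<Pi>\<^sub>E ik\<in>copies n \<beta>. carrier (P (fst ik)))"
  by (simp add: Proj_def dir_sum_simps split_beta)

lemma Proj_ops:
  "\<zero>\<^bsub>Proj n P \<beta>\<^esub> = (\<lambda>ik\<in>copies n \<beta>. \<zero>\<^bsub>P (fst ik)\<^esub>)"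
  "x \<oplus>\<^bsub>Proj n P \<beta>\<^esub> y = (\<lambda>ik\<in>copies n \<beta>. x ik \<oplus>\<^bsub>P (fst ik)\<^esub> y ik)"
  "a \<odot>\<^bsub>Proj n P \<beta>\<^esub> x = (\<lambda>ik\<in>copies n \<beta>. a \<odot>\<^bsub>P (fst ik)\<^esub> x ik)"
  by (simp_all add: Proj_def dir_sum_simps split_beta)

lemma Proj_proj_Hom:
  "ik \<in> copies n \<beta> \<Longrightarrow> (\<lambda>x\<in>carrier (Proj n P \<beta>). x ik) \<in> Hom \<Lambda> (Proj n P \<beta>) (P (fst ik))"
  using ds_proj_Hom[where M = "\<lambda>(i, k). P i" and I = "copies n \<beta>" and i = ik, OF ring_\<Lambda> finite_copies copy_rm]
  by (simp add: ds_proj_def Proj_def split_beta)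

lemma \<phi>_Hom: "j < n \<Longrightarrow> \<phi> j \<in> Hom \<Lambda> (Proj n P (d j)) (sub_module (P j) (radical \<Lambda> (P j)))"
  and \<phi>_inj: "j < n \<Longrightarrow> inj_on (\<phi> j) (carrier (Proj n P (d j)))"
  and \<phi>_surj: "j < n \<Longrightarrow> \<phi> j ` carrier (Proj n P (d j)) = radical \<Lambda> (P j)"
  using \<phi>_iso by (auto simp: Iso_def bij_betw_def)

lemma rad_P_submodule: "j < n \<Longrightarrow> submodule (radical \<Lambda> (P j)) \<Lambda> (P j)"
  by (rule submodule_radical[OF P_rm])

lemma rad_P_rm: "j < n \<Longrightarrow> right_module \<Lambda> (sub_module (P j) (radical \<Lambda> (P j)))"
  by (rule right_module_sub[OF P_rm rad_P_submodule])

lemma \<phi>_Hom_P: "j < n \<Longrightarrow> \<phi> j \<in> Hom \<Lambda> (Proj n P (d j)) (P j)"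
  by (rule Hom_from_into_sub[OF \<phi>_Hom submodule_subset[OF P_rm rad_P_submodule]])

lemma \<phi>_inverse:
  assumes j: "j < n"
  obtains \<psi> where "\<psi> \<in> Hom \<Lambda> (sub_module (P j) (radical \<Lambda> (P j))) (Proj n P (d j))"
    "\<And>x. x \<in> radical \<Lambda> (P j) \<Longrightarrow> \<phi> j (\<psi> x) = x"
    "\<And>q. q \<in> carrier (Proj n P (d j)) \<Longrightarrow> \<psi> (\<phi> j q) = q"
proof -
  have surj: "\<phi> j ` carrier (Proj n P (d j)) = carrier (sub_module (P j) (radical \<Lambda> (P j)))"
    using \<phi>_surj[OF j] by simp
  obtain \<psi> where "\<psi> \<in> Hom \<Lambda> (sub_module (P j) (radical \<Lambda> (P j))) (Proj n P (d j))"
    "\<And>q. q \<in> carrier (Proj n P (d j)) \<Longrightarrow> \<psi> (\<phi> j q) = q"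
    "\<And>x. x \<in> carrier (sub_module (P j) (radical \<Lambda> (P j))) \<Longrightarrow> \<phi> j (\<psi> x) = x"
    by (rule Hom_inverse[OF Proj_rm rad_P_rm[OF j] \<phi>_Hom[OF j] \<phi>_inj[OF j] surj], rule that)
  then show ?thesis using that by simp
qed

definition summand_rel :: "(nat \<times> nat) set" where
  "summand_rel = {(i, j). i < n \<and> j < n \<and> 0 < d j i}"

lemma summand_rel_embedding:
  assumes "(i, j) \<in> summand_rel"
  obtains f where "f \<in> Hom \<Lambda> (P i) (P j)" "inj_on f (carrier (P i))" "f ` carrier (P i) \<noteq> carrier (P j)"
proof -
  have i: "i < n" and j: "j < n" and c: "(i, 0) \<in> copies n (d j)"
    using assms by (auto simp: summand_rel_def copies_def)
  let ?\<iota> = "ds_inj (copies n (d j)) (\<lambda>(i, k). P i) (i, 0)"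
  have \<iota>: "?\<iota> \<in> Hom \<Lambda> (P i) (Proj n P (d j))"
    using ds_inj_Hom[where M = "\<lambda>(i, k). P i" and I = "copies n (d j)", OF ring_\<Lambda> finite_copies copy_rm c]
    unfolding Proj_def by simp
  let ?f = "compose (carrier (P i)) (\<phi> j) ?\<iota>"
  have "?f \<in> Hom \<Lambda> (P i) (P j)" by (rule Hom_compose[OF \<iota> \<phi>_Hom_P[OF j] P_rm[OF i]])
  moreover have "inj_on ?f (carrier (P i))"
  proof (rule inj_onI)
    fix x y assume x: "x \<in> carrier (P i)" "y \<in> carrier (P i)" "?f x = ?f y"
    then have "?\<iota> x = ?\<iota> y"
      using inj_onD[OF \<phi>_inj[OF j] _ HomD(1)[OF \<iota> x(1)] HomD(1)[OF \<iota> x(2)]] by (simp add: compose_eq)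
    then have "?\<iota> x (i, 0) = ?\<iota> y (i, 0)" by simp
    then show "x = y" using x(1,2) c by (simp add: ds_inj_def)
  qed
  moreover have "?f ` carrier (P i) \<subseteq> radical \<Lambda> (P j)"
    using HomD(1)[OF \<phi>_Hom[OF j]] HomD(1)[OF \<iota>] by (auto simp: compose_eq)
  then have "?f ` carrier (P i) \<noteq> carrier (P j)"
    using radical_P_proper[OF j] submodule_subset[OF P_rm[OF j] rad_P_submodule[OF j]] by auto
  ultimately show ?thesis using that by blast
qed

text \<open>
  A summand \<open>P i\<close> of the radical of \<open>P j\<close> embeds properly into \<open>P j\<close>, so a cycle of such
  embeddings would be an injective endomorphism that is not surjective.
\<close>

lemma summand_rel_acyclic: "acyclic summand_rel"
proof -
  have emb: "\<exists>f\<in>Hom \<Lambda> (P i) (P j). inj_on f (carrier (P i)) \<and> f ` carrier (P i) \<noteq> carrier (P j)"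
    if "(i, j) \<in> summand_rel\<^sup>+" for i j
    using that
  proof (induction rule: trancl_induct)
    case (base j)
    then show ?case using summand_rel_embedding by metis
  next
    case (step j l)
    then obtain f where f: "f \<in> Hom \<Lambda> (P i) (P j)" "inj_on f (carrier (P i))" by blast
    obtain g where g: "g \<in> Hom \<Lambda> (P j) (P l)" "inj_on g (carrier (P j))" "g ` carrier (P j) \<noteq> carrier (P l)"
      using summand_rel_embedding[OF step(2)] by blast
    have i: "i < n" using step(1) by (induction rule: trancl_induct) (auto simp: summand_rel_def)
    let ?h = "compose (carrier (P i)) g f"
    have "inj_on ?h (carrier (P i))"
    proof (rule inj_onI)
      fix x y assume x: "x \<in> carrier (P i)" "y \<in> carrier (P i)" "?h x = ?h y"
      then have "f x = f y"
        using inj_onD[OF g(2) _ HomD(1)[OF f(1) x(1)] HomD(1)[OF f(1) x(2)]] by (simp add: compose_eq)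
      then show "x = y" by (rule inj_onD[OF f(2) _ x(1,2)])
    qed
    moreover have "?h ` carrier (P i) \<subseteq> g ` carrier (P j)"
      using HomD(1)[OF f(1)] by (intro image_subsetI) (simp add: compose_eq)
    then have "?h ` carrier (P i) \<noteq> carrier (P l)"
      using g(3) HomD(1)[OF g(1)] by auto
    ultimately show ?case using Hom_compose[OF f(1) g(1) P_rm[OF i]] by blast
  qed
  have "(i, i) \<notin> summand_rel\<^sup>+" for i
  proof
    assume a: "(i, i) \<in> summand_rel\<^sup>+"
    have i: "i < n" using a by (induction rule: trancl_induct) (auto simp: summand_rel_def)
    show False
      using emb[OF a] finite_length_inj_surj[OF P_rm[OF i] P_finite_length[OF i]] by blast
  qed
  then show ?thesis by (simp add: acyclic_def)
qed

definition weight :: "nat \<Rightarrow> nat" where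
  "weight = (SOME w. \<forall>i j. (i, j) \<in> summand_rel \<longrightarrow> w i < w j)"

lemma weight_less:
  assumes "i < n" "j < n" "0 < d j i"
  shows "weight i < weight j"
proof -
  have "finite summand_rel"
    by (rule finite_subset[of _ "{..<n} \<times> {..<n}"]) (auto simp: summand_rel_def)
  then have "\<exists>w :: nat \<Rightarrow> nat. \<forall>i j. (i, j) \<in> summand_rel \<longrightarrow> w i < w j"
    using acyclic_weight[OF _ summand_rel_acyclic] by metis
  then have "\<forall>i j. (i, j) \<in> summand_rel \<longrightarrow> weight i < weight j"
    unfolding weight_def by (rule someI_ex)
  then show ?thesis using assms by (simp add: summand_rel_def)
qed

text \<open>
  The radical of \<open>P m\<close> is a direct sum of modules \<open>P l\<close> with \<open>d m l > 0\<close>.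
\<close>

lemma Hom_into_radical_zero:
  assumes i: "i < n" and m: "m < n" and g: "g \<in> Hom \<Lambda> (P i) (P m)"
    and rad: "\<And>x. x \<in> carrier (P i) \<Longrightarrow> g x \<in> radical \<Lambda> (P m)"
    and low: "\<And>l h x. \<lbrakk>l < n; 0 < d m l; h \<in> Hom \<Lambda> (P i) (P l); x \<in> carrier (P i)\<rbrakk> \<Longrightarrow> h x = \<zero>\<^bsub>P l\<^esub>"
    and x: "x \<in> carrier (P i)"
  shows "g x = \<zero>\<^bsub>P m\<^esub>"
proof -
  obtain \<psi> where \<psi>: "\<psi> \<in> Hom \<Lambda> (sub_module (P m) (radical \<Lambda> (P m))) (Proj n P (d m))"
    and \<phi>\<psi>: "\<And>x. x \<in> radical \<Lambda> (P m) \<Longrightarrow> \<phi> m (\<psi> x) = x"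
    using \<phi>_inverse[OF m] by blast
  have g': "g \<in> Hom \<Lambda> (P i) (sub_module (P m) (radical \<Lambda> (P m)))"
    by (rule Hom_into_sub[OF g rad])
  note c1 = Hom_compose[OF g' \<psi> P_rm[OF i]]
  have q: "\<psi> (g x) \<in> carrier (Proj n P (d m))" using HomD(1)[OF c1 x] x by (simp add: compose_eq)
  have "\<psi> (g x) = \<zero>\<^bsub>Proj n P (d m)\<^esub>"
  proof (rule PiE_ext[OF q[unfolded Proj_carrier]])
    interpret D: right_module \<Lambda> "Proj n P (d m)" by (rule Proj_rm)
    show "\<zero>\<^bsub>Proj n P (d m)\<^esub> \<in> (\<Pi>\<^sub>E ik\<in>copies n (d m). carrier (P (fst ik)))"
      using D.M.zero_closed unfolding Proj_carrier .
    fix lt assume lt: "lt \<in> copies n (d m)"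
    have "compose (carrier (P i)) (\<lambda>x\<in>carrier (Proj n P (d m)). x lt) (compose (carrier (P i)) \<psi> g) x
        = \<zero>\<^bsub>P (fst lt)\<^esub>"
      by (rule low[OF _ _ Hom_compose[OF c1 Proj_proj_Hom[OF lt] P_rm[OF i]] x])
         (use lt in \<open>auto simp: copies_iff\<close>)
    then show "\<psi> (g x) lt = \<zero>\<^bsub>Proj n P (d m)\<^esub> lt"
      using x q lt by (simp add: compose_eq Proj_ops)
  qed
  then show ?thesis
    using \<phi>\<psi>[OF rad[OF x]] Hom_zero[OF Proj_rm P_rm[OF m] \<phi>_Hom_P[OF m]] by simp
qed

text \<open>
  Such a map lands in the radical of \<open>P m\<close>, hence in modules \<open>P l\<close> of still lower weight.
\<close>

lemma Hom_lower_zero: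
  assumes i: "i < n"
  shows "\<lbrakk>m < n; weight m < weight i; g \<in> Hom \<Lambda> (P i) (P m); x \<in> carrier (P i)\<rbrakk> \<Longrightarrow> g x = \<zero>\<^bsub>P m\<^esub>"
proof (induction "weight m" arbitrary: m g x rule: less_induct)
  case less
  have ne: "i \<noteq> m" using less.prems(2) by auto
  show ?case
  proof (rule Hom_into_radical_zero[OF i less.prems(1,3)])
    show "g y \<in> radical \<Lambda> (P m)" if "y \<in> carrier (P i)" for y
      by (rule distinct_into_radical[OF i less.prems(1) ne less.prems(3) that])
    show "h y = \<zero>\<^bsub>P l\<^esub>" if "l < n" "0 < d m l" "h \<in> Hom \<Lambda> (P i) (P l)" "y \<in> carrier (P i)" for l h y
    proof (rule less.hyps[OF _ that(1) _ that(3,4)])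
      show "weight l < weight m" by (rule weight_less[OF that(1) less.prems(1) that(2)])
      then show "weight l < weight i" using less.prems(2) by simp
    qed
  qed (rule less.prems)
qed

text \<open>
  An endomorphism of \<open>P i\<close> that is not surjective lands in the radical, whose summands have lower
  weight, and vanishes; a surjective one is injective by finite length.
\<close>

lemma division_ring_End:
  assumes i: "i < n"
  shows "division_ring (End_ring \<Lambda> (P i))"
  unfolding division_ring_def
proof (intro conjI ballI impI ring_End_ring[OF P_rm[OF i]])
  fix e assume "e \<in> carrier (End_ring \<Lambda> (P i))" and nz: "e \<noteq> \<zero>\<^bsub>End_ring \<Lambda> (P i)\<^esub>"
  then have e: "e \<in> Hom \<Lambda> (P i) (P i)" by simp
  have surj: "e ` carrier (P i) = carrier (P i)"
  proof (rule ccontr)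
    assume ns: "e ` carrier (P i) \<noteq> carrier (P i)"
    have "e x = \<zero>\<^bsub>P i\<^esub>" if "x \<in> carrier (P i)" for x
    proof (rule Hom_into_radical_zero[OF i i e _ _ that])
      show "e y \<in> radical \<Lambda> (P i)" if "y \<in> carrier (P i)" for y
        by (rule nonsurj_into_radical[OF i i e ns that])
      show "h y = \<zero>\<^bsub>P l\<^esub>" if "l < n" "0 < d i l" "h \<in> Hom \<Lambda> (P i) (P l)" "y \<in> carrier (P i)" for l h y
        by (rule Hom_lower_zero[OF i that(1) weight_less[OF that(1) i that(2)] that(3,4)])
    qed
    then have "e = (\<lambda>x\<in>carrier (P i). \<zero>\<^bsub>P i\<^esub>)"
      using HomD(2)[OF e] by (auto simp: fun_eq_iff)
    then show False using nz by simp
  qed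
  have inj: "inj_on e (carrier (P i))"
    by (rule finite_length_surj_inj[OF P_rm[OF i] P_finite_length[OF i] e surj])
  obtain g where g: "g \<in> Hom \<Lambda> (P i) (P i)" "\<And>x. x \<in> carrier (P i) \<Longrightarrow> g (e x) = x"
    "\<And>y. y \<in> carrier (P i) \<Longrightarrow> e (g y) = y"
    by (rule Hom_inverse[OF P_rm[OF i] P_rm[OF i] e inj surj], rule that)
  then have "e \<otimes>\<^bsub>End_ring \<Lambda> (P i)\<^esub> g = \<one>\<^bsub>End_ring \<Lambda> (P i)\<^esub>"
    by (auto simp: compose_def intro!: restrict_ext)
  then show "\<exists>g\<in>carrier (End_ring \<Lambda> (P i)). e \<otimes>\<^bsub>End_ring \<Lambda> (P i)\<^esub> g = \<one>\<^bsub>End_ring \<Lambda> (P i)\<^esub>"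
    using g(1) by auto
qed

text \<open>A nonzero module has a simple submodule, which is covered by some \<open>P i\<close>.\<close>

lemma zero_if_no_Hom:
  assumes Y: "right_module \<Lambda> Y" "finite_length \<Lambda> Y"
    and zero: "\<And>i u x. \<lbrakk>i < n; u \<in> Hom \<Lambda> (P i) Y; x \<in> carrier (P i)\<rbrakk> \<Longrightarrow> u x = \<zero>\<^bsub>Y\<^esub>"
  shows "carrier Y = {\<zero>\<^bsub>Y\<^esub>}"
proof (rule ccontr)
  assume "carrier Y \<noteq> {\<zero>\<^bsub>Y\<^esub>}"
  then obtain U where U: "submodule U \<Lambda> Y" "simple_module \<Lambda> (sub_module Y U)"
    using finite_length_simple_submodule[OF Y] by blast
  obtain X' :: "('a, 'a set) module" where X': "simple_module \<Lambda> X'" "isomorphic \<Lambda> (sub_module Y U) X'"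
    by (rule simple_module_small[OF U(2)])
  obtain i where i: "i < n" "isomorphic \<Lambda> X' (S i)" using S_all[OF X'(1)] by blast
  have Ur: "right_module \<Lambda> (sub_module Y U)" and Xr: "right_module \<Lambda> X'"
    using U(2) X'(1) by (simp_all add: simple_module_def)
  obtain e1 where e1: "e1 \<in> Hom \<Lambda> (sub_module Y U) X'" "bij_betw e1 U (carrier X')"
    using X'(2) by (auto simp: isomorphic_def Iso_def)
  obtain e2 where e2: "e2 \<in> Hom \<Lambda> X' (S i)" "bij_betw e2 (carrier X') (carrier (S i))"
    using i(2) by (auto simp: isomorphic_def Iso_def)
  have b1: "inj_on e1 (carrier (sub_module Y U))" "e1 ` carrier (sub_module Y U) = carrier X'"
    using e1(2) by (auto simp: bij_betw_def)
  have b2: "inj_on e2 (carrier X')" "e2 ` carrier X' = carrier (S i)"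
    using e2(2) by (auto simp: bij_betw_def)
  obtain g1 where g1: "g1 \<in> Hom \<Lambda> X' (sub_module Y U)" "\<And>u. u \<in> carrier (sub_module Y U) \<Longrightarrow> g1 (e1 u) = u"
    by (rule Hom_inverse[OF Ur Xr e1(1) b1], rule that)
  obtain g2 where g2: "g2 \<in> Hom \<Lambda> (S i) X'" "\<And>x. x \<in> carrier X' \<Longrightarrow> g2 (e2 x) = x"
    by (rule Hom_inverse[OF Xr S_rm[OF i(1)] e2(1) b2], rule that)
  let ?u = "compose (carrier (P i)) g1 (compose (carrier (P i)) g2 (pc i))"
  have u: "?u \<in> Hom \<Lambda> (P i) Y"
    by (rule Hom_from_into_sub[OF Hom_compose[OF Hom_compose[OF pc_Hom[OF i(1)] g2(1) P_rm[OF i(1)]] g1(1)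
            P_rm[OF i(1)]] submodule_subset[OF Y(1) U(1)]])
  have "v = \<zero>\<^bsub>Y\<^esub>" if v: "v \<in> U" for v
  proof -
    have c: "e1 v \<in> carrier X'" "e2 (e1 v) \<in> carrier (S i)"
      using v HomD(1)[OF e1(1), of v] HomD(1)[OF e2(1), of "e1 v"] by auto
    then have "e2 (e1 v) \<in> pc i ` carrier (P i)" using pc_surj[OF i(1)] by simp
    then obtain x where x: "x \<in> carrier (P i)" "pc i x = e2 (e1 v)" by (elim imageE) simp
    have "?u x = v" using x g2(2)[OF c(1)] g1(2)[of v] v by (simp add: compose_eq)
    then show ?thesis using zero[OF i(1) u x(1)] by simp
  qed
  then have "U = {\<zero>\<^bsub>Y\<^esub>}" using submodule_zero[OF Y(1) U(1)] by blast
  then show False using U(2) by (simp add: simple_module_def)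
qed

section \<open>The radical of $P(\alpha)$\<close>

text \<open>
  \<open>PA\<close> is $P(\alpha)$ and \<open>RA\<close> its radical, with inclusion into \<open>PA\<close>; \<open>QA\<close> is the source
  $\bigoplus_{i,j} P_i^{\alpha_j d_{ji}}$ of the isomorphism \<open>\<Phi>\<close> onto \<open>RA\<close>.
\<close>

abbreviation "PA \<equiv> Proj n P \<alpha>"
abbreviation "RA \<equiv> rad_Proj \<Lambda> n P \<alpha>"
abbreviation "QA \<equiv> Rad_source n P d \<alpha>"
abbreviation "rad_index \<equiv> rad_copies n d \<alpha>"
abbreviation "\<Phi> \<equiv> Phi n P d \<phi> \<alpha>"

lemma finite_rad_index [simp]: "finite rad_index"
  unfolding rad_copies_def by (intro finite_SigmaI) auto

lemma rad_index_iff: "r \<in> rad_index \<longleftrightarrow> fst r \<in> copies n \<alpha> \<and> snd r \<in> copies n (d (fst (fst r)))"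
  by (cases r) (auto simp: rad_copies_def)

lemma rad_index_rm: "r \<in> rad_index \<Longrightarrow> right_module \<Lambda> ((\<lambda>((j, k), (i, l)). P i) r)"
  by (auto simp: rad_copies_def copies_def P_rm)

lemma QA_eq: "QA = dir_sum rad_index (\<lambda>((j, k), (i, l)). P i)"
  by (simp add: Rad_source_def)

lemma QA_rm: "right_module \<Lambda> QA"
  unfolding QA_eq by (rule right_module_dir_sum[OF ring_\<Lambda> rad_index_rm])

lemma QA_carrier: "q \<in> carrier QA \<longleftrightarrow> q \<in> (\<Pi>\<^sub>E r\<in>rad_index. carrier (P (fst (snd r))))"
  by (simp add: QA_eq dir_sum_simps split_beta)

lemma QA_ops:
  "\<zero>\<^bsub>QA\<^esub> = (\<lambda>r\<in>rad_index. \<zero>\<^bsub>P (fst (snd r))\<^esub>)"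
  "x \<oplus>\<^bsub>QA\<^esub> y = (\<lambda>r\<in>rad_index. x r \<oplus>\<^bsub>P (fst (snd r))\<^esub> y r)"
  "a \<odot>\<^bsub>QA\<^esub> x = (\<lambda>r\<in>rad_index. a \<odot>\<^bsub>P (fst (snd r))\<^esub> x r)"
  by (simp_all add: QA_eq dir_sum_simps split_beta)

lemma RA_eq: "RA = sub_module PA (radical \<Lambda> PA)"
  by (simp add: rad_Proj_def)

lemma RA_submodule: "submodule (carrier RA) \<Lambda> PA"
  unfolding RA_eq by (simp add: submodule_radical[OF Proj_rm])

lemma RA_rm: "right_module \<Lambda> RA"
  unfolding RA_eq by (rule right_module_sub[OF Proj_rm submodule_radical[OF Proj_rm]])

lemma RA_fd: "fd_module K \<Lambda> RA"
  unfolding RA_eq by (rule fd_module_sub[OF alg Proj_fd submodule_radical[OF Proj_rm]])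

lemma RA_subset: "x \<in> carrier RA \<Longrightarrow> x \<in> carrier PA"
  using submodule_subset[OF Proj_rm RA_submodule] by blast

lemma RA_ops [simp]:
  "\<zero>\<^bsub>RA\<^esub> = \<zero>\<^bsub>PA\<^esub>" "x \<oplus>\<^bsub>RA\<^esub> y = x \<oplus>\<^bsub>PA\<^esub> y" "a \<odot>\<^bsub>RA\<^esub> x = a \<odot>\<^bsub>PA\<^esub> x"
  by (simp_all add: RA_eq)

lemma RA_carrier: "x \<in> carrier RA \<longleftrightarrow> x \<in> (\<Pi>\<^sub>E jk\<in>copies n \<alpha>. radical \<Lambda> (P (fst jk)))"
proof -
  have "radical \<Lambda> PA = (\<Pi>\<^sub>E jk\<in>copies n \<alpha>. radical \<Lambda> ((\<lambda>(i, k). P i) jk))"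
    unfolding Proj_def by (rule radical_dir_sum[OF ring_\<Lambda> finite_copies copy_rm])
  then show ?thesis by (simp add: RA_eq split_beta)
qed

text \<open>
  The part of \<open>q\<close> lying over one copy of \<open>P j\<close>, to which \<open>\<phi> j\<close> applies.
\<close>

definition slice :: "((nat \<times> nat) \<times> (nat \<times> nat) \<Rightarrow> 'p) \<Rightarrow> nat \<times> nat \<Rightarrow> (nat \<times> nat \<Rightarrow> 'p)" where
  "slice q jk = (\<lambda>il\<in>copies n (d (fst jk)). q (jk, il))"

lemma slice_closed: "q \<in> carrier QA \<Longrightarrow> jk \<in> copies n \<alpha> \<Longrightarrow> slice q jk \<in> carrier (Proj n P (d (fst jk)))"
  using PiE_mem[of q rad_index "\<lambda>r. carrier (P (fst (snd r)))" "(jk, _)"]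
  by (auto simp: QA_carrier Proj_carrier slice_def rad_index_iff)

lemma \<Phi>_apply: "q \<in> carrier QA \<Longrightarrow> jk \<in> copies n \<alpha> \<Longrightarrow> \<Phi> q jk = \<phi> (fst jk) (slice q jk)"
  by (cases jk) (simp add: Phi_def slice_def)

lemma \<Phi>_closed: "q \<in> carrier QA \<Longrightarrow> \<Phi> q \<in> carrier RA"
proof -
  assume q: "q \<in> carrier QA"
  have "\<phi> (fst jk) (slice q jk) \<in> radical \<Lambda> (P (fst jk))" if "jk \<in> copies n \<alpha>" for jk
    using HomD(1)[OF \<phi>_Hom slice_closed[OF q that]] that by (simp add: copies_iff)
  moreover have "\<Phi> q jk = undefined" if "jk \<notin> copies n \<alpha>" for jk
    using q that by (simp add: Phi_def)
  ultimately show ?thesis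
    unfolding RA_carrier by (auto simp: PiE_iff \<Phi>_apply[OF q] extensional_def)
qed

lemma \<Phi>_Hom: "\<Phi> \<in> Hom \<Lambda> QA RA"
proof (rule HomI)
  interpret Q: right_module \<Lambda> QA by (rule QA_rm)
  interpret R: right_module \<Lambda> RA by (rule RA_rm)
  fix q assume q: "q \<in> carrier QA"
  show "\<Phi> q \<in> carrier RA" by (rule \<Phi>_closed[OF q])
  {
    fix q' assume q': "q' \<in> carrier QA"
    note qq = Q.M.a_closed[OF q q']
    show "\<Phi> (q \<oplus>\<^bsub>QA\<^esub> q') = \<Phi> q \<oplus>\<^bsub>RA\<^esub> \<Phi> q'"
    proof (rule PiE_ext[OF \<Phi>_closed[OF qq, unfolded RA_carrier]
          R.M.a_closed[OF \<Phi>_closed[OF q] \<Phi>_closed[OF q'], unfolded RA_carrier]])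
      fix jk assume jk: "jk \<in> copies n \<alpha>"
      then have j: "fst jk < n" by (simp add: copies_iff)
      have "slice (q \<oplus>\<^bsub>QA\<^esub> q') jk = slice q jk \<oplus>\<^bsub>Proj n P (d (fst jk))\<^esub> slice q' jk"
        using jk by (auto simp: slice_def QA_ops Proj_ops rad_index_iff intro!: restrict_ext)
      then show "\<Phi> (q \<oplus>\<^bsub>QA\<^esub> q') jk = (\<Phi> q \<oplus>\<^bsub>RA\<^esub> \<Phi> q') jk"
        using HomD(3)[OF \<phi>_Hom_P[OF j] slice_closed[OF q jk] slice_closed[OF q' jk]] jk
        by (simp add: \<Phi>_apply[OF qq jk] \<Phi>_apply[OF q jk] \<Phi>_apply[OF q' jk] Proj_ops(2)[of \<alpha>])
    qed
  next
    fix a assume a: "a \<in> carrier \<Lambda>"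
    note qq = Q.smult_closed[OF a q]
    show "\<Phi> (a \<odot>\<^bsub>QA\<^esub> q) = a \<odot>\<^bsub>RA\<^esub> \<Phi> q"
    proof (rule PiE_ext[OF \<Phi>_closed[OF qq, unfolded RA_carrier]
          R.smult_closed[OF a \<Phi>_closed[OF q], unfolded RA_carrier]])
      fix jk assume jk: "jk \<in> copies n \<alpha>"
      then have j: "fst jk < n" by (simp add: copies_iff)
      have "slice (a \<odot>\<^bsub>QA\<^esub> q) jk = a \<odot>\<^bsub>Proj n P (d (fst jk))\<^esub> slice q jk"
        using jk by (auto simp: slice_def QA_ops Proj_ops rad_index_iff intro!: restrict_ext)
      then show "\<Phi> (a \<odot>\<^bsub>QA\<^esub> q) jk = (a \<odot>\<^bsub>RA\<^esub> \<Phi> q) jk"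
        using HomD(4)[OF \<phi>_Hom_P[OF j] a slice_closed[OF q jk]] jk
        by (simp add: \<Phi>_apply[OF qq jk] \<Phi>_apply[OF q jk] Proj_ops(3)[of \<alpha>])
    qed
  }
qed (simp add: Phi_def)

lemma \<Phi>_inj: "inj_on \<Phi> (carrier QA)"
proof (rule inj_onI)
  fix q q' assume q: "q \<in> carrier QA" "q' \<in> carrier QA" "\<Phi> q = \<Phi> q'"
  show "q = q'"
  proof (rule PiE_ext[OF q(1)[unfolded QA_carrier] q(2)[unfolded QA_carrier]])
    fix r assume "r \<in> rad_index"
    then have jk: "fst r \<in> copies n \<alpha>" and il: "snd r \<in> copies n (d (fst (fst r)))"
      by (auto simp: rad_index_iff)
    have "\<phi> (fst (fst r)) (slice q (fst r)) = \<phi> (fst (fst r)) (slice q' (fst r))"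
      using q(3) by (simp add: \<Phi>_apply[OF q(1) jk, symmetric] \<Phi>_apply[OF q(2) jk, symmetric])
    then have "slice q (fst r) = slice q' (fst r)"
      using inj_onD[OF \<phi>_inj _ slice_closed[OF q(1) jk] slice_closed[OF q(2) jk]] jk
      by (simp add: copies_iff)
    then have "slice q (fst r) (snd r) = slice q' (fst r) (snd r)" by simp
    then show "q r = q' r" using il by (simp add: slice_def)
  qed
qed

lemma \<Phi>_surj: "\<Phi> ` carrier QA = carrier RA"
proof (intro equalityI subsetI)
  fix x assume x: "x \<in> carrier RA"
  have "\<exists>q\<in>carrier (Proj n P (d (fst jk))). \<phi> (fst jk) q = x jk" if "jk \<in> copies n \<alpha>" for jk
  proof -
    have "x jk \<in> \<phi> (fst jk) ` carrier (Proj n P (d (fst jk)))"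
      using \<phi>_surj[of "fst jk"] x that by (auto simp: RA_carrier copies_iff PiE_iff)
    then show ?thesis by (elim imageE) (rule bexI, simp_all)
  qed
  then obtain t where t: "\<And>jk. jk \<in> copies n \<alpha> \<Longrightarrow> t jk \<in> carrier (Proj n P (d (fst jk)))"
    "\<And>jk. jk \<in> copies n \<alpha> \<Longrightarrow> \<phi> (fst jk) (t jk) = x jk" by metis
  define q where "q = (\<lambda>r\<in>rad_index. t (fst r) (snd r))"
  have q: "q \<in> carrier QA"
    using t(1) by (auto simp: QA_carrier q_def rad_index_iff Proj_carrier PiE_iff)
  have "\<Phi> q = x"
  proof (rule PiE_ext[OF \<Phi>_closed[OF q, unfolded RA_carrier] x[unfolded RA_carrier]])
    fix jk assume jk: "jk \<in> copies n \<alpha>"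
    have "slice q jk = t jk"
    proof (rule PiE_ext[OF slice_closed[OF q jk, unfolded Proj_carrier] t(1)[OF jk, unfolded Proj_carrier]])
      fix il assume "il \<in> copies n (d (fst jk))"
      then show "slice q jk il = t jk il" using jk by (simp add: slice_def q_def rad_index_iff)
    qed
    then show "\<Phi> q jk = x jk" using t(2)[OF jk] by (simp add: \<Phi>_apply[OF q jk])
  qed
  then show "x \<in> \<Phi> ` carrier QA" using q by blast
qed (use \<Phi>_closed in blast)


section \<open>The representation space\<close>

text \<open>
  \<open>V\<close> is $\mathrm{Rep}(\Lambda,\alpha)$, as a subspace of the space \<open>HA\<close> of all maps from \<open>RA\<close> to \<open>PA\<close>.
\<close>

abbreviation "HA \<equiv> hom_scalars \<Lambda> RA PA"
abbreviation "V \<equiv> Rep \<Lambda> n P d \<phi> \<alpha>"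

definition supported :: "nat \<Rightarrow> (nat \<times> nat \<Rightarrow> 'p) \<Rightarrow> bool" where
  "supported i x \<longleftrightarrow> (\<forall>jk\<in>copies n \<alpha>. fst jk \<noteq> i \<longrightarrow> x jk = \<zero>\<^bsub>P (fst jk)\<^esub>)"

definition source_supported :: "nat \<Rightarrow> ((nat \<times> nat) \<times> (nat \<times> nat) \<Rightarrow> 'p) \<Rightarrow> bool" where
  "source_supported i q \<longleftrightarrow> (\<forall>r\<in>rad_index. fst (snd r) \<noteq> i \<longrightarrow> q r = \<zero>\<^bsub>P (fst (snd r))\<^esub>)"

lemma \<Phi>_Hom_PA: "\<Phi> \<in> Hom \<Lambda> QA PA"
  using \<Phi>_Hom unfolding RA_eq
  by (rule Hom_from_into_sub) (use submodule_subset[OF Proj_rm RA_submodule] in \<open>simp add: RA_eq\<close>)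

lemma V_eq: "V = sub_module HA (carrier V)"
  by (simp add: Rep_def hom_scalars_def sub_module_def)

lemma V_carrier:
  "f \<in> carrier V \<longleftrightarrow> f \<in> Hom \<Lambda> RA PA \<and>
    (\<forall>i<n. \<forall>q\<in>carrier QA. source_supported i q \<longrightarrow> supported i (f (\<Phi> q)))"
proof -
  have "compose (carrier QA) f \<Phi> \<in> Hom \<Lambda> QA PA" if "f \<in> Hom \<Lambda> RA PA"
    by (rule Hom_compose[OF \<Phi>_Hom that QA_rm])
  then show ?thesis
    by (auto simp: Rep_def block_homs_def source_supported_def supported_def compose_eq split_beta)
qed

lemma V_Hom: "f \<in> carrier V \<Longrightarrow> f \<in> Hom \<Lambda> RA PA"
  by (simp add: V_carrier)

lemma HA_rm: "right_module K HA"
  by (rule right_module_hom_scalars[OF alg RA_rm Proj_rm])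

lemma V_submodule: "submodule (carrier V) K HA"
  unfolding submodule_iff[OF HA_rm]
proof (intro conjI ballI)
  note z = P_zero
  show "carrier V \<subseteq> carrier HA" using V_Hom by auto
  show "\<zero>\<^bsub>HA\<^esub> \<in> carrier V"
    using Hom_zero_map[OF RA_rm Proj_rm, of \<alpha>] \<Phi>_closed
    by (auto simp: V_carrier supported_def Proj_ops)
  show "f \<oplus>\<^bsub>HA\<^esub> g \<in> carrier V" if f: "f \<in> carrier V" and g: "g \<in> carrier V" for f g
    using Hom_add[OF RA_rm Proj_rm V_Hom[OF f] V_Hom[OF g]] f g \<Phi>_closed z
    by (auto simp: V_carrier supported_def Proj_ops copies_iff)
  show "k \<odot>\<^bsub>HA\<^esub> f \<in> carrier V" if k: "k \<in> carrier K" and f: "f \<in> carrier V" for k f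
    using Hom_unit_scalar[OF alg RA_rm Proj_rm V_Hom[OF f] k] f \<Phi>_closed z unit_scalar_closed[OF alg k]
    by (auto simp: V_carrier supported_def Proj_ops copies_iff)
qed

lemma V_rm: "right_module K V"
  using right_module_sub[OF HA_rm V_submodule] by (simp add: V_eq[symmetric])

text \<open>
  The block condition makes \<open>f\<close> lower the weight: a component \<open>P m\<close> of the source lying over
  \<open>P j\<close> has smaller weight than \<open>P j\<close>, and \<open>f\<close> maps it into the components \<open>P m\<close>.
\<close>

lemma Rep_lowers_weight:
  assumes f: "f \<in> carrier V" and x: "x \<in> carrier RA"
    and xB: "\<And>jk. \<lbrakk>jk \<in> copies n \<alpha>; Suc B \<le> weight (fst jk)\<rbrakk> \<Longrightarrow> x jk = \<zero>\<^bsub>P (fst jk)\<^esub>"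
    and mk: "mk \<in> copies n \<alpha>" "B \<le> weight (fst mk)"
  shows "f x mk = \<zero>\<^bsub>P (fst mk)\<^esub>"
proof -
  let ?m = "fst mk"
  have m: "?m < n" using mk by (simp add: copies_iff)
  interpret Pm: right_module \<Lambda> "P ?m" by (rule P_rm[OF m])
  let ?M = "\<lambda>((j, k), (i, l)). P i"
  obtain q where q: "q \<in> carrier QA" "x = \<Phi> q" using x \<Phi>_surj by blast
  note fH = V_Hom[OF f]
  let ?h = "compose (carrier QA) (\<lambda>x\<in>carrier PA. x mk) (compose (carrier QA) f \<Phi>)"
  have h: "?h \<in> Hom \<Lambda> QA (P ?m)"
    by (rule Hom_compose[OF Hom_compose[OF \<Phi>_Hom fH QA_rm] Proj_proj_Hom[OF mk(1)] QA_rm])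
  have hq: "?h q' = f (\<Phi> q') mk" if "q' \<in> carrier QA" for q'
    using that HomD(1)[OF fH \<Phi>_closed[OF that]] by (simp add: compose_eq)
  have qr: "q r \<in> carrier (?M r)" if "r \<in> rad_index" for r
    using q(1) that by (auto simp: QA_carrier PiE_iff split_beta)
  have \<iota>: "ds_inj rad_index ?M r (q r) \<in> carrier QA" if r: "r \<in> rad_index" for r
    using HomD(1)[OF ds_inj_Hom[where M = ?M and I = rad_index and i = r, OF ring_\<Lambda> finite_rad_index rad_index_rm r] qr[OF r]]
    by (simp add: QA_eq)
  have zero: "?h (ds_inj rad_index ?M r (q r)) = \<zero>\<^bsub>P ?m\<^esub>" if r: "r \<in> rad_index" for r
  proof (cases "fst (snd r) = ?m")
    case False
    have "source_supported (fst (snd r)) (ds_inj rad_index ?M r (q r))"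
      using qr[OF r] by (auto simp: source_supported_def ds_inj_def split_beta)
    moreover have "fst (snd r) < n" using r by (simp add: rad_index_iff copies_iff)
    ultimately have "supported (fst (snd r)) (f (\<Phi> (ds_inj rad_index ?M r (q r))))"
      using f \<iota>[OF r] by (simp add: V_carrier)
    then show ?thesis using False mk by (simp add: hq[OF \<iota>[OF r]] supported_def)
  next
    case True
    have jk: "fst r \<in> copies n \<alpha>" and il: "snd r \<in> copies n (d (fst (fst r)))"
      using r by (auto simp: rad_index_iff)
    have j: "fst (fst r) < n" using jk by (simp add: copies_iff)
    have "weight ?m < weight (fst (fst r))"
      using weight_less[OF m j] il True by (auto simp: copies_iff)
    then have "x (fst r) = \<zero>\<^bsub>P (fst (fst r))\<^esub>" using xB[OF jk] mk(2) by simp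
    then have "\<phi> (fst (fst r)) (slice q (fst r)) = \<phi> (fst (fst r)) \<zero>\<^bsub>Proj n P (d (fst (fst r)))\<^esub>"
      using \<Phi>_apply[OF q(1) jk] q(2) Hom_zero[OF Proj_rm P_rm[OF j] \<phi>_Hom_P[OF j]] by simp
    then have "slice q (fst r) = \<zero>\<^bsub>Proj n P (d (fst (fst r)))\<^esub>"
      using inj_onD[OF \<phi>_inj[OF j] _ slice_closed[OF q(1) jk]
          submodule_zero[OF Proj_rm submodule_carrier[OF Proj_rm]]] by simp
    then have "slice q (fst r) (snd r) = \<zero>\<^bsub>P (fst (snd r))\<^esub>" using il by (simp add: Proj_ops)
    then have "q r = \<zero>\<^bsub>P (fst (snd r))\<^esub>" using il by (simp add: slice_def)
    then have qz: "q r = \<zero>\<^bsub>?M r\<^esub>" by (simp add: split_beta)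
    have "ds_inj rad_index ?M r (q r) = \<zero>\<^bsub>dir_sum rad_index ?M\<^esub>"
      unfolding qz
      by (rule Hom_zero[OF rad_index_rm[OF r] QA_rm[unfolded QA_eq]])
         (rule ds_inj_Hom[where M = ?M and I = rad_index and i = r, OF ring_\<Lambda> finite_rad_index rad_index_rm r])
    then have "ds_inj rad_index ?M r (q r) = \<zero>\<^bsub>QA\<^esub>" by (simp add: QA_eq)
    then show ?thesis using Hom_zero[OF QA_rm P_rm[OF m] h] by (simp only:)
  qed
  have "q = (\<Oplus>\<^bsub>QA\<^esub>r\<in>rad_index. ds_inj rad_index ?M r (q r))"
    using ds_sum_inj[where M = ?M and I = rad_index and x = q, OF ring_\<Lambda> finite_rad_index rad_index_rm] q(1)
    by (simp add: QA_eq)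
  then have "?h q = ?h (\<Oplus>\<^bsub>QA\<^esub>r\<in>rad_index. ds_inj rad_index ?M r (q r))" by (rule arg_cong)
  also have "\<dots> = (\<Oplus>\<^bsub>P ?m\<^esub>r\<in>rad_index. ?h (ds_inj rad_index ?M r (q r)))"
    by (rule Hom_finsum[OF QA_rm P_rm[OF m] h finite_rad_index \<iota>])
  also have "\<dots> = (\<Oplus>\<^bsub>P ?m\<^esub>r\<in>rad_index. \<zero>\<^bsub>P ?m\<^esub>)"
    by (rule Pm.M.finsum_cong') (use zero in auto)
  finally show ?thesis using hq[OF q(1)] q(2) by simp
qed

definition delta :: "((nat \<times> nat \<Rightarrow> 'p) \<Rightarrow> (nat \<times> nat \<Rightarrow> 'p)) \<Rightarrow> (nat \<times> nat \<Rightarrow> 'p) \<Rightarrow> (nat \<times> nat \<Rightarrow> 'p)" where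
  "delta f = (\<lambda>x\<in>carrier RA. f x \<ominus>\<^bsub>PA\<^esub> x)"

lemma inclusion_Hom: "(\<lambda>x\<in>carrier RA. x) \<in> Hom \<Lambda> RA PA"
  using Hom_from_into_sub[of "\<lambda>x\<in>carrier RA. x" \<Lambda> RA PA "radical \<Lambda> PA"] Hom_id[OF RA_rm]
    submodule_subset[OF Proj_rm RA_submodule] by (simp add: RA_eq)

lemma delta_Hom: "f \<in> Hom \<Lambda> RA PA \<Longrightarrow> delta f \<in> Hom \<Lambda> RA PA"
  unfolding delta_def using Hom_diff[OF RA_rm Proj_rm _ inclusion_Hom, of f] by (simp cong: restrict_cong)

lemma delta_apply: "x \<in> carrier RA \<Longrightarrow> delta f x = f x \<ominus>\<^bsub>PA\<^esub> x"
  by (simp add: delta_def)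

lemma delta_submodule: "f \<in> Hom \<Lambda> RA PA \<Longrightarrow> submodule (delta f ` carrier RA) \<Lambda> PA"
  by (rule submodule_image[OF RA_rm Proj_rm delta_Hom submodule_carrier[OF RA_rm]])

lemma coker_isomorphic_iff:
  assumes f: "f \<in> Hom \<Lambda> RA PA" and M: "right_module \<Lambda> M"
  shows "isomorphic \<Lambda> (coker_rep \<Lambda> n P \<alpha> f) M \<longleftrightarrow>
    (\<exists>\<pi>\<in>Hom \<Lambda> PA M. \<pi> ` carrier PA = carrier M \<and> kern PA M \<pi> = delta f ` carrier RA)"
proof -
  have "coker_rep \<Lambda> n P \<alpha> f = quot_module PA (delta f ` carrier RA)"
    by (simp add: coker_rep_def delta_def)
  then show ?thesis
    using isomorphic_quot_iff[OF Proj_rm delta_submodule[OF f] M] by simp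
qed

text \<open>If \<open>f x = x\<close>, then lowering the weight again and again leaves no component of \<open>x\<close>.\<close>

lemma delta_inj:
  assumes f: "f \<in> carrier V"
  shows "inj_on (delta f) (carrier RA)"
proof -
  interpret PA: right_module \<Lambda> PA by (rule Proj_rm)
  interpret RA: right_module \<Lambda> RA by (rule RA_rm)
  note fH = V_Hom[OF f]
  have "x = \<zero>\<^bsub>RA\<^esub>" if x: "x \<in> carrier RA" and dz: "delta f x = \<zero>\<^bsub>PA\<^esub>" for x
  proof -
    have fx: "f x = x"
      using dz PA.minus_eq_zero_iff[OF HomD(1)[OF fH x] RA_subset[OF x]] by (simp add: delta_apply[OF x])
    obtain B0 where B0: "\<And>jk. jk \<in> copies n \<alpha> \<Longrightarrow> weight (fst jk) < B0"
      using finite_nat_set_iff_bounded[of "(\<lambda>jk. weight (fst jk)) ` copies n \<alpha>"] by auto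
    define C where "C B \<longleftrightarrow> (\<forall>jk\<in>copies n \<alpha>. B \<le> weight (fst jk) \<longrightarrow> x jk = \<zero>\<^bsub>P (fst jk)\<^esub>)" for B
    have step: "C B" if "C (Suc B)" for B
      unfolding C_def
    proof (intro ballI impI)
      fix jk assume jk: "jk \<in> copies n \<alpha>" "B \<le> weight (fst jk)"
      have "f x jk = \<zero>\<^bsub>P (fst jk)\<^esub>"
        by (rule Rep_lowers_weight[OF f x _ jk]) (use that in \<open>simp add: C_def\<close>)
      then show "x jk = \<zero>\<^bsub>P (fst jk)\<^esub>" by (simp add: fx)
    qed
    have "C B0" unfolding C_def using B0 by (blast dest: leD)
    then have "C 0" using step by (induction B0) auto
    then have z: "\<And>jk. jk \<in> copies n \<alpha> \<Longrightarrow> x jk = \<zero>\<^bsub>P (fst jk)\<^esub>" by (simp add: C_def)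
    show ?thesis
    proof (rule PiE_ext[OF x[unfolded RA_carrier] RA.M.zero_closed[unfolded RA_carrier]])
      fix jk assume "jk \<in> copies n \<alpha>"
      then show "x jk = \<zero>\<^bsub>RA\<^esub> jk" by (simp add: z Proj_ops)
    qed
  qed
  then have "kern RA PA (delta f) = {\<zero>\<^bsub>RA\<^esub>}"
    using Hom_zero[OF RA_rm Proj_rm delta_Hom[OF fH]] RA.M.zero_closed unfolding kern_def by blast
  then show ?thesis using inj_on_iff_kern[OF RA_rm Proj_rm delta_Hom[OF fH]] by blast
qed

definition mask :: "(nat \<Rightarrow> bool) \<Rightarrow> (nat \<times> nat \<Rightarrow> 'p) \<Rightarrow> (nat \<times> nat \<Rightarrow> 'p)" where
  "mask Q = (\<lambda>x\<in>carrier PA. \<lambda>jk\<in>copies n \<alpha>. if Q (fst jk) then x jk else \<zero>\<^bsub>P (fst jk)\<^esub>)"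

lemma mask_Hom: "mask Q \<in> Hom \<Lambda> PA PA"
proof -
  interpret PA: right_module \<Lambda> PA by (rule Proj_rm)
  note z = P_zero
  show ?thesis
  proof (rule HomI)
    fix x assume "x \<in> carrier PA"
    then show "mask Q x \<in> carrier PA"
      using z by (auto simp: mask_def Proj_carrier copies_iff PiE_iff)
  next
    fix x y assume xy: "x \<in> carrier PA" "y \<in> carrier PA"
    show "mask Q (x \<oplus>\<^bsub>PA\<^esub> y) = mask Q x \<oplus>\<^bsub>PA\<^esub> mask Q y"
      using xy PA.M.a_closed[OF xy] z by (auto simp: mask_def Proj_ops copies_iff intro!: restrict_ext)
  next
    fix a x assume ax: "a \<in> carrier \<Lambda>" "x \<in> carrier PA"
    show "mask Q (a \<odot>\<^bsub>PA\<^esub> x) = a \<odot>\<^bsub>PA\<^esub> mask Q x"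
      using ax PA.smult_closed[OF ax] z by (auto simp: mask_def Proj_ops copies_iff intro!: restrict_ext)
  qed (simp add: mask_def)
qed

lemma mask_split:
  assumes x: "x \<in> carrier PA"
  shows "mask Q x \<oplus>\<^bsub>PA\<^esub> mask (\<lambda>i. \<not> Q i) x = x"
proof -
  interpret PA: right_module \<Lambda> PA by (rule Proj_rm)
  note c = HomD(1)[OF mask_Hom x]
  show ?thesis
  proof (rule PiE_ext[OF PA.M.a_closed[OF c c, unfolded Proj_carrier] x[unfolded Proj_carrier]])
    fix jk assume jk: "jk \<in> copies n \<alpha>"
    interpret Pj: right_module \<Lambda> "P (fst jk)" by (rule P_rm) (use jk in \<open>simp add: copies_iff\<close>)
    have "x jk \<in> carrier (P (fst jk))" using x jk by (auto simp: Proj_carrier PiE_iff)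
    then show "(mask Q x \<oplus>\<^bsub>PA\<^esub> mask (\<lambda>i. \<not> Q i) x) jk = x jk"
      using jk x by (simp add: mask_def Proj_ops)
  qed
qed

text \<open>
  Modulo the image of \<open>delta f\<close>, an element of the radical may be replaced by its image under \<open>f\<close>,
  whose weight is lower. So every map from \<open>P i\<close> can be moved into the components \<open>P i\<close>.
\<close>

lemma Hom_mod_delta_supported:
  assumes f: "f \<in> carrier V" and i: "i < n"
  shows "g \<in> Hom \<Lambda> (P i) PA \<Longrightarrow>
    (\<And>y jk. \<lbrakk>y \<in> carrier (P i); jk \<in> copies n \<alpha>; fst jk \<noteq> i; B \<le> weight (fst jk)\<rbrakk> \<Longrightarrow> g y jk = \<zero>\<^bsub>P (fst jk)\<^esub>) \<Longrightarrow>
    \<exists>g'\<in>Hom \<Lambda> (P i) PA. (\<forall>y\<in>carrier (P i). supported i (g' y) \<and> g' y \<ominus>\<^bsub>PA\<^esub> g y \<in> delta f ` carrier RA)"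
proof (induction B arbitrary: g)
  case 0
  interpret PA: right_module \<Lambda> PA by (rule Proj_rm)
  have "g y \<ominus>\<^bsub>PA\<^esub> g y \<in> delta f ` carrier RA" if "y \<in> carrier (P i)" for y
    using submodule_zero[OF Proj_rm delta_submodule[OF V_Hom[OF f]]]
      PA.minus_eq_zero_iff[OF HomD(1)[OF 0(1) that] HomD(1)[OF 0(1) that]] by simp
  moreover have "supported i (g y)" if "y \<in> carrier (P i)" for y
    using 0(2)[OF that] by (simp add: supported_def)
  ultimately show ?case using 0(1) by blast
next
  case (Suc B)
  interpret PA: right_module \<Lambda> PA by (rule Proj_rm)
  note fH = V_Hom[OF f]
  note I = delta_submodule[OF fH]
  let ?gi = "compose (carrier (P i)) (mask (\<lambda>j. j = i)) g"
  let ?r = "compose (carrier (P i)) (mask (\<lambda>j. \<not> j = i)) g"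
  have gi: "?gi \<in> Hom \<Lambda> (P i) PA" and r: "?r \<in> Hom \<Lambda> (P i) PA"
    by (rule Hom_compose[OF Suc.prems(1) mask_Hom P_rm[OF i]])+
  have gc: "g y \<in> carrier PA" if "y \<in> carrier (P i)" for y by (rule HomD(1)[OF Suc.prems(1) that])
  have rR: "?r y \<in> carrier RA" if y: "y \<in> carrier (P i)" for y
  proof -
    have "?r y jk \<in> radical \<Lambda> (P (fst jk))" if jk: "jk \<in> copies n \<alpha>" for jk
    proof -
      have j: "fst jk < n" using jk by (simp add: copies_iff)
      show ?thesis
      proof (cases "fst jk = i")
        case True
        then show ?thesis
          using jk y gc[OF y] submodule_zero[OF P_rm[OF j] rad_P_submodule[OF j]]
          by (simp add: compose_eq mask_def)
      next
        case False
        have "compose (carrier (P i)) (\<lambda>x\<in>carrier PA. x jk) g y \<in> radical \<Lambda> (P (fst jk))"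
          by (rule distinct_into_radical[OF i j _ Hom_compose[OF Suc.prems(1) Proj_proj_Hom[OF jk] P_rm[OF i]] y])
             (use False in auto)
        then show ?thesis using False jk y gc[OF y] by (simp add: compose_eq mask_def)
      qed
    qed
    moreover have "?r y \<in> extensional (copies n \<alpha>)"
      using y gc[OF y] by (simp add: compose_eq mask_def)
    ultimately show ?thesis unfolding RA_carrier by (auto simp: PiE_iff)
  qed
  have r': "?r \<in> Hom \<Lambda> (P i) RA"
    unfolding RA_eq by (rule Hom_into_sub[OF r]) (use rR in \<open>simp add: RA_eq\<close>)
  let ?g = "\<lambda>y\<in>carrier (P i). ?gi y \<oplus>\<^bsub>PA\<^esub> compose (carrier (P i)) f ?r y"
  have g: "?g \<in> Hom \<Lambda> (P i) PA"
    by (rule Hom_add[OF P_rm[OF i] Proj_rm gi Hom_compose[OF r' fH P_rm[OF i]]])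
  have "\<exists>g'\<in>Hom \<Lambda> (P i) PA. \<forall>y\<in>carrier (P i). supported i (g' y) \<and> g' y \<ominus>\<^bsub>PA\<^esub> ?g y \<in> delta f ` carrier RA"
  proof (rule Suc.IH[OF g])
    fix y jk assume y: "y \<in> carrier (P i)" and jk: "jk \<in> copies n \<alpha>" "fst jk \<noteq> i" "B \<le> weight (fst jk)"
    interpret Pj: right_module \<Lambda> "P (fst jk)" by (rule P_rm) (use jk in \<open>simp add: copies_iff\<close>)
    have "f (?r y) jk = \<zero>\<^bsub>P (fst jk)\<^esub>"
    proof (rule Rep_lowers_weight[OF f rR[OF y] _ jk(1,3)])
      fix ml assume ml: "ml \<in> copies n \<alpha>" "Suc B \<le> weight (fst ml)"
      show "?r y ml = \<zero>\<^bsub>P (fst ml)\<^esub>"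
        using Suc.prems(2)[OF y ml(1) _ ml(2)] ml y gc[OF y] by (simp add: compose_eq mask_def)
    qed
    moreover have "?gi y jk = \<zero>\<^bsub>P (fst jk)\<^esub>"
      using jk y gc[OF y] by (simp add: compose_eq mask_def)
    ultimately show "?g y jk = \<zero>\<^bsub>P (fst jk)\<^esub>"
      using jk(1) y by (simp add: compose_eq Proj_ops)
  qed
  then obtain g' where g': "g' \<in> Hom \<Lambda> (P i) PA"
    and supp: "\<And>y. y \<in> carrier (P i) \<Longrightarrow> supported i (g' y)"
    and diff: "\<And>y. y \<in> carrier (P i) \<Longrightarrow> g' y \<ominus>\<^bsub>PA\<^esub> ?g y \<in> delta f ` carrier RA" by blast
  have "g' y \<ominus>\<^bsub>PA\<^esub> g y \<in> delta f ` carrier RA" if y: "y \<in> carrier (P i)" for y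
  proof -
    define a where "a = ?gi y"
    define b where "b = ?r y"
    have c: "a \<in> carrier PA" "b \<in> carrier PA" "f b \<in> carrier PA" "g' y \<in> carrier PA"
      using HomD(1)[OF gi y] HomD(1)[OF r y] HomD(1)[OF fH rR[OF y]] HomD(1)[OF g' y] by (simp_all add: a_def b_def)
    have gy: "g y = a \<oplus>\<^bsub>PA\<^esub> b"
      using mask_split[OF gc[OF y], of "\<lambda>j. j = i"] y by (simp add: a_def b_def compose_eq)
    have Gy: "?g y = a \<oplus>\<^bsub>PA\<^esub> f b" using y by (simp add: a_def b_def compose_eq)
    have "(a \<oplus>\<^bsub>PA\<^esub> f b) \<ominus>\<^bsub>PA\<^esub> (a \<oplus>\<^bsub>PA\<^esub> b) = f b \<ominus>\<^bsub>PA\<^esub> b"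
      using c PA.M.a_lcomm[of "f b" "\<ominus>\<^bsub>PA\<^esub> a" "\<ominus>\<^bsub>PA\<^esub> b"]
      by (simp add: a_minus_def PA.M.minus_add PA.M.a_assoc PA.M.r_neg2)
    then have 1: "(a \<oplus>\<^bsub>PA\<^esub> f b) \<ominus>\<^bsub>PA\<^esub> g y \<in> delta f ` carrier RA"
      using rR[OF y] by (auto simp: gy b_def delta_apply[symmetric])
    have 2: "g' y \<ominus>\<^bsub>PA\<^esub> (a \<oplus>\<^bsub>PA\<^esub> f b) \<in> delta f ` carrier RA" using diff[OF y] Gy by simp
    have "(x \<ominus>\<^bsub>PA\<^esub> w) \<oplus>\<^bsub>PA\<^esub> (w \<ominus>\<^bsub>PA\<^esub> z) = x \<ominus>\<^bsub>PA\<^esub> z"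
      if "x \<in> carrier PA" "w \<in> carrier PA" "z \<in> carrier PA" for x w z
      using that by (simp add: a_minus_def PA.M.a_assoc PA.M.r_neg1)
    from this[OF c(4) PA.M.a_closed[OF c(1,3)] gc[OF y]]
    have "(g' y \<ominus>\<^bsub>PA\<^esub> (a \<oplus>\<^bsub>PA\<^esub> f b)) \<oplus>\<^bsub>PA\<^esub> ((a \<oplus>\<^bsub>PA\<^esub> f b) \<ominus>\<^bsub>PA\<^esub> g y) = g' y \<ominus>\<^bsub>PA\<^esub> g y" .
    then show ?thesis using submodule_add[OF Proj_rm I 2 1] by simp
  qed
  then show ?case using g' supp by blast
qed


section \<open>Every module of dimension vector $\alpha$ is some $N_f$\<close>

text \<open>An $\mathrm{End}(P_i)$-basis of $\mathrm{Hom}(P_i,M)$ with its two defining properties, read pointwise.\<close>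

definition hom_basis :: "('a, 'm) module \<Rightarrow> nat \<Rightarrow> (nat \<Rightarrow> 'p \<Rightarrow> 'm) \<Rightarrow> bool" where
  "hom_basis M i b \<longleftrightarrow> (\<forall>k<\<alpha> i. b k \<in> Hom \<Lambda> (P i) M) \<and>
     (\<forall>u\<in>Hom \<Lambda> (P i) M. \<exists>c. (\<forall>k<\<alpha> i. c k \<in> Hom \<Lambda> (P i) (P i)) \<and>
        (\<forall>y\<in>carrier (P i). u y = (\<Oplus>\<^bsub>M\<^esub>k\<in>{..<\<alpha> i}. b k (c k y)))) \<and>
     (\<forall>c. (\<forall>k<\<alpha> i. c k \<in> Hom \<Lambda> (P i) (P i)) \<longrightarrow>
        (\<forall>y\<in>carrier (P i). (\<Oplus>\<^bsub>M\<^esub>k\<in>{..<\<alpha> i}. b k (c k y)) = \<zero>\<^bsub>M\<^esub>) \<longrightarrow>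
        (\<forall>k<\<alpha> i. \<forall>y\<in>carrier (P i). c k y = \<zero>\<^bsub>P i\<^esub>))"

text \<open>
  $\mathrm{Hom}(P_i,M)$ has finite dimension over the division ring $\mathrm{End}(P_i)$, and the
  dimension vector counts the elements of a basis.
\<close>

lemma hom_basis_exists:
  assumes M: "fd_module K \<Lambda> M" and i: "i < n" and dim: "dimv \<Lambda> (P i) M = \<alpha> i"
  shows "\<exists>b. hom_basis M i b"
proof -
  let ?D = "End_ring \<Lambda> (P i)" and ?H = "hom_precomp \<Lambda> (P i) M"
  have Mr: "right_module \<Lambda> M" using M by (simp add: fd_module_def)
  note Pr = P_rm[OF i]
  interpret M: right_module \<Lambda> M by (rule Mr)
  interpret Pi: right_module \<Lambda> "P i" by (rule Pr)
  have H: "right_module ?D ?H" by (rule right_module_hom_precomp[OF Pr Mr])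
  interpret H: right_module ?D ?H by (rule H)
  have fin: "finite_dim ?D ?H"
    by (rule finite_length_finite_dim[OF division_ring_End[OF i] H finite_length_hom_precomp[OF alg P_fd[OF i] M]])
  define B where "B = (SOME B. finite_basis ?D ?H B)"
  have B: "finite_basis ?D ?H B"
    unfolding B_def by (rule someI_ex) (use fin in \<open>simp add: finite_dim_def\<close>)
  note fB = finite_basisD(1,2)[OF B]
  have BH: "\<beta> \<in> Hom \<Lambda> (P i) M" if "\<beta> \<in> B" for \<beta>
    using that fB(2) by (auto simp: hom_precomp_def)
  have "card B = \<alpha> i" using dim by (simp add: dimv_def dim_over_def B_def)
  then obtain b where b: "bij_betw b {..<\<alpha> i} B"
    using ex_bij_betw_nat_finite[OF fB(1)] by (auto simp: lessThan_atLeast0)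
  have bB: "b k \<in> B" if "k < \<alpha> i" for k using b that by (auto simp: bij_betw_def)
  have cH: "C \<beta> \<odot>\<^bsub>?H\<^esub> \<beta> \<in> Hom \<Lambda> (P i) M" if "C \<in> B \<rightarrow> Hom \<Lambda> (P i) (P i)" "\<beta> \<in> B" for C \<beta>
    using Hom_compose[OF _ BH[OF that(2)] Pr, of "C \<beta>"] that by (auto simp: hom_precomp_def)
  have pt: "(\<Oplus>\<^bsub>?H\<^esub>\<beta>\<in>B. C \<beta> \<odot>\<^bsub>?H\<^esub> \<beta>) y = (\<Oplus>\<^bsub>M\<^esub>k\<in>{..<\<alpha> i}. b k (C (b k) y))"
    if C: "C \<in> B \<rightarrow> Hom \<Lambda> (P i) (P i)" and y: "y \<in> carrier (P i)" for C y
  proof -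
    have c: "\<beta> (C \<beta> y) \<in> carrier M" if "\<beta> \<in> B" for \<beta>
    proof -
      have "C \<beta> \<in> Hom \<Lambda> (P i) (P i)" using C that by auto
      then show ?thesis by (intro HomD(1)[OF BH[OF that]] HomD(1)[OF _ y])
    qed
    have "(\<Oplus>\<^bsub>?H\<^esub>\<beta>\<in>B. C \<beta> \<odot>\<^bsub>?H\<^esub> \<beta>) y = (\<Oplus>\<^bsub>M\<^esub>\<beta>\<in>B. (C \<beta> \<odot>\<^bsub>?H\<^esub> \<beta>) y)"
      using hom_space_finsum_apply[OF Pr Mr fB(1) cH[OF C] y] by (simp add: hom_precomp_def)
    also have "\<dots> = (\<Oplus>\<^bsub>M\<^esub>\<beta>\<in>B. \<beta> (C \<beta> y))"
      by (rule M.M.finsum_cong') (use c y in \<open>auto simp: hom_precomp_def compose_eq\<close>)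
    also have "\<dots> = (\<Oplus>\<^bsub>M\<^esub>\<beta>\<in>b ` {..<\<alpha> i}. \<beta> (C \<beta> y))"
      using b by (simp add: bij_betw_def)
    also have "\<dots> = (\<Oplus>\<^bsub>M\<^esub>k\<in>{..<\<alpha> i}. b k (C (b k) y))"
      by (rule M.M.finsum_reindex) (use b c in \<open>auto simp: bij_betw_def\<close>)
    finally show ?thesis .
  qed
  have "\<exists>c. (\<forall>k<\<alpha> i. c k \<in> Hom \<Lambda> (P i) (P i)) \<and>
      (\<forall>y\<in>carrier (P i). u y = (\<Oplus>\<^bsub>M\<^esub>k\<in>{..<\<alpha> i}. b k (c k y)))"
    if u: "u \<in> Hom \<Lambda> (P i) M" for u
  proof -
    have "u \<in> carrier ?H" using u by (simp add: hom_precomp_def)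
    then obtain C where C: "C \<in> B \<rightarrow>\<^sub>E carrier ?D" "u = (\<Oplus>\<^bsub>?H\<^esub>\<beta>\<in>B. C \<beta> \<odot>\<^bsub>?H\<^esub> \<beta>)"
      using ex1_implies_ex[OF finite_basisD(3)[OF B]] by blast
    have C': "C \<in> B \<rightarrow> Hom \<Lambda> (P i) (P i)" using C(1) by auto
    show ?thesis
      by (rule exI[of _ "\<lambda>k. C (b k)"]) (use C' bB pt[OF C'] C(2) in auto)
  qed
  moreover have "c k y = \<zero>\<^bsub>P i\<^esub>"
    if c: "\<forall>k<\<alpha> i. c k \<in> Hom \<Lambda> (P i) (P i)"
      and z: "\<forall>y\<in>carrier (P i). (\<Oplus>\<^bsub>M\<^esub>k\<in>{..<\<alpha> i}. b k (c k y)) = \<zero>\<^bsub>M\<^esub>"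
      and k: "k < \<alpha> i" and y: "y \<in> carrier (P i)" for c k y
  proof -
    define C where "C = (\<lambda>\<beta>\<in>B. c (inv_into {..<\<alpha> i} b \<beta>))"
    define C0 where "C0 = (\<lambda>\<beta>\<in>B. \<zero>\<^bsub>?D\<^esub>)"
    have Cb: "C (b k) = c k" if "k < \<alpha> i" for k
      using that bB[OF that] inv_into_f_f[of b "{..<\<alpha> i}" k] b by (simp add: C_def bij_betw_def)
    have inv: "inv_into {..<\<alpha> i} b \<beta> < \<alpha> i" if "\<beta> \<in> B" for \<beta>
      using inv_into_into[of \<beta> b "{..<\<alpha> i}"] that b by (simp add: bij_betw_def)
    have CE: "C \<in> B \<rightarrow>\<^sub>E carrier ?D" using c inv by (auto simp: C_def)
    have C0E: "C0 \<in> B \<rightarrow>\<^sub>E carrier ?D" using Hom_zero_map[OF Pr Pr] by (auto simp: C0_def)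
    have zH: "\<zero>\<^bsub>?H\<^esub> = (\<lambda>y\<in>carrier (P i). \<zero>\<^bsub>M\<^esub>)" by (simp add: hom_precomp_def)
    have eq: "\<zero>\<^bsub>?H\<^esub> = (\<Oplus>\<^bsub>?H\<^esub>\<beta>\<in>B. E \<beta> \<odot>\<^bsub>?H\<^esub> \<beta>)"
      if E: "E \<in> B \<rightarrow>\<^sub>E carrier ?D"
        and Ez: "\<And>y. y \<in> carrier (P i) \<Longrightarrow> (\<Oplus>\<^bsub>M\<^esub>k\<in>{..<\<alpha> i}. b k (E (b k) y)) = \<zero>\<^bsub>M\<^esub>" for E
    proof (rule Hom_eqI)
      have E': "E \<in> B \<rightarrow> Hom \<Lambda> (P i) (P i)" using E by auto
      show "\<zero>\<^bsub>?H\<^esub> \<in> Hom \<Lambda> (P i) M" unfolding zH by (rule Hom_zero_map[OF Pr Mr])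
      have "(\<Oplus>\<^bsub>?H\<^esub>\<beta>\<in>B. E \<beta> \<odot>\<^bsub>?H\<^esub> \<beta>) \<in> carrier ?H"
        by (rule H.M.finsum_closed) (use cH[OF E'] in \<open>simp add: hom_precomp_def\<close>)
      then show "(\<Oplus>\<^bsub>?H\<^esub>\<beta>\<in>B. E \<beta> \<odot>\<^bsub>?H\<^esub> \<beta>) \<in> Hom \<Lambda> (P i) M" by (simp add: hom_precomp_def)
      fix y assume y: "y \<in> carrier (P i)"
      show "\<zero>\<^bsub>?H\<^esub> y = (\<Oplus>\<^bsub>?H\<^esub>\<beta>\<in>B. E \<beta> \<odot>\<^bsub>?H\<^esub> \<beta>) y"
        using pt[OF E' y] Ez[OF y] y by (simp add: zH)
    qed
    have zC: "\<zero>\<^bsub>?H\<^esub> = (\<Oplus>\<^bsub>?H\<^esub>\<beta>\<in>B. C \<beta> \<odot>\<^bsub>?H\<^esub> \<beta>)"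
    proof (rule eq[OF CE])
      fix y assume y: "y \<in> carrier (P i)"
      have "(\<Oplus>\<^bsub>M\<^esub>k\<in>{..<\<alpha> i}. b k (C (b k) y)) = (\<Oplus>\<^bsub>M\<^esub>k\<in>{..<\<alpha> i}. b k (c k y))"
      proof (rule M.M.finsum_cong')
        show "(\<lambda>k. b k (c k y)) \<in> {..<\<alpha> i} \<rightarrow> carrier M"
        proof
          fix k assume "k \<in> {..<\<alpha> i}"
          then have k: "k < \<alpha> i" by simp
          show "b k (c k y) \<in> carrier M"
            by (rule HomD(1)[OF BH[OF bB[OF k]] HomD(1)[OF c[rule_format, OF k] y]])
        qed
      qed (simp_all add: Cb)
      then show "(\<Oplus>\<^bsub>M\<^esub>k\<in>{..<\<alpha> i}. b k (C (b k) y)) = \<zero>\<^bsub>M\<^esub>" using z y by simp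
    qed
    have zC0: "\<zero>\<^bsub>?H\<^esub> = (\<Oplus>\<^bsub>?H\<^esub>\<beta>\<in>B. C0 \<beta> \<odot>\<^bsub>?H\<^esub> \<beta>)"
    proof (rule eq[OF C0E])
      fix y assume y: "y \<in> carrier (P i)"
      have "(\<Oplus>\<^bsub>M\<^esub>k\<in>{..<\<alpha> i}. b k (C0 (b k) y)) = (\<Oplus>\<^bsub>M\<^esub>k\<in>{..<\<alpha> i}. \<zero>\<^bsub>M\<^esub>)"
        by (rule M.M.finsum_cong') (use bB y Hom_zero[OF Pr Mr BH[OF bB]] in \<open>auto simp: C0_def\<close>)
      then show "(\<Oplus>\<^bsub>M\<^esub>k\<in>{..<\<alpha> i}. b k (C0 (b k) y)) = \<zero>\<^bsub>M\<^esub>" by simp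
    qed
    have "C = C0"
      using the1_equality[OF finite_basisD(3)[OF B H.M.zero_closed], OF conjI[OF CE zC]]
        the1_equality[OF finite_basisD(3)[OF B H.M.zero_closed], OF conjI[OF C0E zC0]] by (rule trans[OF sym])
    then have "c k = C0 (b k)" using Cb[OF k] by simp
    then show ?thesis using bB[OF k] y by (simp add: C0_def)
  qed
  moreover have "\<forall>k<\<alpha> i. b k \<in> Hom \<Lambda> (P i) M" using BH bB by blast
  ultimately show ?thesis unfolding hom_basis_def by (intro exI[of _ b]) simp
qed

text \<open>
  Let \<open>\<pi>\<close> be the map from $P(\alpha)$ to \<open>M\<close> given by the bases. A map from \<open>P i\<close> to \<open>M\<close> lifts
  along \<open>\<pi>\<close> uniquely into the components \<open>P i\<close>; lifting the restriction of \<open>\<pi>\<close> to each summand of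
  the radical yields the \<open>f\<close> with \<open>\<pi> \<circ> f = \<pi> \<circ> inc\<close>. That \<open>\<pi>\<close> presents \<open>M\<close> as the
  cokernel of \<open>delta f\<close> is tested on maps from the \<open>P i\<close>.
\<close>

lemma exists_presentation:
  assumes M: "fd_module K \<Lambda> M" and dim: "\<And>i. i < n \<Longrightarrow> dimv \<Lambda> (P i) M = \<alpha> i"
  shows "\<exists>f\<in>carrier V. isomorphic \<Lambda> (coker_rep \<Lambda> n P \<alpha> f) M"
proof -
  have Mr: "right_module \<Lambda> M" using M by (simp add: fd_module_def)
  interpret M: right_module \<Lambda> M by (rule Mr)
  interpret PA: right_module \<Lambda> PA by (rule Proj_rm)
  have "\<forall>i. \<exists>b. i < n \<longrightarrow> hom_basis M i b" using hom_basis_exists[OF M _ dim] by blast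
  then obtain b where b: "\<And>i. i < n \<Longrightarrow> hom_basis M i (b i)" by metis
  have bH: "b i k \<in> Hom \<Lambda> (P i) M" if "i < n" "k < \<alpha> i" for i k
    using b[OF that(1)] that(2) by (simp add: hom_basis_def)
  let ?N = "\<lambda>(i, k). P i"
  let ?M = "\<lambda>((j, k), (i, l)). P i"
  have Nik: "?N ik = P (fst ik)" for ik :: "nat \<times> nat" by (simp add: split_beta)
  have Mr': "?M r = P (fst (snd r))" for r :: "(nat \<times> nat) \<times> (nat \<times> nat)" by (simp add: split_beta)
  define \<pi> where "\<pi> = ds_copair (copies n \<alpha>) ?N M (\<lambda>ik. b (fst ik) (snd ik))"
  have bN: "b (fst ik) (snd ik) \<in> Hom \<Lambda> (?N ik) M" if "ik \<in> copies n \<alpha>" for ik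
    using bH[of "fst ik" "snd ik"] that by (simp add: Nik copies_iff)
  have \<pi>: "\<pi> \<in> Hom \<Lambda> PA M"
    unfolding \<pi>_def Proj_def by (rule ds_copair_Hom[OF ring_\<Lambda> finite_copies copy_rm Mr bN])
  have \<pi>x: "\<pi> x = (\<Oplus>\<^bsub>M\<^esub>ik\<in>copies n \<alpha>. b (fst ik) (snd ik) (x ik))" if "x \<in> carrier PA" for x
    using that by (simp add: \<pi>_def ds_copair_def Proj_def)
  have \<pi>s: "\<pi> x = (\<Oplus>\<^bsub>M\<^esub>k\<in>{..<\<alpha> i}. b i k (x (i, k)))"
    if x: "x \<in> carrier PA" and s: "supported i x" and i: "i < n" for x i
  proof -
    have c: "b (fst ik) (snd ik) (x ik) \<in> carrier M" if "ik \<in> copies n \<alpha>" for ik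
      using HomD(1)[OF bH[of "fst ik" "snd ik"], of "x ik"] that x by (auto simp: copies_iff Proj_carrier PiE_iff)
    have sub: "Pair i ` {..<\<alpha> i} \<subseteq> copies n \<alpha>" using i by (auto simp: copies_iff)
    have "(\<Oplus>\<^bsub>M\<^esub>ik\<in>Pair i ` {..<\<alpha> i}. b (fst ik) (snd ik) (x ik)) =
        (\<Oplus>\<^bsub>M\<^esub>ik\<in>copies n \<alpha>. b (fst ik) (snd ik) (x ik))"
    proof (rule M.M.add.finprod_mono_neutral_cong_left)
      show "\<And>ik. ik \<in> copies n \<alpha> - Pair i ` {..<\<alpha> i} \<Longrightarrow> b (fst ik) (snd ik) (x ik) = \<zero>\<^bsub>M\<^esub>"
      proof -
        fix ik assume ik: "ik \<in> copies n \<alpha> - Pair i ` {..<\<alpha> i}"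
        then have "fst ik \<noteq> i" by (cases ik) (auto simp: copies_iff)
        then have "x ik = \<zero>\<^bsub>P (fst ik)\<^esub>" using s ik by (simp add: supported_def)
        moreover have "fst ik < n" "snd ik < \<alpha> (fst ik)" using ik by (auto simp: copies_iff)
        ultimately show "b (fst ik) (snd ik) (x ik) = \<zero>\<^bsub>M\<^esub>"
          using Hom_zero[OF P_rm Mr bH] by simp
      qed
    qed (use sub c in auto)
    moreover have "(\<Oplus>\<^bsub>M\<^esub>ik\<in>Pair i ` {..<\<alpha> i}. b (fst ik) (snd ik) (x ik)) =
        (\<Oplus>\<^bsub>M\<^esub>k\<in>{..<\<alpha> i}. b (fst (i, k)) (snd (i, k)) (x (i, k)))"
      by (rule M.M.finsum_reindex) (use c sub in \<open>auto simp: inj_on_def\<close>)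
    ultimately show ?thesis using \<pi>x[OF x] by simp
  qed
  have unique: "g y = \<zero>\<^bsub>PA\<^esub>"
    if i: "i < n" and g: "g \<in> Hom \<Lambda> (P i) PA" and s: "\<And>y. y \<in> carrier (P i) \<Longrightarrow> supported i (g y)"
      and z: "\<And>y. y \<in> carrier (P i) \<Longrightarrow> \<pi> (g y) = \<zero>\<^bsub>M\<^esub>" and y: "y \<in> carrier (P i)" for i g y
  proof -
    define c where "c k = compose (carrier (P i)) (\<lambda>x\<in>carrier PA. x (i, k)) g" for k
    have c: "c k \<in> Hom \<Lambda> (P i) (P i)" if "k < \<alpha> i" for k
      unfolding c_def using Hom_compose[OF g Proj_proj_Hom[of "(i, k)"] P_rm[OF i]] i that by (simp add: copies_iff)
    have cy: "c k y = g y (i, k)" if "y \<in> carrier (P i)" for k y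
      using that HomD(1)[OF g that] by (simp add: c_def compose_eq)
    have "(\<Oplus>\<^bsub>M\<^esub>k\<in>{..<\<alpha> i}. b i k (c k y)) = \<zero>\<^bsub>M\<^esub>" if y: "y \<in> carrier (P i)" for y
      using \<pi>s[OF HomD(1)[OF g y] s[OF y] i] z[OF y] by (simp add: cy[OF y])
    then have c0: "\<forall>k<\<alpha> i. \<forall>y\<in>carrier (P i). c k y = \<zero>\<^bsub>P i\<^esub>"
      using b[OF i] c unfolding hom_basis_def by blast
    show ?thesis
    proof (rule PiE_ext[OF HomD(1)[OF g y, unfolded Proj_carrier] PA.M.zero_closed[unfolded Proj_carrier]])
      fix jk assume jk: "jk \<in> copies n \<alpha>"
      show "g y jk = \<zero>\<^bsub>PA\<^esub> jk"
      proof (cases "fst jk = i")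
        case True
        then have "c (snd jk) y = \<zero>\<^bsub>P i\<^esub>" "jk = (i, snd jk)" using c0 jk y by (auto simp: copies_iff)
        then show ?thesis using cy[OF y, of "snd jk"] jk True by (simp add: Proj_ops)
      next
        case False
        then show ?thesis using s[OF y] jk by (simp add: supported_def Proj_ops)
      qed
    qed
  qed
  have lift: "\<exists>g\<in>Hom \<Lambda> (P i) PA. \<forall>y\<in>carrier (P i). supported i (g y) \<and> \<pi> (g y) = u y"
    if i: "i < n" and u: "u \<in> Hom \<Lambda> (P i) M" for i u
  proof -
    interpret Pi: right_module \<Lambda> "P i" by (rule P_rm[OF i])
    from bspec[OF conjunct1[OF conjunct2[OF b[OF i, unfolded hom_basis_def]]] u]
    obtain c where "\<forall>k<\<alpha> i. c k \<in> Hom \<Lambda> (P i) (P i)"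
      and "\<forall>y\<in>carrier (P i). u y = (\<Oplus>\<^bsub>M\<^esub>k\<in>{..<\<alpha> i}. b i k (c k y))"
      by (elim exE conjE)
    then have c: "\<And>k. k < \<alpha> i \<Longrightarrow> c k \<in> Hom \<Lambda> (P i) (P i)"
      and uc: "\<And>y. y \<in> carrier (P i) \<Longrightarrow> u y = (\<Oplus>\<^bsub>M\<^esub>k\<in>{..<\<alpha> i}. b i k (c k y))"
      by simp_all
    define g where "g = (\<lambda>y\<in>carrier (P i). \<lambda>jk\<in>copies n \<alpha>. if fst jk = i then c (snd jk) y else \<zero>\<^bsub>P (fst jk)\<^esub>)"
    note z = P_zero
    have cc: "c k y \<in> carrier (P i)" if "k < \<alpha> i" "y \<in> carrier (P i)" for k y
      by (rule HomD(1)[OF c[OF that(1)] that(2)])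
    have g: "g \<in> Hom \<Lambda> (P i) PA"
    proof (rule HomI)
      fix y assume "y \<in> carrier (P i)"
      then show "g y \<in> carrier PA"
        using z cc by (auto simp: g_def Proj_carrier copies_iff PiE_iff)
    next
      fix y y' assume "y \<in> carrier (P i)" "y' \<in> carrier (P i)"
      then show "g (y \<oplus>\<^bsub>P i\<^esub> y') = g y \<oplus>\<^bsub>PA\<^esub> g y'"
        using z HomD(3)[OF c] by (auto simp: g_def Proj_ops copies_iff intro!: restrict_ext)
    next
      fix a y assume "a \<in> carrier \<Lambda>" "y \<in> carrier (P i)"
      then show "g (a \<odot>\<^bsub>P i\<^esub> y) = a \<odot>\<^bsub>PA\<^esub> g y"
        using z HomD(4)[OF c] by (auto simp: g_def Proj_ops copies_iff intro!: restrict_ext)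
    qed (simp add: g_def)
    have s: "supported i (g y)" if "y \<in> carrier (P i)" for y
      using that by (simp add: supported_def g_def)
    have "\<pi> (g y) = u y" if y: "y \<in> carrier (P i)" for y
    proof -
      have "\<pi> (g y) = (\<Oplus>\<^bsub>M\<^esub>k\<in>{..<\<alpha> i}. b i k (g y (i, k)))"
        by (rule \<pi>s[OF HomD(1)[OF g y] s[OF y] i])
      also have "\<dots> = (\<Oplus>\<^bsub>M\<^esub>k\<in>{..<\<alpha> i}. b i k (c k y))"
        by (rule M.M.finsum_cong')
           (use y i cc HomD(1)[OF bH[OF i]] in \<open>auto simp: g_def copies_iff\<close>)
      finally show ?thesis using uc[OF y] by simp
    qed
    then show ?thesis using g s by blast
  qed
  let ?\<iota> = "ds_inj rad_index ?M"
  have \<iota>: "?\<iota> r \<in> Hom \<Lambda> (P (fst (snd r))) QA" if r: "r \<in> rad_index" for r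
    using ds_inj_Hom[where M = ?M and I = rad_index and i = r, OF ring_\<Lambda> finite_rad_index rad_index_rm r]
    by (simp add: QA_eq split_beta)
  have rn: "fst (snd r) < n" if "r \<in> rad_index" for r using that by (simp add: rad_index_iff copies_iff)
  have "\<exists>g\<in>Hom \<Lambda> (P (fst (snd r))) PA. \<forall>y\<in>carrier (P (fst (snd r))).
      supported (fst (snd r)) (g y) \<and> \<pi> (g y) = \<pi> (\<Phi> (?\<iota> r y))" if r: "r \<in> rad_index" for r
  proof -
    have "\<exists>g\<in>Hom \<Lambda> (P (fst (snd r))) PA. \<forall>y\<in>carrier (P (fst (snd r))). supported (fst (snd r)) (g y) \<and>
        \<pi> (g y) = compose (carrier (P (fst (snd r)))) \<pi> (compose (carrier (P (fst (snd r)))) \<Phi> (?\<iota> r)) y"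
      by (rule lift[OF rn[OF r] Hom_compose[OF Hom_compose[OF \<iota>[OF r] \<Phi>_Hom_PA P_rm[OF rn[OF r]]] \<pi> P_rm[OF rn[OF r]]]])
    then show ?thesis by (simp add: compose_eq)
  qed
  then obtain g where g: "\<And>r. r \<in> rad_index \<Longrightarrow> g r \<in> Hom \<Lambda> (P (fst (snd r))) PA"
    and gs: "\<And>r y. \<lbrakk>r \<in> rad_index; y \<in> carrier (P (fst (snd r)))\<rbrakk> \<Longrightarrow> supported (fst (snd r)) (g r y)"
    and g\<pi>: "\<And>r y. \<lbrakk>r \<in> rad_index; y \<in> carrier (P (fst (snd r)))\<rbrakk> \<Longrightarrow> \<pi> (g r y) = \<pi> (\<Phi> (?\<iota> r y))"
    by metis
  define F where "F = ds_copair rad_index ?M PA g"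
  have gM: "g r \<in> Hom \<Lambda> (?M r) PA" if "r \<in> rad_index" for r using g[OF that] by (simp add: Mr')
  have F: "F \<in> Hom \<Lambda> QA PA"
    unfolding F_def QA_eq by (rule ds_copair_Hom[OF ring_\<Lambda> finite_rad_index rad_index_rm Proj_rm gM])
  have Fq: "F q = (\<Oplus>\<^bsub>PA\<^esub>r\<in>rad_index. g r (q r))" if "q \<in> carrier QA" for q
    using that by (simp add: F_def ds_copair_def QA_eq)
  have qr: "q r \<in> carrier (P (fst (snd r)))" if "q \<in> carrier QA" "r \<in> rad_index" for q r
    using that by (auto simp: QA_carrier PiE_iff)
  have gc: "g r (q r) \<in> carrier PA" if "q \<in> carrier QA" "r \<in> rad_index" for q r
    by (rule HomD(1)[OF g[OF that(2)] qr[OF that]])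
  have \<pi>F: "\<pi> (F q) = \<pi> (\<Phi> q)" if q: "q \<in> carrier QA" for q
  proof -
    have "\<pi> (F q) = (\<Oplus>\<^bsub>M\<^esub>r\<in>rad_index. \<pi> (g r (q r)))"
      unfolding Fq[OF q] by (rule Hom_finsum[OF Proj_rm Mr \<pi> finite_rad_index gc[OF q]])
    also have "\<dots> = (\<Oplus>\<^bsub>M\<^esub>r\<in>rad_index. compose (carrier QA) \<pi> \<Phi> (?\<iota> r (q r)))"
    proof (rule M.M.finsum_cong')
      fix r assume r: "r \<in> rad_index"
      show "\<pi> (g r (q r)) = compose (carrier QA) \<pi> \<Phi> (?\<iota> r (q r))"
        using g\<pi>[OF r qr[OF q r]] HomD(1)[OF \<iota>[OF r] qr[OF q r]] by (simp add: compose_eq)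
    qed (use HomD(1)[OF Hom_compose[OF \<Phi>_Hom_PA \<pi> QA_rm]] HomD(1)[OF \<iota>] qr[OF q] in auto)
    also have "\<dots> = compose (carrier QA) \<pi> \<Phi> (\<Oplus>\<^bsub>QA\<^esub>r\<in>rad_index. ?\<iota> r (q r))"
      by (rule Hom_finsum[OF QA_rm Mr Hom_compose[OF \<Phi>_Hom_PA \<pi> QA_rm] finite_rad_index, symmetric])
         (rule HomD(1)[OF \<iota> qr[OF q]])
    also have "(\<Oplus>\<^bsub>QA\<^esub>r\<in>rad_index. ?\<iota> r (q r)) = q"
      using ds_sum_inj[where M = ?M and I = rad_index and x = q, OF ring_\<Lambda> finite_rad_index rad_index_rm] q
      by (simp add: QA_eq)
    finally show ?thesis using q by (simp add: compose_eq)
  qed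
  have Fs: "supported i (F q)" if q: "q \<in> carrier QA" and s: "source_supported i q" for i q
    unfolding supported_def
  proof (intro ballI impI)
    fix jk assume jk: "jk \<in> copies n \<alpha>" "fst jk \<noteq> i"
    have j: "fst jk < n" using jk by (simp add: copies_iff)
    interpret Pj: right_module \<Lambda> "P (fst jk)" by (rule P_rm[OF j])
    let ?p = "\<lambda>x\<in>carrier PA. x jk"
    note p = Proj_proj_Hom[OF jk(1)]
    have "?p (F q) = (\<Oplus>\<^bsub>P (fst jk)\<^esub>r\<in>rad_index. ?p (g r (q r)))"
      unfolding Fq[OF q] by (rule Hom_finsum[OF Proj_rm P_rm[OF j] p finite_rad_index gc[OF q]])
    also have "\<dots> = (\<Oplus>\<^bsub>P (fst jk)\<^esub>r\<in>rad_index. \<zero>\<^bsub>P (fst jk)\<^esub>)"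
    proof (rule Pj.M.finsum_cong')
      fix r assume r: "r \<in> rad_index"
      show "?p (g r (q r)) = \<zero>\<^bsub>P (fst jk)\<^esub>"
      proof (cases "fst (snd r) = i")
        case True
        then show ?thesis using gs[OF r qr[OF q r]] jk gc[OF q r] by (simp add: supported_def)
      next
        case False
        then have "q r = \<zero>\<^bsub>P (fst (snd r))\<^esub>" using s r by (simp add: source_supported_def)
        then have "g r (q r) = \<zero>\<^bsub>PA\<^esub>" using Hom_zero[OF P_rm[OF rn[OF r]] Proj_rm g[OF r]] by simp
        then show ?thesis using Hom_zero[OF Proj_rm P_rm[OF j] p] by (simp only:)
      qed
    qed auto
    finally show "F q jk = \<zero>\<^bsub>P (fst jk)\<^esub>" using HomD(1)[OF F q] by simp
  qed
  obtain \<Theta> where \<Theta>: "\<Theta> \<in> Hom \<Lambda> RA QA" "\<And>q. q \<in> carrier QA \<Longrightarrow> \<Theta> (\<Phi> q) = q"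
    "\<And>x. x \<in> carrier RA \<Longrightarrow> \<Phi> (\<Theta> x) = x"
    by (rule Hom_inverse[OF QA_rm RA_rm \<Phi>_Hom \<Phi>_inj \<Phi>_surj], rule that)
  define f where "f = compose (carrier RA) F \<Theta>"
  have fH: "f \<in> Hom \<Lambda> RA PA" unfolding f_def by (rule Hom_compose[OF \<Theta>(1) F RA_rm])
  have f\<Phi>: "f (\<Phi> q) = F q" if "q \<in> carrier QA" for q
    using \<Phi>_closed[OF that] \<Theta>(2)[OF that] by (simp add: f_def compose_eq)
  have fV: "f \<in> carrier V" unfolding V_carrier using fH f\<Phi> Fs by simp
  have \<pi>f: "\<pi> (f x) = \<pi> x" if x: "x \<in> carrier RA" for x
  proof -
    obtain q where "q \<in> carrier QA" "x = \<Phi> q" using x \<Phi>_surj by blast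
    then show ?thesis using f\<Phi> \<pi>F by simp
  qed
  let ?I = "delta f ` carrier RA" and ?k = "kern PA M \<pi>"
  note I = delta_submodule[OF fH] and k = submodule_kern[OF Proj_rm Mr \<pi>]
  have Ik: "?I \<subseteq> ?k"
  proof
    fix z assume "z \<in> ?I"
    then obtain x where x: "x \<in> carrier RA" "z = delta f x" by blast
    have "f x \<ominus>\<^bsub>PA\<^esub> x \<in> ?k"
      using Hom_eq_iff_kern[OF Proj_rm Mr \<pi> HomD(1)[OF fH x(1)] RA_subset[OF x(1)]] \<pi>f[OF x(1)] by simp
    then show "z \<in> ?k" using x by (simp add: delta_apply)
  qed
  let ?Z = "sub_module PA ?k"
  note Z = right_module_sub[OF Proj_rm k]
  have IZ: "submodule ?I \<Lambda> ?Z" using I Ik by (simp add: submodule_sub_module_iff[OF Proj_rm k])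
  note q = quot_map[OF Z IZ]
  note PAfl = fd_module_finite_length[OF alg Proj_fd]
  have zeroY: "carrier (quot_module ?Z ?I) = {\<zero>\<^bsub>quot_module ?Z ?I\<^esub>}"
  proof (rule zero_if_no_Hom[OF right_module_quot[OF Z IZ]
        finite_length_quot[OF Z finite_length_sub[OF Proj_rm PAfl k] IZ]])
    fix i u y assume i: "i < n" and u: "u \<in> Hom \<Lambda> (P i) (quot_module ?Z ?I)" and y: "y \<in> carrier (P i)"
    let ?q = "\<lambda>x\<in>carrier ?Z. ?I +>\<^bsub>?Z\<^esub> x"
    obtain h where h: "h \<in> Hom \<Lambda> (P i) ?Z" "compose (carrier (P i)) ?q h = u"
      using projective_lift[OF P_projective[OF i] Z right_module_quot[OF Z IZ] q(1,2) u] by blast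
    have hP: "h \<in> Hom \<Lambda> (P i) PA" by (rule Hom_from_into_sub[OF h(1) submodule_subset[OF Proj_rm k]])
    \<comment> \<open>Above all weights, so that nothing is assumed about the components of \<open>h\<close>.\<close>
    obtain B0 where B0: "\<And>jk. jk \<in> copies n \<alpha> \<Longrightarrow> weight (fst jk) < B0"
      using finite_nat_set_iff_bounded[of "(\<lambda>jk. weight (fst jk)) ` copies n \<alpha>"] by auto
    have "\<exists>g'\<in>Hom \<Lambda> (P i) PA. \<forall>y\<in>carrier (P i). supported i (g' y) \<and> g' y \<ominus>\<^bsub>PA\<^esub> h y \<in> ?I"
      by (rule Hom_mod_delta_supported[OF fV i hP, of B0]) (use B0 in \<open>force simp: not_le\<close>)
    then obtain g' where g': "g' \<in> Hom \<Lambda> (P i) PA" "\<And>y. y \<in> carrier (P i) \<Longrightarrow> supported i (g' y)"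
      "\<And>y. y \<in> carrier (P i) \<Longrightarrow> g' y \<ominus>\<^bsub>PA\<^esub> h y \<in> ?I" by blast
    have hk: "h y \<in> ?k" if "y \<in> carrier (P i)" for y using HomD(1)[OF h(1) that] by simp
    have \<pi>g': "\<pi> (g' y) = \<zero>\<^bsub>M\<^esub>" if y: "y \<in> carrier (P i)" for y
    proof -
      have "g' y \<ominus>\<^bsub>PA\<^esub> h y \<in> ?k" using g'(3)[OF y] Ik by blast
      then have "\<pi> (g' y) = \<pi> (h y)"
        using Hom_eq_iff_kern[OF Proj_rm Mr \<pi> HomD(1)[OF g'(1) y] HomD(1)[OF hP y]] by simp
      then show ?thesis using hk[OF y] by (simp add: kern_def)
    qed
    have "g' y = \<zero>\<^bsub>PA\<^esub>" by (rule unique[OF i g'(1,2) \<pi>g' y])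
    then have "\<ominus>\<^bsub>PA\<^esub> h y \<in> ?I" using g'(3)[OF y] HomD(1)[OF hP y] by (simp add: a_minus_def)
    then have "\<ominus>\<^bsub>PA\<^esub> (\<ominus>\<^bsub>PA\<^esub> h y) \<in> ?I" by (rule submodule_uminus[OF Proj_rm I])
    then have "h y \<in> ?I" using HomD(1)[OF hP y] by simp
    then have "h y \<in> kern ?Z (quot_module ?Z ?I) ?q" by (simp only: q(3))
    then have "?q (h y) = \<zero>\<^bsub>quot_module ?Z ?I\<^esub>" unfolding kern_def by blast
    then show "u y = \<zero>\<^bsub>quot_module ?Z ?I\<^esub>"
      using fun_cong[OF h(2), of y] y by (simp add: compose_def)
  qed
  have "?k \<subseteq> ?I"
  proof
    fix z assume z: "z \<in> ?k"
    let ?q = "\<lambda>x\<in>carrier ?Z. ?I +>\<^bsub>?Z\<^esub> x"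
    have zc: "z \<in> carrier ?Z" using z by simp
    have "?q z \<in> carrier (quot_module ?Z ?I)" by (rule HomD(1)[OF q(1) zc])
    then have "?q z = \<zero>\<^bsub>quot_module ?Z ?I\<^esub>" unfolding zeroY by blast
    then have "z \<in> kern ?Z (quot_module ?Z ?I) ?q" using zc unfolding kern_def by blast
    then show "z \<in> ?I" by (simp only: q(3))
  qed
  then have keq: "?k = ?I" using Ik by blast
  let ?J = "\<pi> ` carrier PA"
  note J = submodule_image[OF Proj_rm Mr \<pi> submodule_carrier[OF Proj_rm]]
  note q' = quot_map[OF Mr J]
  have zeroM: "carrier (quot_module M ?J) = {\<zero>\<^bsub>quot_module M ?J\<^esub>}"
  proof (rule zero_if_no_Hom[OF right_module_quot[OF Mr J]
        finite_length_quot[OF Mr fd_module_finite_length[OF alg M] J]])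
    fix i u y assume i: "i < n" and u: "u \<in> Hom \<Lambda> (P i) (quot_module M ?J)" and y: "y \<in> carrier (P i)"
    let ?q = "\<lambda>x\<in>carrier M. ?J +>\<^bsub>M\<^esub> x"
    obtain h where h: "h \<in> Hom \<Lambda> (P i) M" "compose (carrier (P i)) ?q h = u"
      using projective_lift[OF P_projective[OF i] Mr right_module_quot[OF Mr J] q'(1,2) u] by blast
    obtain g' where g': "g' \<in> Hom \<Lambda> (P i) PA" "\<And>y. y \<in> carrier (P i) \<Longrightarrow> \<pi> (g' y) = h y"
      using lift[OF i h(1)] by blast
    have "\<pi> (g' y) \<in> ?J" by (rule imageI) (rule HomD(1)[OF g'(1) y])
    then have "h y \<in> ?J" using g'(2)[OF y] by simp
    then have "h y \<in> kern M (quot_module M ?J) ?q" by (simp only: q'(3))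
    then have "?q (h y) = \<zero>\<^bsub>quot_module M ?J\<^esub>" unfolding kern_def by blast
    then show "u y = \<zero>\<^bsub>quot_module M ?J\<^esub>"
      using fun_cong[OF h(2), of y] y by (simp add: compose_def)
  qed
  have "carrier M \<subseteq> ?J"
  proof
    fix z assume z: "z \<in> carrier M"
    let ?q = "\<lambda>x\<in>carrier M. ?J +>\<^bsub>M\<^esub> x"
    have "?q z \<in> carrier (quot_module M ?J)" by (rule HomD(1)[OF q'(1) z])
    then have "?q z = \<zero>\<^bsub>quot_module M ?J\<^esub>" unfolding zeroM by blast
    then have "z \<in> kern M (quot_module M ?J) ?q" using z unfolding kern_def by blast
    then show "z \<in> ?J" by (simp only: q'(3))
  qed
  then have "?J = carrier M" using submodule_subset[OF Mr J] by blast
  then have "isomorphic \<Lambda> (coker_rep \<Lambda> n P \<alpha> f) M"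
    using coker_isomorphic_iff[OF fH Mr] \<pi> keq by blast
  then show ?thesis using fV by blast
qed


section \<open>The modules isomorphic to a rigid one form an open set\<close>

lemma V_ops:
  "v \<oplus>\<^bsub>V\<^esub> w = (\<lambda>x\<in>carrier RA. v x \<oplus>\<^bsub>PA\<^esub> w x)"
  "k \<odot>\<^bsub>V\<^esub> v = (\<lambda>x\<in>carrier RA. (k \<odot>\<^bsub>\<Lambda>\<^esub> \<one>\<^bsub>\<Lambda>\<^esub>) \<odot>\<^bsub>PA\<^esub> v x)"
  by (simp_all add: Rep_def restrict_def)

text \<open>
  If $N_f$ is rigid, then \<open>g\<close> composed with the projection to $N_f$ extends along \<open>delta f\<close> to a map
  from $P(\alpha)$, which lifts to an endomorphism \<open>a\<close>; the difference lands in the image of \<open>delta f\<close>.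
\<close>

lemma rigid_decompose:
  assumes f: "f \<in> carrier V" and M: "right_module \<Lambda> M" and rig: "rigid \<Lambda> M"
    and \<pi>: "\<pi> \<in> Hom \<Lambda> PA M" "\<pi> ` carrier PA = carrier M" "kern PA M \<pi> = delta f ` carrier RA"
    and g: "g \<in> Hom \<Lambda> RA PA"
  shows "\<exists>a\<in>Hom \<Lambda> PA PA. \<exists>b\<in>Hom \<Lambda> RA RA. \<forall>x\<in>carrier RA. g x = a (delta f x) \<oplus>\<^bsub>PA\<^esub> delta f (b x)"
proof -
  interpret PA: right_module \<Lambda> PA by (rule Proj_rm)
  interpret M: right_module \<Lambda> M by (rule M)
  note \<delta> = delta_Hom[OF V_Hom[OF f]]
  note k = submodule_kern[OF Proj_rm M \<pi>(1)]
  let ?Z = "sub_module PA (kern PA M \<pi>)"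
  note Z = right_module_sub[OF Proj_rm k]
  have \<delta>Z: "delta f \<in> Hom \<Lambda> RA ?Z" by (rule Hom_into_sub[OF \<delta>]) (simp add: \<pi>(3))
  have surj: "delta f ` carrier RA = carrier ?Z" by (simp add: \<pi>(3))
  obtain \<eta> where \<eta>: "\<eta> \<in> Hom \<Lambda> ?Z RA" "\<And>x. x \<in> carrier RA \<Longrightarrow> \<eta> (delta f x) = x"
    "\<And>z. z \<in> carrier ?Z \<Longrightarrow> delta f (\<eta> z) = z"
    by (rule Hom_inverse[OF RA_rm Z \<delta>Z delta_inj[OF f] surj], rule that)
  note \<pi>g = Hom_compose[OF g \<pi>(1) RA_rm]
  obtain h where h: "h \<in> Hom \<Lambda> PA M"
    and hz: "\<And>z. z \<in> kern PA M \<pi> \<Longrightarrow> h z = compose (carrier ?Z) (compose (carrier RA) \<pi> g) \<eta> z"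
    by (rule rigid_extend[OF Proj_projective M rig \<pi>(1,2) Hom_compose[OF \<eta>(1) \<pi>g Z]], rule that)
  have h\<delta>: "h (delta f x) = \<pi> (g x)" if x: "x \<in> carrier RA" for x
    using hz[of "delta f x"] HomD(1)[OF \<delta>Z x] \<eta>(2)[OF x] x by (simp add: compose_eq)
  obtain a where a: "a \<in> Hom \<Lambda> PA PA" "compose (carrier PA) \<pi> a = h"
    using projective_lift[OF Proj_projective Proj_rm M \<pi>(1,2) h] by blast
  have \<pi>a: "\<pi> (a y) = h y" if "y \<in> carrier PA" for y
    using fun_cong[OF a(2), of y] that by (simp add: compose_def)
  let ?e = "\<lambda>x\<in>carrier RA. g x \<ominus>\<^bsub>PA\<^esub> compose (carrier RA) a (delta f) x"
  have e: "?e \<in> Hom \<Lambda> RA PA"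
    by (rule Hom_diff[OF RA_rm Proj_rm g Hom_compose[OF \<delta> a(1) RA_rm]])
  have c: "g x \<in> carrier PA" "delta f x \<in> carrier PA" "a (delta f x) \<in> carrier PA" if "x \<in> carrier RA" for x
    using HomD(1)[OF g that] HomD(1)[OF \<delta> that] HomD(1)[OF a(1)] by auto
  have ek: "?e x \<in> kern PA M \<pi>" if x: "x \<in> carrier RA" for x
    using Hom_eq_iff_kern[OF Proj_rm M \<pi>(1) c(1)[OF x] c(3)[OF x]] h\<delta>[OF x] \<pi>a[OF c(2)[OF x]] x
    by (simp add: compose_eq)
  have eZ: "?e \<in> Hom \<Lambda> RA ?Z" by (rule Hom_into_sub[OF e ek])
  let ?b = "compose (carrier RA) \<eta> ?e"
  have "g x = a (delta f x) \<oplus>\<^bsub>PA\<^esub> delta f (?b x)" if x: "x \<in> carrier RA" for x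
  proof -
    have "delta f (?b x) = g x \<ominus>\<^bsub>PA\<^esub> a (delta f x)"
      using \<eta>(3)[of "?e x"] ek[OF x] x by (simp add: compose_eq)
    then show ?thesis
      using c[OF x] PA.M.a_lcomm[of "a (delta f x)" "g x" "\<ominus>\<^bsub>PA\<^esub> a (delta f x)"]
      by (simp add: a_minus_def PA.M.r_neg)
  qed
  then show ?thesis using a(1) Hom_compose[OF eZ \<eta>(1) RA_rm] by blast
qed

text \<open>
  An isomorphism between presentations \<open>delta f0\<close> and \<open>delta v\<close> is a pair of maps with
  \<open>A (delta f0 x) = delta v (b x)\<close>. By \<open>rigid_decompose\<close> this linear system in the deviation of
  \<open>(A, b)\<close> from the identity is solvable at \<open>f0\<close> with every right-hand side; so \<open>cramer\<close> solves it near
  \<open>f0\<close>, polynomially in \<open>v\<close> and with solution \<open>A = id\<close> at \<open>f0\<close>. Then \<open>A\<close> is bijective near \<open>f0\<close>.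
\<close>

lemma isomorphic_near:
  assumes f0: "f0 \<in> carrier V" and M: "right_module \<Lambda> M" and rig: "rigid \<Lambda> M"
    and iso: "isomorphic \<Lambda> (coker_rep \<Lambda> n P \<alpha> f0) M"
  shows "\<exists>q. poly_fun K V q \<and> q f0 \<noteq> \<zero>\<^bsub>K\<^esub> \<and>
    (\<forall>v\<in>carrier V. q v \<noteq> \<zero>\<^bsub>K\<^esub> \<longrightarrow> isomorphic \<Lambda> (coker_rep \<Lambda> n P \<alpha> v) M)"
proof -
  interpret PS: poly_space K V
    by (intro poly_space.intro fd_field[OF alg] V_rm)
  interpret PA: right_module \<Lambda> PA by (rule Proj_rm)
  interpret RA: right_module \<Lambda> RA by (rule RA_rm)
  interpret HA: right_module K HA by (rule HA_rm)
  let ?HP = "hom_scalars \<Lambda> PA PA" and ?HR = "hom_scalars \<Lambda> RA RA"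
  note HP_rm = right_module_hom_scalars[OF alg Proj_rm Proj_rm, of \<alpha> \<alpha>]
  note HR_rm = right_module_hom_scalars[OF alg RA_rm RA_rm]
  interpret HP: right_module K ?HP by (rule HP_rm)
  interpret HR: right_module K ?HR by (rule HR_rm)
  note us = unit_scalar_closed[OF alg]
  note \<delta>0 = delta_Hom[OF V_Hom[OF f0]]
  obtain \<pi> where \<pi>: "\<pi> \<in> Hom \<Lambda> PA M" "\<pi> ` carrier PA = carrier M" "kern PA M \<pi> = delta f0 ` carrier RA"
    using iso unfolding coker_isomorphic_iff[OF V_Hom[OF f0] M] by blast
  have HAfd: "finite_dim K HA"
    by (rule finite_length_finite_dim[OF division_ring_field[OF fd_field[OF alg]] HA_rm
          finite_length_hom_scalars[OF alg RA_fd Proj_fd]])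
  then obtain B where B: "finite_basis K HA B" by (auto simp: finite_dim_def)
  note fB = finite_basisD(1,2)[OF B]
  obtain \<xi> where \<xi>: "\<And>b. b \<in> B \<Longrightarrow> \<xi> b \<in> Hom K HA (regular K)"
    and \<xi>s: "\<And>x. x \<in> carrier HA \<Longrightarrow> (\<Oplus>\<^bsub>HA\<^esub>b\<in>B. \<xi> b x \<odot>\<^bsub>HA\<^esub> b) = x"
    and "\<And>b b'. \<lbrakk>b \<in> B; b' \<in> B\<rbrakk> \<Longrightarrow> \<xi> b b' = (if b = b' then \<one>\<^bsub>K\<^esub> else \<zero>\<^bsub>K\<^esub>)"
    by (rule basis_coordinates[OF HA_rm B PS.ring_axioms], rule that)
  have \<xi>c: "\<xi> \<beta> h \<in> carrier K" if "\<beta> \<in> B" "h \<in> Hom \<Lambda> RA PA" for \<beta> h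
    using HomD(1)[OF \<xi>[OF that(1)], of h] that(2) by simp
  have BH: "\<beta> \<in> Hom \<Lambda> RA PA" if "\<beta> \<in> B" for \<beta> using that fB(2) by auto
  have "\<forall>\<beta>\<in>B. \<exists>a b. a \<in> Hom \<Lambda> PA PA \<and> b \<in> Hom \<Lambda> RA RA \<and>
      (\<forall>x\<in>carrier RA. \<beta> x = a (delta f0 x) \<oplus>\<^bsub>PA\<^esub> delta f0 (b x))"
    using rigid_decompose[OF f0 M rig \<pi> BH] by blast
  then obtain a b where a: "\<And>\<beta>. \<beta> \<in> B \<Longrightarrow> a \<beta> \<in> Hom \<Lambda> PA PA"
    and b: "\<And>\<beta>. \<beta> \<in> B \<Longrightarrow> b \<beta> \<in> Hom \<Lambda> RA RA"
    and ab: "\<And>\<beta> x. \<lbrakk>\<beta> \<in> B; x \<in> carrier RA\<rbrakk> \<Longrightarrow> \<beta> x = a \<beta> (delta f0 x) \<oplus>\<^bsub>PA\<^esub> delta f0 (b \<beta> x)"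
    by metis
  have ac: "a \<beta> y \<in> carrier PA" if "\<beta> \<in> B" "y \<in> carrier PA" for \<beta> y by (rule HomD(1)[OF a[OF that(1)] that(2)])
  have bc: "b \<beta> x \<in> carrier RA" if "\<beta> \<in> B" "x \<in> carrier RA" for \<beta> x by (rule HomD(1)[OF b[OF that(1)] that(2)])
  have \<delta>c: "delta v x \<in> carrier PA" if "v \<in> carrier V" "x \<in> carrier RA" for v x
    by (rule HomD(1)[OF delta_Hom[OF V_Hom[OF that(1)]] that(2)])
  have vc: "v x \<in> carrier PA" if "v \<in> carrier V" "x \<in> carrier RA" for v x
    by (rule HomD(1)[OF V_Hom[OF that(1)] that(2)])
  \<comment> \<open>The pair \<open>(a \<beta>, b \<beta>)\<close> solves the system at \<open>f0\<close> with right-hand side \<open>\<beta>\<close>; at \<open>v\<close> its right-hand side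
    is \<open>E \<beta> v\<close>, and \<open>L v\<close> extends \<open>\<beta> \<mapsto> E \<beta> v\<close> linearly.\<close>
  define E where "E \<beta> v = (\<lambda>x\<in>carrier RA. compose (carrier RA) (a \<beta>) (delta f0) x \<oplus>\<^bsub>PA\<^esub>
      compose (carrier RA) (delta v) (b \<beta>) x)" for \<beta> v
  have EH: "E \<beta> v \<in> carrier HA" if "\<beta> \<in> B" "v \<in> carrier V" for \<beta> v
    using Hom_add[OF RA_rm Proj_rm Hom_compose[OF \<delta>0 a[OF that(1)] RA_rm]
        Hom_compose[OF b[OF that(1)] delta_Hom[OF V_Hom[OF that(2)]] RA_rm]] by (simp add: E_def)
  have Ex: "E \<beta> v x = a \<beta> (delta f0 x) \<oplus>\<^bsub>PA\<^esub> delta v (b \<beta> x)" if "x \<in> carrier RA" for \<beta> v x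
    using that by (simp add: E_def compose_eq)
  have E0: "E \<beta> f0 = \<beta>" if \<beta>: "\<beta> \<in> B" for \<beta>
    by (rule Hom_eqI[of _ \<Lambda> RA PA _ PA]) (use EH[OF \<beta> f0] BH[OF \<beta>] Ex ab[OF \<beta>] in auto)
  have Ep: "poly_map K V HA (E \<beta>)" if \<beta>: "\<beta> \<in> B" for \<beta>
  proof -
    let ?C = "\<lambda>x\<in>carrier RA. compose (carrier RA) (a \<beta>) (delta f0) x \<ominus>\<^bsub>PA\<^esub> b \<beta> x"
    let ?G = "\<lambda>v\<in>carrier V. compose (carrier RA) v (b \<beta>)"
    have bP: "b \<beta> \<in> Hom \<Lambda> RA PA"
      using b[OF \<beta>] Hom_from_into_sub[of "b \<beta>" \<Lambda> RA PA "radical \<Lambda> PA"] submodule_subset[OF Proj_rm RA_submodule]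
      by (simp add: RA_eq)
    have C: "?C \<in> carrier HA"
      using Hom_diff[OF RA_rm Proj_rm Hom_compose[OF \<delta>0 a[OF \<beta>] RA_rm] bP] by simp
    have G: "?G \<in> Hom K V HA"
    proof (rule HomI)
      fix v assume v: "v \<in> carrier V"
      show "?G v \<in> carrier HA" using Hom_compose[OF b[OF \<beta>] V_Hom[OF v] RA_rm] v by simp
    next
      fix v w assume v: "v \<in> carrier V" and w: "w \<in> carrier V"
      have "compose (carrier RA) (v \<oplus>\<^bsub>V\<^esub> w) (b \<beta>) =
          (\<lambda>x\<in>carrier RA. compose (carrier RA) v (b \<beta>) x \<oplus>\<^bsub>PA\<^esub> compose (carrier RA) w (b \<beta>) x)"
        unfolding compose_def V_ops by (rule restrict_ext) (simp add: bc[OF \<beta>])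
      then show "?G (v \<oplus>\<^bsub>V\<^esub> w) = ?G v \<oplus>\<^bsub>HA\<^esub> ?G w"
        using v w PS.V.M.a_closed[OF v w] by simp
    next
      fix k v assume k: "k \<in> carrier K" and v: "v \<in> carrier V"
      have "compose (carrier RA) (k \<odot>\<^bsub>V\<^esub> v) (b \<beta>) =
          (\<lambda>x\<in>carrier RA. (k \<odot>\<^bsub>\<Lambda>\<^esub> \<one>\<^bsub>\<Lambda>\<^esub>) \<odot>\<^bsub>PA\<^esub> compose (carrier RA) v (b \<beta>) x)"
        unfolding compose_def V_ops by (rule restrict_ext) (simp add: bc[OF \<beta>])
      then show "?G (k \<odot>\<^bsub>V\<^esub> v) = k \<odot>\<^bsub>HA\<^esub> ?G v"
        using v PS.V.smult_closed[OF k v] by simp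
    qed simp
    have eq: "?C \<oplus>\<^bsub>HA\<^esub> ?G v = E \<beta> v" if v: "v \<in> carrier V" for v
    proof -
      have "(u \<ominus>\<^bsub>PA\<^esub> y) \<oplus>\<^bsub>PA\<^esub> w = u \<oplus>\<^bsub>PA\<^esub> (w \<ominus>\<^bsub>PA\<^esub> y)"
        if "u \<in> carrier PA" "y \<in> carrier PA" "w \<in> carrier PA" for u y w
        using that PA.M.a_comm[of "\<ominus>\<^bsub>PA\<^esub> y" w] by (simp add: a_minus_def PA.M.a_assoc)
      then show ?thesis
        using v ac[OF \<beta>] \<delta>c[OF f0] bc[OF \<beta>] vc[OF v] RA_subset[OF bc[OF \<beta>]]
        by (auto simp: E_def compose_eq delta_apply intro!: restrict_ext)
    qed
    show ?thesis
      by (rule PS.poly_map_cong[OF PS.poly_map_add[OF PS.poly_map_const[OF C] PS.poly_map_linear[OF G] HA_rm]])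
         (rule eq)
  qed
  define L where "L v = (\<lambda>h\<in>carrier HA. \<Oplus>\<^bsub>HA\<^esub>\<beta>\<in>B. \<xi> \<beta> h \<odot>\<^bsub>HA\<^esub> E \<beta> v)" for v
  have LH: "L v \<in> Hom K HA HA" if "v \<in> carrier V" for v
    unfolding L_def by (rule functional_comb_Hom[OF HA_rm HA_rm fB(1) \<xi> EH[OF _ that]])
  have Lp: "poly_map K V HA (\<lambda>v. L v h)" if h: "h \<in> carrier HA" for h
  proof -
    have "poly_map K V HA (\<lambda>v. \<Oplus>\<^bsub>HA\<^esub>\<beta>\<in>B. \<xi> \<beta> h \<odot>\<^bsub>HA\<^esub> E \<beta> v)"
      by (intro PS.poly_map_finsum PS.poly_map_smult PS.poly_fun_const Ep HA_rm fB(1))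
         (use \<xi>c h in auto)
    then show ?thesis using h by (simp add: L_def)
  qed
  have L0: "L f0 h = h" if h: "h \<in> carrier HA" for h
  proof -
    have "(\<Oplus>\<^bsub>HA\<^esub>\<beta>\<in>B. \<xi> \<beta> h \<odot>\<^bsub>HA\<^esub> E \<beta> f0) = (\<Oplus>\<^bsub>HA\<^esub>\<beta>\<in>B. \<xi> \<beta> h \<odot>\<^bsub>HA\<^esub> \<beta>)"
    proof (rule HA.M.finsum_cong')
      show "(\<lambda>\<beta>. \<xi> \<beta> h \<odot>\<^bsub>HA\<^esub> \<beta>) \<in> B \<rightarrow> carrier HA"
      proof
        fix \<beta> assume \<beta>: "\<beta> \<in> B"
        show "\<xi> \<beta> h \<odot>\<^bsub>HA\<^esub> \<beta> \<in> carrier HA"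
          by (rule HA.smult_closed) (use \<xi>c[OF \<beta>] BH[OF \<beta>] h in auto)
      qed
    qed (simp_all only: E0)
    then show ?thesis using \<xi>s[OF h] h by (simp only: L_def restrict_apply' if_True)
  qed
  let ?nf0 = "\<lambda>x\<in>carrier RA. \<ominus>\<^bsub>PA\<^esub> f0 x"
  have nf0: "?nf0 \<in> carrier HA" using Hom_minus_map[OF RA_rm Proj_rm V_Hom[OF f0]] by simp
  have incl: "(\<lambda>v\<in>carrier V. v) \<in> Hom K V HA"
    by (rule HomI) (use PS.V.M.a_closed PS.V.smult_closed V_Hom in \<open>auto simp: V_ops\<close>)
  \<comment> \<open>The identity maps miss being a map from \<open>delta f0\<close> to \<open>delta v\<close> by \<open>v - f0\<close>.\<close>
  define r where "r v = (\<lambda>v\<in>carrier V. v) v \<oplus>\<^bsub>HA\<^esub> ?nf0" for v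
  have rp: "poly_map K V HA r"
    unfolding r_def by (rule PS.poly_map_add[OF PS.poly_map_linear[OF incl] PS.poly_map_const[OF nf0] HA_rm])
  have rx: "r v x = v x \<ominus>\<^bsub>PA\<^esub> f0 x" if "v \<in> carrier V" "x \<in> carrier RA" for v x
    using that by (simp add: r_def a_minus_def)
  obtain p h where p: "poly_fun K V p" "p f0 = \<one>\<^bsub>K\<^esub>" and hp: "poly_map K V HA h"
    and Lh: "\<And>v. v \<in> carrier V \<Longrightarrow> L v (h v) = p v \<odot>\<^bsub>HA\<^esub> r v"
  proof (rule PS.cramer[where L = L and b = r, OF HA_rm HAfd f0])
    show "\<And>v. v \<in> carrier V \<Longrightarrow> L v \<in> Hom K HA HA" by (rule LH)
    show "\<And>h. h \<in> carrier HA \<Longrightarrow> poly_map K V HA (\<lambda>v. L v h)" by (rule Lp)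
    show "\<And>h. h \<in> carrier HA \<Longrightarrow> L f0 h = h" by (rule L0)
    show "poly_map K V HA r" by (rule rp)
  qed (rule that)
  have hc: "h v \<in> carrier HA" if "v \<in> carrier V" for v by (rule PS.poly_map_closed[OF hp that])
  have h0: "h f0 = \<zero>\<^bsub>HA\<^esub>"
  proof -
    have "r f0 = \<zero>\<^bsub>HA\<^esub>"
    proof (rule Hom_eqI[of _ \<Lambda> RA PA _ PA])
      show "r f0 \<in> Hom \<Lambda> RA PA" using PS.poly_map_closed[OF rp f0] by simp
      show "\<zero>\<^bsub>HA\<^esub> \<in> Hom \<Lambda> RA PA" using HA.M.zero_closed by simp
      fix x assume x: "x \<in> carrier RA"
      show "r f0 x = \<zero>\<^bsub>HA\<^esub> x"
        using rx[OF f0 x] vc[OF f0 x] x by (simp add: a_minus_def PA.M.r_neg)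
    qed
    then have "L f0 (h f0) = \<zero>\<^bsub>HA\<^esub>"
      using Lh[OF f0] p(2) HA.smult_one[OF HA.M.zero_closed] by simp
    then show ?thesis using L0[OF hc[OF f0]] by simp
  qed
  define s where "s \<beta> v = \<xi> \<beta> (h v)" for \<beta> v
  have sp: "poly_fun K V (s \<beta>)" if "\<beta> \<in> B" for \<beta>
    unfolding s_def by (rule PS.poly_mapD[OF hp \<xi>[OF that]])
  have s0: "s \<beta> f0 = \<zero>\<^bsub>K\<^esub>" if "\<beta> \<in> B" for \<beta>
    using Hom_zero[OF HA_rm PS.rm_reg \<xi>[OF that]] by (simp only: s_def h0 regular_simps)
  have sc: "s \<beta> v \<in> carrier K" if "\<beta> \<in> B" "v \<in> carrier V" for \<beta> v
    by (rule PS.poly_fun_closed[OF sp[OF that(1)] that(2)])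
  have pc: "p v \<in> carrier K" if "v \<in> carrier V" for v by (rule PS.poly_fun_closed[OF p(1) that])
  let ?id = "\<lambda>y\<in>carrier PA. y"
  \<comment> \<open>The identity, scaled by the common denominator \<open>p\<close>, corrected by the solution of the system.\<close>
  define A where "A v = p v \<odot>\<^bsub>?HP\<^esub> ?id \<oplus>\<^bsub>?HP\<^esub> (\<Oplus>\<^bsub>?HP\<^esub>\<beta>\<in>B. s \<beta> v \<odot>\<^bsub>?HP\<^esub> a \<beta>)" for v
  have Ap: "poly_map K V ?HP A"
    unfolding A_def
    by (intro PS.poly_map_add PS.poly_map_finsum PS.poly_map_smult PS.poly_map_const HP_rm fB(1) p(1) sp)
       (use Hom_id[OF Proj_rm] a in simp_all)
  have AH: "A v \<in> Hom \<Lambda> PA PA" if "v \<in> carrier V" for v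
    using PS.poly_map_closed[OF Ap that] by simp
  let ?u = "\<lambda>k. k \<odot>\<^bsub>\<Lambda>\<^esub> \<one>\<^bsub>\<Lambda>\<^esub>"
  have Ay: "A v y = ?u (p v) \<odot>\<^bsub>PA\<^esub> y \<oplus>\<^bsub>PA\<^esub> (\<Oplus>\<^bsub>PA\<^esub>\<beta>\<in>B. ?u (s \<beta> v) \<odot>\<^bsub>PA\<^esub> a \<beta> y)"
    if v: "v \<in> carrier V" and y: "y \<in> carrier PA" for v y
  proof -
    have sm: "s \<beta> v \<odot>\<^bsub>?HP\<^esub> a \<beta> \<in> Hom \<Lambda> PA PA" if "\<beta> \<in> B" for \<beta>
      using HP.smult_closed[OF sc[OF that v], of "a \<beta>"] a[OF that] by simp
    have "(\<Oplus>\<^bsub>?HP\<^esub>\<beta>\<in>B. s \<beta> v \<odot>\<^bsub>?HP\<^esub> a \<beta>) y = (\<Oplus>\<^bsub>PA\<^esub>\<beta>\<in>B. (s \<beta> v \<odot>\<^bsub>?HP\<^esub> a \<beta>) y)"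
      by (rule hom_scalars_finsum_apply[OF Proj_rm Proj_rm fB(1) _ y]) (rule sm)
    also have "\<dots> = (\<Oplus>\<^bsub>PA\<^esub>\<beta>\<in>B. ?u (s \<beta> v) \<odot>\<^bsub>PA\<^esub> a \<beta> y)"
      by (rule PA.M.finsum_cong') (use y v sc us ac in auto)
    finally show ?thesis using y by (simp add: A_def)
  qed
  have A0: "A f0 y = y" if y: "y \<in> carrier PA" for y
  proof -
    have "(\<Oplus>\<^bsub>PA\<^esub>\<beta>\<in>B. ?u (s \<beta> f0) \<odot>\<^bsub>PA\<^esub> a \<beta> y) = (\<Oplus>\<^bsub>PA\<^esub>\<beta>\<in>B. \<zero>\<^bsub>PA\<^esub>)"
      by (rule PA.M.finsum_cong') (use y ac in \<open>auto simp: s0 unit_scalar_zero[OF alg]\<close>)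
    then show ?thesis using Ay[OF f0 y] y by (simp add: p(2) unit_scalar_one[OF alg])
  qed
  have PAs: "right_module K (scalars \<Lambda> PA)" "finite_dim K (scalars \<Lambda> PA)"
    using Proj_fd[of \<alpha>] right_module_scalars[OF alg Proj_rm] by (auto simp: fd_module_def)
  have AK: "A v \<in> Hom K (scalars \<Lambda> PA) (scalars \<Lambda> PA)" if "v \<in> carrier V" for v
    by (rule Hom_scalars[OF alg AH[OF that]])
  have Ayp: "poly_map K V (scalars \<Lambda> PA) (\<lambda>v. A v y)" if y: "y \<in> carrier (scalars \<Lambda> PA)" for y
  proof -
    have y': "y \<in> carrier PA" using y by simp
    show ?thesis
      by (rule PS.poly_map_cong[OF PS.poly_map_compose[OF HP_rm Ap eval_Hom[OF alg Proj_rm Proj_rm y']]])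
         (simp add: AH)
  qed
  have A0': "A f0 y = y" if "y \<in> carrier (scalars \<Lambda> PA)" for y using A0 that by simp
  obtain q where q: "poly_fun K V q" "q f0 = \<one>\<^bsub>K\<^esub>"
    and qs: "\<And>v. \<lbrakk>v \<in> carrier V; q v \<noteq> \<zero>\<^bsub>K\<^esub>\<rbrakk> \<Longrightarrow> A v ` carrier (scalars \<Lambda> PA) = carrier (scalars \<Lambda> PA)"
  proof (rule PS.surj_near_identity[where L = A, OF PAs f0])
    show "\<And>v. v \<in> carrier V \<Longrightarrow> A v \<in> Hom K (scalars \<Lambda> PA) (scalars \<Lambda> PA)" by (rule AK)
    show "\<And>y. y \<in> carrier (scalars \<Lambda> PA) \<Longrightarrow> poly_map K V (scalars \<Lambda> PA) (\<lambda>v. A v y)" by (rule Ayp)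
    show "\<And>y. y \<in> carrier (scalars \<Lambda> PA) \<Longrightarrow> A f0 y = y" by (rule A0')
  qed (rule that)
  have "isomorphic \<Lambda> (coker_rep \<Lambda> n P \<alpha> v) M" if v: "v \<in> carrier V" and qv: "q v \<noteq> \<zero>\<^bsub>K\<^esub>" for v
  proof -
    note \<delta>v = delta_Hom[OF V_Hom[OF v]]
    have Asurj: "A v ` carrier PA = carrier PA" using qs[OF v qv] by simp
    have Ainj: "inj_on (A v) (carrier PA)"
      by (rule finite_length_surj_inj[OF Proj_rm fd_module_finite_length[OF alg Proj_fd] AH[OF v] Asurj])
    define w where "w = (\<Oplus>\<^bsub>?HR\<^esub>\<beta>\<in>B. s \<beta> v \<odot>\<^bsub>?HR\<^esub> b \<beta>)"
    have wb: "s \<beta> v \<odot>\<^bsub>?HR\<^esub> b \<beta> \<in> Hom \<Lambda> RA RA" if "\<beta> \<in> B" for \<beta>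
      using HR.smult_closed[OF sc[OF that v], of "b \<beta>"] b[OF that] by simp
    have wH: "w \<in> Hom \<Lambda> RA RA"
      using HR.M.finsum_closed[of "\<lambda>\<beta>. s \<beta> v \<odot>\<^bsub>?HR\<^esub> b \<beta>" B] wb unfolding w_def by (simp add: Pi_iff)
    let ?pid = "\<lambda>x\<in>carrier RA. ?u (p v) \<odot>\<^bsub>RA\<^esub> (\<lambda>x\<in>carrier RA. x) x"
    have pid: "?pid \<in> Hom \<Lambda> RA RA" by (rule Hom_unit_scalar[OF alg RA_rm RA_rm Hom_id[OF RA_rm] pc[OF v]])
    \<comment> \<open>The companion of \<open>A v\<close> on the radical.\<close>
    let ?b = "\<lambda>x\<in>carrier RA. ?pid x \<ominus>\<^bsub>RA\<^esub> w x"
    have bH: "?b \<in> Hom \<Lambda> RA RA" by (rule Hom_diff[OF RA_rm RA_rm pid wH])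
    have key: "A v (delta f0 x) = delta v (?b x)" if x: "x \<in> carrier RA" for x
    proof -
      define U where "U = (\<Oplus>\<^bsub>PA\<^esub>\<beta>\<in>B. ?u (s \<beta> v) \<odot>\<^bsub>PA\<^esub> a \<beta> (delta f0 x))"
      define W where "W = (\<Oplus>\<^bsub>PA\<^esub>\<beta>\<in>B. ?u (s \<beta> v) \<odot>\<^bsub>PA\<^esub> delta v (b \<beta> x))"
      define D where "D = ?u (p v) \<odot>\<^bsub>PA\<^esub> delta v x"
      define D0 where "D0 = ?u (p v) \<odot>\<^bsub>PA\<^esub> delta f0 x"
      have t: "?u (s \<beta> v) \<odot>\<^bsub>PA\<^esub> a \<beta> (delta f0 x) \<in> carrier PA"
        "?u (s \<beta> v) \<odot>\<^bsub>PA\<^esub> delta v (b \<beta> x) \<in> carrier PA" if "\<beta> \<in> B" for \<beta>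
        using us[OF sc[OF that v]] ac[OF that \<delta>c[OF f0 x]] \<delta>c[OF v bc[OF that x]] by auto
      have cl: "U \<in> carrier PA" "W \<in> carrier PA" "D \<in> carrier PA" "D0 \<in> carrier PA"
        using t us[OF pc[OF v]] \<delta>c[OF v x] \<delta>c[OF f0 x]
        by (auto simp: U_def W_def D_def D0_def intro!: PA.M.finsum_closed)
      have A1: "A v (delta f0 x) = D0 \<oplus>\<^bsub>PA\<^esub> U"
        using Ay[OF v \<delta>c[OF f0 x]] by (simp add: U_def D0_def)
      have wx: "w x = (\<Oplus>\<^bsub>RA\<^esub>\<beta>\<in>B. (s \<beta> v \<odot>\<^bsub>?HR\<^esub> b \<beta>) x)"
        unfolding w_def by (rule hom_scalars_finsum_apply[OF RA_rm RA_rm fB(1) _ x]) (rule wb)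
      have "delta v (w x) = (\<Oplus>\<^bsub>PA\<^esub>\<beta>\<in>B. delta v ((s \<beta> v \<odot>\<^bsub>?HR\<^esub> b \<beta>) x))"
        unfolding wx by (rule Hom_finsum[OF RA_rm Proj_rm \<delta>v fB(1)]) (rule HomD(1)[OF wb x])
      also have "\<dots> = W"
        unfolding W_def
      proof (rule PA.M.finsum_cong')
        fix \<beta> assume \<beta>: "\<beta> \<in> B"
        show "delta v ((s \<beta> v \<odot>\<^bsub>?HR\<^esub> b \<beta>) x) = ?u (s \<beta> v) \<odot>\<^bsub>PA\<^esub> delta v (b \<beta> x)"
          using HomD(4)[OF \<delta>v us[OF sc[OF \<beta> v]] bc[OF \<beta> x]] x by simp
      qed (use t in auto)
      finally have dw: "delta v (w x) = W" .
      have "delta v (?pid x) = D"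
        using HomD(4)[OF \<delta>v us[OF pc[OF v]] x] x by (simp add: D_def)
      then have b1: "delta v (?b x) = D \<ominus>\<^bsub>PA\<^esub> W"
        using Hom_minus[OF RA_rm Proj_rm \<delta>v HomD(1)[OF pid x] HomD(1)[OF wH x]] dw x by simp
      have Et: "s \<beta> v \<odot>\<^bsub>HA\<^esub> E \<beta> v \<in> Hom \<Lambda> RA PA" if "\<beta> \<in> B" for \<beta>
        using HA.smult_closed[OF sc[OF that v] EH[OF that v]] by simp
      have Lhv: "L v (h v) = (\<Oplus>\<^bsub>HA\<^esub>\<beta>\<in>B. s \<beta> v \<odot>\<^bsub>HA\<^esub> E \<beta> v)"
        using hc[OF v] by (simp only: L_def restrict_apply' if_True s_def)
      have "L v (h v) x = (\<Oplus>\<^bsub>PA\<^esub>\<beta>\<in>B. (s \<beta> v \<odot>\<^bsub>HA\<^esub> E \<beta> v) x)"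
        unfolding Lhv by (rule hom_scalars_finsum_apply[OF RA_rm Proj_rm fB(1) _ x]) (rule Et)
      also have "\<dots> = (\<Oplus>\<^bsub>PA\<^esub>\<beta>\<in>B. ?u (s \<beta> v) \<odot>\<^bsub>PA\<^esub> a \<beta> (delta f0 x) \<oplus>\<^bsub>PA\<^esub> ?u (s \<beta> v) \<odot>\<^bsub>PA\<^esub> delta v (b \<beta> x))"
      proof (rule PA.M.finsum_cong')
        fix \<beta> assume \<beta>: "\<beta> \<in> B"
        show "(s \<beta> v \<odot>\<^bsub>HA\<^esub> E \<beta> v) x =
            ?u (s \<beta> v) \<odot>\<^bsub>PA\<^esub> a \<beta> (delta f0 x) \<oplus>\<^bsub>PA\<^esub> ?u (s \<beta> v) \<odot>\<^bsub>PA\<^esub> delta v (b \<beta> x)"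
          using PA.smult_r_distr[OF us[OF sc[OF \<beta> v]] ac[OF \<beta> \<delta>c[OF f0 x]] \<delta>c[OF v bc[OF \<beta> x]]] x
          by (simp add: Ex)
      qed (use t in auto)
      also have "\<dots> = U \<oplus>\<^bsub>PA\<^esub> W"
        unfolding U_def W_def by (rule PA.M.finsum_addf) (use t in auto)
      finally have "U \<oplus>\<^bsub>PA\<^esub> W = (p v \<odot>\<^bsub>HA\<^esub> r v) x" using Lh[OF v] by simp
      also have "\<dots> = ?u (p v) \<odot>\<^bsub>PA\<^esub> (v x \<ominus>\<^bsub>PA\<^esub> f0 x)" using x rx[OF v x] by simp
      also have "v x \<ominus>\<^bsub>PA\<^esub> f0 x = delta v x \<ominus>\<^bsub>PA\<^esub> delta f0 x"
      proof -
        have "y \<ominus>\<^bsub>PA\<^esub> y' = (y \<ominus>\<^bsub>PA\<^esub> z) \<ominus>\<^bsub>PA\<^esub> (y' \<ominus>\<^bsub>PA\<^esub> z)"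
          if "y \<in> carrier PA" "y' \<in> carrier PA" "z \<in> carrier PA" for y y' z
          using that PA.M.a_lcomm[of "\<ominus>\<^bsub>PA\<^esub> z" "\<ominus>\<^bsub>PA\<^esub> y'" z]
          by (simp add: a_minus_def PA.M.minus_add PA.M.a_assoc PA.M.l_neg)
        from this[OF vc[OF v x] vc[OF f0 x] RA_subset[OF x]] show ?thesis
          by (simp add: delta_apply[OF x])
      qed
      also have "?u (p v) \<odot>\<^bsub>PA\<^esub> (delta v x \<ominus>\<^bsub>PA\<^esub> delta f0 x) = D \<ominus>\<^bsub>PA\<^esub> D0"
        using Hom_minus[OF Proj_rm Proj_rm Hom_unit_scalar[OF alg Proj_rm Proj_rm Hom_id[OF Proj_rm] pc[OF v]]
            \<delta>c[OF v x] \<delta>c[OF f0 x]] \<delta>c[OF v x] \<delta>c[OF f0 x]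
        by (simp add: D_def D0_def)
      finally have UW: "U \<oplus>\<^bsub>PA\<^esub> W = D \<ominus>\<^bsub>PA\<^esub> D0" .
      have "D0 \<oplus>\<^bsub>PA\<^esub> U = (D0 \<oplus>\<^bsub>PA\<^esub> (U \<oplus>\<^bsub>PA\<^esub> W)) \<ominus>\<^bsub>PA\<^esub> W"
        using cl by (simp add: a_minus_def PA.M.a_assoc PA.M.r_neg)
      also have "\<dots> = D \<ominus>\<^bsub>PA\<^esub> W"
        unfolding UW using cl PA.M.a_lcomm[of D0 D "\<ominus>\<^bsub>PA\<^esub> D0"] by (simp add: a_minus_def PA.M.r_neg)
      finally show ?thesis using A1 b1 by simp
    qed
    have binj: "inj_on ?b (carrier RA)"
    proof (rule inj_onI)
      fix x x' assume x: "x \<in> carrier RA" "x' \<in> carrier RA" "?b x = ?b x'"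
      then have "A v (delta f0 x) = A v (delta f0 x')" by (simp only: key)
      then have "delta f0 x = delta f0 x'"
        by (rule inj_onD[OF Ainj _ \<delta>c[OF f0 x(1)] \<delta>c[OF f0 x(2)]])
      then show "x = x'" by (rule inj_onD[OF delta_inj[OF f0] _ x(1,2)])
    qed
    have bsurj: "?b ` carrier RA = carrier RA"
      by (rule finite_length_inj_surj[OF RA_rm fd_module_finite_length[OF alg RA_fd] bH binj])
    obtain A' where A': "A' \<in> Hom \<Lambda> PA PA" "\<And>y. y \<in> carrier PA \<Longrightarrow> A' (A v y) = y"
      "\<And>y. y \<in> carrier PA \<Longrightarrow> A v (A' y) = y"
      by (rule Hom_inverse[OF Proj_rm Proj_rm AH[OF v] Ainj Asurj], rule that)
    let ?\<pi> = "compose (carrier PA) \<pi> A'"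
    have \<pi>'H: "?\<pi> \<in> Hom \<Lambda> PA M" by (rule Hom_compose[OF A'(1) \<pi>(1) Proj_rm])
    have "?\<pi> ` carrier PA = carrier M"
    proof (intro equalityI subsetI)
      fix m assume "m \<in> carrier M"
      then obtain y where y: "y \<in> carrier PA" "m = \<pi> y" using \<pi>(2) by blast
      have "?\<pi> (A v y) = m" using y A'(2)[OF y(1)] HomD(1)[OF AH[OF v] y(1)] by (simp add: compose_eq)
      then show "m \<in> ?\<pi> ` carrier PA" using HomD(1)[OF AH[OF v] y(1)] by blast
    qed (use HomD(1)[OF \<pi>'H] in blast)
    moreover have "kern PA M ?\<pi> = delta v ` carrier RA"
    proof (intro equalityI subsetI)
      fix y assume "y \<in> kern PA M ?\<pi>"
      then have y: "y \<in> carrier PA" "\<pi> (A' y) = \<zero>\<^bsub>M\<^esub>" by (auto simp: kern_def compose_eq)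
      then have "A' y \<in> kern PA M \<pi>" using HomD(1)[OF A'(1) y(1)] by (simp add: kern_def)
      then obtain x where x: "x \<in> carrier RA" "A' y = delta f0 x" unfolding \<pi>(3) by blast
      then have "y = delta v (?b x)" using key[OF x(1)] A'(3)[OF y(1)] by simp
      then show "y \<in> delta v ` carrier RA" using HomD(1)[OF bH x(1)] by blast
    next
      fix y assume "y \<in> delta v ` carrier RA"
      then obtain z where z: "z \<in> carrier RA" "y = delta v z" by blast
      then have "z \<in> ?b ` carrier RA" using bsurj by simp
      then obtain x where x: "x \<in> carrier RA" "z = ?b x" by (elim imageE)
      have "y = A v (delta f0 x)" using key[OF x(1)] z(2) x(2) by simp
      then have "A' y = delta f0 x" using A'(2)[OF \<delta>c[OF f0 x(1)]] by simp
      then have "A' y \<in> kern PA M \<pi>" using x(1) unfolding \<pi>(3) by blast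
      then show "y \<in> kern PA M ?\<pi>" using z \<delta>c[OF v z(1)] by (simp add: kern_def compose_eq)
    qed
    ultimately show ?thesis
      unfolding coker_isomorphic_iff[OF V_Hom[OF v] M] using \<pi>'H by blast
  qed
  then show ?thesis using q by auto
qed

end

section \<open>Rigid modules are generic\<close>

theorem theorem2p1p6:
  fixes K :: "'k ring" and \<Lambda> :: "('k, 'a) module"
    and n :: nat
    and S :: "nat \<Rightarrow> ('a, 's) module" and P :: "nat \<Rightarrow> ('a, 'p) module"
    and \<phi> :: "nat \<Rightarrow> (nat \<times> nat \<Rightarrow> 'p) \<Rightarrow> 'p"
    and \<alpha> :: "nat \<Rightarrow> nat" and M :: "('a, 'm) module"
  assumes "fd_algebra K \<Lambda>" and "infinite (carrier K)"
    and "hereditary \<Lambda>" and "basic \<Lambda>"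
    and "\<forall>i<n. simple_module \<Lambda> (S i)"
    and "\<forall>i<n. \<forall>j<n. i \<noteq> j \<longrightarrow> \<not> isomorphic \<Lambda> (S i) (S j)"
    and "\<forall>X :: ('a, 'a set) module. simple_module \<Lambda> X \<longrightarrow> (\<exists>i<n. isomorphic \<Lambda> X (S i))"
    and "\<forall>i<n. \<exists>p. projective_cover \<Lambda> (P i) (S i) p"
    and "\<forall>j<n. \<phi> j \<in> Iso \<Lambda> (Proj n P (ext_dim \<Lambda> S j)) (sub_module (P j) (radical \<Lambda> (P j)))"
    and "fd_module K \<Lambda> M" and "\<forall>i<n. dimv \<Lambda> (P i) M = \<alpha> i"
    and "rigid \<Lambda> M"
  shows "openin (zariski K (Rep \<Lambda> n P (ext_dim \<Lambda> S) \<phi> \<alpha>))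
           {f \<in> carrier (Rep \<Lambda> n P (ext_dim \<Lambda> S) \<phi> \<alpha>). isomorphic \<Lambda> (coker_rep \<Lambda> n P \<alpha> f) M}
       \<and> zariski K (Rep \<Lambda> n P (ext_dim \<Lambda> S) \<phi> \<alpha>) closure_of
           {f \<in> carrier (Rep \<Lambda> n P (ext_dim \<Lambda> S) \<phi> \<alpha>). isomorphic \<Lambda> (coker_rep \<Lambda> n P \<alpha> f) M}
         = topspace (zariski K (Rep \<Lambda> n P (ext_dim \<Lambda> S) \<phi> \<alpha>))"
proof -
  interpret rep_setup K \<Lambda> n S P "ext_dim \<Lambda> S" \<phi> \<alpha>
    by (rule rep_setup.intro) (use assms(1,5-9) in simp_all)
  have M: "right_module \<Lambda> M" using assms(10) by (simp add: fd_module_def)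
  interpret PS: poly_space K V
    by (intro poly_space.intro fd_field[OF alg] V_rm)
  let ?U = "{f \<in> carrier V. isomorphic \<Lambda> (coker_rep \<Lambda> n P \<alpha> f) M}"
  have op: "openin (zariski K V) ?U"
  proof (rule PS.openin_zariskiI)
    fix f assume "f \<in> ?U"
    then have f: "f \<in> carrier V" "isomorphic \<Lambda> (coker_rep \<Lambda> n P \<alpha> f) M" by simp_all
    obtain q where "poly_fun K V q" "q f \<noteq> \<zero>\<^bsub>K\<^esub>"
      "\<And>v. \<lbrakk>v \<in> carrier V; q v \<noteq> \<zero>\<^bsub>K\<^esub>\<rbrakk> \<Longrightarrow> isomorphic \<Lambda> (coker_rep \<Lambda> n P \<alpha> v) M"
      using isomorphic_near[OF f(1) M assms(12) f(2)] by blast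
    then show "\<exists>q. poly_fun K V q \<and> q f \<noteq> \<zero>\<^bsub>K\<^esub> \<and> (\<forall>w\<in>carrier V. q w \<noteq> \<zero>\<^bsub>K\<^esub> \<longrightarrow> w \<in> ?U)"
      by (intro exI[of _ q]) simp
  qed simp
  moreover have "?U \<noteq> {}"
    using exists_presentation[OF assms(10)] assms(11) by blast
  ultimately show ?thesis
    using PS.zariski_open_dense[OF assms(2) op] by blast
qed

end
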